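(* Let $\boldsymbol\nu\in\mathbb N^r$. (a) If $\boldsymbol\nu\notin(\boldsymbol\delta-\mathbb N^r)\cup\Gamma_0\cup\Gamma_1$, then $\mathbb M_{\boldsymbol\nu}$ is a presentation matrix of the $A_k$-module $(B^{\mathrm{sat}})_{\boldsymbol\nu}$. In particular, for a system $\boldsymbol f=\{f_0,\dots,f_n\}$ of multihomogeneous polynomials of degrees $\boldsymbol d_0,\dots,\boldsymbol d_n$ with coefficients in a field $\mathbb K$, the specialized matrix $\mathbb M_{\boldsymbol\nu}(\boldsymbol f)$ is surjective if and only if $\boldsymbol f$ has no common zero in $\mathbb P^{n_1}_{\overline{\mathbb K}}\times\cdots\times\mathbb P^{n_r}_{\overline{\mathbb K}}$. (b) If $\boldsymbol\nu=\boldsymbol\delta-(\mu_1,\dots,\mu_r)$ with $0\le\mu_j<\min_{i}d_{i,j}$ for all $j=1,\dots,r$, then $\mathbb H_{\boldsymbol\nu}$ is a presentation matrix of the $A_k$-module $(B^{\mathrm{sat}})_{\boldsymbol\nu}$. In particular, for $\boldsymbol f$ as in (a), $\mathbb H_{\boldsymbol\nu}(\boldsymbol f)$ is surjective if and only if $\boldsymbol f$ has no common zero in $\mathbb P^{n_1}_{\overline{\mathbb K}}\times\cdots\times\mathbb P^{n_r}_{\overline{\mathbb K}}$.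
   Context: Setting. Let $r\ge 1$ and $n_1,\dots,n_r\ge 1$ be integers, $n=n_1+\cdots+n_r$, and let $k$ be a commutative ring. For $j=1,\dots,r$ let $\boldsymbol x_j=(x_{j,0},\dots,x_{j,n_j})$. For $i=0,\dots,n$ fix $\boldsymbol d_i=(d_{i,1},\dots,d_{i,r})$ with all $d_{i,j}\ge 1$. Let $A_k$ be the polynomial ring over $k$ in the indeterminates $U_{i,\alpha_1,\dots,\alpha_r}$, where $0\le i\le n$ and $\alpha_j\in\mathbb N^{n_j+1}$ with $|\alpha_j|=d_{i,j}$. Let $C=A_k[\boldsymbol x_1,\dots,\boldsymbol x_r]$, which is $\mathbb Z^r$-graded by giving each $x_{j,l}$ the degree $\boldsymbol e_j$ and elements of $A_k$ degree $0$. The generic multihomogeneous polynomials are $F_i=\sum U_{i,\alpha_1,\dots,\alpha_r}\boldsymbol x_1^{\alpha_1}\cdots\boldsymbol x_r^{\alpha_r}\in C$, the sum being over all $(\alpha_1,\dots,\alpha_r)$ with $|\alpha_j|=d_{i,j}$. Put $\mathfrak m_j=(\boldsymbol x_j)\subset C$, $\mathfrak b=\prod_{j=1}^r\mathfrak m_j$, $I=(F_0,\dots,F_n)$, $I^{\mathrm{sat}}=(I:\mathfrak b^\infty)=\{p\in C:\exists N,\ \mathfrak b^Np\subset I\}$, $B^{\mathrm{sat}}=C/I^{\mathrm{sat}}$, and $\boldsymbol\delta=(\delta_1,\dots,\delta_r)=\sum_{i=0}^n\boldsymbol d_i-(n_1+1,\dots,n_r+1)$. The sets $\Gamma_i$.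 For a $\mathbb Z^r$-graded module $M$, $\mathrm{Supp}(M)=\{\boldsymbol\mu\in\mathbb Z^r: M_{\boldsymbol\mu}\ne 0\}$. Let $K_\bullet(\boldsymbol F,C)$ be the $\mathbb Z^r$-graded Koszul complex of $F_0,\dots,F_n$, so $K_p(\boldsymbol F,C)=\bigoplus_{\lambda\subset\{0,\dots,n\},\,|\lambda|=p}C(-\sum_{j\in\lambda}\boldsymbol d_j)$ (zero for $p<0$ or $p>n+1$). For $i=0,1$, $\Gamma_i=\bigcup_{-1\le p\le n-1}\mathrm{Supp}\big(H^{p+1}_{\mathfrak b}(K_{p+i}(\boldsymbol F,C))\big)\subset\mathbb Z^r$, where $H^\bullet_{\mathfrak b}$ is local cohomology. Multigraded Sylvester forms. Let $\alpha_j=(\alpha^{(j)}_0,\dots,\alpha^{(j)}_{n_j})\in\mathbb N^{n_j+1}$ with $|\alpha_j|<\min_i d_{i,j}$ for $j=1,\dots,r$. Fix an ordering of the polynomials, of the groups of variables and of the variables in each group (here, the one given by the indexing). Choose for each $i$ a decomposition, with multihomogeneous $F^{(l)}_{i,j}\in C$, $$F_i=\sum_{j=0}^{n_1-1}x_{1,j}^{\alpha^{(1)}_j+1}F^{(1)}_{i,j}+x_{1,n_1}^{\alpha^{(1)}_{n_1}+1}\Big(\sum_{j=0}^{n_2-1}x_{2,j}^{\alpha^{(2)}_j+1}F^{(2)}_{i,j}+x_{2,n_2}^{\alpha^{(2)}_{n_2}+1}\Big(\cdots+x_{r-1,n_{r-1}}^{\alpha^{(r-1)}_{n_{r-1}}+1}\Big(\sum_{j=0}^{n_r}x_{r,j}^{\alpha^{(r)}_j+1}F^{(r)}_{i,j}\Big)\Big)\Big)$$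 (first decompose $F_i$ over the $x_{1,j}^{\alpha_j^{(1)}+1}$, $0\le j\le n_1$, then the coefficient of $x_{1,n_1}^{\alpha^{(1)}_{n_1}+1}$ over the $x_{2,j}^{\alpha^{(2)}_j+1}$, and so on). Let $\mathcal D_{\alpha_1,\dots,\alpha_r}$ be the determinant of the $(n+1)\times(n+1)$ matrix with $i$-th row $\big(F^{(1)}_{i,0},\dots,F^{(1)}_{i,n_1-1},F^{(2)}_{i,0},\dots,F^{(2)}_{i,n_2-1},\dots,F^{(r-1)}_{i,n_{r-1}-1},F^{(r)}_{i,0},\dots,F^{(r)}_{i,n_r}\big)$, $i=0,\dots,n$. With $v_i=\sum_{j=i+1}^rn_j$, put $\mathrm{Sylv}_{\alpha_1,\dots,\alpha_r}=\big(\prod_{i=1}^{r-1}x_{i,n_i}^{(\alpha^{(i)}_{n_i}+1)v_i}\big)\mathcal D_{\alpha_1,\dots,\alpha_r}$, an element of $I^{\mathrm{sat}}$ of degree $(\delta_1-|\alpha_1|,\dots,\delta_r-|\alpha_r|)$. Matrices. For $\boldsymbol\nu\in\mathbb N^r$ as in (a), $\mathbb M_{\boldsymbol\nu}$ is the matrix, in monomial bases, of the $A_k$-linear map $\bigoplus_{i=0}^nC_{\boldsymbol\nu-\boldsymbol d_i}\to C_{\boldsymbol\nu}$, $(G_0,\dots,G_n)\mapsto\sum_iG_iF_i$. For $\boldsymbol\nu$ as in (b), $\mathbb H_{\boldsymbol\nu}$ is the matrix, in canonical bases, of the $A_k$-linear map $$\bigoplus_{i=0}^nC_{\boldsymbol\nu-\boldsymbol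 d_i}\ \oplus\bigoplus_{\alpha=(\alpha_1,\dots,\alpha_r):\,|\alpha_j|=\delta_j-\nu_j}A_k\ \to\ C_{\boldsymbol\nu},\qquad(G_0,\dots,G_n,(\ell_\alpha)_\alpha)\mapsto\sum_iG_iF_i+\sum_\alpha\ell_\alpha\,\mathrm{Sylv}_\alpha .$$ A matrix is a presentation matrix of a module if the cokernel of the corresponding linear map is that module. Specialization. For a field $\mathbb K$ with algebraic closure $\overline{\mathbb K}$ and multihomogeneous $f_i\in R=\mathbb K[\boldsymbol x_1,\dots,\boldsymbol x_r]$ of degree $\boldsymbol d_i$, take $k=\mathbb Z$ and let $A_{\mathbb Z}\to\mathbb K$ send each coefficient of $F_i$ to the corresponding coefficient of $f_i$; $\mathbb M_{\boldsymbol\nu}(\boldsymbol f)$, $\mathbb H_{\boldsymbol\nu}(\boldsymbol f)$ are the images of the matrices under this map, viewed as $\mathbb K$-linear maps to $R_{\boldsymbol\nu}$. *)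

theory Defs
  imports
    "HOL-Algebra.Module"
    "HOL-Algebra.QuotRing"
    "HOL-Algebra.Ideal_Product"
    "HOL-Algebra.Algebraic_Closure_Type"
    "Jordan_Normal_Form.Determinant"
    "HOL-Library.Poly_Mapping"
begin

section \<open>Modules, presentation matrices\<close>

text \<open>The fields \<open>mult\<close> and \<open>one\<close> that module records inherit from rings carry no meaning
  and are left \<open>undefined\<close> throughout. Index sets of free modules are finite.\<close>

definition ring_on :: "'a::comm_ring_1 set \<Rightarrow> 'a ring" where
  "ring_on S = \<lparr>carrier = S, monoid.mult = (*), one = 1, zero = 0, add = (+)\<rparr>"

definition free_module :: "('a, 'r) ring_scheme \<Rightarrow> 'i set \<Rightarrow> ('a, 'i \<Rightarrow> 'a) module" where
  "free_module R I =
    \<lparr>carrier = I \<rightarrow>\<^sub>E carrier R, monoid.mult = undefined, one = undefined,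
     zero = (\<lambda>i\<in>I. \<zero>\<^bsub>R\<^esub>), add = (\<lambda>v w. \<lambda>i\<in>I. v i \<oplus>\<^bsub>R\<^esub> w i),
     module.smult = (\<lambda>a v. \<lambda>i\<in>I. a \<otimes>\<^bsub>R\<^esub> v i)\<rparr>"

text \<open>The representative \<open>x\<close> of a coset does not matter: for a submodule \<open>N\<close>, the union
  defining scalar multiplication is a union of copies of one coset.\<close>

definition quot_module :: "('a, 'b, 'm) module_scheme \<Rightarrow> 'b set \<Rightarrow> ('a, 'b set) module" where
  "quot_module M N =
    \<lparr>carrier = a_rcosets\<^bsub>M\<^esub> N, monoid.mult = undefined, one = undefined,
     zero = N, add = set_add M,
     module.smult = (\<lambda>a T. \<Union>x\<in>T. N +>\<^bsub>M\<^esub> (a \<odot>\<^bsub>M\<^esub> x))\<rparr>"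

definition module_isomorphic ::
    "('a, 'r) ring_scheme \<Rightarrow> ('a, 'b, 'm) module_scheme \<Rightarrow> ('a, 'c, 'l) module_scheme \<Rightarrow> bool" where
  "module_isomorphic R M N \<longleftrightarrow>
    (\<exists>h. bij_betw h (carrier M) (carrier N) \<and>
         (\<forall>x\<in>carrier M. \<forall>y\<in>carrier M. h (x \<oplus>\<^bsub>M\<^esub> y) = h x \<oplus>\<^bsub>N\<^esub> h y) \<and>
         (\<forall>a\<in>carrier R. \<forall>x\<in>carrier M. h (a \<odot>\<^bsub>M\<^esub> x) = a \<odot>\<^bsub>N\<^esub> h x))"

text \<open>Matrices are indexed by (finite) sets of basis elements instead of initial segments of
  the natural numbers.\<close>

definition mat_map ::
    "('a, 'r) ring_scheme \<Rightarrow> 'i set \<Rightarrow> 'j set \<Rightarrow> ('i \<Rightarrow> 'j \<Rightarrow> 'a) \<Rightarrow> ('j \<Rightarrow> 'a) \<Rightarrow> ('i \<Rightarrow> 'a)" where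
  "mat_map R I J A v = (\<lambda>i\<in>I. \<Oplus>\<^bsub>R\<^esub>j\<in>J. A i j \<otimes>\<^bsub>R\<^esub> v j)"

definition mat_cokernel ::
    "('a, 'r) ring_scheme \<Rightarrow> 'i set \<Rightarrow> 'j set \<Rightarrow> ('i \<Rightarrow> 'j \<Rightarrow> 'a) \<Rightarrow> ('a, ('i \<Rightarrow> 'a) set) module" where
  "mat_cokernel R I J A =
    quot_module (free_module R I) (mat_map R I J A ` carrier (free_module R J))"

definition presentation_matrix ::
    "('a, 'r) ring_scheme \<Rightarrow> 'i set \<Rightarrow> 'j set \<Rightarrow> ('i \<Rightarrow> 'j \<Rightarrow> 'a) \<Rightarrow> ('a, 'b, 'm) module_scheme \<Rightarrow> bool" where
  "presentation_matrix R I J A M \<longleftrightarrow> module_isomorphic R (mat_cokernel R I J A) M"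

definition mat_surjective ::
    "('a, 'r) ring_scheme \<Rightarrow> 'i set \<Rightarrow> 'j set \<Rightarrow> ('i \<Rightarrow> 'j \<Rightarrow> 'a) \<Rightarrow> bool" where
  "mat_surjective R I J A \<longleftrightarrow>
    mat_map R I J A ` carrier (free_module R J) = carrier (free_module R I)"


section \<open>Graded modules and local cohomology\<close>

text \<open>Elements of \<open>\<int>\<^sup>r\<close> are functions \<open>nat \<Rightarrow> int\<close> that vanish outside \<open>{1..r}\<close>.\<close>

definition Zvec :: "nat \<Rightarrow> (nat \<Rightarrow> int) set" where
  "Zvec r = {\<mu>. \<forall>j. j \<notin> {1..r} \<longrightarrow> \<mu> j = 0}"

definition Nvec :: "nat \<Rightarrow> (nat \<Rightarrow> int) set" where
  "Nvec r = {\<mu> \<in> Zvec r. \<forall>j. \<mu> j \<ge> 0}"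

record ('a, 'b) gr_module = "('a, 'b) module" +
  hcomp :: "(nat \<Rightarrow> int) \<Rightarrow> 'b set"

definition quot_gr_module ::
    "('a, 'b, 'm) gr_module_scheme \<Rightarrow> 'b set \<Rightarrow> ('a, 'b set) gr_module" where
  "quot_gr_module M N =
    module.extend (quot_module M N) (gr_module.fields (\<lambda>\<mu>. (\<lambda>x. N +>\<^bsub>M\<^esub> x) ` hcomp M \<mu>))"

definition Supp :: "('a, 'b, 'm) gr_module_scheme \<Rightarrow> (nat \<Rightarrow> int) set" where
  "Supp M = {\<mu>. hcomp M \<mu> \<noteq> {\<zero>\<^bsub>M\<^esub>}}"

text \<open>The localization \<open>M\<^sub>s\<close>: the fraction \<open>m / s\<^sup>k\<close> is the equivalence class of the
  pair \<open>(m, k)\<close>.\<close>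

definition loc_frac ::
    "('a, 'r) ring_scheme \<Rightarrow> ('a, 'b, 'm) module_scheme \<Rightarrow> 'a \<Rightarrow> 'b \<Rightarrow> nat \<Rightarrow> ('b \<times> nat) set" where
  "loc_frac R M s m k =
    {(m', k'). m' \<in> carrier M \<and>
       (\<exists>t::nat. (s [^]\<^bsub>R\<^esub> (t + k')) \<odot>\<^bsub>M\<^esub> m = (s [^]\<^bsub>R\<^esub> (t + k)) \<odot>\<^bsub>M\<^esub> m')}"

text \<open>In the graded structure \<open>s\<close> is homogeneous of degree \<open>e\<close>. The operations are given by
  the usual formulas on representatives.\<close>

definition localization ::
    "('a, 'r) ring_scheme \<Rightarrow> ('a, 'b, 'm) gr_module_scheme \<Rightarrow> 'a \<Rightarrow> (nat \<Rightarrow> int)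
      \<Rightarrow> ('a, ('b \<times> nat) set) gr_module" where
  "localization R M s e =
    \<lparr>carrier = {loc_frac R M s m k | m k. m \<in> carrier M}, monoid.mult = undefined, one = undefined,
     zero = loc_frac R M s \<zero>\<^bsub>M\<^esub> 0,
     add = (\<lambda>T T'. the_elem (\<Union>(m, k)\<in>T. \<Union>(m', k')\<in>T'.
       {loc_frac R M s ((s [^]\<^bsub>R\<^esub> k') \<odot>\<^bsub>M\<^esub> m \<oplus>\<^bsub>M\<^esub> (s [^]\<^bsub>R\<^esub> k) \<odot>\<^bsub>M\<^esub> m') (k + k')})),
     module.smult = (\<lambda>a T. the_elem (\<Union>(m, k)\<in>T. {loc_frac R M s (a \<odot>\<^bsub>M\<^esub> m) k})),
     hcomp = (\<lambda>\<mu>. {loc_frac R M s m k | m k. m \<in> hcomp M (\<lambda>j. \<mu> j + int k * e j)})\<rparr>"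

text \<open>The natural map \<open>M\<^sub>s \<rightarrow> M\<^bsub>s u\<^esub>\<close>, \<open>m / s\<^sup>k \<mapsto> u\<^sup>k m / (s u)\<^sup>k\<close>, where
  \<open>s'\<close> is \<open>s u\<close>.\<close>

definition loc_map ::
    "('a, 'r) ring_scheme \<Rightarrow> ('a, 'b, 'm) module_scheme \<Rightarrow> 'a \<Rightarrow> 'a \<Rightarrow> ('b \<times> nat) set \<Rightarrow> ('b \<times> nat) set" where
  "loc_map R M s' u T = the_elem (\<Union>(m, k)\<in>T. {loc_frac R M s' ((u [^]\<^bsub>R\<^esub> k) \<odot>\<^bsub>M\<^esub> m) k})"

text \<open>Local cohomology with respect to a finitely generated ideal is the cohomology of the
  Cech complex on a finite list \<open>gs\<close> of homogeneous generators; each entry of \<open>gs\<close> is a generator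
  together with its degree. In cohomological degree \<open>p\<close> the complex is the direct sum of the
  localizations of \<open>M\<close> at the products of \<open>p\<close> generators at distinct positions.\<close>

definition cech_loc ::
    "('a, 'r) ring_scheme \<Rightarrow> ('a, 'b, 'm) gr_module_scheme \<Rightarrow> ('a \<times> (nat \<Rightarrow> int)) list \<Rightarrow> nat set
      \<Rightarrow> ('a, ('b \<times> nat) set) gr_module" where
  "cech_loc R M gs \<sigma> =
    localization R M (\<Otimes>\<^bsub>R\<^esub>i\<in>\<sigma>. fst (gs ! i)) (\<lambda>j. \<Sum>i\<in>\<sigma>. snd (gs ! i) j)"

definition cech_index :: "'c list \<Rightarrow> nat \<Rightarrow> nat set set" where
  "cech_index gs p = {\<sigma>. \<sigma> \<subseteq> {..<length gs} \<and> card \<sigma> = p}"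

definition cech ::
    "('a, 'r) ring_scheme \<Rightarrow> ('a, 'b, 'm) gr_module_scheme \<Rightarrow> ('a \<times> (nat \<Rightarrow> int)) list \<Rightarrow> nat
      \<Rightarrow> ('a, nat set \<Rightarrow> ('b \<times> nat) set) gr_module" where
  "cech R M gs p =
    \<lparr>carrier = (\<Pi>\<^sub>E \<sigma>\<in>cech_index gs p. carrier (cech_loc R M gs \<sigma>)),
     monoid.mult = undefined, one = undefined,
     zero = (\<lambda>\<sigma>\<in>cech_index gs p. \<zero>\<^bsub>cech_loc R M gs \<sigma>\<^esub>),
     add = (\<lambda>c c'. \<lambda>\<sigma>\<in>cech_index gs p. c \<sigma> \<oplus>\<^bsub>cech_loc R M gs \<sigma>\<^esub> c' \<sigma>),
     module.smult = (\<lambda>a c. \<lambda>\<sigma>\<in>cech_index gs p. a \<odot>\<^bsub>cech_loc R M gs \<sigma>\<^esub> c \<sigma>),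
     hcomp = (\<lambda>\<mu>. \<Pi>\<^sub>E \<sigma>\<in>cech_index gs p. hcomp (cech_loc R M gs \<sigma>) \<mu>)\<rparr>"

definition cech_diff ::
    "('a, 'r) ring_scheme \<Rightarrow> ('a, 'b, 'm) gr_module_scheme \<Rightarrow> ('a \<times> (nat \<Rightarrow> int)) list \<Rightarrow> nat
      \<Rightarrow> (nat set \<Rightarrow> ('b \<times> nat) set) \<Rightarrow> (nat set \<Rightarrow> ('b \<times> nat) set)" where
  "cech_diff R M gs p c =
    (\<lambda>\<tau>\<in>cech_index gs (Suc p). \<Oplus>\<^bsub>cech_loc R M gs \<tau>\<^esub>i\<in>\<tau>.
       (let y = loc_map R M (\<Otimes>\<^bsub>R\<^esub>j\<in>\<tau>. fst (gs ! j)) (fst (gs ! i)) (c (\<tau> - {i}))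
        in if even (card {i'\<in>\<tau>. i' < i}) then y else \<ominus>\<^bsub>cech_loc R M gs \<tau>\<^esub> y))"

definition cech_cocycles ::
    "('a, 'r) ring_scheme \<Rightarrow> ('a, 'b, 'm) gr_module_scheme \<Rightarrow> ('a \<times> (nat \<Rightarrow> int)) list \<Rightarrow> nat
      \<Rightarrow> (nat set \<Rightarrow> ('b \<times> nat) set) set" where
  "cech_cocycles R M gs p =
    {c \<in> carrier (cech R M gs p). cech_diff R M gs p c = \<zero>\<^bsub>cech R M gs (Suc p)\<^esub>}"

definition cech_coboundaries ::
    "('a, 'r) ring_scheme \<Rightarrow> ('a, 'b, 'm) gr_module_scheme \<Rightarrow> ('a \<times> (nat \<Rightarrow> int)) list \<Rightarrow> nat
      \<Rightarrow> (nat set \<Rightarrow> ('b \<times> nat) set) set" where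
  "cech_coboundaries R M gs p =
    (case p of 0 \<Rightarrow> {\<zero>\<^bsub>cech R M gs 0\<^esub>}
     | Suc q \<Rightarrow> cech_diff R M gs q ` carrier (cech R M gs q))"

definition local_cohomology ::
    "('a, 'r) ring_scheme \<Rightarrow> ('a, 'b, 'm) gr_module_scheme \<Rightarrow> ('a \<times> (nat \<Rightarrow> int)) list \<Rightarrow> nat
      \<Rightarrow> ('a, (nat set \<Rightarrow> ('b \<times> nat) set) set) gr_module" where
  "local_cohomology R M gs p =
    quot_gr_module
      (cech R M gs p
        \<lparr>carrier := cech_cocycles R M gs p,
         hcomp := (\<lambda>\<mu>. cech_cocycles R M gs p \<inter> hcomp (cech R M gs p) \<mu>)\<rparr>)
      (cech_coboundaries R M gs p)"


section \<open>Polynomial rings\<close>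

text \<open>A monomial is its exponent vector, and a polynomial is its coefficient function.
  \<open>mpolys V S\<close> is the set of polynomials in the variables \<open>V\<close> with coefficients in the subring
  \<open>S\<close> of \<open>'a\<close>.\<close>

definition mpolys :: "'v set \<Rightarrow> 'a set \<Rightarrow> (('v \<Rightarrow>\<^sub>0 nat) \<Rightarrow>\<^sub>0 'a::comm_ring_1) set" where
  "mpolys V S =
    {p. (\<forall>m\<in>Poly_Mapping.keys p. Poly_Mapping.keys m \<subseteq> V) \<and> (\<forall>m\<in>Poly_Mapping.keys p. Poly_Mapping.lookup p m \<in> S)}"

definition mpoly_const :: "'a \<Rightarrow> ('v \<Rightarrow>\<^sub>0 nat) \<Rightarrow>\<^sub>0 'a::comm_ring_1" where
  "mpoly_const a = Poly_Mapping.single 0 a"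

definition mpoly_var :: "'v \<Rightarrow> ('v \<Rightarrow>\<^sub>0 nat) \<Rightarrow>\<^sub>0 'a::comm_ring_1" where
  "mpoly_var v = Poly_Mapping.single (Poly_Mapping.single v 1) 1"

definition mpoly_eval ::
    "('a \<Rightarrow> 'b) \<Rightarrow> ('v \<Rightarrow> 'b) \<Rightarrow> (('v \<Rightarrow>\<^sub>0 nat) \<Rightarrow>\<^sub>0 'a::comm_ring_1) \<Rightarrow> 'b::comm_ring_1" where
  "mpoly_eval \<phi> z p = (\<Sum>m\<in>Poly_Mapping.keys p. \<phi> (Poly_Mapping.lookup p m) * (\<Prod>v\<in>Poly_Mapping.keys m. z v ^ Poly_Mapping.lookup m v))"

text \<open>The variable \<open>x\<^sub>j\<^sub>,\<^sub>l\<close> is the pair \<open>(j, l)\<close>. A family \<open>(\<alpha>\<^sub>1, \<dots>, \<alpha>\<^sub>r)\<close> of exponent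
  vectors is one exponent vector in all variables, the \<open>l\<close>-th entry of \<open>\<alpha>\<^sub>j\<close> being
  \<open>Poly_Mapping.lookup \<alpha> (j, l)\<close>. The indeterminate \<open>U\<^sub>i\<^sub>,\<^sub>\<alpha>\<close> is the pair \<open>(i, \<alpha>)\<close>.\<close>

type_synonym xvar = "nat \<times> nat"
type_synonym xmono = "xvar \<Rightarrow>\<^sub>0 nat"
type_synonym 'a xpoly = "xmono \<Rightarrow>\<^sub>0 'a"
type_synonym 'k upoly = "((nat \<times> xmono) \<Rightarrow>\<^sub>0 nat) \<Rightarrow>\<^sub>0 'k"

definition xvars :: "nat \<Rightarrow> (nat \<Rightarrow> nat) \<Rightarrow> xvar set" where
  "xvars r n = (SIGMA j:{1..r}. {..n j})"

definition xmono_deg :: "(nat \<Rightarrow> nat) \<Rightarrow> xmono \<Rightarrow> nat \<Rightarrow> int" where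
  "xmono_deg n m = (\<lambda>j. \<Sum>l\<le>n j. int (Poly_Mapping.lookup m (j, l)))"

definition xmonos :: "nat \<Rightarrow> (nat \<Rightarrow> nat) \<Rightarrow> (nat \<Rightarrow> int) \<Rightarrow> xmono set" where
  "xmonos r n \<mu> = {m. Poly_Mapping.keys m \<subseteq> xvars r n \<and> xmono_deg n m = \<mu>}"

definition xpolys_deg :: "nat \<Rightarrow> (nat \<Rightarrow> nat) \<Rightarrow> 'a set \<Rightarrow> (nat \<Rightarrow> int) \<Rightarrow> 'a::comm_ring_1 xpoly set" where
  "xpolys_deg r n S \<mu> = {p \<in> mpolys (xvars r n) S. \<forall>m\<in>Poly_Mapping.keys p. xmono_deg n m = \<mu>}"


section \<open>Generic multihomogeneous polynomials\<close>

definition ntot :: "nat \<Rightarrow> (nat \<Rightarrow> nat) \<Rightarrow> nat" where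
  "ntot r n = (\<Sum>j=1..r. n j)"

definition coeffs_A :: "nat \<Rightarrow> (nat \<Rightarrow> nat) \<Rightarrow> (nat \<Rightarrow> nat \<Rightarrow> int) \<Rightarrow> 'k::comm_ring_1 upoly set" where
  "coeffs_A r n d = mpolys (SIGMA i:{..ntot r n}. xmonos r n (d i)) UNIV"

definition ring_A :: "nat \<Rightarrow> (nat \<Rightarrow> nat) \<Rightarrow> (nat \<Rightarrow> nat \<Rightarrow> int) \<Rightarrow> 'k::comm_ring_1 upoly ring" where
  "ring_A r n d = ring_on (coeffs_A r n d)"

definition ring_C :: "nat \<Rightarrow> (nat \<Rightarrow> nat) \<Rightarrow> (nat \<Rightarrow> nat \<Rightarrow> int) \<Rightarrow> 'k::comm_ring_1 upoly xpoly ring" where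
  "ring_C r n d = ring_on (mpolys (xvars r n) (coeffs_A r n d))"

definition comp_C ::
    "nat \<Rightarrow> (nat \<Rightarrow> nat) \<Rightarrow> (nat \<Rightarrow> nat \<Rightarrow> int) \<Rightarrow> (nat \<Rightarrow> int) \<Rightarrow> 'k::comm_ring_1 upoly xpoly set" where
  "comp_C r n d \<mu> = xpolys_deg r n (coeffs_A r n d) \<mu>"

definition F_gen ::
    "nat \<Rightarrow> (nat \<Rightarrow> nat) \<Rightarrow> (nat \<Rightarrow> nat \<Rightarrow> int) \<Rightarrow> nat \<Rightarrow> 'k::comm_ring_1 upoly xpoly" where
  "F_gen r n d i =
    (\<Sum>\<alpha>\<in>xmonos r n (d i). mpoly_const (mpoly_var (i, \<alpha>)) * Poly_Mapping.single \<alpha> 1)"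

definition delta :: "nat \<Rightarrow> (nat \<Rightarrow> nat) \<Rightarrow> (nat \<Rightarrow> nat \<Rightarrow> int) \<Rightarrow> nat \<Rightarrow> int" where
  "delta r n d j = (if j \<in> {1..r} then (\<Sum>i\<le>ntot r n. d i j) - (int (n j) + 1) else 0)"

definition ideal_m ::
    "nat \<Rightarrow> (nat \<Rightarrow> nat) \<Rightarrow> (nat \<Rightarrow> nat \<Rightarrow> int) \<Rightarrow> nat \<Rightarrow> 'k::comm_ring_1 upoly xpoly set" where
  "ideal_m r n d j = Idl\<^bsub>ring_C r n d\<^esub> ((\<lambda>l. mpoly_var (j, l)) ` {..n j})"

text \<open>Products and powers of ideals are taken in the commutative monoid \<^const>\<open>ideals_set\<close>.\<close>

definition ideal_b ::
    "nat \<Rightarrow> (nat \<Rightarrow> nat) \<Rightarrow> (nat \<Rightarrow> nat \<Rightarrow> int) \<Rightarrow> 'k::comm_ring_1 upoly xpoly set" where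
  "ideal_b r n d = (\<Otimes>\<^bsub>ideals_set (ring_C r n d)\<^esub>j\<in>{1..r}. ideal_m r n d j)"

definition ideal_I ::
    "nat \<Rightarrow> (nat \<Rightarrow> nat) \<Rightarrow> (nat \<Rightarrow> nat \<Rightarrow> int) \<Rightarrow> 'k::comm_ring_1 upoly xpoly set" where
  "ideal_I r n d = Idl\<^bsub>ring_C r n d\<^esub> (F_gen r n d ` {..ntot r n})"

definition ideal_Isat ::
    "nat \<Rightarrow> (nat \<Rightarrow> nat) \<Rightarrow> (nat \<Rightarrow> nat \<Rightarrow> int) \<Rightarrow> 'k::comm_ring_1 upoly xpoly set" where
  "ideal_Isat r n d =
    {p \<in> carrier (ring_C r n d). \<exists>N::nat.
       \<forall>q \<in> ideal_b r n d [^]\<^bsub>ideals_set (ring_C r n d)\<^esub> N. q \<otimes>\<^bsub>ring_C r n d\<^esub> p \<in> ideal_I r n d}"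

definition module_C ::
    "nat \<Rightarrow> (nat \<Rightarrow> nat) \<Rightarrow> (nat \<Rightarrow> nat \<Rightarrow> int)
      \<Rightarrow> ('k::comm_ring_1 upoly xpoly, 'k upoly xpoly) gr_module" where
  "module_C r n d =
    \<lparr>carrier = carrier (ring_C r n d), monoid.mult = undefined, one = undefined,
     zero = 0, add = (+), module.smult = (*), hcomp = comp_C r n d\<rparr>"

definition B_sat ::
    "nat \<Rightarrow> (nat \<Rightarrow> nat) \<Rightarrow> (nat \<Rightarrow> nat \<Rightarrow> int)
      \<Rightarrow> ('k::comm_ring_1 upoly xpoly, 'k upoly xpoly set) gr_module" where
  "B_sat r n d = quot_gr_module (module_C r n d) (ideal_Isat r n d)"

definition B_sat_piece ::
    "nat \<Rightarrow> (nat \<Rightarrow> nat) \<Rightarrow> (nat \<Rightarrow> nat \<Rightarrow> int) \<Rightarrow> (nat \<Rightarrow> int)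
      \<Rightarrow> ('k::comm_ring_1 upoly, 'k upoly xpoly set) module" where
  "B_sat_piece r n d \<nu> =
    \<lparr>carrier = hcomp (B_sat r n d) \<nu>, monoid.mult = undefined, one = undefined,
     zero = \<zero>\<^bsub>B_sat r n d\<^esub>, add = add (B_sat r n d),
     module.smult = (\<lambda>a T. mpoly_const a \<odot>\<^bsub>B_sat r n d\<^esub> T)\<rparr>"


section \<open>The sets \<open>\<Gamma>\<^sub>0\<close> and \<open>\<Gamma>\<^sub>1\<close>\<close>

text \<open>Only the terms of the Koszul complex enter, not its differential.\<close>

definition koszul_index :: "nat \<Rightarrow> int \<Rightarrow> nat set set" where
  "koszul_index N p = {L. L \<subseteq> {..N} \<and> int (card L) = p}"

definition koszul ::
    "nat \<Rightarrow> (nat \<Rightarrow> nat) \<Rightarrow> (nat \<Rightarrow> nat \<Rightarrow> int) \<Rightarrow> int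
      \<Rightarrow> ('k::comm_ring_1 upoly xpoly, nat set \<Rightarrow> 'k upoly xpoly) gr_module" where
  "koszul r n d p =
    module.extend (free_module (ring_C r n d) (koszul_index (ntot r n) p))
      (gr_module.fields
        (\<lambda>\<mu>. \<Pi>\<^sub>E L\<in>koszul_index (ntot r n) p. comp_C r n d (\<lambda>j. \<mu> j - (\<Sum>i\<in>L. d i j))))"

text \<open>The generators \<open>x\<^sub>1\<^sub>,\<^sub>l\<^sub>1 \<cdots> x\<^sub>r\<^sub>,\<^sub>l\<^sub>r\<close> of \<open>ideal_b\<close>, all of degree
  \<open>(1, \<dots>, 1)\<close>.\<close>

definition b_gens ::
    "nat \<Rightarrow> (nat \<Rightarrow> nat) \<Rightarrow> ('k::comm_ring_1 upoly xpoly \<times> (nat \<Rightarrow> int)) list" where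
  "b_gens r n =
    map (\<lambda>xs. (prod_list xs, \<lambda>j. if j \<in> {1..r} then 1 else 0))
      (product_lists (map (\<lambda>j. map (\<lambda>l. mpoly_var (j, l)) [0..<Suc (n j)]) [1..<Suc r]))"

text \<open>The first argument only fixes the base ring \<open>'k\<close>.\<close>

definition Gamma ::
    "'k::comm_ring_1 itself \<Rightarrow> int \<Rightarrow> nat \<Rightarrow> (nat \<Rightarrow> nat) \<Rightarrow> (nat \<Rightarrow> nat \<Rightarrow> int) \<Rightarrow> (nat \<Rightarrow> int) set" where
  "Gamma K i r n d =
    (\<Union>p\<in>{-1..int (ntot r n) - 1}.
       Supp (local_cohomology (ring_C r n d) (koszul r n d (p + i) :: ('k upoly xpoly, _) gr_module)
               (b_gens r n) (nat (p + 1))))"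


section \<open>Multigraded Sylvester forms\<close>

text \<open>\<open>nested r n \<alpha> G l\<close> is the right-hand side of the decomposition from the \<open>l\<close>-th group of
  variables on, with \<open>G l j\<close> in the role of \<open>F\<^sup>(\<^sup>l\<^sup>)\<^sub>j\<close>.\<close>

function nested ::
    "nat \<Rightarrow> (nat \<Rightarrow> nat) \<Rightarrow> xmono \<Rightarrow> (nat \<Rightarrow> nat \<Rightarrow> 'a::comm_ring_1 xpoly) \<Rightarrow> nat \<Rightarrow> 'a xpoly" where
  "nested r n \<alpha> G l =
    (if l < r
     then (\<Sum>j<n l. mpoly_var (l, j) ^ (Poly_Mapping.lookup \<alpha> (l, j) + 1) * G l j)
          + mpoly_var (l, n l) ^ (Poly_Mapping.lookup \<alpha> (l, n l) + 1) * nested r n \<alpha> G (Suc l)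
     else (\<Sum>j\<le>n l. mpoly_var (l, j) ^ (Poly_Mapping.lookup \<alpha> (l, j) + 1) * G l j))"
  by pat_completeness auto
termination by (relation "measure (\<lambda>(r, n, \<alpha>, G, l). r - l)") auto

declare nested.simps [simp del]

definition sylv_cols :: "nat \<Rightarrow> (nat \<Rightarrow> nat) \<Rightarrow> (nat \<times> nat) list" where
  "sylv_cols r n = concat (map (\<lambda>l. map (Pair l) [0..<n l]) [1..<Suc r]) @ [(r, n r)]"

definition sylv_decomp ::
    "nat \<Rightarrow> (nat \<Rightarrow> nat) \<Rightarrow> (nat \<Rightarrow> nat \<Rightarrow> int) \<Rightarrow> xmono
      \<Rightarrow> (nat \<Rightarrow> nat \<Rightarrow> nat \<Rightarrow> 'k::comm_ring_1 upoly xpoly) \<Rightarrow> bool" where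
  "sylv_decomp r n d \<alpha> G \<longleftrightarrow>
    (\<forall>i\<le>ntot r n. (\<forall>(l, j) \<in> set (sylv_cols r n). \<exists>\<mu>. G i l j \<in> comp_C r n d \<mu>) \<and>
                 F_gen r n d i = nested r n \<alpha> (G i) 1)"

definition sylv_det ::
    "nat \<Rightarrow> (nat \<Rightarrow> nat) \<Rightarrow> (nat \<Rightarrow> nat \<Rightarrow> nat \<Rightarrow> 'k::comm_ring_1 upoly xpoly) \<Rightarrow> 'k upoly xpoly" where
  "sylv_det r n G =
    det (mat (ntot r n + 1) (ntot r n + 1) (\<lambda>(i, c). case sylv_cols r n ! c of (l, j) \<Rightarrow> G i l j))"

definition sylv ::
    "nat \<Rightarrow> (nat \<Rightarrow> nat) \<Rightarrow> xmono \<Rightarrow> (nat \<Rightarrow> nat \<Rightarrow> nat \<Rightarrow> 'k::comm_ring_1 upoly xpoly)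
      \<Rightarrow> 'k upoly xpoly" where
  "sylv r n \<alpha> G =
    (\<Prod>i=1..<r. mpoly_var (i, n i) ^ ((Poly_Mapping.lookup \<alpha> (i, n i) + 1) * (\<Sum>j=i+1..r. n j))) * sylv_det r n G"


section \<open>The elimination matrices and their specializations\<close>

text \<open>Rows are indexed by the monomials of degree \<open>\<nu>\<close>; a column \<open>(i, \<beta>)\<close> stands for the
  element \<open>x\<^sup>\<beta>\<close> of the \<open>i\<close>-th summand of the source.\<close>

definition M_cols :: "nat \<Rightarrow> (nat \<Rightarrow> nat) \<Rightarrow> (nat \<Rightarrow> nat \<Rightarrow> int) \<Rightarrow> (nat \<Rightarrow> int) \<Rightarrow> (nat \<times> xmono) set" where
  "M_cols r n d \<nu> = (SIGMA i:{..ntot r n}. xmonos r n (\<nu> - d i))"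

definition M_mat ::
    "nat \<Rightarrow> (nat \<Rightarrow> nat) \<Rightarrow> (nat \<Rightarrow> nat \<Rightarrow> int) \<Rightarrow> xmono \<Rightarrow> nat \<times> xmono \<Rightarrow> 'k::comm_ring_1 upoly" where
  "M_mat r n d \<gamma> c = (case c of (i, \<beta>) \<Rightarrow> Poly_Mapping.lookup (Poly_Mapping.single \<beta> 1 * F_gen r n d i) \<gamma>)"

definition H_cols ::
    "nat \<Rightarrow> (nat \<Rightarrow> nat) \<Rightarrow> (nat \<Rightarrow> nat \<Rightarrow> int) \<Rightarrow> (nat \<Rightarrow> int) \<Rightarrow> (nat \<times> xmono + xmono) set" where
  "H_cols r n d \<nu> = Inl ` M_cols r n d \<nu> \<union> Inr ` xmonos r n (delta r n d - \<nu>)"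

text \<open>\<open>G \<alpha>\<close> is the decomposition used to form the Sylvester form of index \<open>\<alpha>\<close>.\<close>

definition H_mat ::
    "nat \<Rightarrow> (nat \<Rightarrow> nat) \<Rightarrow> (nat \<Rightarrow> nat \<Rightarrow> int)
      \<Rightarrow> (xmono \<Rightarrow> nat \<Rightarrow> nat \<Rightarrow> nat \<Rightarrow> 'k::comm_ring_1 upoly xpoly)
      \<Rightarrow> xmono \<Rightarrow> nat \<times> xmono + xmono \<Rightarrow> 'k upoly" where
  "H_mat r n d G \<gamma> c =
    (case c of Inl c' \<Rightarrow> M_mat r n d \<gamma> c' | Inr \<alpha> \<Rightarrow> Poly_Mapping.lookup (sylv r n \<alpha> (G \<alpha>)) \<gamma>)"

definition specialize :: "(nat \<Rightarrow> 'a::field xpoly) \<Rightarrow> int upoly \<Rightarrow> 'a" where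
  "specialize f = mpoly_eval of_int (\<lambda>(i, \<alpha>). Poly_Mapping.lookup (f i) \<alpha>)"

definition nonzero_vecs :: "nat \<Rightarrow> (nat \<Rightarrow> 'b::field) set" where
  "nonzero_vecs m = {v \<in> {..m} \<rightarrow>\<^sub>E UNIV. \<exists>l\<le>m. v l \<noteq> 0}"

definition proj_space :: "nat \<Rightarrow> (nat \<Rightarrow> 'b::field) set set" where
  "proj_space m =
    nonzero_vecs m //
      {(v, w). v \<in> nonzero_vecs m \<and> w \<in> nonzero_vecs m \<and> (\<exists>c. c \<noteq> 0 \<and> (\<forall>l\<le>m. w l = c * v l))}"

text \<open>Coefficients are moved to the algebraic closure by \<^const>\<open>to_ac\<close>.\<close>

definition has_common_zero :: "nat \<Rightarrow> (nat \<Rightarrow> nat) \<Rightarrow> (nat \<Rightarrow> 'a::field xpoly) \<Rightarrow> bool" where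
  "has_common_zero r n f \<longleftrightarrow>
    (\<exists>P \<in> (\<Pi>\<^sub>E j\<in>{1..r}. (proj_space (n j) :: (nat \<Rightarrow> 'a alg_closure) set set)).
       \<forall>i\<le>ntot r n. \<forall>v \<in> (\<Pi>\<^sub>E j\<in>{1..r}. P j). mpoly_eval to_ac (\<lambda>(j, l). v j l) (f i) = 0)"

end

theory Submission
 imports Defs "HOL-Library.Product_Lexorder" "HOL-Library.Function_Algebras"
begin

text \<open>For a transversal \<open>\<sigma>\<close> let \<open>x\<^sub>\<sigma>\<close> be the product of the variables \<open>x\<^sub>j\<^sub>,\<^sub>\<sigma>\<^sub>j\<close>; a form lies in
  \<open>I\<^sup>s\<^sup>a\<^sup>t\<close> iff for each \<open>\<sigma>\<close> it is multiplied into \<open>I\<close> by a power of \<open>x\<^sub>\<sigma>\<close>. Consider the double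
  complex built from the Koszul complex of the generic forms and a cellular model of the Cech
  complex: its cells are sets \<open>W\<close> of variables that meet every group, with coefficients in the
  localization at \<open>W\<close>. The generic forms are a regular sequence after localization, so the Koszul
  direction is exact; in a fixed fine degree the cellular direction is exact unless the negative
  exponents fill the groups in some \<open>J\<close> and \<open>card W = r + (\<Sum>j\<in>J. n j)\<close>. A diagram chase gives
  \<open>I\<^sup>s\<^sup>a\<^sup>t = I\<close> in degree \<open>\<nu>\<close> when no exceptional fine degree occurs on the diagonal. For (a), an exceptional
  degree, multiplied with the pullback of a simplex to the Cech complex, represents a nonzero local
  cohomology class, so it forces \<open>\<nu>\<close> into \<open>\<delta> - \<nat>\<^sup>r\<close> or \<open>\<Gamma>\<^sub>1\<close>. For (b) only the degrees with all
  exponents negative remain, and the complementary minors of a decomposition matrix form a zigzag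
  from \<open>Sylv\<^sub>\<alpha>\<close> to \<open>x\<^sup>-\<^sup>\<alpha>\<^sup>-\<^sup>1\<close>.

  If \<open>f\<close> has no common zero, the Nullstellensatz provides \<open>a\<close> in the saturated ideal over \<open>\<int>\<close> that is a
  constant not specializing to zero; then \<open>a x\<^sup>\<gamma>\<close> lies in the image of the generic matrix over \<open>\<int>\<close>
  for all \<open>\<gamma>\<close>. Conversely, \<open>I\<^sup>s\<^sup>a\<^sup>t\<close> vanishes at common zeros.\<close>

section \<open>Signs and minors\<close>

text \<open>The cellular model of the Cech complex is chosen because it stops exactly where the
  Koszul complex does: a cell has at most \<open>N + r\<close> variables, so the diagonal ends in a
  corner with one index set and one cell, where coefficients can be read off. The base ring is
  arbitrary, which rules out dimension counts and duality over a field. Exactness is therefore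
  proved by explicit homotopies on the coefficient of one monomial, and regularity by solving a
  generic form for the coefficient of a monomial that the localization inverts. Cells of dimension
  \<open>q - 1\<close> correspond to Cech degree \<open>q\<close>; this shift is why an exceptional
  degree at the diagonal spot \<open>(q, q)\<close> belongs to the local cohomology of degree
  \<open>q\<close> of the \<open>q\<close>-th Koszul term. The corner \<open>q = N + 1\<close> lies
  beyond the range of the union defining \<open>Gamma\<close> and is governed by \<delta>. The
  simplex on the columns of the Sylvester determinant serves twice, through the same map from
  transversals to columns: it shapes the Sylvester zigzag, and it supplies the cocycles that detect
  exceptional degrees.\<close>

definition sg :: "'v::linorder => 'v set => 'b::ab_group_add => 'b" where
 "sg x S p = (if even (card {y\<in>S. y < x}) then p else - p)"

lemma sg_add: "sg x S (p + q) = sg x S p + sg x S q"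
 and sg_diff: "sg x S (p - q) = sg x S p - sg x S q"
 and sg_minus: "sg x S (- p) = - sg x S p"
 and sg_zero [simp]: "sg x S 0 = 0"
 and sg_sg [simp]: "sg x S (sg x S p) = p"
 and sg_comm: "sg x S (sg y T p) = sg y T (sg x S p)"
 and sg_eq_0_iff [simp]: "sg x S p = 0 \<longleftrightarrow> p = 0" by (simp_all add: sg_def)

lemma sg_empty [simp]: "sg x {} p = p"
 and sg_singleton [simp]: "sg x {x} p = p"
proof -
 have "{y \<in> {x}. y < x} = {}" by auto
 thus "sg x {x} p = p" by (simp only: sg_def) simp
qed (simp add: sg_def)

lemma sg_sum: "sg x S (sum f A) = (\<Sum>a\<in>A. sg x S (f a))" by (simp add: sg_def sum_negf)

lemma sg_mult_right: "(a::'b::ring) * sg x S p = sg x S (a * p)"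
 and sg_mult_left: "sg x S p * (a::'b::ring) = sg x S (p * a)" by (simp_all add: sg_def)

lemma sg_insert:
 assumes "finite S" "x \<notin> S"
 shows "sg y (insert x S) p = (if x < y then - sg y S p else sg y S p)"
proof (cases "x < y")
 case True
 have "{z \<in> insert x S. z < y} = insert x {z\<in>S. z < y}" using True by auto
 thus ?thesis using True assms by (simp add: sg_def)
next
 case False
 have "{z \<in> insert x S. z < y} = {z\<in>S. z < y}" using False by auto
 thus ?thesis using False by (simp add: sg_def)
qed

lemma sg_remove:
 assumes "finite S" "x \<in> S"
 shows "sg y (S - {x}) p = (if x < y then - sg y S p else sg y S p)"
proof -
 have "sg y S p = (if x < y then - sg y (S - {x}) p else sg y (S - {x}) p)"
  using sg_insert[of "S - {x}" x y p] assms by (simp add: insert_absorb)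
 thus ?thesis by (auto simp: sg_minus)
qed

text \<open>Both relations of the form d d = 0, for \<open>cobd\<close> and for \<open>kos\<close>,
  come down to this cancellation: the two orders of treating a pair of elements contribute opposite
  signs.\<close>

lemma sum_pairs_antisym:
 fixes f :: "'v::linorder => 'v => 'b::ab_group_add"
 assumes "finite S" "!!x y. x \<in> S ==> y \<in> S ==> x < y ==> f x y = - f y x"
 shows "(\<Sum>x\<in>S. \<Sum>y\<in>S - {x}. f x y) = 0"
proof -
 have "(\<Sum>x\<in>S. \<Sum>y\<in>S - {x}. f x y) = (\<Sum>x\<in>S. (\<Sum>y\<in>{y\<in>S. x < y}. f x y) + (\<Sum>y\<in>{y\<in>S. y < x}. f x y))"
 proof (rule sum.cong[OF refl])
  fix x assume "x \<in> S"
  have "S - {x} = {y\<in>S. x < y} \<union> {y\<in>S. y < x}" by auto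
  moreover have "sum (f x) ({y\<in>S. x < y} \<union> {y\<in>S. y < x}) = sum (f x) {y\<in>S. x < y} + sum (f x) {y\<in>S. y < x}"
   using assms(1) by (intro sum.union_disjoint) auto
  ultimately show "(\<Sum>y\<in>S - {x}. f x y) = (\<Sum>y\<in>{y\<in>S. x < y}. f x y) + (\<Sum>y\<in>{y\<in>S. y < x}. f x y)"
   by metis
 qed
 also have "\<dots> = (\<Sum>x\<in>S. \<Sum>y\<in>{y\<in>S. x < y}. f x y) + (\<Sum>x\<in>S. \<Sum>y\<in>{y\<in>S. y < x}. f x y)"
  by (simp add: sum.distrib)
 also have "(\<Sum>x\<in>S. \<Sum>y\<in>{y\<in>S. y < x}. f x y) = (\<Sum>y\<in>S. \<Sum>x\<in>{x\<in>S. y < x}. f x y)"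
  by (rule sum.swap_restrict[OF assms(1) assms(1), where R = "%x y. y < x"])
 also have "\<dots> = (\<Sum>y\<in>S. \<Sum>x\<in>{x\<in>S. y < x}. - f y x)"
  using assms(2) by (intro sum.cong refl) (metis (mono_tags, lifting) mem_Collect_eq minus_minus)
 finally show ?thesis by (simp add: sum_negf)
qed

text \<open>Cochains are functions on all sets; being carried by cells is a separate support
  condition. The sign \<open>sg x S\<close> counts the elements of S below x whether or not x lies
  in S, so that it serves removal of x here and insertion of x in \<open>kos\<close>.\<close>

definition cobd :: "('v::linorder set => 'b::ab_group_add) => 'v set => 'b" where
 "cobd e S = (\<Sum>x\<in>S. sg x S (e (S - {x})))"

lemma cobd_cobd:
 assumes "finite S"
 shows "cobd (cobd e) S = 0"
proof -
 have "cobd (cobd e) S = (\<Sum>x\<in>S. \<Sum>y\<in>S - {x}. sg x S (sg y (S - {x}) (e (S - {x} - {y}))))"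
  by (simp add: cobd_def sg_sum)
 also have "\<dots> = 0"
 proof (rule sum_pairs_antisym[OF assms])
  fix x y assume "x \<in> S" "y \<in> S" "x < y"
  moreover have "S - {x} - {y} = S - {y} - {x}" by auto
  moreover have "~ y < x" using \<open>x < y\<close> by simp
  ultimately show "sg x S (sg y (S - {x}) (e (S - {x} - {y}))) = - sg y S (sg x (S - {y}) (e (S - {y} - {x})))"
   using assms by (simp add: sg_remove sg_minus sg_comm[of x S y S])
 qed
 finally show ?thesis .
qed

lemma cobd_diff: "cobd (%S. e S - e' S) S = cobd e S - cobd e' S" by (simp add: cobd_def sg_diff sum_subtractf)

lemma cobd_add: "cobd (%S. e S + e' S) S = cobd e S + cobd e' S" by (simp add: cobd_def sg_add sum.distrib)

lemma cobd_cong: "(!!x. x \<in> S ==> e (S - {x}) = e' (S - {x})) ==> cobd e S = cobd e' S" by (simp add: cobd_def)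

text \<open>The contraction with apex \<open>v\<close>, dual to adding \<open>v\<close> to a
  simplex. The complex is augmented: the empty set takes part, so the homotopy identity has no
  exception in lowest degree.\<close>

definition cone_op :: "'v::linorder => ('v set => 'b::ab_group_add) => 'v set => 'b" where
 "cone_op v c W = (if v \<in> W then 0 else sg v W (c (insert v W)))"

lemma cone_op_homotopy:
 assumes "finite W"
 shows "cobd (cone_op v c) W + cone_op v (cobd c) W = c W"
proof (cases "v \<in> W")
 case True
 have "cobd (cone_op v c) W = sg v W (cone_op v c (W - {v})) + (\<Sum>x\<in>W - {v}. sg x W (cone_op v c (W - {x})))"
  unfolding cobd_def using assms True by (simp add: sum.remove)
 also have "(\<Sum>x\<in>W - {v}. sg x W (cone_op v c (W - {x}))) = 0" using True by (intro sum.neutral) (auto simp: cone_op_def)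
 also have "sg v W (cone_op v c (W - {v})) = c W" using assms True by (simp add: cone_op_def sg_remove insert_absorb)
 finally show ?thesis using True by (simp add: cone_op_def[of v "cobd c"])
next
 case False
 have "cone_op v (cobd c) W = sg v W (sg v (insert v W) (c W)
   + (\<Sum>x\<in>W. sg x (insert v W) (c (insert v W - {x}))))" using assms False by (simp add: cone_op_def cobd_def)
 also have "\<dots> = c W + (\<Sum>x\<in>W. sg v W (sg x (insert v W) (c (insert v W - {x}))))"
  using assms False by (simp add: sg_add sg_sum sg_insert)
 finally have 1: "cone_op v (cobd c) W = c W + (\<Sum>x\<in>W. sg v W (sg x (insert v W) (c (insert v W - {x}))))" .
 have "sg v W (sg x (insert v W) (c (insert v W - {x}))) = - sg x W (cone_op v c (W - {x}))" if "x \<in> W" for x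
 proof -
  have "x ~= v" using that False by auto
  thus ?thesis using that False assms
   by (cases "v < x") (auto simp: cone_op_def sg_insert sg_remove sg_minus insert_Diff_if sg_comm[of v W x W])
 qed
 hence "(\<Sum>x\<in>W. sg v W (sg x (insert v W) (c (insert v W - {x})))) = - cobd (cone_op v c) W"
  by (simp add: cobd_def sum_negf)
 with 1 show ?thesis by simp
qed

text \<open>The \<open>k \<times> k\<close> minors of \<open>G\<close>, by Laplace expansion along the first row.\<close>

primrec minr :: "nat => ('i::linorder => 'c::linorder => 'b::comm_ring_1) => 'i set => 'c set => 'b" where
 "minr 0 G P R = 1"
| "minr (Suc k) G P R = (\<Sum>c\<in>R. sg c R (G (Min P) c * minr k G (P - {Min P}) (R - {c})))"

text \<open>Cramer's rule in Laplace form: the terms with c in R would be minors with a repeated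
  column. It is used with the generic forms and their decomposition, and with F = y = 1 for
  indicator matrices, where it becomes the boundary formula of a simplicial map.\<close>

lemma minr_expand:
 fixes G :: "'i::linorder => 'c::linorder => 'b::comm_ring_1"
 assumes "finite P" "card P = Suc k" "finite U" "R \<subseteq> U" "card R = k"
  and "!!i. i \<in> P ==> F i = (\<Sum>c\<in>U. G i c * y c)"
 shows "(\<Sum>i\<in>P. sg i P (F i * minr k G (P - {i}) R))
    = (\<Sum>c\<in>U - R. sg c R (y c * minr (Suc k) G P (insert c R)))" using assms
proof (induction k arbitrary: P R)
 case 0
 then obtain s where P: "P = {s}" using card_1_singletonE by (metis One_nat_def)
 have R: "R = {}" using 0 finite_subset by fastforce
 show ?case using 0 unfolding P R by (simp add: mult.commute)
next
 case (Suc k)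
 define s where "s = Min P"
 have Pne: "P ~= {}" using Suc.prems(2) by auto
 have s: "s \<in> P" "!!x. x \<in> P ==> s \<le> x" using Suc.prems(1) Pne by (auto simp: s_def)
 have finR: "finite R" using Suc.prems finite_subset by blast
 let ?P = "P - {s}"
 have fP: "finite ?P" "card ?P = Suc k" using Suc.prems s by auto
 define L where "L c0 = (\<Sum>i\<in>?P. sg i ?P (F i * minr k G (?P - {i}) (R - {c0})))" for c0
 have s0: "{y. y \<in> P \<and> y < s} = {}" using s(2) by (auto dest: leD)
 \<comment> \<open>As \<open>s\<close> is the least row, its own term has sign + and every other
   minor can be expanded along row \<open>s\<close>.\<close>
 have lhs: "(\<Sum>i\<in>P. sg i P (F i * minr (Suc k) G (P - {i}) R))
   = F s * minr (Suc k) G ?P R - (\<Sum>c0\<in>R. sg c0 R (G s c0 * L c0))"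
 proof -
  have a: "sg i P (F i * minr (Suc k) G (P - {i}) R)
    = - (\<Sum>c0\<in>R. sg c0 R (G s c0 * sg i ?P (F i * minr k G (?P - {i}) (R - {c0}))))"
   if i: "i \<in> ?P" for i
  proof -
   have "Min (P - {i}) = s" using i s Suc.prems(1) by (intro Min_eqI) auto
   moreover have "s < i" using i s(2)[of i] by (auto simp: order_less_le)
   moreover have "P - {i} - {s} = ?P - {i}" by auto
   ultimately have m: "minr (Suc k) G (P - {i}) R = (\<Sum>c0\<in>R. sg c0 R (G s c0 * minr k G (?P - {i}) (R - {c0})))" by simp
   have sP: "sg i P x = - sg i ?P x" for x :: 'b using sg_remove[OF Suc.prems(1) s(1), of i x] \<open>s < i\<close> by simp
   have "F i * minr (Suc k) G (P - {i}) R = (\<Sum>c0\<in>R. sg c0 R (G s c0 * (F i * minr k G (?P - {i}) (R - {c0}))))"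
    unfolding m sum_distrib_left by (intro sum.cong refl) (simp only: sg_mult_right mult.left_commute)
   thus ?thesis unfolding sP by (simp only: sg_sum sg_mult_right sg_comm[of _ R i ?P])
  qed
  have "(\<Sum>i\<in>P. sg i P (F i * minr (Suc k) G (P - {i}) R))
    = sg s P (F s * minr (Suc k) G ?P R) + (\<Sum>i\<in>?P. sg i P (F i * minr (Suc k) G (P - {i}) R))"
   using Suc.prems(1) s by (simp add: sum.remove)
  also have "sg s P (F s * minr (Suc k) G ?P R) = F s * minr (Suc k) G ?P R" by (simp only: sg_def s0) simp
  also have "(\<Sum>i\<in>?P. sg i P (F i * minr (Suc k) G (P - {i}) R))
    = - (\<Sum>i\<in>?P. \<Sum>c0\<in>R. sg c0 R (G s c0 * sg i ?P (F i * minr k G (?P - {i}) (R - {c0}))))"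
   by (simp only: a sum_negf cong: sum.cong)
  also have "(\<Sum>i\<in>?P. \<Sum>c0\<in>R. sg c0 R (G s c0 * sg i ?P (F i * minr k G (?P - {i}) (R - {c0}))))
    = (\<Sum>c0\<in>R. sg c0 R (G s c0 * L c0))" by (subst sum.swap) (simp add: L_def sg_sum sum_distrib_left)
  finally show ?thesis by simp
 qed
 \<comment> \<open>Column \<open>c0\<close> has left R and joins the complement. The extra summands
   add up to the part of F s carried by R, which cancels against the term of row
   \<open>s\<close>.\<close>
 have IH: "L c0 = sg c0 R (y c0 * minr (Suc k) G ?P R) + (\<Sum>c\<in>U - R. sg c (R - {c0}) (y c * minr (Suc k) G ?P (insert c (R - {c0}))))"
  if c0: "c0 \<in> R" for c0
 proof -
  have "L c0 = (\<Sum>c\<in>U - (R - {c0}). sg c (R - {c0}) (y c * minr (Suc k) G ?P (insert c (R - {c0}))))"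
   unfolding L_def using fP Suc.prems c0 finR by (intro Suc.IH) auto
  also have "U - (R - {c0}) = insert c0 (U - R)" using c0 Suc.prems by auto
  finally show ?thesis using c0 finR Suc.prems(3) by (simp add: insert_absorb sg_remove del: minr.simps)
 qed
 have "(\<Sum>c0\<in>R. sg c0 R (G s c0 * L c0)) = (\<Sum>c0\<in>R. G s c0 * y c0) * minr (Suc k) G ?P R
   + (\<Sum>c0\<in>R. \<Sum>c\<in>U - R. sg c0 R (sg c (R - {c0}) (G s c0 * (y c * minr (Suc k) G ?P (insert c (R - {c0}))))))"
  by (simp add: IH distrib_left sg_add sg_mult_right sum.distrib sum_distrib_left sum_distrib_right sg_sum mult.assoc
    del: minr.simps)
 also have "(\<Sum>c0\<in>R. G s c0 * y c0) = F s - (\<Sum>c\<in>U - R. G s c * y c)"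
  using Suc.prems s sum.subset_diff[of R U "%c. G s c * y c"] by simp
 finally have lhs2: "(\<Sum>i\<in>P. sg i P (F i * minr (Suc k) G (P - {i}) R))
   = (\<Sum>c\<in>U - R. G s c * y c) * minr (Suc k) G ?P R
   - (\<Sum>c0\<in>R. \<Sum>c\<in>U - R. sg c0 R (sg c (R - {c0}) (G s c0 * (y c * minr (Suc k) G ?P (insert c (R - {c0}))))))"
  unfolding lhs by (simp add: left_diff_distrib del: minr.simps)
 have rhs: "sg c R (y c * minr (Suc (Suc k)) G P (insert c R)) = G s c * y c * minr (Suc k) G ?P R
   - (\<Sum>c0\<in>R. sg c0 R (sg c (R - {c0}) (G s c0 * (y c * minr (Suc k) G ?P (insert c (R - {c0}))))))"
  if c: "c \<in> U - R" for c
 proof -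
  have e: "minr (Suc (Suc k)) G P (insert c R)
   = (\<Sum>c0\<in>insert c R. sg c0 (insert c R) (G s c0 * minr (Suc k) G ?P (insert c R - {c0})))"
   by (simp only: minr.simps(2)[of "Suc k"] s_def)
  have "sg c R (y c * minr (Suc (Suc k)) G P (insert c R))
    = sg c R (y c * sg c (insert c R) (G s c * minr (Suc k) G ?P (insert c R - {c})))
    + (\<Sum>c0\<in>R. sg c R (y c * sg c0 (insert c R) (G s c0 * minr (Suc k) G ?P (insert c R - {c0}))))"
   unfolding e using c finR by (simp add: distrib_left sg_add sum_distrib_left sg_sum del: minr.simps)
  also have "sg c R (y c * sg c (insert c R) (G s c * minr (Suc k) G ?P (insert c R - {c})))
    = G s c * y c * minr (Suc k) G ?P R" using c finR by (simp add: sg_insert sg_mult_right mult_ac del: minr.simps)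
  also have "(\<Sum>c0\<in>R. sg c R (y c * sg c0 (insert c R) (G s c0 * minr (Suc k) G ?P (insert c R - {c0}))))
    = (\<Sum>c0\<in>R. - sg c0 R (sg c (R - {c0}) (G s c0 * (y c * minr (Suc k) G ?P (insert c (R - {c0}))))))"
  proof (rule sum.cong[OF refl])
   fix c0 assume c0: "c0 \<in> R"
   have i: "insert c R - {c0} = insert c (R - {c0})" "c ~= c0" using c c0 by auto
   show "sg c R (y c * sg c0 (insert c R) (G s c0 * minr (Suc k) G ?P (insert c R - {c0})))
    = - sg c0 R (sg c (R - {c0}) (G s c0 * (y c * minr (Suc k) G ?P (insert c (R - {c0})))))" unfolding i(1) using c c0 finR i(2)
    by (cases "c < c0") (auto simp: sg_insert sg_remove sg_minus sg_comm[of c R c0 R] sg_mult_right mult.left_commute simp del: minr.simps)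
  qed
  finally show ?thesis by (simp add: sum_negf del: minr.simps)
 qed
 have "(\<Sum>c\<in>U - R. sg c R (y c * minr (Suc (Suc k)) G P (insert c R)))
  = (\<Sum>c\<in>U - R. G s c * y c) * minr (Suc k) G ?P R
   - (\<Sum>c\<in>U - R. \<Sum>c0\<in>R. sg c0 R (sg c (R - {c0}) (G s c0 * (y c * minr (Suc k) G ?P (insert c (R - {c0}))))))"
  by (simp only: rhs sum_subtractf sum_distrib_right cong: sum.cong)
 thus ?case unfolding lhs2 by (subst sum.swap) simp
qed

text \<open>Rows and columns come as increasing lists, so that the position in the list is the
  number counted by \<open>sg\<close> and no sign of a permutation enters.\<close>

lemma det_eq_minr:
 assumes "length ps = k" "length rs = k" "sorted_wrt (<) ps" "sorted_wrt (<) rs"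
 shows "det (mat k k (%(i, j). G (ps ! i) (rs ! j))) = minr k G (set ps) (set rs)" using assms
proof (induction k arbitrary: ps rs)
 case 0
 thus ?case by simp
next
 case (Suc k)
 obtain p ps' where ps: "ps = p # ps'" using Suc.prems by (cases ps) auto
 have Mp: "Min (set ps) = p" "set ps - {p} = set ps'" using Suc.prems unfolding ps by (auto intro!: Min_eqI)
 let ?A = "mat (Suc k) (Suc k) (%(i, j). G (ps ! i) (rs ! j))"
 have dis: "distinct rs" using Suc.prems(4) by (simp add: strict_sorted_iff)
 have "det ?A = (\<Sum>j<Suc k. ?A $$ (0, j) * cofactor ?A 0 j)" by (rule laplace_expansion_row[of _ "Suc k"]) auto
 also have "\<dots> = (\<Sum>j<Suc k. sg (rs ! j) (set rs) (G p (rs ! j) * minr k G (set ps') (set rs - {rs ! j})))"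
 proof (rule sum.cong[OF refl])
  fix j assume j: "j \<in> {..<Suc k}"
  let ?rs = "take j rs @ drop (Suc j) rs"
  have len: "j < length rs" using j Suc.prems by simp
  have rs: "rs = take j rs @ rs ! j # drop (Suc j) rs" using len by (simp add: id_take_nth_drop)
  have srt: "sorted_wrt (<) ?rs" using Suc.prems(4) by (subst (asm) rs) (auto simp: sorted_wrt_append)
  have set: "set ?rs = set rs - {rs ! j}" using dis by (subst (3) rs, subst (asm) rs) auto
  have "mat_delete ?A 0 j = mat k k (%(i, j'). G (ps' ! i) (?rs ! j'))"
   using len Suc.prems by (intro eq_matI) (auto simp: mat_delete_def ps nth_append min_def)
  hence "det (mat_delete ?A 0 j) = minr k G (set ps') (set ?rs)" using Suc.IH[of ps' ?rs] Suc.prems srt ps len by simp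
  moreover have "card {y \<in> set rs. y < rs ! j} = j"
  proof -
   have "x < rs ! j" if "x \<in> set (take j rs)" for x using Suc.prems(4) that by (subst (asm) rs) (auto simp: sorted_wrt_append)
   moreover have "rs ! j < x" if "x \<in> set (drop (Suc j) rs)" for x
    using Suc.prems(4) that by (subst (asm) rs) (auto simp: sorted_wrt_append)
   ultimately have "{y \<in> set rs. y < rs ! j} = set (take j rs)" by (subst rs) (auto dest: less_asym)
   thus ?thesis using dis len by (simp add: distinct_card)
  qed
  ultimately show "?A $$ (0, j) * cofactor ?A 0 j
    = sg (rs ! j) (set rs) (G p (rs ! j) * minr k G (set ps') (set rs - {rs ! j}))"
   using j set by (auto simp: cofactor_def sg_def ps)
 qed
 also have "\<dots> = (\<Sum>c\<in>set rs. sg c (set rs) (G p c * minr k G (set ps') (set rs - {c})))"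
  using bij_betw_nth[OF dis, of "{..<Suc k}" "set rs"] Suc.prems by (intro sum.reindex_bij_betw) auto
 finally show ?case by (simp add: Mp)
qed

section \<open>The cellular complex of a product of simplices\<close>

definition grp :: "(nat => nat) => nat => xvar set" where
 "grp n j = {j} \<times> {..n j}"

text \<open>A cell \<open>S\<^sub>1 \<times> \<dots> \<times> S\<^sub>r\<close> is encoded as the disjoint union of its (nonempty) factors; its
 dimension is \<open>card W - r\<close>.\<close>

definition cells :: "nat => (nat => nat) => xvar set set" where
 "cells r n = {W. W \<subseteq> xvars r n \<and> (\<forall>j\<in>{1..r}. W \<inter> grp n j ~= {})}"

lemma finite_xvars [simp]: "finite (xvars r n)" by (simp add: xvars_def)

lemma xvars_eq: "xvars r n = (\<Union>j\<in>{1..r}. grp n j)" by (auto simp: xvars_def grp_def)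

lemma finite_grp [simp]: "finite (grp n j)"
 and card_grp [simp]: "card (grp n j) = n j + 1"
 and grp_disjoint: "i ~= j ==> grp n i \<inter> grp n j = {}" by (auto simp: grp_def card_cartesian_product)

lemma cells_finite: "W \<in> cells r n ==> finite W" by (auto simp: cells_def intro: finite_subset)

lemma cells_mono: "W \<in> cells r n ==> W \<subseteq> W' ==> W' \<subseteq> xvars r n ==> W' \<in> cells r n"
 by (fastforce simp: cells_def)

lemma card_by_groups:
 assumes "W \<subseteq> xvars r n"
 shows "card W = (\<Sum>j\<in>{1..r}. card (W \<inter> grp n j))"
proof -
 have "W = (\<Union>j\<in>{1..r}. W \<inter> grp n j)" using assms by (auto simp: xvars_eq)
 hence "card W = card (\<Union>j\<in>{1..r}. W \<inter> grp n j)" by simp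
 also have "\<dots> = (\<Sum>j\<in>{1..r}. card (W \<inter> grp n j))"
  using grp_disjoint[of _ _ n] finite_subset[OF assms] by (intro card_UN_disjoint ballI impI) (simp, simp, blast)
 finally show ?thesis .
qed

text \<open>Every group contributes at least one variable, so the least possible cardinality leaves
  no room for a second one.\<close>

lemma vertex_card_grp:
 assumes W: "W \<in> cells r n" and r: "card W = r" and j: "j \<in> {1..r}"
 shows "card (W \<inter> grp n j) = 1"
proof -
 have ge: "card (W \<inter> grp n i) \<ge> 1" if "i \<in> {1..r}" for i
  using W that cells_finite[OF W] by (auto simp: cells_def Suc_le_eq card_gt_0_iff)
 have "(\<Sum>i\<in>{1..r}. card (W \<inter> grp n i) - 1) = (\<Sum>i\<in>{1..r}. card (W \<inter> grp n i)) - (\<Sum>i\<in>{1..r}. 1)"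
  using ge by (intro sum_subtractf_nat) auto
 also have "\<dots> = 0" using W r card_by_groups[of W r n] by (simp add: cells_def)
 finally have "card (W \<inter> grp n j) - 1 = 0" using j by simp
 with ge[OF j] show ?thesis by simp
qed

lemma cobd_supported:
 assumes "cobd c W ~= 0" obtains x where "x \<in> W" "c (W - {x}) ~= 0"
proof -
 have "\<exists>x\<in>W. sg x W (c (W - {x})) ~= 0" using assms(1) unfolding cobd_def by (meson sum.neutral)
 thus thesis using that by auto
qed

text \<open>The part of the Cech complex in a fixed fine degree: \<open>N\<close> is the set of variables with a
 negative exponent. In the excluded case \<open>N\<close> consists of the full groups in \<open>J\<close>, and there is
 a genuine cohomology class.\<close>

lemma cone_exact:
 fixes c :: "xvar set => 'b::ab_group_add"
 assumes v: "v \<in> xvars r n" "v \<notin> N" and w: "w \<in> N" "fst w = fst v"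
  and N: "N \<subseteq> xvars r n"
  and supp: "!!W. c W ~= 0 ==> W \<in> cells r n \<and> N \<subseteq> W \<and> card W = m"
  and cocycle: "!!W. W \<subseteq> xvars r n ==> cobd c W = 0"
 shows "\<exists>e. (\<forall>W. e W ~= 0 --> W \<in> cells r n \<and> N \<subseteq> W \<and> Suc (card W) = m) \<and>
       (\<forall>W. W \<subseteq> xvars r n --> cobd e W = c W)"
proof (intro exI[of _ "cone_op v c"] conjI allI impI)
 fix W assume "W \<subseteq> xvars r n"
 hence "cobd (cone_op v c) W + cone_op v (cobd c) W = c W" "cobd c (insert v W) = 0"
  using v by (auto intro!: cone_op_homotopy cocycle finite_subset[OF _ finite_xvars[of r n]])
 thus "cobd (cone_op v c) W = c W" by (auto simp: cone_op_def[of v "cobd c"] split: if_splits)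
next
 fix W assume "cone_op v c W ~= 0"
 hence vW: "v \<notin> W" and "c (insert v W) ~= 0" by (auto simp: cone_op_def split: if_splits)
 with supp have *: "insert v W \<in> cells r n" "N \<subseteq> insert v W" "card (insert v W) = m" by auto
 from * v(2) show NW: "N \<subseteq> W" by auto
 have "finite W" using cells_finite[OF *(1)] by simp
 thus "Suc (card W) = m" using * vW by simp
 \<comment> \<open>Deleting \<open>v\<close> cannot empty its group, because \<open>w\<close> lies
   in the same group and in N.\<close>
 have "W \<inter> grp n j ~= {}" if j: "j \<in> {1..r}" for j
 proof (cases "j = fst v")
  case True
  hence "w \<in> W \<inter> grp n j" using w NW N by (auto simp: xvars_def grp_def)
  thus ?thesis by blast
 next
  case False
  hence "v \<notin> grp n j" by (auto simp: grp_def)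
  moreover have "insert v W \<inter> grp n j ~= {}" using * j by (simp add: cells_def)
  ultimately show ?thesis by simp
 qed
 thus "W \<in> cells r n" using *(1) by (auto simp: cells_def)
qed

text \<open>A group without negative exponents is a contractible factor. The cone with apex
  \<open>(j, 0)\<close> leaves the cells only by emptying group \<open>j\<close>; this part is split
  off as \<open>h2\<close>, the rest is \<open>h1\<close>. The coboundary of \<open>h1\<close> is an
  honest one, and that of \<open>h2\<close> is carried by cells with a single variable of group
  \<open>j\<close>.\<close>

lemma collapse_groups:
 fixes c :: "xvar set => 'b::ab_group_add"
 assumes "finite L" "L \<subseteq> {1..r}" "!!j. j \<in> L ==> N \<inter> grp n j = {}"
  and supp: "!!W. c W ~= 0 ==> W \<in> cells r n \<and> N \<subseteq> W \<and> card W = m"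
  and cocycle: "!!W. W \<subseteq> xvars r n ==> cobd c W = 0"
 shows "\<exists>e c'. (\<forall>W. e W ~= 0 --> W \<in> cells r n \<and> N \<subseteq> W \<and> Suc (card W) = m) \<and>
   (\<forall>W. c' W ~= 0 --> W \<in> cells r n \<and> N \<subseteq> W \<and> card W = m \<and> (\<forall>j\<in>L. card (W \<inter> grp n j) = 1)) \<and>
   (\<forall>W. W \<subseteq> xvars r n --> cobd c' W = 0) \<and>
   (\<forall>W. W \<subseteq> xvars r n --> c W = cobd e W + c' W)" using assms(1-3)
proof (induction L)
 case empty
 show ?case using supp cocycle by (intro exI[of _ "%_. 0"] exI[of _ c]) (auto simp: cobd_def)
next
 case (insert j L)
 then obtain e c' where
  e: "!!W. e W ~= 0 ==> W \<in> cells r n \<and> N \<subseteq> W \<and> Suc (card W) = m" and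
  c': "!!W. c' W ~= 0 ==> W \<in> cells r n \<and> N \<subseteq> W \<and> card W = m \<and> (\<forall>j\<in>L. card (W \<inter> grp n j) = 1)" and
  cc: "!!W. W \<subseteq> xvars r n ==> cobd c' W = 0" and
  ce: "!!W. W \<subseteq> xvars r n ==> c W = cobd e W + c' W" by auto
 define v where "v = (j, 0::nat)"
 have j: "j \<in> {1..r}" and v: "v \<in> xvars r n" "v \<in> grp n j" "v \<notin> N"
  using insert.prems by (auto simp: v_def xvars_def grp_def)
 define h1 where "h1 W = (if W \<inter> grp n j = {} then 0 else cone_op v c' W)" for W
 define h2 where "h2 W = (if W \<inter> grp n j = {} then cone_op v c' W else 0)" for W
 define c2 where "c2 W = (if W \<subseteq> xvars r n then cobd h2 W else 0)" for W
 have fin: "finite W" if "W \<subseteq> xvars r n" for W using finite_subset[OF that] by simp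
 have split: "c' W = cobd h1 W + cobd h2 W" if W: "W \<subseteq> xvars r n" for W
 proof -
  have "cobd (cone_op v c') W + cone_op v (cobd c') W = c' W" by (rule cone_op_homotopy[OF fin[OF W]])
  moreover have "cone_op v (cobd c') W = 0" using cc W v by (simp add: cone_op_def)
  moreover have "cobd (cone_op v c') W = cobd (%W. h1 W + h2 W) W" by (rule cobd_cong) (simp add: h1_def h2_def)
  ultimately show ?thesis by (simp add: cobd_add)
 qed
 have h1: "W \<in> cells r n \<and> N \<subseteq> W \<and> Suc (card W) = m" if h: "h1 W ~= 0" for W
 proof -
  from h have ne: "W \<inter> grp n j ~= {}" and vW: "v \<notin> W" and "c' (insert v W) ~= 0"
   by (auto simp: h1_def cone_op_def split: if_splits)
  with c' have *: "insert v W \<in> cells r n" "N \<subseteq> insert v W" "card (insert v W) = m" by auto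
  have "W \<inter> grp n i ~= {}" if "i \<in> {1..r}" for i
  proof (cases "i = j")
   case False
   hence "v \<notin> grp n i" by (auto simp: v_def grp_def)
   thus ?thesis using * that by (auto simp: cells_def)
  qed (use ne in simp)
  thus ?thesis using * vW v fin[of W] by (auto simp: cells_def)
 qed
 have c2: "W \<in> cells r n \<and> N \<subseteq> W \<and> card W = m \<and> (\<forall>i\<in>insert j L. card (W \<inter> grp n i) = 1)"
  if h: "c2 W ~= 0" for W
 proof -
  from h have W: "W \<subseteq> xvars r n" and h': "cobd h2 W ~= 0" by (auto simp: c2_def split: if_splits)
  have *: "W \<in> cells r n \<and> N \<subseteq> W \<and> card W = m"
  proof (cases "c' W = 0")
   case True
   hence "cobd h1 W ~= 0" using split[OF W] h' by auto
   then obtain x where x: "x \<in> W" "h1 (W - {x}) ~= 0" by (rule cobd_supported)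
   from h1[OF this(2)] show ?thesis using x W card_Suc_Diff1[OF fin[OF W] x(1)] by (auto intro: cells_mono)
  qed (use c' in blast)
  from h' obtain x where x: "x \<in> W" "h2 (W - {x}) ~= 0" by (rule cobd_supported)
  hence e0: "(W - {x}) \<inter> grp n j = {}" and nz: "c' (insert v (W - {x})) ~= 0"
   by (auto simp: h2_def cone_op_def split: if_splits)
  have "W \<inter> grp n j ~= {}" using * j by (auto simp: cells_def)
  with e0 have xj: "x \<in> grp n j" and W1: "W \<inter> grp n j = {x}" by auto
  have "card (W \<inter> grp n i) = 1" if i: "i \<in> L" for i
  proof -
   have "i ~= j" using i insert.hyps by auto
   hence "insert v (W - {x}) \<inter> grp n i = W \<inter> grp n i" using grp_disjoint[of i j n] xj v by auto
   thus ?thesis using c'[OF nz] i by metis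
  qed
  thus ?thesis using * W1 by auto
 qed
 \<comment> \<open>\<open>h2\<close> is not carried by cells, so this makes \<open>c2\<close> a
   cocycle but not a coboundary of the cellular complex.\<close>
 have cc2: "cobd c2 W = 0" if W: "W \<subseteq> xvars r n" for W
 proof -
  have "cobd c2 W = cobd (cobd h2) W" using W by (intro cobd_cong) (auto simp: c2_def)
  thus ?thesis using cobd_cobd fin[OF W] by metis
 qed
 let ?e = "%W. e W + h1 W"
 have 1: "\<forall>W. ?e W ~= 0 --> W \<in> cells r n \<and> N \<subseteq> W \<and> Suc (card W) = m"
 proof (intro allI impI)
  fix W assume "?e W ~= 0"
  thus "W \<in> cells r n \<and> N \<subseteq> W \<and> Suc (card W) = m" using e[of W] h1[of W] by (cases "e W = 0") auto
 qed
 have 2: "\<forall>W. c2 W ~= 0 --> W \<in> cells r n \<and> N \<subseteq> W \<and> card W = m \<and> (\<forall>i\<in>insert j L. card (W \<inter> grp n i) = 1)"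
  using c2 by blast
 have 3: "\<forall>W. W \<subseteq> xvars r n --> cobd c2 W = 0" using cc2 by blast
 have 4: "\<forall>W. W \<subseteq> xvars r n --> c W = cobd ?e W + c2 W" using ce split by (simp add: cobd_add c2_def)
 show ?case by (rule exI[of _ ?e], rule exI[of _ c2]) (intro conjI 1 2 3 4)
qed

text \<open>If N fills some group only partly, a cone with apex at a missing variable of that group
  contracts. Otherwise N is the union of the groups in J; once the other groups are collapsed, the
  remaining cells all have one cardinality, with \<open>n j + 1\<close> variables for j in J and one
  for each other group, and \<open>good\<close> excludes it.\<close>

lemma fine_exact:
 fixes c :: "xvar set => 'b::ab_group_add"
 assumes N: "N \<subseteq> xvars r n"
  and supp: "!!W. c W ~= 0 ==> W \<in> cells r n \<and> N \<subseteq> W \<and> card W = m"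
  and cocycle: "!!W. W \<subseteq> xvars r n ==> cobd c W = 0"
  and good: "!!J. J \<subseteq> {1..r} ==> N = (\<Union>j\<in>J. grp n j) ==> m ~= (\<Sum>j\<in>J. n j) + r"
 shows "\<exists>e. (\<forall>W. e W ~= 0 --> W \<in> cells r n \<and> N \<subseteq> W \<and> Suc (card W) = m) \<and>
       (\<forall>W. W \<subseteq> xvars r n --> cobd e W = c W)"
proof (cases "\<exists>v w. v \<in> xvars r n \<and> v \<notin> N \<and> w \<in> N \<and> fst w = fst v")
 case True
 thus ?thesis using cone_exact[OF _ _ _ _ N supp cocycle] by blast
next
 case False
 define J where "J = {j\<in>{1..r}. N \<inter> grp n j ~= {}}"
 have NJ: "N = (\<Union>j\<in>J. grp n j)"
 proof
  show "N \<subseteq> (\<Union>j\<in>J. grp n j)" 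
  proof
   fix v assume "v \<in> N"
   with N obtain j where "j \<in> {1..r}" "v \<in> grp n j" unfolding xvars_eq by blast
   with \<open>v \<in> N\<close> show "v \<in> (\<Union>j\<in>J. grp n j)" unfolding J_def by blast
  qed
  show "(\<Union>j\<in>J. grp n j) \<subseteq> N"
  proof
   fix v assume "v \<in> (\<Union>j\<in>J. grp n j)"
   then obtain j w where "j \<in> {1..r}" "v \<in> grp n j" "w \<in> N" "w \<in> grp n j" by (auto simp: J_def)
   hence "v \<in> xvars r n" "fst w = fst v" by (auto simp: xvars_eq, auto simp: grp_def)
   with False \<open>w \<in> N\<close> show "v \<in> N" by blast
  qed
 qed
 let ?L = "{1..r} - J"
 have "\<exists>e c'. (\<forall>W. e W ~= 0 --> W \<in> cells r n \<and> N \<subseteq> W \<and> Suc (card W) = m) \<and>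
   (\<forall>W. c' W ~= 0 --> W \<in> cells r n \<and> N \<subseteq> W \<and> card W = m \<and> (\<forall>j\<in>?L. card (W \<inter> grp n j) = 1)) \<and>
   (\<forall>W. W \<subseteq> xvars r n --> cobd c' W = 0) \<and>
   (\<forall>W. W \<subseteq> xvars r n --> c W = cobd e W + c' W)"
  by (rule collapse_groups[OF _ _ _ supp cocycle]) (auto simp: J_def)
 then obtain e c' where
  e: "!!W. e W ~= 0 ==> W \<in> cells r n \<and> N \<subseteq> W \<and> Suc (card W) = m" and
  c': "!!W. c' W ~= 0 ==> W \<in> cells r n \<and> N \<subseteq> W \<and> card W = m \<and> (\<forall>j\<in>?L. card (W \<inter> grp n j) = 1)" and
  ce: "!!W. W \<subseteq> xvars r n ==> c W = cobd e W + c' W" by auto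
 have "c' W = 0" if W: "W \<subseteq> xvars r n" for W
 proof (rule ccontr)
  assume nz: "c' W ~= 0"
  have J: "J \<subseteq> {1..r}" by (auto simp: J_def)
  have "card W = (\<Sum>j\<in>{1..r}. card (W \<inter> grp n j))" by (rule card_by_groups[OF W])
  also have "\<dots> = (\<Sum>j\<in>?L. card (W \<inter> grp n j)) + (\<Sum>j\<in>J. card (W \<inter> grp n j))"
   using J by (intro sum.subset_diff) auto
  also have "(\<Sum>j\<in>?L. card (W \<inter> grp n j)) = (\<Sum>j\<in>?L. 1)" using c'[OF nz] by (intro sum.cong) auto
  also have "(\<Sum>j\<in>J. card (W \<inter> grp n j)) = (\<Sum>j\<in>J. n j + 1)"
  proof (rule sum.cong[OF refl])
   fix j assume "j \<in> J"
   hence "W \<inter> grp n j = grp n j" using c'[OF nz] NJ by blast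
   thus "card (W \<inter> grp n j) = n j + 1" by simp
  qed
  also have "(\<Sum>j\<in>?L. 1) + (\<Sum>j\<in>J. n j + 1) = (\<Sum>j\<in>J. n j) + r"
   using J finite_subset[OF J] card_mono[OF _ J] by (simp add: sum.distrib card_Diff_subset del: One_nat_def)
  finally show False using good[OF J NJ] c'[OF nz] by simp
 qed
 thus ?thesis using e ce by (intro exI[of _ e]) auto
qed

section \<open>Cocycles on the vertices\<close>

lemma sg_same_group:
 assumes "finite W" "W \<inter> grp n j = {}" "l \<le> n j" "l' \<le> n j" "W \<subseteq> xvars r n"
 shows "sg (j, l) W p = sg (j, l') W p"
proof -
 have "{y \<in> W. y < (j, l)} = {y \<in> W. y < (j, l')}"
 proof -
  have "fst y ~= j" if "y \<in> W" for y using that assms by (cases y) (auto simp: grp_def xvars_def)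
  thus ?thesis by (auto simp: less_prod_def' less_le)
 qed
 thus ?thesis by (simp add: sg_def)
qed

text \<open>Adjacent vertices bound an edge, whose other faces miss a group and are no cells. The
  cocycle condition on the edge is an equality because both variables lie in one group and so have
  the same position relative to the rest.\<close>

lemma constant_on_adjacent_vertices:
 fixes c :: "xvar set => 'b::ab_group_add"
 assumes supp: "!!W. c W ~= 0 ==> W \<in> cells r n"
  and cocycle: "!!W. W \<subseteq> xvars r n ==> cobd c W = 0"
  and W: "W \<in> cells r n" "card W = r" and l: "(j, l) \<in> W" "l' \<le> n j"
 shows "c (insert (j, l') (W - {(j, l)})) = c W"
proof (cases "l' = l")
 case True
 thus ?thesis using l by (simp add: insert_absorb)
next
 case False
 define W0 where "W0 = W - {(j, l)}"
 have Wx: "W \<subseteq> xvars r n" using W by (simp add: cells_def)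
 have j: "j \<in> {1..r}" "l \<le> n j" using l Wx by (auto simp: xvars_def)
 have fW: "finite W0" using cells_finite[OF W(1)] by (simp add: W0_def)
 have Wj: "W \<inter> grp n i = {x}" if "x \<in> W" "x \<in> grp n i" "i \<in> {1..r}" for x i
  using vertex_card_grp[OF W that(3)] that by (metis IntI card_1_singletonE singletonD)
 have W0j: "W0 \<inter> grp n j = {}" using Wj[of "(j, l)" j] l j by (auto simp: W0_def grp_def)
 hence nin: "(j, l') \<notin> W0" "(j, l) \<notin> W0" using l j by (auto simp: grp_def)
 let ?U = "insert (j, l') (insert (j, l) W0)"
 have Ux: "?U \<subseteq> xvars r n" using Wx j l by (auto simp: W0_def xvars_def)
 have U: "?U - {(j, l)} = insert (j, l') W0" "?U - {(j, l')} = insert (j, l) W0" using nin False by auto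
 have "c (?U - {x}) = 0" if x: "x \<in> W0" for x
 proof (rule ccontr)
  assume "c (?U - {x}) ~= 0"
  hence cell: "?U - {x} \<in> cells r n" by (rule supp)
  from x Wx obtain i where i: "i \<in> {1..r}" "x \<in> grp n i" by (auto simp: W0_def xvars_eq)
  have "i ~= j" using i x W0j by auto
  have "W \<inter> grp n i = {x}" using x i by (intro Wj) (auto simp: W0_def)
  hence "(?U - {x}) \<inter> grp n i = {}" using \<open>i ~= j\<close> by (auto simp: W0_def grp_def)
  thus False using cell i by (auto simp: cells_def)
 qed
 hence "(\<Sum>x\<in>W0. sg x ?U (c (?U - {x}))) = 0" by simp
 hence "sg (j, l') ?U (c (insert (j, l) W0)) + sg (j, l) ?U (c (insert (j, l') W0)) = 0"
  using cocycle[OF Ux] fW nin False by (simp add: cobd_def U)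
 moreover have "sg (j, l') W0 p = sg (j, l) W0 p" for p :: 'b using fW W0j l j Wx by (intro sg_same_group) (auto simp: W0_def)
 ultimately have "sg (j, l) W0 (c (insert (j, l) W0)) = sg (j, l) W0 (c (insert (j, l') W0))"
  using fW nin False by (auto simp: sg_insert sg_minus split: if_splits)
 hence "c (insert (j, l) W0) = c (insert (j, l') W0)" by (metis sg_sg)
 thus ?thesis using l by (simp add: W0_def insert_absorb)
qed

text \<open>The vertex is moved to the base vertex one group at a time; the induction counts the
  groups where the index is not yet 0.\<close>

lemma constant_on_vertices:
 fixes c :: "xvar set => 'b::ab_group_add"
 assumes supp: "!!W. c W ~= 0 ==> W \<in> cells r n"
  and cocycle: "!!W. W \<subseteq> xvars r n ==> cobd c W = 0"
  and W: "W \<in> cells r n" "card W = r"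
 shows "c W = c ((%j. (j, 0)) ` {1..r})" using W
proof (induction "card {j\<in>{1..r}. (j, 0) \<notin> W}" arbitrary: W rule: less_induct)
 case less
 let ?B = "(%j. (j, 0::nat)) ` {1..r}"
 have fW: "finite W" using less.prems cells_finite by blast
 show ?case
 proof (cases "\<exists>j\<in>{1..r}. (j, 0) \<notin> W")
  case False
  hence "?B \<subseteq> W" by auto
  moreover have "card ?B = r" by (subst card_image) (auto simp: inj_on_def)
  ultimately have "?B = W" using less.prems fW by (intro card_subset_eq) auto
  thus ?thesis by simp
 next
  case True
  then obtain j where j: "j \<in> {1..r}" "(j, 0) \<notin> W" by blast
  then obtain l where l: "(j, l) \<in> W" "l \<le> n j" using less.prems by (fastforce simp: cells_def grp_def)
  have Wj: "W \<inter> grp n j = {(j, l)}"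
   using vertex_card_grp[OF less.prems j(1)] l by (metis IntI card_1_singletonE grp_def mem_Sigma_iff atMost_iff singletonD singletonI)
  define W' where "W' = insert (j, 0) (W - {(j, l)})"
  have eq: "c W' = c W" unfolding W'_def by (rule constant_on_adjacent_vertices[OF supp cocycle less.prems l(1)]) auto
  have cell: "W' \<in> cells r n" unfolding cells_def
  proof (intro CollectI conjI ballI)
   show "W' \<subseteq> xvars r n" using less.prems j by (auto simp: W'_def cells_def xvars_def)
   fix i assume i: "i \<in> {1..r}"
   show "W' \<inter> grp n i ~= {}"
   proof (cases "i = j")
    case True
    thus ?thesis by (auto simp: W'_def grp_def)
   next
    case False
    from i less.prems obtain x where "x \<in> W \<inter> grp n i" by (fastforce simp: cells_def)
    hence "x \<in> W' \<inter> grp n i" using False by (auto simp: W'_def grp_def)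
    thus ?thesis by blast
   qed
  qed
  have card: "card W' = r" using fW l j less.prems by (simp add: W'_def card_Suc_Diff1)
  have "{j'\<in>{1..r}. (j', 0) \<notin> W'} \<subset> {j'\<in>{1..r}. (j', 0) \<notin> W}" using j l by (auto simp: W'_def)
  hence "card {j'\<in>{1..r}. (j', 0) \<notin> W'} < card {j'\<in>{1..r}. (j', 0) \<notin> W}" by (intro psubset_card_mono) auto
  from less.hyps[OF this cell card] eq show ?thesis by simp
 qed
qed

section \<open>Evaluating simplicial cochains on cells\<close>

text \<open>Values of \<open>ev\<close> and \<open>Lam\<close> need not vanish off the cells, so
  faces that are no cells must be left out explicitly.\<close>

definition cell_bd :: "nat => (nat => nat) => (xvar set => 'b::ab_group_add) => xvar set => 'b" where
 "cell_bd r n g = cobd (%U. if U \<in> cells r n then g U else 0)"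

lemma cell_bd_cell_bd:
 assumes "W \<subseteq> xvars r n"
 shows "cell_bd r n (cell_bd r n g) W = 0"
proof -
 define g' where "g' U = (if U \<in> cells r n then g U else 0)" for U
 have "(if U \<in> cells r n then cobd g' U else 0) = cobd g' U" if "U \<subseteq> W" for U
 proof (cases "U \<in> cells r n")
  case False
  hence "g' (U - {x}) = 0" for x using cells_mono[of "U - {x}" r n U] that assms by (auto simp: g'_def)
  thus ?thesis by (simp add: cobd_def)
 qed simp
 hence "cell_bd r n (cell_bd r n g) W = cobd (cobd g') W" unfolding cell_bd_def g'_def[symmetric] by (intro cobd_cong) auto
 thus ?thesis using cobd_cobd assms finite_subset[OF assms] by simp
qed

lemma cell_bd_cong:
 assumes "!!w. w \<in> W ==> W - {w} \<in> cells r n ==> g (W - {w}) = g' (W - {w})"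
 shows "cell_bd r n g W = cell_bd r n g' W" unfolding cell_bd_def using assms by (intro cobd_cong) auto

lemma cell_bd_diff: "cell_bd r n (%U. g U - g' U) W = cell_bd r n g W - cell_bd r n g' W"
proof -
 have "(%U. if U \<in> cells r n then g U - g' U else 0)
   = (%U. (if U \<in> cells r n then g U else 0) - (if U \<in> cells r n then g' U else 0))" by (simp add: fun_eq_iff)
 thus ?thesis by (simp add: cell_bd_def cobd_diff)
qed

lemma cell_bd_eq:
 "cell_bd r n g W = (\<Sum>w\<in>W. sg w W (if W - {w} \<in> cells r n then g (W - {w}) else 0))"
 by (simp add: cell_bd_def cobd_def)

text \<open>An edge has exactly two vertices. They enter with opposite signs, since the two
  variables concerned lie in one group and one of them precedes the other.\<close>

lemma cell_bd_edge_const: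
 assumes W: "W \<in> cells r n" and "card W = Suc r"
 shows "cell_bd r n (%_. p) W = 0"
proof (cases "\<exists>w\<in>W. W - {w} \<in> cells r n")
 case False
 thus ?thesis by (simp add: cell_bd_eq)
next
 case True
 then obtain w where w: "w \<in> W" "W - {w} \<in> cells r n" by blast
 have fW: "finite W" using cells_finite[OF W] .
 have Wx: "W \<subseteq> xvars r n" using W by (simp add: cells_def)
 have card: "card (W - {w}) = r" using assms w fW by simp
 obtain j l where wjl: "w = (j, l)" by (cases w)
 have j: "j \<in> {1..r}" "l \<le> n j" using w Wx wjl by (auto simp: xvars_def)
 obtain w' where w': "(W - {w}) \<inter> grp n j = {w'}"
  using vertex_card_grp[OF w(2) card j(1)] by (auto simp: card_1_singleton_iff)
 obtain l' where wjl': "w' = (j, l')" "l' \<le> n j" using w' by (auto simp: grp_def)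
 have ww: "w' \<in> W" "w' ~= w" using w' by auto
 have other: "W - {x} \<notin> cells r n" if x: "x \<in> W - {w} - {w'}" for x
 proof
  assume c: "W - {x} \<in> cells r n"
  obtain i where i: "i \<in> {1..r}" "x \<in> grp n i" using x Wx by (auto simp: xvars_eq)
  obtain y where y: "(W - {w}) \<inter> grp n i = {y}" using vertex_card_grp[OF w(2) card i(1)] card_1_singletonE by blast
  have "x \<in> (W - {w}) \<inter> grp n i" using x i by simp
  hence "y = x" unfolding y by simp
  have "i ~= j"
  proof
   assume "i = j"
   hence "x \<in> (W - {w}) \<inter> grp n j" using x i by simp
   thus False using x unfolding w' by simp
  qed
  hence "W \<inter> grp n i = {x}" using \<open>y = x\<close> using y wjl by (auto simp: grp_def)
  hence "(W - {x}) \<inter> grp n i = {}" by auto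
  thus False using c i by (auto simp: cells_def)
 qed
 define W0 where "W0 = W - {w} - {w'}"
 have W0: "finite W0" "W0 \<inter> grp n j = {}" "w \<notin> W0" "w' \<notin> W0" "W0 \<subseteq> xvars r n" "W = insert w (insert w' W0)"
  using fW w' Wx ww w by (auto simp: W0_def)
 have eq: "sg w W0 p = sg w' W0 p" unfolding wjl wjl' using W0 wjl' j by (intro sg_same_group) auto
 have cell': "W - {w'} \<in> cells r n" unfolding cells_def
 proof (intro CollectI conjI ballI)
  fix i assume i: "i \<in> {1..r}"
  show "(W - {w'}) \<inter> grp n i ~= {}"
  proof (cases "i = j")
   case True
   hence "w \<in> (W - {w'}) \<inter> grp n i" using w wjl j ww by (auto simp: grp_def)
   thus ?thesis by blast
  next
   case False
   have "(W - {w}) \<inter> grp n i ~= {}" using w(2) i by (simp add: cells_def)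
   thus ?thesis using False wjl' by (auto simp: grp_def)
  qed
 qed (use Wx in blast)
 have "(\<Sum>x\<in>W0. sg x W (if W - {x} \<in> cells r n then p else 0)) = 0"
  using other by (intro sum.neutral) (auto simp: W0_def)
 moreover have "cell_bd r n (%_. p) W = sg w W p + (sg w' W p + (\<Sum>x\<in>W0. sg x W (if W - {x} \<in> cells r n then p else 0)))"
  unfolding cell_bd_eq using W0 ww w(2) cell' by (subst (1) W0(6)) simp
 moreover have "sg w W p + sg w' W p = 0" using W0(1-4) ww eq unfolding W0(6) by (auto simp: sg_insert sg_minus dest: order.asym)
 ultimately show ?thesis by simp
qed

text \<open>The numbers below \<open>M\<close> stand for the generators of the irrelevant ideal,
  that is for the positions of the Cech complex; \<open>vtx s j\<close> is the index of the variable
  that generator \<open>s\<close> takes from group \<open>j\<close>.\<close>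

locale cell_vertices =
 fixes r :: nat and n :: "nat => nat" and M :: nat and vtx :: "nat => nat => nat"
 assumes all_vertices: "!!\<sigma>. (!!j. j \<in> {1..r} ==> \<sigma> j \<le> n j) ==> \<exists>s<M. \<forall>j\<in>{1..r}. vtx s j = \<sigma> j"
begin

definition verts :: "xvar set => nat set" where
 "verts W = {s. s < M \<and> (\<forall>j\<in>{1..r}. (j, vtx s j) \<in> W)}"

definition vert :: "xvar set => nat" where
 "vert W = (SOME s. s \<in> verts W)"

lemma finite_verts [simp]: "finite (verts W)" by (simp add: verts_def)

lemma verts_mono: "W' \<subseteq> W ==> verts W' \<subseteq> verts W" by (auto simp: verts_def)

lemma vert_in_verts:
 assumes "W \<in> cells r n"
 shows "vert W \<in> verts W"
proof -
 have "\<forall>j\<in>{1..r}. \<exists>l. l \<le> n j \<and> (j, l) \<in> W" using assms by (fastforce simp: cells_def grp_def)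
 then obtain \<sigma> where \<sigma>: "\<forall>j\<in>{1..r}. \<sigma> j \<le> n j \<and> (j, \<sigma> j) \<in> W" by metis
 then obtain s where "s < M" "\<forall>j\<in>{1..r}. vtx s j = \<sigma> j" using all_vertices[of \<sigma>] by blast
 hence "s \<in> verts W" using \<sigma> by (simp add: verts_def)
 thus ?thesis unfolding vert_def by (rule someI)
qed

text \<open>\<open>ev k e W\<close> evaluates \<open>e\<close> on the image of the \<open>k\<close>-cell \<open>W\<close> under a chain map from cells to
 simplices on the vertices, built by coning off the image of the boundary.\<close>

primrec ev :: "nat => (nat set => 'b::ab_group_add) => xvar set => 'b" where
 "ev 0 e W = e {vert W}"
| "ev (Suc k) e W = cell_bd r n (ev k (cone_op (vert W) e)) W"

text \<open>An acyclic carrier argument: all simplices met in the construction have their vertices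
  in W. This locality is what \<open>ev_cobd_zero\<close> rests on.\<close>

lemma ev_cong:
 assumes "W \<in> cells r n" "card W = r + k"
  and "!!S. S \<subseteq> verts W ==> card S = Suc k ==> e S = e' S"
 shows "ev k e W = ev k e' W" using assms
proof (induction k arbitrary: W e e')
 case 0
 thus ?case using vert_in_verts[of W] by simp
next
 case (Suc k)
 have fin: "finite W" using Suc.prems cells_finite by blast
 show ?case unfolding ev.simps
 proof (rule cell_bd_cong)
  fix w assume w: "w \<in> W" "W - {w} \<in> cells r n"
  show "ev k (cone_op (vert W) e) (W - {w}) = ev k (cone_op (vert W) e') (W - {w})"
  proof (rule Suc.IH[OF w(2)])
   show "card (W - {w}) = r + k" using Suc.prems w fin by simp
   fix S assume S: "S \<subseteq> verts (W - {w})" "card S = Suc k"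
   have "finite S" using S card.infinite by fastforce
   moreover have "S \<subseteq> verts W" using S(1) verts_mono[of "W - {w}" W] by blast
   ultimately show "cone_op (vert W) e S = cone_op (vert W) e' S"
    using S Suc.prems vert_in_verts[OF Suc.prems(1)] by (auto simp: cone_op_def)
  qed
 qed
qed

text \<open>Lets integral evaluations be compared with evaluations of cochains with values in any
  ring.\<close>

lemma ev_hom:
 assumes add: "!!x y. h (x + y) = h x + h y"
 shows "h (ev k e W) = ev k (%S. h (e S)) W"
proof -
 have h0: "h 0 = 0" using add[of 0 0] by simp
 have hm: "h (- x) = - h x" for x using add[of x "- x"] h0 by (simp add: minus_unique)
 have hsg: "h (sg x S p) = sg x S (h p)" for x S p by (simp add: sg_def hm)
 have hsum: "h (sum f A) = (\<Sum>a\<in>A. h (f a))" for f :: "'z => 'a" and A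
  by (induction A rule: infinite_finite_induct) (simp_all add: h0 add)
 show ?thesis
 proof (induction k arbitrary: e W)
  case (Suc k)
  have "(%S. h (cone_op v e S)) = cone_op v (%S. h (e S))" for v by (auto simp: cone_op_def hsg h0)
  thus ?case by (simp add: cell_bd_eq hsum hsg h0 Suc.IH if_distrib[of h] cong: if_cong)
 qed simp
qed

lemma cone_op_add: "cone_op v (%S. e S + e' S) = (%S. cone_op v e S + cone_op v e' S)" by (auto simp: cone_op_def sg_add)

lemma ev_zero: "ev k (%S. 0) W = 0"
proof (induction k arbitrary: W)
 case (Suc k)
 have "cone_op v (%S. 0) = (%S. 0::'a)" for v :: nat by (auto simp: cone_op_def)
 thus ?case by (simp add: cell_bd_eq Suc cong: if_cong)
qed simp

lemma ev_add: "ev k (%S. e S + e' S) W = ev k e W + ev k e' W"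
proof (induction k arbitrary: e e' W)
 case (Suc k)
 have "(%U. if U \<in> cells r n then ev k (cone_op (vert W) e) U + ev k (cone_op (vert W) e') U else 0)
  = (%U. (if U \<in> cells r n then ev k (cone_op (vert W) e) U else 0)
   + (if U \<in> cells r n then ev k (cone_op (vert W) e') U else 0))" by auto
 thus ?case by (simp add: cone_op_add Suc cell_bd_def cobd_add cong: if_cong)
qed simp

lemma ev_sum: "finite I ==> ev k (%S. \<Sum>i\<in>I. f i S) W = (\<Sum>i\<in>I. ev k (f i) W)"
 by (induction I rule: finite_induct) (simp_all add: ev_zero ev_add)

lemma ev_diff: "ev k (%S. e S - e' S) W = ev k e W - ev k e' W"
proof -
 have "ev k e W = ev k (%S. (e S - e' S) + e' S) W" by simp
 thus ?thesis by (simp only: ev_add) simp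
qed

text \<open>The chain map property in dual form. The homotopy identity at \<open>vert W\<close>
  replaces the coned coboundary by e minus a coboundary, and the correction vanishes as a double
  boundary; in dimension one the correction is a constant, which an edge does not see.\<close>

lemma ev_cobd:
 assumes "W \<in> cells r n" "card W = r + Suc k"
 shows "ev (Suc k) (cobd e) W = cell_bd r n (ev k e) W" using assms
proof (induction k arbitrary: e W)
 case k: 0
 have fin: "finite W" using k.prems cells_finite by blast
 let ?v = "vert W"
 have "ev (Suc 0) (cobd e) W = cell_bd r n (%U. ev 0 e U - e {?v}) W" unfolding ev.simps
 proof (rule cell_bd_cong)
  fix w assume "w \<in> W" "W - {w} \<in> cells r n"
  have "cobd (cone_op ?v e) {vert (W - {w})} + cone_op ?v (cobd e) {vert (W - {w})} = e {vert (W - {w})}"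
   by (rule cone_op_homotopy) simp
  thus "cone_op ?v (cobd e) {vert (W - {w})} = e {vert (W - {w})} - e {?v}"
   by (simp add: cobd_def[of "cone_op ?v e"] cone_op_def[of ?v e] algebra_simps)
 qed
 also have "\<dots> = cell_bd r n (ev 0 e) W - cell_bd r n (%U. e {?v}) W" by (rule cell_bd_diff)
 also have "cell_bd r n (%U. e {?v}) W = 0" using k.prems by (intro cell_bd_edge_const) auto
 finally show ?case by simp
next
 case (Suc k)
 have fin: "finite W" using Suc.prems cells_finite by blast
 let ?v = "vert W"
 have "ev (Suc (Suc k)) (cobd e) W = cell_bd r n (%U. ev (Suc k) e U - cell_bd r n (ev k (cone_op ?v e)) U) W"
  unfolding ev.simps(2)[of "Suc k" "cobd e"]
 proof (rule cell_bd_cong)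
  fix w assume w: "w \<in> W" "W - {w} \<in> cells r n"
  have card: "card (W - {w}) = r + Suc k" using Suc.prems w fin by simp
  have "ev (Suc k) (cone_op ?v (cobd e)) (W - {w}) = ev (Suc k) (%S. e S - cobd (cone_op ?v e) S) (W - {w})"
  proof (rule ev_cong[OF w(2) card])
   fix S assume "S \<subseteq> verts (W - {w})" "card S = Suc (Suc k)"
   hence "finite S" using card.infinite by fastforce
   from cone_op_homotopy[OF this, of ?v e]
   show "cone_op ?v (cobd e) S = e S - cobd (cone_op ?v e) S" by (simp add: algebra_simps)
  qed
  also have "\<dots> = ev (Suc k) e (W - {w}) - ev (Suc k) (cobd (cone_op ?v e)) (W - {w})" by (rule ev_diff)
  also have "ev (Suc k) (cobd (cone_op ?v e)) (W - {w}) = cell_bd r n (ev k (cone_op ?v e)) (W - {w})"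
   by (rule Suc.IH[OF w(2) card])
  finally show "ev (Suc k) (cone_op ?v (cobd e)) (W - {w})
    = ev (Suc k) e (W - {w}) - cell_bd r n (ev k (cone_op ?v e)) (W - {w})" .
 qed
 also have "\<dots> = cell_bd r n (ev (Suc k) e) W"
  using Suc.prems by (simp add: cell_bd_diff cell_bd_cell_bd cells_def del: ev.simps)
 finally show ?case .
qed

end

section \<open>From transversals to the columns of the determinant\<close>

definition last_col :: "nat => (nat => nat) => xvar" where
 "last_col r n = (r, n r)"

text \<open>The vertices of a simplex whose dimension is the sum of the \<open>n j\<close> over J.
  For J = {1..r} they are the columns of the Sylvester determinant.\<close>

definition scols :: "nat set => nat => (nat => nat) => xvar set" where
 "scols J r n = insert (last_col r n) (SIGMA j:J. {..<n j})"

text \<open>The map that the nested decomposition dictates: the first group where \<sigma> leaves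
  the last variable decides. For J = {1..r} the monomial in front of the resulting column involves
  only variables \<open>(j, \<sigma> j)\<close>.\<close>

definition col_of :: "nat set => nat => (nat => nat) => (nat => nat) => xvar" where
 "col_of J r n \<sigma> = (if \<forall>j\<in>J. \<sigma> j = n j then last_col r n
   else let j = Min {j\<in>J. \<sigma> j ~= n j} in (j, \<sigma> j))"

lemma finite_scols: "finite J ==> finite (scols J r n)"
 and card_scols: "finite J ==> card (scols J r n) = (\<Sum>j\<in>J. n j) + 1" by (auto simp: scols_def last_col_def card_insert_if)

lemma col_of_cases:
 assumes "finite J"
 obtains "\<forall>j\<in>J. \<sigma> j = n j" "col_of J r n \<sigma> = last_col r n"
 | j where "j \<in> J" "\<sigma> j ~= n j" "col_of J r n \<sigma> = (j, \<sigma> j)" "!!i. i \<in> J ==> i < j ==> \<sigma> i = n i"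
proof (cases "\<forall>j\<in>J. \<sigma> j = n j")
 case True
 thus ?thesis using that(1) by (simp add: col_of_def)
next
 case False
 define j where "j = Min {j\<in>J. \<sigma> j ~= n j}"
 have "j \<in> {j\<in>J. \<sigma> j ~= n j}" unfolding j_def using assms False by (intro Min_in) auto
 moreover have "\<sigma> i = n i" if "i \<in> J" "i < j" for i
 proof (rule ccontr)
  assume "\<sigma> i ~= n i"
  hence "j \<le> i" unfolding j_def using assms that by (intro Min_le) auto
  thus False using that by simp
 qed
 ultimately show ?thesis using that(2)[of j] False by (auto simp: col_of_def j_def Let_def)
qed

text \<open>Indicator matrix of a map; its minors are the pullbacks of the dual basis of simplices.\<close>

definition ind_mat :: "('i => 'c) => 'i => 'c => int" where
 "ind_mat c s q = (if c s = q then 1 else 0)"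

text \<open>A nonzero minor has a nonzero product along some bijection of rows and columns, so every
  column is hit.\<close>

lemma minr_ind_mat_support:
 fixes c :: "'i::linorder => 'c::linorder"
 assumes "minr k (ind_mat c) S Q ~= 0" "card S = k" "card Q = k" "finite Q"
 shows "Q \<subseteq> c ` S" using assms
proof (induction k arbitrary: S Q)
 case 0
 thus ?case by simp
next
 case (Suc k)
 have S: "finite S" "S ~= {}" "finite Q" using Suc.prems card.infinite by force+
 from Suc.prems(1) have "\<exists>q\<in>Q. sg q Q (ind_mat c (Min S) q * minr k (ind_mat c) (S - {Min S}) (Q - {q})) ~= 0"
  unfolding minr.simps by (meson sum.neutral)
 then obtain q where q: "q \<in> Q" "c (Min S) = q" "minr k (ind_mat c) (S - {Min S}) (Q - {q}) ~= 0"
  by (auto simp: ind_mat_def split: if_splits)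
 have "Q - {q} \<subseteq> c ` (S - {Min S})" using q S Suc.prems by (intro Suc.IH) (auto simp: Min_in)
 moreover have "Min S \<in> S" using S by (intro Min_in)
 ultimately show ?case using q by blast
qed

context cell_vertices
begin

text \<open>The coefficient of the simplex Q on the columns in the image of the
  \<open>k\<close>-cell W, for the chain map from cells to simplices on vertices followed by the
  simplicial map \<open>col_of\<close>.\<close>

definition Lam :: "nat set => nat => xvar set => xvar set => int" where
 "Lam J k W Q = ev k (%S. minr (Suc k) (ind_mat (%s. col_of J r n (vtx s))) S Q) W"

lemma col_of_verts:
 assumes "finite J" "J \<subseteq> {1..r}" "s \<in> verts W" "W \<subseteq> xvars r n"
 shows "col_of J r n (vtx s) \<in> scols J r n"
proof -
 have "vtx s j \<le> n j" if "j \<in> J" for j using that assms by (auto simp: verts_def xvars_def)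
 thus ?thesis by (cases rule: col_of_cases[OF assms(1), of "vtx s" n r]) (auto simp: scols_def order_le_neq_trans)
qed

lemma Lam_support:
 assumes "W \<in> cells r n" "card W = r + k" "card Q = Suc k" "Lam J k W Q ~= 0"
 shows "Q \<subseteq> (%s. col_of J r n (vtx s)) ` verts W"
proof (rule ccontr)
 assume *: "~ ?thesis"
 have fQ: "finite Q" using assms(3) card.infinite by fastforce
 have "Lam J k W Q = ev k (%S. 0) W" unfolding Lam_def
 proof (rule ev_cong[OF assms(1,2)])
  fix S assume S: "S \<subseteq> verts W" "card S = Suc k"
  show "minr (Suc k) (ind_mat (%s. col_of J r n (vtx s))) S Q = 0"
  proof (rule ccontr)
   assume "minr (Suc k) (ind_mat (%s. col_of J r n (vtx s))) S Q ~= 0"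
   from minr_ind_mat_support[OF this S(2) assms(3) fQ] S(1) * show False by blast
  qed
 qed
 thus False using assms(4) by (simp add: ev_zero)
qed

text \<open>Each vertex goes to exactly one column, so all row sums of the indicator matrix are 1,
  and \<open>minr_expand\<close> with F = y = 1 computes the boundary on the columns;
  \<open>ev_cobd\<close> does the same on the cells.\<close>

lemma Lam_chain_map:
 assumes J: "finite J" "J \<subseteq> {1..r}" and W: "W \<in> cells r n" "card W = r + Suc k"
  and Q: "Q \<subseteq> scols J r n" "card Q = Suc k"
 shows "(\<Sum>q\<in>scols J r n - Q. sg q Q (Lam J (Suc k) W (insert q Q))) = cell_bd r n (%W. Lam J k W Q) W"
proof -
 let ?c = "%s. col_of J r n (vtx s)"
 let ?U = "scols J r n"
 have "cell_bd r n (%W. Lam J k W Q) W = ev (Suc k) (cobd (%S. minr (Suc k) (ind_mat ?c) S Q)) W"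
  unfolding Lam_def by (rule ev_cobd[OF W, symmetric])
 also have "\<dots> = ev (Suc k) (%S. \<Sum>q\<in>?U - Q. sg q Q (minr (Suc (Suc k)) (ind_mat ?c) S (insert q Q))) W"
 proof (rule ev_cong[OF W])
  fix S assume S: "S \<subseteq> verts W" "card S = Suc (Suc k)"
  have fS: "finite S" using S card.infinite by fastforce
  have "(\<Sum>i\<in>S. sg i S (1 * minr (Suc k) (ind_mat ?c) (S - {i}) Q))
    = (\<Sum>q\<in>?U - Q. sg q Q (1 * minr (Suc (Suc k)) (ind_mat ?c) S (insert q Q)))"
  proof (rule minr_expand[OF fS S(2) finite_scols[OF J(1)] Q])
   fix i assume "i \<in> S"
   hence "?c i \<in> ?U" using S col_of_verts[OF J] W by (auto simp: cells_def)
   thus "1 = (\<Sum>q\<in>?U. ind_mat ?c i q * 1)" using finite_scols[OF J(1)] by (simp add: ind_mat_def)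
  qed
  thus "cobd (%S. minr (Suc k) (ind_mat ?c) S Q) S
    = (\<Sum>q\<in>?U - Q. sg q Q (minr (Suc (Suc k)) (ind_mat ?c) S (insert q Q)))" by (simp only: cobd_def mult_1)
 qed
 also have "\<dots> = (\<Sum>q\<in>?U - Q. ev (Suc k) (%S. sg q Q (minr (Suc (Suc k)) (ind_mat ?c) S (insert q Q))) W)"
  using finite_scols[OF J(1)] by (intro ev_sum) auto
 also have "\<dots> = (\<Sum>q\<in>?U - Q. sg q Q (Lam J (Suc k) W (insert q Q)))"
  unfolding Lam_def by (intro sum.cong refl ev_hom[symmetric]) (simp add: sg_add)
 finally show ?thesis ..
qed

lemma Lam_vertex:
 "Lam J 0 W {q} = (if col_of J r n (vtx (vert W)) = q then 1 else 0)" by (simp add: Lam_def ind_mat_def)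

lemma Lam_vertex_sum:
 assumes "finite J" "J \<subseteq> {1..r}" "W \<in> cells r n"
 shows "(\<Sum>q\<in>scols J r n. Lam J 0 W {q}) = 1"
 using col_of_verts[OF assms(1,2) vert_in_verts[OF assms(3)]] assms finite_scols[OF assms(1)] by (simp add: Lam_vertex cells_def)

definition top_vertex :: "xvar set" where
 "top_vertex = (%j. (j, n j)) ` {1..r}"

text \<open>Removing the variables one by one, in each step only one term of the chain map relation
 survives on either side.\<close>

lemma Lam_unit:
 assumes J: "finite J" "J \<subseteq> {1..r}" and "top_vertex \<subseteq> W" "W - top_vertex \<subseteq> (\<Union>j\<in>J. grp n j)"
  and "card W = r + k"
 shows "\<bar>Lam J k W (insert (last_col r n) (W - top_vertex))\<bar> = 1" using assms(3-)
proof (induction k arbitrary: W)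
 case 0
 have fin: "finite W" using 0(2) finite_subset[of "W - top_vertex"] J by (auto simp: top_vertex_def)
 have ct: "card top_vertex = r" by (simp add: top_vertex_def card_image inj_on_def)
 have W: "W = top_vertex" using 0 fin ct card_subset_eq[of W top_vertex] by simp
 have cell: "W \<in> cells r n" by (auto simp: W top_vertex_def cells_def grp_def xvars_def)
 have "vert W \<in> verts W" by (rule vert_in_verts[OF cell])
 hence "\<forall>j\<in>J. vtx (vert W) j = n j" using J by (auto simp: verts_def W top_vertex_def)
 hence "col_of J r n (vtx (vert W)) = last_col r n" by (simp add: col_of_def)
 thus ?case using W by (simp add: Lam_vertex)
next
 case (Suc k)
 let ?l = "last_col r n"
 have fin: "finite W" using Suc.prems(2) finite_subset[of "W - top_vertex"] J by (auto simp: top_vertex_def)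
 have ct: "card top_vertex = r" by (simp add: top_vertex_def card_image inj_on_def)
 have "W ~= top_vertex" using Suc.prems ct by auto
 then obtain f where f: "f \<in> W" "f \<notin> top_vertex" using Suc.prems by auto
 have in_cells: "U \<in> cells r n" if "top_vertex \<subseteq> U" "U \<subseteq> W" for U
 proof -
  have "top_vertex \<in> cells r n" by (auto simp: top_vertex_def cells_def grp_def xvars_def)
  moreover have "U \<subseteq> xvars r n"
  proof
   fix x assume "x \<in> U"
   hence "x \<in> top_vertex \<or> (\<exists>j\<in>J. x \<in> grp n j)" using that Suc.prems by blast
   thus "x \<in> xvars r n" using J by (auto simp: xvars_eq top_vertex_def grp_def)
  qed
  ultimately show ?thesis using that cells_mono by blast
 qed
 have tW: "top_vertex \<subseteq> W - {f}" using f Suc.prems by auto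
 have cell: "W \<in> cells r n" "W - {f} \<in> cells r n" using in_cells Suc.prems tW by auto
 have last_n: "?l \<notin> W - top_vertex" if "r \<ge> 1" using that by (auto simp: last_col_def top_vertex_def)
 have r1: "r \<ge> 1"
 proof -
  obtain j where "j \<in> J" using f Suc.prems by blast
  thus ?thesis using J by force
 qed
 let ?Q = "insert ?l (W - top_vertex)" and ?Q' = "insert ?l (W - {f} - top_vertex)"
 have Q: "?Q = insert f ?Q'" using f by auto
 have fQ': "f \<notin> ?Q'" using f last_n r1 by auto
 have cardQ': "card ?Q' = Suc k"
 proof -
  have "card (W - {f} - top_vertex) = k" using Suc.prems f tW fin ct by (simp add: card_Diff_subset finite_subset[OF tW])
  thus ?thesis using last_n r1 fin by auto
 qed
 have strict: "l < n j \<and> j \<in> J" if "(j, l) \<in> W - top_vertex" for j l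
 proof -
  have "\<exists>j'\<in>J. (j, l) \<in> grp n j'" using that Suc.prems by blast
  hence "j \<in> J" "l \<le> n j" by (auto simp: grp_def)
  moreover have "l ~= n j" using that \<open>j \<in> J\<close> J by (auto simp: top_vertex_def)
  ultimately show ?thesis by simp
 qed
 have Q'cols: "?Q' \<subseteq> scols J r n" using strict by (auto simp: scols_def)
 have fcols: "f \<in> scols J r n" using strict[of "fst f" "snd f"] f by (cases f) (auto simp: scols_def)
 have rel: "(\<Sum>q\<in>scols J r n - ?Q'. sg q ?Q' (Lam J (Suc k) W (insert q ?Q'))) = cell_bd r n (%W. Lam J k W ?Q') W"
  using Suc.prems cell by (intro Lam_chain_map J Q'cols cardQ') auto
 have col_in: "col_of J r n (vtx s) \<in> insert ?l (U - top_vertex)"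
  if "s \<in> verts U" for s U
 proof (cases rule: col_of_cases[OF J(1), of "vtx s" n r])
  case (2 j)
  hence "(j, vtx s j) \<in> U" using that J by (auto simp: verts_def)
  moreover have "(j, vtx s j) \<notin> top_vertex" using 2 by (auto simp: top_vertex_def)
  ultimately show ?thesis using 2 by simp
 qed simp
 have "(\<Sum>q\<in>scols J r n - ?Q'. sg q ?Q' (Lam J (Suc k) W (insert q ?Q'))) = sg f ?Q' (Lam J (Suc k) W ?Q)"
 proof -
  \<comment> \<open>By \<open>col_in\<close> the vertices of W hit only columns in
    \<open>?Q\<close>, which leaves q = f.\<close>
  have "Lam J (Suc k) W (insert q ?Q') = 0" if q: "q \<in> scols J r n - ?Q' - {f}" for q
  proof (rule ccontr)
   assume nz: "Lam J (Suc k) W (insert q ?Q') ~= 0"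
   have "card (insert q ?Q') = Suc (Suc k)" using q cardQ' fin by auto
   from Lam_support[OF cell(1) _ this nz] Suc.prems
   have "q \<in> (%s. col_of J r n (vtx s)) ` verts W" by auto
   thus False using col_in q f by auto
  qed
  hence "(\<Sum>q\<in>scols J r n - ?Q' - {f}. sg q ?Q' (Lam J (Suc k) W (insert q ?Q'))) = 0"
   by (intro sum.neutral ballI) (simp only: sg_zero)
  thus ?thesis using fcols fQ' finite_scols[OF J(1)] by (subst sum.remove[of _ f]) (simp_all add: Q)
 qed
 moreover have "cell_bd r n (%W. Lam J k W ?Q') W = sg f W (Lam J k (W - {f}) ?Q')"
 proof -
  have "(if W - {w} \<in> cells r n then Lam J k (W - {w}) ?Q' else 0) = 0" if w: "w \<in> W - {f}" for w
  proof (rule ccontr)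
   assume "~ ?thesis"
   hence c: "W - {w} \<in> cells r n" and nz: "Lam J k (W - {w}) ?Q' ~= 0" by (auto split: if_splits)
   have sup: "?Q' \<subseteq> (%s. col_of J r n (vtx s)) ` verts (W - {w})"
    using w Suc.prems fin by (intro Lam_support[OF c _ cardQ' nz]) auto
   \<comment> \<open>A variable off the top vertex is itself a column of \<open>?Q'\<close>, which
     can then no longer be hit. A variable of the top vertex in a group of J is needed to hit the
     last column. In any other group it is alone, so the face is no cell.\<close>
   show False
   proof (cases "w \<in> top_vertex")
    case False
    hence "w \<in> ?Q'" using w by auto
    then obtain s where "s \<in> verts (W - {w})" "w = col_of J r n (vtx s)" using sup by blast
    with col_in[of s "W - {w}"] have "w = ?l" by auto
    thus False using False last_n r1 w by auto
   next
    case True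
    then obtain j where j: "j \<in> {1..r}" "w = (j, n j)" by (auto simp: top_vertex_def)
    show False
    proof (cases "j \<in> J")
     case True
     obtain s where s: "s \<in> verts (W - {w})" "?l = col_of J r n (vtx s)" using sup by blast
     have "\<forall>i\<in>J. vtx s i = n i"
     proof (cases rule: col_of_cases[OF J(1), of "vtx s" n r])
      case (2 i)
      hence "?l = (i, vtx s i)" "vtx s i ~= n i" using s by auto
      thus ?thesis by (auto simp: last_col_def)
     qed
     hence "vtx s j = n j" using True by simp
     thus False using s(1) j by (auto simp: verts_def)
    next
     case False
     have "(W - {w}) \<inter> grp n j = {}"
     proof -
      have "x = w" if "x \<in> W \<inter> grp n j" for x
      proof (rule ccontr)
       assume "x ~= w"
       hence "x \<in> W - top_vertex" using that j by (auto simp: top_vertex_def grp_def)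
       hence "j \<in> J" using strict[of "fst x" "snd x"] that by (auto simp: grp_def)
       thus False using False by simp
      qed
      thus ?thesis by blast
     qed
     thus False using c j by (auto simp: cells_def)
    qed
   qed
  qed
  hence "(\<Sum>w\<in>W - {f}. sg w W (if W - {w} \<in> cells r n then Lam J k (W - {w}) ?Q' else 0)) = 0" by simp
  thus ?thesis unfolding cell_bd_eq using f fin cell by (subst sum.remove[of _ f]) auto
 qed
 moreover have "\<bar>Lam J k (W - {f}) ?Q'\<bar> = 1" using Suc.prems f tW fin by (intro Suc.IH) auto
 ultimately have "\<bar>sg f ?Q' (Lam J (Suc k) W ?Q)\<bar> = 1" using rel by (simp add: sg_def)
 thus ?case by (auto simp: sg_def split: if_splits)
qed

end

section \<open>Polynomials and Laurent polynomials\<close>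

type_synonym 'k cpoly = "'k upoly xpoly"

abbreviation "pkeys \<equiv> Poly_Mapping.keys"
abbreviation "lkp \<equiv> Poly_Mapping.lookup"
abbreviation "sgl \<equiv> Poly_Mapping.single"

lemma pm_expand: "p = (\<Sum>m\<in>pkeys p. sgl m (lkp p m))"
proof (rule poly_mapping_eqI)
 fix k
 have "lkp (\<Sum>m\<in>pkeys p. sgl m (lkp p m)) k = (\<Sum>m\<in>pkeys p. if m = k then lkp p m else 0)"
  by (simp add: lookup_sum lookup_single when_def)
 also have "\<dots> = lkp p k" by (simp add: in_keys_iff)
 finally show "lkp p k = lkp (\<Sum>m\<in>pkeys p. sgl m (lkp p m)) k" ..
qed

text \<open>The step for a single monomial may use that it occurs in p, so closure conditions on the
  monomials of p are available there.\<close>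

lemma pm_induct [case_names zero single add]:
 fixes P :: "('m \<Rightarrow>\<^sub>0 'c::comm_monoid_add) => bool"
 assumes "P 0" "!!m. m \<in> pkeys p ==> P (sgl m (lkp p m))" "!!a b. P a ==> P b ==> P (a + b)"
 shows "P p"
proof -
 have "P (\<Sum>m\<in>A. sgl m (lkp p m))" if "finite A" "A \<subseteq> pkeys p" for A
  using that by (induction A rule: finite_induct) (simp_all add: assms)
 from this[of "pkeys p"] show ?thesis by (simp add: pm_expand[symmetric])
qed

section \<open>Homomorphisms on monoid algebras\<close>

definition rhom :: "('c::comm_ring_1 => 'b::comm_ring_1) => bool" where
 "rhom \<phi> \<longleftrightarrow> \<phi> 0 = 0 \<and> \<phi> 1 = 1 \<and> (\<forall>a b. \<phi> (a + b) = \<phi> a + \<phi> b) \<and> (\<forall>a b. \<phi> (a * b) = \<phi> a * \<phi> b)"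

definition mhom :: "('m::comm_monoid_add => 'b::comm_ring_1) => bool" where
 "mhom \<chi> \<longleftrightarrow> \<chi> 0 = 1 \<and> (\<forall>a b. \<chi> (a + b) = \<chi> a * \<chi> b)"

text \<open>The universal property of a monoid algebra, with \<phi> on coefficients and \<chi> on
  monomials. One definition covers polynomials, Laurent polynomials and changes of
  coefficients.\<close>

definition pm_eval :: "('c::comm_ring_1 => 'b::comm_ring_1) => ('m => 'b) => ('m \<Rightarrow>\<^sub>0 'c) => 'b" where
 "pm_eval \<phi> \<chi> p = (\<Sum>m\<in>pkeys p. \<phi> (lkp p m) * \<chi> m)"

lemma rhomD:
 assumes "rhom \<phi>"
 shows "\<phi> 0 = 0" "\<phi> 1 = 1" "\<phi> (a + b) = \<phi> a + \<phi> b" "\<phi> (a * b) = \<phi> a * \<phi> b"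
  "\<phi> (- a) = - \<phi> a" "\<phi> (a - b) = \<phi> a - \<phi> b"
  "\<phi> (sum f A) = (\<Sum>x\<in>A. \<phi> (f x))" "\<phi> (prod f A) = (\<Prod>x\<in>A. \<phi> (f x))" "\<phi> (a ^ k) = \<phi> a ^ k"
proof -
 show 0: "\<phi> 0 = 0" "\<phi> 1 = 1" and add: "\<phi> (a + b) = \<phi> a + \<phi> b" and mult: "\<phi> (a * b) = \<phi> a * \<phi> b" for a b
  using assms by (auto simp: rhom_def)
 show m: "\<phi> (- a) = - \<phi> a" for a using add[of a "- a"] 0 by (simp add: minus_unique)
 show "\<phi> (a - b) = \<phi> a - \<phi> b" using add[of a "- b"] m by simp
 show "\<phi> (sum f A) = (\<Sum>x\<in>A. \<phi> (f x))" by (induction A rule: infinite_finite_induct) (simp_all add: 0 add)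
 show "\<phi> (prod f A) = (\<Prod>x\<in>A. \<phi> (f x))" by (induction A rule: infinite_finite_induct) (simp_all add: 0 mult)
 show "\<phi> (a ^ k) = \<phi> a ^ k" by (induction k) (simp_all add: 0 mult)
qed

lemma pm_eval_superset:
 assumes "\<phi> 0 = 0" "finite A" "pkeys p \<subseteq> A"
 shows "pm_eval \<phi> \<chi> p = (\<Sum>m\<in>A. \<phi> (lkp p m) * \<chi> m)" unfolding pm_eval_def
 using assms by (intro sum.mono_neutral_left) (auto simp: in_keys_iff)

lemma pm_eval_single:
 assumes "rhom \<phi>" shows "pm_eval \<phi> \<chi> (sgl m c) = \<phi> c * \<chi> m"
 using rhomD(1)[OF assms] by (subst pm_eval_superset[of \<phi> "{m}"]) auto

lemma pm_eval_add:
 assumes "rhom \<phi>" shows "pm_eval \<phi> \<chi> (p + q) = pm_eval \<phi> \<chi> p + pm_eval \<phi> \<chi> q"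
proof -
 let ?A = "pkeys p \<union> pkeys q"
 have "pkeys (p + q) \<subseteq> ?A" by (rule Poly_Mapping.keys_add)
 thus ?thesis using rhomD[OF assms] by (simp add: pm_eval_superset[of \<phi> ?A] lookup_add distrib_right sum.distrib)
qed

lemma pm_eval_zero [simp]: "pm_eval \<phi> \<chi> 0 = 0" by (simp add: pm_eval_def)

lemma pm_eval_mult:
 assumes \<phi>: "rhom \<phi>" and \<chi>: "mhom \<chi>"
 shows "pm_eval \<phi> \<chi> (p * q) = pm_eval \<phi> \<chi> p * pm_eval \<phi> \<chi> q"
proof (induction p rule: pm_induct)
 case (single m)
 show ?case
 proof (induction q rule: pm_induct)
  case (single m')
  thus ?case using \<chi> by (simp add: mult_single pm_eval_single[OF \<phi>] rhomD[OF \<phi>] mhom_def mult_ac)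
 qed (simp_all add: distrib_left pm_eval_add[OF \<phi>])
qed (simp_all add: distrib_right pm_eval_add[OF \<phi>])

lemma rhom_pm_eval:
 assumes "rhom \<phi>" "mhom \<chi>"
 shows "rhom (pm_eval \<phi> \<chi>)"
proof -
 have "pm_eval \<phi> \<chi> 1 = 1"
  using pm_eval_single[OF assms(1), of \<chi> 0 1] assms(2) rhomD[OF assms(1)] by (simp add: mhom_def)
 thus ?thesis by (simp add: rhom_def pm_eval_add[OF assms(1)] pm_eval_mult[OF assms])
qed

lemma mhom_monomial: "mhom (%m::'v \<Rightarrow>\<^sub>0 nat. \<Prod>v\<in>pkeys m. (z v :: 'b::comm_ring_1) ^ lkp m v)"
 unfolding mhom_def
proof (intro conjI allI)
 fix a b :: "'v \<Rightarrow>\<^sub>0 nat"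
 let ?A = "pkeys a \<union> pkeys b"
 have eq: "(\<Prod>v\<in>pkeys m. z v ^ lkp m v) = (\<Prod>v\<in>?A. z v ^ lkp m v)" if "pkeys m \<subseteq> ?A" for m
  using that by (intro prod.mono_neutral_left) (auto simp: in_keys_iff)
 show "(\<Prod>v\<in>pkeys (a + b). z v ^ lkp (a + b) v)
   = (\<Prod>v\<in>pkeys a. z v ^ lkp a v) * (\<Prod>v\<in>pkeys b. z v ^ lkp b v)"
  using eq[of a] eq[of b] eq[OF Poly_Mapping.keys_add] by (simp add: lookup_add power_add prod.distrib)
qed simp

lemma mpoly_eval_eq: "mpoly_eval \<phi> z = pm_eval \<phi> (%m. \<Prod>v\<in>pkeys m. z v ^ lkp m v)"
 by (simp add: fun_eq_iff mpoly_eval_def pm_eval_def)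

lemma rhom_mpoly_eval: "rhom \<phi> ==> rhom (mpoly_eval \<phi> z)"
 unfolding mpoly_eval_eq by (rule rhom_pm_eval[OF _ mhom_monomial])

lemma rhom_single0: "rhom (sgl (0::'m::comm_monoid_add) :: 'c::comm_ring_1 => _)" by (simp add: rhom_def single_add mult_single)

lemma rhom_compose: "rhom f ==> rhom g ==> rhom (%x. f (g x))" by (simp add: rhom_def)

lemma rhom_eq_on_pm:
 fixes f :: "('m::comm_monoid_add \<Rightarrow>\<^sub>0 'c::comm_ring_1) => 'b::comm_ring_1"
 assumes "rhom f" "rhom g" "!!c. f (sgl 0 c) = g (sgl 0 c)" "!!m. f (sgl m 1) = g (sgl m 1)"
 shows "f p = g p"
proof (induction p rule: pm_induct)
 case (single m)
 have "sgl m c = sgl 0 c * sgl m 1" for c :: 'c by (simp add: mult_single)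
 hence "sgl m (lkp p m) = sgl 0 (lkp p m) * sgl m 1" .
 thus ?case by (simp only: rhomD(4)[OF assms(1)] rhomD(4)[OF assms(2)] assms(3,4))
qed (simp_all add: rhomD[OF assms(1)] rhomD[OF assms(2)])

subsection \<open>Restriction to a set of monomials\<close>

definition pm_restrict :: "('m => bool) => ('m \<Rightarrow>\<^sub>0 'c::zero) => ('m \<Rightarrow>\<^sub>0 'c)" where
 "pm_restrict P p = Poly_Mapping.mapp (%k v. v when P k) p"

lemma lkp_restrict: "lkp (pm_restrict P p) m = (if P m then lkp p m else 0)"
 by (simp add: pm_restrict_def lookup_mapp when_def in_keys_iff)

lemma keys_restrict: "pkeys (pm_restrict P p) = {m\<in>pkeys p. P m}" by (auto simp: in_keys_iff lkp_restrict split: if_splits)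

lemma restrict_add: "pm_restrict P (p + q) = pm_restrict P p + pm_restrict P (q::_ \<Rightarrow>\<^sub>0 'c::monoid_add)"
 by (rule poly_mapping_eqI) (simp add: lkp_restrict lookup_add)

lemma restrict_zero [simp]: "pm_restrict P 0 = 0" by (rule poly_mapping_eqI) (simp add: lkp_restrict)

lemma restrict_id: "(!!m. m \<in> pkeys p ==> P m) ==> pm_restrict P p = p"
 by (rule poly_mapping_eqI) (auto simp: lkp_restrict in_keys_iff)

lemma restrict_single: "pm_restrict P (sgl m c) = (if P m then sgl m c else 0)"
 by (rule poly_mapping_eqI) (auto simp: lkp_restrict lookup_single when_def)

lemma restrict_sum: "pm_restrict P (sum f A) = (\<Sum>x\<in>A. pm_restrict P (f x :: _ \<Rightarrow>\<^sub>0 'c::comm_monoid_add))"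
 by (induction A rule: infinite_finite_induct) (simp_all add: restrict_add)

text \<open>This is how homogeneous parts are taken: Q and P are the degree conditions before and
  after multiplication by f. The induction runs over all g with monomials among those of f, so that
  the hypothesis stays available.\<close>

lemma restrict_mult:
 fixes f h :: "'m::comm_monoid_add \<Rightarrow>\<^sub>0 'c::comm_ring_1"
 assumes "!!m m'. m \<in> pkeys f ==> P (m + m') \<longleftrightarrow> Q m'"
 shows "pm_restrict P (f * h) = f * pm_restrict Q h"
proof -
 have "pm_restrict P (g * h) = g * pm_restrict Q h" if "pkeys g \<subseteq> pkeys f" for g
 proof (induction g rule: pm_induct)
  case (single m)
  hence m: "!!m'. P (m + m') \<longleftrightarrow> Q m'" using that assms by blast
  show ?case by (induction h rule: pm_induct)
     (simp_all add: distrib_left restrict_add mult_single restrict_single m)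
 qed (simp_all add: distrib_right restrict_add)
 thus ?thesis by blast
qed

subsection \<open>The Laurent ring and its localizations\<close>

type_synonym 'a laur = "(xvar \<Rightarrow>\<^sub>0 int) \<Rightarrow>\<^sub>0 'a"

definition emb :: "('v \<Rightarrow>\<^sub>0 nat) => ('v \<Rightarrow>\<^sub>0 int)" where
 "emb m = Poly_Mapping.map int m"

lemma lkp_emb [simp]: "lkp (emb m) v = int (lkp m v)" by (simp add: emb_def Poly_Mapping.map.rep_eq when_def)

lemma emb_zero [simp]: "emb 0 = 0"
 and emb_add: "emb (a + b) = emb a + emb b"
 and emb_eq_iff [simp]: "emb a = emb b \<longleftrightarrow> a = b"
 by (auto intro!: poly_mapping_eqI simp: lookup_add poly_mapping_eq_iff fun_eq_iff)

lemma keys_emb [simp]: "pkeys (emb m) = pkeys m" by (auto simp: in_keys_iff)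

lemma emb_surj:
 assumes "!!v. lkp a v \<ge> 0" obtains m where "emb m = a"
proof
 show "emb (Poly_Mapping.map nat a) = a" using assms by (intro poly_mapping_eqI) (auto simp: Poly_Mapping.map.rep_eq when_def)
qed

definition to_laur :: "(('v \<Rightarrow>\<^sub>0 nat) \<Rightarrow>\<^sub>0 'a::comm_ring_1) => (('v \<Rightarrow>\<^sub>0 int) \<Rightarrow>\<^sub>0 'a)" where
 "to_laur = pm_eval (sgl 0) (%m. sgl (emb m) 1)"

lemma rhom_to_laur: "rhom to_laur" unfolding to_laur_def
 by (rule rhom_pm_eval[OF rhom_single0]) (simp add: mhom_def emb_add mult_single)

lemma to_laur_single [simp]: "to_laur (sgl m c) = sgl (emb m) c"
 unfolding to_laur_def by (simp add: pm_eval_single[OF rhom_single0] mult_single)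

lemma lkp_to_laur [simp]: "lkp (to_laur p) (emb m) = lkp p m"
proof (induction p rule: pm_induct)
 case (single k)
 show ?case by (simp add: lookup_single when_def)
qed (simp_all add: rhomD[OF rhom_to_laur] lookup_add)

lemma keys_to_laur: "pkeys (to_laur p) = emb ` pkeys p"
proof -
 have "pkeys (to_laur p) \<subseteq> range emb"
 proof (induction p rule: pm_induct)
  case (add a b)
  thus ?case using Poly_Mapping.keys_add[of "to_laur a" "to_laur b"] by (auto simp: rhomD[OF rhom_to_laur])
 qed (auto simp: rhomD[OF rhom_to_laur])
 thus ?thesis by (auto simp: in_keys_iff dest: subsetD)
qed

lemma to_laur_eq_iff [simp]: "to_laur p = to_laur q \<longleftrightarrow> p = q" by (metis lkp_to_laur poly_mapping_eqI)

lemma to_laur_surj: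
 assumes "!!a v. a \<in> pkeys f ==> lkp a v \<ge> 0"
 obtains p where "to_laur p = f"
proof -
 have "\<exists>p. to_laur p = f"
 proof (induction f rule: pm_induct)
  case (single a)
  then obtain m where "emb m = a" using assms emb_surj by metis
  thus ?case by (metis to_laur_single)
 qed (metis rhomD(1)[OF rhom_to_laur], metis rhomD(3)[OF rhom_to_laur])
 thus thesis using that by blast
qed

definition ldeg :: "(nat => nat) => (xvar \<Rightarrow>\<^sub>0 int) => nat => int" where
 "ldeg n a j = (\<Sum>l\<le>n j. lkp a (j, l))"

lemma ldeg_emb: "ldeg n (emb m) = xmono_deg n m" by (simp add: fun_eq_iff ldeg_def xmono_deg_def)

lemma ldeg_add: "ldeg n (a + b) j = ldeg n a j + ldeg n b j"
 and ldeg_zero [simp]: "ldeg n 0 j = 0"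
 and ldeg_diff: "ldeg n (a - b) j = ldeg n a j - ldeg n b j"
 by (simp_all add: ldeg_def lookup_add sum.distrib lookup_minus sum_subtractf)

lemma xmono_deg_add: "xmono_deg n (a + b) j = xmono_deg n a j + xmono_deg n b j" by (simp add: xmono_deg_def lookup_add sum.distrib)

definition Lexp :: "nat => (nat => nat) => xvar set => (xvar \<Rightarrow>\<^sub>0 int) set" where
 "Lexp r n W = {a. pkeys a \<subseteq> xvars r n \<and> (\<forall>v. lkp a v < 0 --> v \<in> W)}"

text \<open>The localization of the polynomial ring at the variables in \<open>W\<close>.\<close>

definition Lring :: "nat => (nat => nat) => xvar set => 'a::comm_ring_1 laur set" where
 "Lring r n W = {p. pkeys p \<subseteq> Lexp r n W}"

definition Lhom :: "nat => (nat => nat) => xvar set => (nat => int) => 'a::comm_ring_1 laur set" where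
 "Lhom r n W \<mu> = {p \<in> Lring r n W. \<forall>a\<in>pkeys p. ldeg n a = \<mu>}"

lemma Lexp_zero [simp]: "0 \<in> Lexp r n W" by (simp add: Lexp_def)

lemma Lexp_add: "a \<in> Lexp r n W ==> b \<in> Lexp r n W ==> a + b \<in> Lexp r n W"
 unfolding Lexp_def using Poly_Mapping.keys_add[of a b] by (auto simp: lookup_add) (smt (verit, best))

lemma Lexp_mono: "W \<subseteq> W' ==> Lexp r n W \<subseteq> Lexp r n W'" by (auto simp: Lexp_def)

lemma Lring_mono: "W \<subseteq> W' ==> Lring r n W \<subseteq> Lring r n W'" using Lexp_mono[of W W' r n] by (auto simp: Lring_def)

lemma Lhom_mono: "W \<subseteq> W' ==> Lhom r n W \<mu> \<subseteq> Lhom r n W' \<mu>"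
 using Lring_mono[of W W' r n] by (auto simp: Lhom_def)

lemma Lring_closed:
 shows Lring_zero [simp]: "0 \<in> Lring r n W"
  and Lring_one [simp]: "1 \<in> Lring r n W"
  and Lring_add: "p \<in> Lring r n W ==> q \<in> Lring r n W ==> p + q \<in> Lring r n W"
  and Lring_minus: "p \<in> Lring r n W ==> - p \<in> Lring r n W"
  and Lring_diff: "p \<in> Lring r n W ==> q \<in> Lring r n W ==> p - q \<in> Lring r n W"
  and Lring_mult: "p \<in> Lring r n W ==> q \<in> Lring r n W ==> p * q \<in> Lring r n W"
proof -
 show "0 \<in> Lring r n W" "1 \<in> Lring r n W" by (simp_all add: Lring_def)
 show add: "p + q \<in> Lring r n W" if "p \<in> Lring r n W" "q \<in> Lring r n W" for p q
  using that Poly_Mapping.keys_add[of p q] by (auto simp: Lring_def)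
 show minus: "- p \<in> Lring r n W" if "p \<in> Lring r n W" for p using that by (auto simp: Lring_def in_keys_iff)
 show "p - q \<in> Lring r n W" if "p \<in> Lring r n W" "q \<in> Lring r n W" using add[OF that(1) minus[OF that(2)]] by simp
 show "p * q \<in> Lring r n W" if "p \<in> Lring r n W" "q \<in> Lring r n W" unfolding Lring_def
 proof (intro CollectI subsetI)
  fix c assume "c \<in> pkeys (p * q)"
  then obtain a b where "c = a + b" "a \<in> pkeys p" "b \<in> pkeys q" using Poly_Mapping.keys_mult[of p q] by blast
  thus "c \<in> Lexp r n W" using that by (auto simp: Lring_def intro!: Lexp_add)
 qed
qed

lemma Lring_single: "a \<in> Lexp r n W ==> sgl a c \<in> Lring r n W" by (simp add: Lring_def)

lemma Lhom_zero [simp]: "0 \<in> Lhom r n W \<mu>" by (simp add: Lhom_def)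

lemma Lhom_add: "p \<in> Lhom r n W \<mu> ==> q \<in> Lhom r n W \<mu> ==> p + q \<in> Lhom r n W \<mu>"
 using Poly_Mapping.keys_add[of p q] by (auto simp: Lhom_def Lring_add)

lemma Lhom_minus: "p \<in> Lhom r n W \<mu> ==> - p \<in> Lhom r n W \<mu>" by (auto simp: Lhom_def Lring_minus)

lemma Lhom_diff: "p \<in> Lhom r n W \<mu> ==> q \<in> Lhom r n W \<mu> ==> p - q \<in> Lhom r n W \<mu>"
 using Lhom_add[of p r n W \<mu> "- q"] Lhom_minus by fastforce

lemma Lhom_sg: "p \<in> Lhom r n W \<mu> ==> sg x S p \<in> Lhom r n W \<mu>" by (simp add: sg_def Lhom_minus)

lemma Lhom_sum: "(!!x. x \<in> A ==> f x \<in> Lhom r n W \<mu>) ==> sum f A \<in> Lhom r n W \<mu>"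
 by (induction A rule: infinite_finite_induct) (simp_all add: Lhom_add)

lemma Lhom_mult:
 assumes "p \<in> Lhom r n W \<mu>" "q \<in> Lhom r n W \<mu>'" "!!j. \<mu> j + \<mu>' j = \<mu>'' j"
 shows "p * q \<in> Lhom r n W \<mu>''" using assms Poly_Mapping.keys_mult[of p q] Lring_mult[of p r n W q]
 by (fastforce simp: Lhom_def fun_eq_iff ldeg_add)

lemma Lhom_single: "a \<in> Lexp r n W ==> ldeg n a = \<mu> ==> sgl a c \<in> Lhom r n W \<mu>" by (simp add: Lhom_def Lring_single)

lemma emb_in_Lexp [simp]: "emb m \<in> Lexp r n W \<longleftrightarrow> pkeys m \<subseteq> xvars r n" by (simp add: Lexp_def)

lemma to_laur_in_Lhom:
 "p \<in> xpolys_deg r n UNIV \<mu> \<longleftrightarrow> to_laur p \<in> Lhom r n {} \<mu>"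
 by (simp add: xpolys_deg_def mpolys_def Lhom_def Lring_def image_subset_iff keys_to_laur ldeg_emb)

lemma to_laur_in_Lring: "p \<in> mpolys (xvars r n) UNIV \<longleftrightarrow> to_laur p \<in> Lring r n {}"
 by (simp add: mpolys_def Lring_def image_subset_iff keys_to_laur)

lemma Lring_empty_to_laur:
 assumes "f \<in> Lring r n {}" obtains p where "to_laur p = f" "p \<in> mpolys (xvars r n) UNIV"
proof -
 have "!!a v. a \<in> pkeys f ==> lkp a v \<ge> 0" using assms unfolding Lring_def Lexp_def
  by (metis (mono_tags, lifting) empty_iff leI mem_Collect_eq subsetD)
 then obtain p where "to_laur p = f" using to_laur_surj by blast
 thus ?thesis using that assms to_laur_in_Lring by blast
qed

section \<open>Exactness in the two directions of the double complex\<close>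

lemma lkp_sg: "lkp (sg x S p) a = sg x S (lkp p a)" by (simp add: sg_def)

lemma lkp_cobd: "lkp (cobd c W) a = cobd (%W. lkp (c W) a) W" by (simp add: cobd_def lookup_sum lkp_sg)

definition neg_part :: "(xvar \<Rightarrow>\<^sub>0 int) => xvar set" where
 "neg_part a = {v. lkp a v < 0}"

lemma Lexp_alt: "a \<in> Lexp r n W \<longleftrightarrow> pkeys a \<subseteq> xvars r n \<and> neg_part a \<subseteq> W"
 by (auto simp: Lexp_def neg_part_def)

lemma neg_part_keys: "neg_part a \<subseteq> pkeys a" by (auto simp: neg_part_def in_keys_iff)

text \<open>Signs and inclusions do not touch exponents, so the complex splits into the coefficients
  of single monomials. The coefficient at \<open>a\<close> is carried by the cells containing
  \<open>neg_part a\<close>; finitely many \<open>a\<close> occur, and \<open>fine_exact\<close> is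
  solved for each.\<close>

lemma laur_exact:
 fixes c :: "xvar set => 'a::comm_ring_1 laur"
 assumes hom: "!!W. c W \<in> Lhom r n W \<mu>"
  and supp: "!!W. c W ~= 0 ==> W \<in> cells r n \<and> card W = m"
  and cocycle: "!!W. W \<subseteq> xvars r n ==> cobd c W = 0"
  and good: "!!W a J. a \<in> pkeys (c W) ==> J \<subseteq> {1..r} ==> neg_part a = (\<Union>j\<in>J. grp n j)
   ==> m ~= (\<Sum>j\<in>J. n j) + r"
 shows "\<exists>e. (\<forall>W. e W \<in> Lhom r n W \<mu>) \<and> (\<forall>W. e W ~= 0 --> W \<in> cells r n \<and> Suc (card W) = m) \<and>
   (\<forall>W. W \<subseteq> xvars r n --> cobd e W = c W)"
proof -
 define A where "A = (\<Union>W\<in>Pow (xvars r n). pkeys (c W))"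
 have finA: "finite A" by (simp add: A_def)
 have inA: "\<exists>W. a \<in> pkeys (c W)" if "a \<in> A" for a using that by (auto simp: A_def)
 have key: "pkeys a \<subseteq> xvars r n" "neg_part a \<subseteq> W" "ldeg n a = \<mu>" if "a \<in> pkeys (c W)" for a W
  using hom[of W] that by (auto simp: Lhom_def Lring_def subset_iff Lexp_alt)
 have "\<exists>e. (\<forall>W. e W ~= 0 --> W \<in> cells r n \<and> neg_part a \<subseteq> W \<and> Suc (card W) = m) \<and>
       (\<forall>W. W \<subseteq> xvars r n --> cobd e W = lkp (c W) a)" if a: "a \<in> A" for a
 proof (rule fine_exact)
  show "neg_part a \<subseteq> xvars r n" using inA[OF a] key neg_part_keys by blast
  show "W \<in> cells r n \<and> neg_part a \<subseteq> W \<and> card W = m" if "lkp (c W) a ~= 0" for W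
  proof -
   have "a \<in> pkeys (c W)" using that by (simp add: in_keys_iff)
   moreover from this have "c W ~= 0" by auto
   ultimately show ?thesis using supp key by blast
  qed
  show "cobd (%W. lkp (c W) a) W = 0" if "W \<subseteq> xvars r n" for W using cocycle[OF that] by (simp add: lkp_cobd[symmetric])
  show "m ~= (\<Sum>j\<in>J. n j) + r" if "J \<subseteq> {1..r}" "neg_part a = (\<Union>j\<in>J. grp n j)" for J
   using inA[OF a] good that by blast
 qed
 then obtain f where
  f1: "!!a W. a \<in> A ==> f a W ~= 0 ==> W \<in> cells r n \<and> neg_part a \<subseteq> W \<and> Suc (card W) = m" and
  f2: "!!a W. a \<in> A ==> W \<subseteq> xvars r n ==> cobd (f a) W = lkp (c W) a" by metis
 define e where "e W = (\<Sum>a\<in>A. sgl a (f a W))" for W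
 have "e W \<in> Lhom r n W \<mu>" for W unfolding e_def
 proof (rule Lhom_sum)
  fix a assume a: "a \<in> A"
  then obtain W' where W': "a \<in> pkeys (c W')" using inA by blast
  show "sgl a (f a W) \<in> Lhom r n W \<mu>"
  proof (cases "f a W = 0")
   case False
   thus ?thesis using f1[OF a False] key[OF W'] by (intro Lhom_single) (auto simp: Lexp_alt)
  qed simp
 qed
 moreover have "W \<in> cells r n \<and> Suc (card W) = m" if "e W ~= 0" for W
 proof -
  from that have "\<exists>a\<in>A. sgl a (f a W) ~= 0" unfolding e_def by (meson sum.neutral)
  then obtain a where "a \<in> A" "f a W ~= 0" by (metis single_zero)
  thus ?thesis using f1 by blast
 qed
 moreover have "cobd e W = c W" if W: "W \<subseteq> xvars r n" for W
 proof (rule poly_mapping_eqI)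
  fix b
  have "lkp (cobd e W) b = cobd (%W. if b \<in> A then f b W else 0) W" unfolding lkp_cobd using finA
   by (intro cobd_cong) (simp add: e_def lookup_sum lookup_single when_def)
  also have "\<dots> = lkp (c W) b"
  proof (cases "b \<in> A")
   case False
   hence "b \<notin> pkeys (c W)" using W by (auto simp: A_def)
   thus ?thesis using False by (simp add: cobd_def in_keys_iff)
  qed (simp add: f2 W)
  finally show "lkp (cobd e W) b = lkp (c W) b" .
 qed
 ultimately show ?thesis by blast
qed

text \<open>A cocycle on the vertices is one and the same Laurent polynomial in all these
  localizations. It has no denominators because every variable is avoided by some vertex, which
  takes two variables in each group.\<close>

lemma laur_exact_augmentation:
 fixes c :: "xvar set => 'a::comm_ring_1 laur"
 assumes n: "!!j. j \<in> {1..r} ==> n j \<ge> 1"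
  and hom: "!!W. c W \<in> Lhom r n W \<mu>"
  and supp: "!!W. c W ~= 0 ==> W \<in> cells r n"
  and cocycle: "!!W. W \<subseteq> xvars r n ==> cobd c W = 0"
 shows "\<exists>p\<in>Lhom r n {} \<mu>. \<forall>W\<in>cells r n. card W = r --> c W = p"
proof
 let ?B = "(%j. (j, 0::nat)) ` {1..r}"
 show all: "\<forall>W\<in>cells r n. card W = r --> c W = c ?B" using constant_on_vertices[of c r n, OF supp cocycle] by blast
 have "neg_part a = {}" if a: "a \<in> pkeys (c ?B)" for a
 proof (rule ccontr)
  assume "neg_part a ~= {}"
  then obtain v where v: "v \<in> neg_part a" by blast
  \<comment> \<open>Index 1 is taken only in the group where index 0 would give \<open>v\<close>, so
    the vertex \<open>?W\<close> avoids \<open>v\<close>.\<close>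
  define \<sigma> where "\<sigma> j = (if v = (j, 0) then 1 else 0::nat)" for j
  let ?W = "(%j. (j, \<sigma> j)) ` {1..r}"
  have "?W \<in> cells r n" using n by (fastforce simp: cells_def xvars_def grp_def \<sigma>_def)
  moreover have "card ?W = r" by (subst card_image) (auto simp: inj_on_def)
  ultimately have "c ?W = c ?B" using all by blast
  hence "a \<in> pkeys (c ?W)" using a by simp
  hence "neg_part a \<subseteq> ?W" using hom[of ?W] by (auto simp: Lhom_def Lring_def subset_iff Lexp_alt)
  hence "v \<in> ?W" using v by blast
  thus False by (auto simp: \<sigma>_def split: if_splits)
 qed
 thus "c ?B \<in> Lhom r n {} \<mu>" using hom[of ?B] by (auto simp: Lhom_def Lring_def subset_iff Lexp_alt)
qed

text \<open>The Koszul differential in coordinates: z L is the coefficient at the basis element of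
  L, so the value at L collects the contributions of L with one index added.\<close>

definition kos :: "(nat => 'b::comm_ring_1) => nat => (nat set => 'b) => nat set => 'b" where
 "kos F M z L = (\<Sum>i\<in>{..<M} - L. sg i L (F i * z (insert i L)))"

definition ideal_of :: "'b::comm_ring_1 set => (nat => 'b) => nat => 'b set" where
 "ideal_of S F M = {v. \<exists>h. (\<forall>i<M. h i \<in> S) \<and> v = (\<Sum>i<M. h i * F i)}"

lemma kos_kos:
 assumes "L \<subseteq> {..<M}"
 shows "kos F M (kos F M z) L = 0"
proof -
 have fin: "finite L" using assms finite_subset by blast
 have "kos F M (kos F M z) L = (\<Sum>i\<in>{..<M} - L. \<Sum>j\<in>{..<M} - L - {i}.
   sg i L (sg j (insert i L) (F i * F j * z (insert i (insert j L)))))" unfolding kos_def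
 proof (rule sum.cong[OF refl])
  fix i assume "i \<in> {..<M} - L"
  have "{..<M} - insert i L = {..<M} - L - {i}" by auto
  thus "sg i L (F i * (\<Sum>j\<in>{..<M} - insert i L. sg j (insert i L) (F j * z (insert j (insert i L)))))
   = (\<Sum>j\<in>{..<M} - L - {i}. sg i L (sg j (insert i L) (F i * F j * z (insert i (insert j L)))))"
   by (simp add: sum_distrib_left sg_sum sg_mult_right mult.assoc insert_commute)
 qed
 also have "\<dots> = 0"
 proof (rule sum_pairs_antisym)
  fix i j assume *: "i \<in> {..<M} - L" "j \<in> {..<M} - L" "i < j"
  moreover have "~ j < i" using * by simp
  ultimately show "sg i L (sg j (insert i L) (F i * F j * z (insert i (insert j L))))
   = - sg j L (sg i (insert j L) (F j * F i * z (insert j (insert i L))))"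
   using fin by (simp add: sg_insert sg_minus sg_comm[of i L j L] insert_commute mult.commute)
 qed simp
 finally show ?thesis .
qed

lemma kos_add: "kos F M (%L. z L + z' L) L = kos F M z L + kos F M z' L" by (simp add: kos_def distrib_left sg_add sum.distrib)

lemma kos_diff: "kos F M (%L. z L - z' L) L = kos F M z L - kos F M z' L"
 by (simp add: kos_def right_diff_distrib sg_diff sum_subtractf)

lemma kos_cong: "(!!i. i < M ==> i \<notin> L ==> z (insert i L) = z' (insert i L)) ==> kos F M z L = kos F M z' L"
 by (simp add: kos_def)

locale subring_on =
 fixes S :: "'b::comm_ring_1 set"
 assumes S0: "0 \<in> S" and Sadd: "a \<in> S ==> b \<in> S ==> a + b \<in> S" and Sminus: "a \<in> S ==> - a \<in> S"
  and Smult: "a \<in> S ==> b \<in> S ==> a * b \<in> S"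
begin

lemma Sdiff: "a \<in> S ==> b \<in> S ==> a - b \<in> S" using Sadd[of a "- b"] Sminus by simp

lemma Ssum: "(!!x. x \<in> A ==> f x \<in> S) ==> sum f A \<in> S"
 by (induction A rule: infinite_finite_induct) (simp_all add: S0 Sadd)

lemma Ssg: "p \<in> S ==> sg x L p \<in> S" by (simp add: sg_def Sminus)

lemma kos_in: "(!!i. i < M ==> F i \<in> S) ==> (!!L. z L \<in> S) ==> kos F M z L \<in> S"
 unfolding kos_def by (intro Ssum Ssg Smult) auto

text \<open>Induction on the length, splitting a cycle according to whether the last index occurs.\<close>

lemma koszul_exact:
 assumes F: "!!i. i < M ==> F i \<in> S"
  and reg: "!!m v. m < M ==> v \<in> S ==> F m * v \<in> ideal_of S F m ==> v \<in> ideal_of S F m"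
  and "p \<ge> 1" "!!L. z L \<in> S" "!!L. z L ~= 0 ==> L \<subseteq> {..<M} \<and> card L = p"
  and "!!L. L \<subseteq> {..<M} ==> kos F M z L = 0"
 shows "\<exists>y. (\<forall>L. y L \<in> S) \<and> (\<forall>L. y L ~= 0 --> L \<subseteq> {..<M} \<and> card L = Suc p) \<and>
   (\<forall>L. L \<subseteq> {..<M} --> kos F M y L = z L)" using assms
proof (induction M arbitrary: p z)
 case 0
 have "z L = 0" for L using 0(5)[of L] 0(3) by fastforce
 thus ?case by (intro exI[of _ "%_. 0"]) (simp add: S0 kos_def)
next
 case (Suc M)
 note IH = Suc.IH and F = Suc.prems(1) and reg = Suc.prems(2) and p = Suc.prems(3)
  and zS = Suc.prems(4) and supp = Suc.prems(5) and cyc = Suc.prems(6)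
 have sgM: "sg i (insert M L) q = sg i L q" if "L \<subseteq> {..<M}" "i < M" for i L and q :: 'b
  using that finite_subset[OF that(1)] by (subst sg_insert) auto
 have kosM: "kos F (Suc M) w (insert M L) = kos F M (%L. w (insert M L)) L" if L: "L \<subseteq> {..<M}" for w L
 proof -
  have "{..<Suc M} - insert M L = {..<M} - L" using L by auto
  thus ?thesis unfolding kos_def using L by (simp add: sgM insert_commute)
 qed
 have kosn: "kos F (Suc M) w L = sg M L (F M * w (insert M L)) + kos F M w L" if L: "L \<subseteq> {..<M}" for w L
 proof -
  have "{..<Suc M} - L = insert M ({..<M} - L)" using L by auto
  thus ?thesis unfolding kos_def by simp
 qed
 \<comment> \<open>The coefficients at the basis elements that contain the last index
   \<open>M\<close>; they form a cycle of degree p - 1 on the earlier indices.\<close>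
 define v where "v L = (if L \<subseteq> {..<M} then z (insert M L) else 0)" for L
 have vS: "v L \<in> S" for L by (simp add: v_def zS S0)
 have vsupp: "L \<subseteq> {..<M} \<and> Suc (card L) = p" if "v L ~= 0" for L
 proof -
  from that have L: "L \<subseteq> {..<M}" "z (insert M L) ~= 0" by (auto simp: v_def split: if_splits)
  hence "card (insert M L) = p" "M \<notin> L" "finite L" using supp finite_subset by auto
  thus ?thesis using L by simp
 qed
 have vcyc: "kos F M v L = 0" if L: "L \<subseteq> {..<M}" for L
 proof -
  have "kos F M v L = kos F M (%L. z (insert M L)) L" using L by (intro kos_cong) (auto simp: v_def)
  also have "\<dots> = kos F (Suc M) z (insert M L)" using kosM[OF L] by simp
  also have "\<dots> = 0" using L by (intro cyc) auto
  finally show ?thesis .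
 qed
 \<comment> \<open>For p > 1 this is the induction hypothesis. For p = 1 the cycle condition at the
   empty set puts F M * v {} into the ideal of the earlier elements, and here regularity
   enters.\<close>
 have "\<exists>v'. (\<forall>L. v' L \<in> S) \<and> (\<forall>L. v' L ~= 0 --> L \<subseteq> {..<M} \<and> card L = p) \<and> (\<forall>L. L \<subseteq> {..<M} --> kos F M v' L = v L)"
 proof (cases "p = 1")
  case False
  then obtain p' where p': "p = Suc p'" "p' \<ge> 1" using p by (cases p) auto
  show ?thesis unfolding p'(1) using F reg p' vS vsupp vcyc by (intro IH) auto
 next
  case True
  have "kos F (Suc M) z {} = 0" by (intro cyc) auto
  hence "F M * z {M} + (\<Sum>i<M. F i * z {i}) = 0" by (simp add: kosn) (simp add: kos_def)
  hence "F M * v {} = (\<Sum>i<M. - z {i} * F i)" by (simp add: v_def sum_negf mult.commute eq_neg_iff_add_eq_0)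
  hence "F M * v {} \<in> ideal_of S F M" unfolding ideal_of_def using zS Sminus by (intro CollectI exI[of _ "%i. - z {i}"]) simp
  hence "v {} \<in> ideal_of S F M" using reg[of M "v {}"] vS by simp
  then obtain h where h: "!!i. i < M ==> h i \<in> S" "v {} = (\<Sum>i<M. h i * F i)" by (auto simp: ideal_of_def)
  define v' where "v' L = (if \<exists>i<M. L = {i} then h (THE i. L = {i}) else 0)" for L
  have v'1: "v' {i} = h i" if "i < M" for i using that by (simp add: v'_def)
  have "kos F M v' L = v L" if L: "L \<subseteq> {..<M}" for L
  proof (cases "L = {}")
   case True
   thus ?thesis using h(2) by (simp add: kos_def v'1 mult.commute)
  next
   case False
   have fL: "finite L" using L finite_subset by blast
   have "v L = 0" using vsupp[of L] False \<open>p = 1\<close> fL by auto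
   moreover have "v' (insert i L) = 0" if "i \<notin> L" for i using that False by (auto simp: v'_def)
   ultimately show ?thesis by (simp add: kos_def)
  qed
  moreover have "v' L \<in> S" for L using h(1) by (auto simp: v'_def S0)
  moreover have "L \<subseteq> {..<M} \<and> card L = p" if "v' L ~= 0" for L
   using that True by (auto simp: v'_def split: if_splits)
  ultimately show ?thesis by blast
 qed
 then obtain v' where v'S: "!!L. v' L \<in> S" and v's: "!!L. v' L ~= 0 ==> L \<subseteq> {..<M} \<and> card L = p"
  and v'k: "!!L. L \<subseteq> {..<M} ==> kos F M v' L = v L" by blast
 \<comment> \<open>Joining the index \<open>M\<close> to \<open>v'\<close> needs no sign, since
   \<open>M\<close> is the largest index. Subtracting the boundary of \<open>y1\<close> removes from
   z all terms containing \<open>M\<close> and leaves a cycle \<open>z'\<close> on the earlier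
   indices.\<close>
 define y1 where "y1 L = (if M \<in> L then v' (L - {M}) else 0)" for L
 have y1M: "y1 (insert M L) = v' L" if "L \<subseteq> {..<M}" for L
 proof -
  have "insert M L - {M} = L" using that by auto
  thus ?thesis by (simp add: y1_def)
 qed
 have y1S: "y1 L \<in> S" for L by (simp add: y1_def v'S S0)
 define z' where "z' L = (if L \<subseteq> {..<M} then z L - kos F (Suc M) y1 L else 0)" for L
 have z'eq: "z L - kos F (Suc M) y1 L = z' L" if L: "L \<subseteq> {..<Suc M}" for L
 proof (cases "M \<in> L")
  case False
  hence "L \<subseteq> {..<M}" using L by (auto simp: less_Suc_eq)
  thus ?thesis by (simp add: z'_def)
 next
  case True
  define L' where "L' = L - {M}"
  have L': "L' \<subseteq> {..<M}" "L = insert M L'" using True L by (auto simp: L'_def less_Suc_eq)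
  have "kos F (Suc M) y1 L = kos F M (%L. y1 (insert M L)) L'" unfolding L'(2) by (rule kosM[OF L'(1)])
  also have "\<dots> = kos F M v' L'" using L' by (intro kos_cong y1M) auto
  also have "\<dots> = z L" using v'k[OF L'(1)] L' by (simp add: v_def)
  finally show ?thesis using True by (auto simp: z'_def)
 qed
 have z'S: "z' L \<in> S" for L unfolding z'_def using F zS y1S by (auto intro!: Sdiff kos_in S0)
 have y1s: "card L = Suc p" if "y1 L ~= 0" for L
 proof -
  from that have "M \<in> L" "v' (L - {M}) ~= 0" by (auto simp: y1_def split: if_splits)
  moreover from v's[OF this(2)] have "L - {M} \<subseteq> {..<M}" "card (L - {M}) = p" by auto
  moreover from this have "finite (L - {M})" using finite_subset by blast
  ultimately show ?thesis using card_Suc_Diff1[of L M] by simp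
 qed
 have z's: "L \<subseteq> {..<M} \<and> card L = p" if "z' L ~= 0" for L
 proof -
  from that have L: "L \<subseteq> {..<M}" and nz: "z L ~= 0 \<or> kos F (Suc M) y1 L ~= 0" by (auto simp: z'_def split: if_splits)
  have fL: "finite L" using L finite_subset by blast
  have "card L = p" if "kos F (Suc M) y1 L ~= 0"
  proof -
   from that have "\<exists>i\<in>{..<Suc M} - L. sg i L (F i * y1 (insert i L)) ~= 0" unfolding kos_def by (meson sum.neutral)
   then obtain i where "i \<notin> L" "y1 (insert i L) ~= 0" by (metis Diff_iff mult_zero_right sg_zero)
   thus ?thesis using y1s[of "insert i L"] fL by simp
  qed
  thus ?thesis using nz supp L by blast
 qed
 have z'cyc: "kos F M z' L = 0" if L: "L \<subseteq> {..<M}" for L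
 proof -
  have "kos F M z' L = kos F (Suc M) z' L" using kosn[OF L, of z'] L by (auto simp: z'_def)
  also have "\<dots> = kos F (Suc M) (%L. z L - kos F (Suc M) y1 L) L" using L by (intro kos_cong z'eq[symmetric]) auto
  also have "\<dots> = kos F (Suc M) z L - kos F (Suc M) (kos F (Suc M) y1) L" by (rule kos_diff)
  also have "\<dots> = 0" using L by (subst kos_kos) (auto intro!: cyc)
  finally show ?thesis .
 qed
 have "\<exists>y. (\<forall>L. y L \<in> S) \<and> (\<forall>L. y L ~= 0 --> L \<subseteq> {..<M} \<and> card L = Suc p) \<and>
   (\<forall>L. L \<subseteq> {..<M} --> kos F M y L = z' L)" using F reg p z'S z's z'cyc by (intro IH) auto
 then obtain y2 where y2S: "!!L. y2 L \<in> S" and y2s: "!!L. y2 L ~= 0 ==> L \<subseteq> {..<M} \<and> card L = Suc p"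
  and y2k: "!!L. L \<subseteq> {..<M} ==> kos F M y2 L = z' L" by blast
 have y2M: "y2 L = 0" if "M \<in> L" for L using y2s[of L] that by auto
 have y2k': "kos F (Suc M) y2 L = z' L" if L: "L \<subseteq> {..<Suc M}" for L
 proof (cases "M \<in> L")
  case False
  hence "L \<subseteq> {..<M}" using L by (auto simp: less_Suc_eq)
  thus ?thesis using y2k by (simp add: kosn y2M)
 next
  case True
  hence "kos F (Suc M) y2 L = 0" unfolding kos_def using y2M by (intro sum.neutral) auto
  moreover have "z' L = 0" using True by (auto simp: z'_def)
  ultimately show ?thesis by simp
 qed
 have y1sub: "L \<subseteq> {..<Suc M}" if "y1 L ~= 0" for L
 proof -
  from that have "v' (L - {M}) ~= 0" by (auto simp: y1_def split: if_splits)
  from v's[OF this] have "L - {M} \<subseteq> {..<M}" by blast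
  thus ?thesis by (auto simp: less_Suc_eq)
 qed
 show ?case
 proof (intro exI[of _ "%L. y1 L + y2 L"] conjI allI impI)
  fix L
  show "y1 L + y2 L \<in> S" using y1S y2S Sadd by blast
  show "kos F (Suc M) (%L. y1 L + y2 L) L = z L" if "L \<subseteq> {..<Suc M}"
   using y2k'[OF that] z'eq[OF that] by (simp add: kos_add algebra_simps)
  assume "y1 L + y2 L ~= 0"
  hence "y1 L ~= 0 \<or> y2 L ~= 0" by auto
  thus "L \<subseteq> {..<Suc M}" "card L = Suc p" using y1sub[of L] y1s[of L] y2s[of L] by (auto simp: less_Suc_eq)
 qed
qed

end

section \<open>The diagram chase\<close>

text \<open>The first lift \<open>c1\<close> is assumed because \<open>K_exact\<close> says nothing
  at p = 0, where the cokernel is the localized quotient by the forms. Saturation will provide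
  it.\<close>

lemma chase_up:
 fixes G :: "nat => nat => 'g::ab_group_add set" and dK :: "'g => 'g" and dT :: "nat => 'g => 'g"
 assumes T: "!!p q x. x \<in> G p q ==> dT q x \<in> G p (Suc q)"
  and TT: "!!p q x. x \<in> G p q ==> dT (Suc q) (dT q x) = 0"
  and KT: "!!p q x. x \<in> G (Suc p) q ==> dT q (dK x) = dK (dT q x)"
  and K_exact: "!!p q x. x \<in> G (Suc p) (Suc q) ==> dK x = 0 ==> \<exists>y\<in>G (Suc (Suc p)) (Suc q). dK y = x"
  and c0: "c0 \<in> G 0 0" and c1: "c1 \<in> G 1 1" "dK c1 = dT 0 c0"
 shows "\<exists>c. c 0 = c0 \<and> (\<forall>q\<le>t. c q \<in> G q q) \<and> (\<forall>q<t. dK (c (Suc q)) = dT q (c q))"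
proof (induction t)
 case 0
 show ?case by (rule exI[of _ "%_. c0"]) (simp add: c0)
next
 case (Suc t)
 then obtain c where c: "c 0 = c0" "!!q. q \<le> t ==> c q \<in> G q q" "!!q. q < t ==> dK (c (Suc q)) = dT q (c q)" by blast
 have "\<exists>y\<in>G (Suc t) (Suc t). dK y = dT t (c t)"
 proof (cases t)
  case 0
  thus ?thesis using c1 c by auto
 next
  case (Suc t')
  have "dK (dT t (c t)) = dT t (dK (c t))" using KT[of "c t" t' t] c(2)[of t] Suc by simp
  also have "\<dots> = dT (Suc t') (dT t' (c t'))" using c(3)[of t'] Suc by simp
  also have "\<dots> = 0" using TT[of "c t'" t' t'] c(2)[of t'] Suc by simp
  finally show ?thesis using K_exact[of "dT t (c t)" t' t] T[of "c t" t t] c(2)[of t] Suc by simp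
 qed
 then obtain y where y: "y \<in> G (Suc t) (Suc t)" "dK y = dT t (c t)" by blast
 show ?case by (rule exI[of _ "c(Suc t := y)"]) (use c y in \<open>auto simp: le_Suc_eq less_Suc_eq\<close>)
qed

text \<open>The invariant asks only that \<open>dT q e\<close> and \<open>c (Suc q)\<close> agree
  after \<open>dK\<close>. An \<open>e\<close> from the level above then makes the error
  \<open>c (Suc q) - dK e\<close> a cocycle for \<open>dT\<close>, and a preimage of this error
  satisfies the invariant one level lower.\<close>

lemma chase_down:
 fixes G :: "nat => nat => 'g::ab_group_add set" and dK :: "'g => 'g" and dT :: "nat => 'g => 'g"
 assumes K: "!!p q x. x \<in> G (Suc p) q ==> dK x \<in> G p q"
  and Kdiff: "!!x y. dK (x - y) = dK x - dK y" and Tdiff: "!!q x y. dT q (x - y) = dT q x - dT q y"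
  and Gdiff: "!!p q x y. x \<in> G p q ==> y \<in> G p q ==> x - y \<in> G p q"
  and KK: "!!p q x. x \<in> G (Suc (Suc p)) q ==> dK (dK x) = 0"
  and KT: "!!p q x. x \<in> G (Suc p) q ==> dT q (dK x) = dK (dT q x)"
  and T_exact0: "!!x. x \<in> G 0 0 ==> dT 0 x = 0 ==> x = 0"
  and T_exact: "!!q x. Suc q \<le> t ==> x \<in> G (Suc q) (Suc q) ==> dT (Suc q) x = 0 ==> \<exists>y\<in>G (Suc q) q. dT q y = x"
  and c: "!!q. q \<le> Suc t ==> c q \<in> G q q" "!!q. q \<le> t ==> dK (c (Suc q)) = dT q (c q)"
  and top: "e \<in> G (Suc t) t" "dT t e = c (Suc t)"
 shows "\<exists>e\<in>G 1 0. dK e = c 0"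
proof -
 have "\<exists>e\<in>G (Suc q) q. dK (dT q e) = dK (c (Suc q))" if "q \<le> t" for q using that
 proof (induction q rule: inc_induct)
  case base
  show ?case by (rule bexI[of _ e]) (simp_all add: top)
 next
  case (step q)
  then obtain e where e: "e \<in> G (Suc (Suc q)) (Suc q)" "dK (dT (Suc q) e) = dK (c (Suc (Suc q)))" by blast
  define x where "x = c (Suc q) - dK e"
  have x: "x \<in> G (Suc q) (Suc q)" unfolding x_def using step e K c by (intro Gdiff) auto
  have "dT (Suc q) x = dT (Suc q) (c (Suc q)) - dK (dT (Suc q) e)" unfolding x_def Tdiff using KT[OF e(1)] by simp
  also have "\<dots> = 0" using e c(2)[of "Suc q"] step by simp
  finally obtain y where y: "y \<in> G (Suc q) q" "dT q y = x" using T_exact[OF _ x] step by auto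
  hence "dK (dT q y) = dK (c (Suc q))" using KK[OF e(1)] by (simp add: x_def Kdiff)
  thus ?case using y by blast
 qed
 then obtain e where e: "e \<in> G 1 0" "dK (dT 0 e) = dK (c 1)" by fastforce
 have "c 0 - dK e = 0"
 proof (rule T_exact0)
  show "c 0 - dK e \<in> G 0 0" using c e K[of e 0 0] by (intro Gdiff) auto
  show "dT 0 (c 0 - dK e) = 0" using c(2)[of 0] e KT[of e 0 0] by (simp add: Tdiff)
 qed
 thus ?thesis using e by (intro bexI[of _ e]) auto
qed

section \<open>The generic forms are a regular sequence after localization\<close>

lemma finite_xmonos [simp]: "finite (xmonos r n \<mu>)"
proof -
 let ?V = "xvars r n"
 define B where "B = nat (Max (insert 0 (\<mu> ` {1..r})))"
 have "lkp m v \<le> B" if m: "m \<in> xmonos r n \<mu>" and v: "v \<in> ?V" for m v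
 proof -
  obtain j l where jl: "v = (j, l)" "j \<in> {1..r}" "l \<le> n j" using v by (auto simp: xvars_def)
  have "int (lkp m (j, l)) \<le> (\<Sum>l\<le>n j. int (lkp m (j, l)))" using jl by (intro member_le_sum) auto
  also have "\<dots> = \<mu> j" using m by (auto simp: xmonos_def xmono_deg_def)
  also have "\<dots> \<le> Max (insert 0 (\<mu> ` {1..r}))" using jl by (intro Max_ge) auto
  finally show ?thesis using jl by (simp add: B_def)
 qed
 hence "(%m. restrict (lkp m) ?V) ` xmonos r n \<mu> \<subseteq> ?V \<rightarrow>\<^sub>E {..B}" by auto
 hence "finite ((%m. restrict (lkp m) ?V) ` xmonos r n \<mu>)" by (rule finite_subset) (intro finite_PiE, auto)
 moreover have "inj_on (%m. restrict (lkp m) ?V) (xmonos r n \<mu>)"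
 proof (rule inj_onI, rule poly_mapping_eqI)
  fix m m' v assume m: "m \<in> xmonos r n \<mu>" "m' \<in> xmonos r n \<mu>" and eq: "restrict (lkp m) ?V = restrict (lkp m') ?V"
  show "lkp m v = lkp m' v"
  proof (cases "v \<in> ?V")
   case True
   thus ?thesis using fun_cong[OF eq, of v] by simp
  next
   case False
   hence "v \<notin> pkeys m" "v \<notin> pkeys m'" using m by (auto simp: xmonos_def)
   thus ?thesis by (simp add: in_keys_iff)
  qed
 qed
 ultimately show ?thesis by (rule finite_imageD)
qed

lemma xmono_deg_outside: "pkeys m \<subseteq> xvars r n ==> j \<notin> {1..r} ==> xmono_deg n m j = 0"
proof -
 assume m: "pkeys m \<subseteq> xvars r n" and j: "j \<notin> {1..r}"
 have "lkp m (j, l) = 0" for l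
 proof -
  have "(j, l) \<notin> xvars r n" using j by (auto simp: xvars_def)
  hence "(j, l) \<notin> pkeys m" using m by blast
  thus ?thesis by (simp add: in_keys_iff)
 qed
 thus ?thesis by (simp add: xmono_deg_def)
qed

definition vmono :: "nat => (nat => nat) => (nat => nat) => xmono" where
 "vmono r \<sigma> \<mu> = (\<Sum>j\<in>{1..r}. sgl (j, \<sigma> j) (\<mu> j))"

lemma lkp_vmono: "lkp (vmono r \<sigma> \<mu>) (j, l) = (if j \<in> {1..r} \<and> l = \<sigma> j then \<mu> j else 0)"
proof -
 have "lkp (vmono r \<sigma> \<mu>) (j, l) = (\<Sum>i\<in>{1..r}. if i = j then (if l = \<sigma> j then \<mu> j else 0) else 0)"
  unfolding vmono_def lookup_sum by (intro sum.cong) (auto simp: lookup_single when_def)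
 thus ?thesis by simp
qed

lemma keys_vmono: "pkeys (vmono r \<sigma> \<mu>) \<subseteq> (%j. (j, \<sigma> j)) ` {1..r}"
 by (auto simp: in_keys_iff lkp_vmono split: if_splits)

lemma vmono_in_xmonos:
 assumes "!!j. j \<in> {1..r} ==> \<sigma> j \<le> n j" "\<mu> \<in> Nvec r"
 shows "vmono r \<sigma> (%j. nat (\<mu> j)) \<in> xmonos r n \<mu>"
proof -
 have sub: "pkeys (vmono r \<sigma> (%j. nat (\<mu> j))) \<subseteq> xvars r n"
  using keys_vmono assms(1) by (fastforce simp: xvars_def)
 have "xmono_deg n (vmono r \<sigma> (%j. nat (\<mu> j))) j = \<mu> j" for j
 proof (cases "j \<in> {1..r}")
  case True
  hence "xmono_deg n (vmono r \<sigma> (%j. nat (\<mu> j))) j = (\<Sum>l\<le>n j. if l = \<sigma> j then \<mu> j else 0)"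
   using assms(2) unfolding xmono_deg_def by (intro sum.cong) (auto simp: lkp_vmono Nvec_def)
  also have "\<dots> = \<mu> j" using True assms(1) by simp
  finally show ?thesis .
 next
  case False
  thus ?thesis using xmono_deg_outside[OF sub] assms(2) by (simp add: Nvec_def Zvec_def)
 qed
 thus ?thesis using sub by (auto simp: xmonos_def)
qed

lemma cell_transversal:
 assumes "W \<in> cells r n"
 obtains \<sigma> where "!!j. j \<in> {1..r} ==> \<sigma> j \<le> n j \<and> (j, \<sigma> j) \<in> W"
proof -
 have "\<forall>j\<in>{1..r}. \<exists>l. l \<le> n j \<and> (j, l) \<in> W" using assms by (fastforce simp: cells_def grp_def)
 thus ?thesis using that by metis
qed

definition F_laur :: "nat => (nat => nat) => (nat => nat => int) => nat => 'k::comm_ring_1 upoly laur" where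
 "F_laur r n d i = to_laur (F_gen r n d i)"

lemma F_laur_eq: "F_laur r n d i = (\<Sum>\<alpha>\<in>xmonos r n (d i). sgl (emb \<alpha>) (mpoly_var (i, \<alpha>)))"
 by (simp add: F_laur_def F_gen_def rhomD[OF rhom_to_laur] mpoly_const_def mult_single)

lemma rhom_const: "rhom (%k. sgl 0 (mpoly_const k))" unfolding mpoly_const_def by (intro rhom_compose[OF rhom_single0 rhom_single0])

lemma mpoly_eval_var: "rhom \<phi> ==> mpoly_eval \<phi> z (mpoly_var v) = z v"
 unfolding mpoly_eval_eq mpoly_var_def by (simp add: pm_eval_single rhomD)

lemma mpoly_eval_const: "rhom \<phi> ==> mpoly_eval \<phi> z (mpoly_const k) = \<phi> k"
 unfolding mpoly_eval_eq mpoly_const_def by (simp add: pm_eval_single rhomD)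

lemma mono_induct [case_names const var add]:
 fixes P :: "('v \<Rightarrow>\<^sub>0 nat) => bool"
 assumes "P 0" "!!v. P (sgl v 1)" "!!a b. P a ==> P b ==> P (a + b)"
 shows "P m"
proof (induction m rule: pm_induct)
 case (single v)
 have "P (sgl v k)" for k
 proof (induction k)
  case (Suc k)
  have "sgl v (Suc k) = sgl v 1 + sgl v k" by (simp add: single_add[symmetric])
  thus ?case using assms Suc by metis
 qed (simp add: assms)
 thus ?case .
qed (simp_all add: assms)

text \<open>Enough generators to verify statements about ring homomorphisms: base constants,
  coefficient variables, and the monomials that occur in p.\<close>

lemma upoly_pm_induct [case_names zero const var mono add mult]:
 fixes P :: "('m::comm_monoid_add \<Rightarrow>\<^sub>0 ('u \<Rightarrow>\<^sub>0 nat) \<Rightarrow>\<^sub>0 'k::comm_ring_1) => bool"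
 assumes "P 0" "!!k. P (sgl 0 (mpoly_const k))" "!!u. P (sgl 0 (mpoly_var u))"
  "!!a. a \<in> pkeys p ==> P (sgl a 1)"
  "!!a b. P a ==> P b ==> P (a + b)" "!!a b. P a ==> P b ==> P (a * b)"
 shows "P p"
proof -
 have m: "P (sgl 0 (sgl m 1))" for m
 proof (induction m rule: mono_induct)
  case const
  thus ?case using assms(2)[of 1] by (simp add: mpoly_const_def)
 next
  case (var v)
  thus ?case using assms(3)[of v] by (simp add: mpoly_var_def)
 next
  case (add a b)
  have "sgl 0 (sgl (a + b) 1) = (sgl 0 (sgl a 1) * sgl 0 (sgl b 1) :: 'm \<Rightarrow>\<^sub>0 ('u \<Rightarrow>\<^sub>0 nat) \<Rightarrow>\<^sub>0 'k)"
   by (simp add: mult_single)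
  thus ?case using add assms(6) by metis
 qed
 have c: "P (sgl 0 c)" for c
 proof (induction c rule: pm_induct)
  case (single m)
  have "sgl 0 (sgl m k) = (sgl 0 (mpoly_const k) * sgl 0 (sgl m 1) :: 'm \<Rightarrow>\<^sub>0 ('u \<Rightarrow>\<^sub>0 nat) \<Rightarrow>\<^sub>0 'k)" for k
   by (simp add: mult_single mpoly_const_def)
  thus ?case using m assms(2,6) by metis
 qed (simp_all add: assms single_add)
 show ?thesis
 proof (induction p rule: pm_induct)
  case (single a)
  have "sgl a k = sgl 0 k * sgl a 1" for k :: "('u \<Rightarrow>\<^sub>0 nat) \<Rightarrow>\<^sub>0 'k" by (simp add: mult_single)
  thus ?case using c assms(4)[OF single] assms(6) by metis
 qed (simp_all add: assms)
qed

lemma upoly_pm_rhom_eq: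
 fixes f g :: "('m::comm_monoid_add \<Rightarrow>\<^sub>0 ('u \<Rightarrow>\<^sub>0 nat) \<Rightarrow>\<^sub>0 'k::comm_ring_1) => 'b::comm_ring_1"
 assumes "rhom f" "rhom g" "!!k. f (sgl 0 (mpoly_const k)) = g (sgl 0 (mpoly_const k))"
  "!!u. f (sgl 0 (mpoly_var u)) = g (sgl 0 (mpoly_var u))" "!!a. f (sgl a 1) = g (sgl a 1)"
 shows "f p = g p" by (induction p rule: upoly_pm_induct)
   (simp_all add: assms(3-5) rhomD[OF assms(1)] rhomD[OF assms(2)])

lemma subring_on_Lring: "subring_on (Lring r n W)" by unfold_locales (simp_all add: Lring_add Lring_minus Lring_mult)

lemma linear_unit_poly_nzd:
 fixes a b c :: "'b::comm_ring_1"
 assumes "b * c = 1" "[:a, b:] * q = 0"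
 shows "q = 0"
proof (rule ccontr)
 assume q: "q ~= 0"
 have "b ~= 0" using assms(1) by auto
 hence "degree [:a, b:] = 1" by simp
 hence "coeff ([:a, b:] * q) (1 + degree q) = b * lead_coeff q" using coeff_mult_degree_sum[of "[:a, b:]" q] by simp
 hence "b * lead_coeff q = 0" unfolding assms(2) by simp
 hence "c * (b * lead_coeff q) = 0" by simp
 hence "lead_coeff q = 0" using assms(1) by (metis mult.assoc mult.commute mult_1)
 thus False using q by simp
qed

text \<open>A homomorphism given by its values on the coefficient variables, the base ring and the
  Laurent monomials; substitutions for coefficients of the generic forms are of this kind.\<close>

definition sub_eval :: "((nat \<times> xmono) => 'b) => ('k => 'b) => ((xvar \<Rightarrow>\<^sub>0 int) => 'b) => 'k::comm_ring_1 upoly laur => 'b::comm_ring_1" where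
 "sub_eval Z \<phi> \<chi> = pm_eval (mpoly_eval \<phi> Z) \<chi>"

lemma sub_eval:
 assumes "rhom \<phi>" "mhom \<chi>"
 shows rhom_sub_eval: "rhom (sub_eval Z \<phi> \<chi>)"
  and sub_eval_const: "sub_eval Z \<phi> \<chi> (sgl 0 (mpoly_const k)) = \<phi> k"
  and sub_eval_var: "sub_eval Z \<phi> \<chi> (sgl 0 (mpoly_var u)) = Z u"
  and sub_eval_single_var: "sub_eval Z \<phi> \<chi> (sgl a (mpoly_var u)) = Z u * \<chi> a"
  and sub_eval_mono: "sub_eval Z \<phi> \<chi> (sgl a 1) = \<chi> a"
proof -
 have 1: "rhom (mpoly_eval \<phi> Z)" by (rule rhom_mpoly_eval[OF assms(1)])
 show "rhom (sub_eval Z \<phi> \<chi>)" unfolding sub_eval_def by (rule rhom_pm_eval[OF 1 assms(2)])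
 have "\<chi> 0 = 1" using assms(2) by (simp add: mhom_def)
 thus "sub_eval Z \<phi> \<chi> (sgl 0 (mpoly_const k)) = \<phi> k" "sub_eval Z \<phi> \<chi> (sgl 0 (mpoly_var u)) = Z u"
   "sub_eval Z \<phi> \<chi> (sgl a (mpoly_var u)) = Z u * \<chi> a" "sub_eval Z \<phi> \<chi> (sgl a 1) = \<chi> a"
  unfolding sub_eval_def by (simp_all add: pm_eval_single[OF 1] mpoly_eval_const mpoly_eval_var assms(1) rhomD[OF 1])
qed

lemma mhom_sgl: "mhom (%a::'m::comm_monoid_add. sgl a (1::'c::comm_ring_1))" unfolding mhom_def
proof (intro conjI allI)
 fix a b :: 'm
 show "sgl (a + b) (1::'c) = sgl a 1 * sgl b 1" by (simp only: mult_single mult_1)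
qed simp

lemma rhom_pCons: "rhom f ==> rhom (%x. [:f x:])" by (simp add: rhom_def)

text \<open>The coefficient variable of \<alpha>0 occurs in one term only, multiplied by a monomial,
  which is a unit. Adding a new indeterminate T to that variable turns the form into a linear
  polynomial in T with unit leading coefficient; setting T = 0 recovers h.\<close>

lemma generic_nzd:
 fixes g :: "'k::comm_ring_1 upoly laur"
 assumes g: "g = (\<Sum>\<alpha>\<in>A. sgl (b \<alpha>) (mpoly_var (i, \<alpha>)))" and "\<alpha>0 \<notin> A" "finite A"
  and h: "(sgl a (mpoly_var (i, \<alpha>0)) + g) * h = 0"
 shows "h = 0"
proof -
 let ?\<phi> = "%k. [:sgl 0 (mpoly_const k):] :: 'k upoly laur poly"
 let ?\<chi> = "%a. [:sgl a 1:] :: 'k upoly laur poly"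
 define Z :: "nat \<times> xmono => 'k upoly laur poly"
  where "Z u = (if u = (i, \<alpha>0) then [:sgl 0 (mpoly_var u), 1:] else [:sgl 0 (mpoly_var u):])" for u
 have \<phi>: "rhom ?\<phi>" by (rule rhom_pCons[OF rhom_const])
 have \<chi>: "mhom ?\<chi>" by (simp add: mhom_def mult_single add.commute)
 define \<Psi> where "\<Psi> = sub_eval Z ?\<phi> ?\<chi>"
 note E = sub_eval[OF \<phi> \<chi>, of Z, folded \<Psi>_def]
 have ev0: "poly (\<Psi> p) 0 = p" for p
 proof (rule upoly_pm_rhom_eq[of "%p. poly (\<Psi> p) 0" "%p. p"])
  show "rhom (%p. poly (\<Psi> p) 0)" using rhomD[OF E(1)] by (simp add: rhom_def)
 qed (simp_all add: E rhom_def Z_def)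
 have "\<Psi> g = [:g:]"
 proof -
  have "\<Psi> g = (\<Sum>\<alpha>\<in>A. [:sgl (b \<alpha>) (mpoly_var (i, \<alpha>)):])" unfolding g rhomD(7)[OF E(1)] E(4)
   using assms(2) by (intro sum.cong refl) (auto simp: Z_def mult_single)
  also have "\<dots> = [:g:]" unfolding g using assms(3) by (induction A rule: finite_induct) auto
  finally show ?thesis .
 qed
 hence "[:sgl a (mpoly_var (i, \<alpha>0)) + g, sgl a 1:] * \<Psi> h = 0"
  using arg_cong[OF h, of \<Psi>] by (simp add: rhomD[OF E(1)] E(4) Z_def mult_single)
 moreover have "sgl a 1 * sgl (- a) 1 = (1 :: 'k upoly laur)" by (simp add: mult_single)
 ultimately have "\<Psi> h = 0" by (rule linear_unit_poly_nzd[rotated])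
 thus ?thesis using ev0[of h] by simp
qed

locale multiproj =
 fixes r :: nat and n :: "nat => nat" and d :: "nat => nat => int"
 assumes r1: "r \<ge> 1" and n1: "!!j. j \<in> {1..r} ==> n j \<ge> 1"
  and dZ: "!!i. i \<le> ntot r n ==> d i \<in> Zvec r"
  and d1: "!!i j. i \<le> ntot r n ==> j \<in> {1..r} ==> d i j \<ge> 1"
begin

abbreviation "Mon \<equiv> xmonos r n"
abbreviation "AA \<equiv> coeffs_A r n d"
abbreviation "XD \<equiv> xpolys_deg r n"
abbreviation "VV \<equiv> xvars r n"
abbreviation "FG \<equiv> F_gen r n d"
abbreviation "dlt \<equiv> delta r n d"
abbreviation "MC \<equiv> M_cols r n d"
abbreviation "HC \<equiv> H_cols r n d"
abbreviation "LR \<equiv> Lring r n"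
abbreviation "LH \<equiv> Lhom r n"
abbreviation "xp \<sigma> k \<equiv> sgl (vmono r \<sigma> (\<lambda>_. k)) 1"

abbreviation "N \<equiv> ntot r n"
abbreviation "F \<equiv> F_laur r n d"

lemma dN: "i \<le> N ==> d i \<in> Nvec r"
 using dZ[of i] d1[of i] by (auto simp: Nvec_def Zvec_def) (metis atLeastAtMost_iff le_cases order_trans zero_le_one order_refl)

lemma F_in_Lhom: "F i \<in> LH W (d i)" unfolding F_laur_eq by (intro Lhom_sum Lhom_single) (auto simp: xmonos_def ldeg_emb)

lemma F_in_Lring: "F i \<in> LR W" using F_in_Lhom by (auto simp: Lhom_def)

text \<open>On a cell each form has an invertible monomial \<open>al i\<close>, so F i = 0 can be
  solved for the coefficient of that monomial. The substitution \<theta> does this for all i < m: it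
  kills these F i, fixes F m, and moves elements only modulo the earlier forms. As F m is no zero
  divisor, \<theta> v = 0, so v is congruent to 0.\<close>

lemma generic_regular:
 fixes v :: "'k::comm_ring_1 upoly laur"
 assumes W: "W \<in> cells r n" and m: "m \<le> N" and v: "v \<in> LR W"
  and Fv: "F m * v \<in> ideal_of (LR W) F m"
 shows "v \<in> ideal_of (LR W) F m"
proof -
 interpret S: subring_on "LR W :: 'k upoly laur set" by (rule subring_on_Lring)
 obtain \<sigma> where \<sigma>: "!!j. j \<in> {1..r} ==> \<sigma> j \<le> n j \<and> (j, \<sigma> j) \<in> W" using cell_transversal[OF W] by blast
 define al where "al i = vmono r \<sigma> (%j. nat (d i j))" for i
 have al: "al i \<in> Mon (d i)" if "i \<le> N" for i
  unfolding al_def using \<sigma> dN[OF that] by (intro vmono_in_xmonos) auto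
 have alW: "pkeys (al i) \<subseteq> W" for i using keys_vmono \<sigma> unfolding al_def by fast
 have Wx: "W \<subseteq> VV" using W by (simp add: cells_def)
 have e: "- emb (al i) \<in> Lexp r n W" for i unfolding Lexp_def using alW[of i] Wx by (auto simp: in_keys_iff subset_iff)
 define g :: "nat => 'k upoly laur"
  where "g i = (\<Sum>\<alpha>\<in>Mon (d i) - {al i}. sgl (emb \<alpha>) (mpoly_var (i, \<alpha>)))" for i
 have Fg: "F i = sgl (emb (al i)) (mpoly_var (i, al i)) + g i" if "i \<le> N" for i
  unfolding F_laur_eq g_def using al[OF that] by (simp add: sum.remove)
 have gS: "g i \<in> LR W" for i unfolding g_def by (intro S.Ssum Lring_single) (auto simp: xmonos_def)
 define Z :: "nat \<times> xmono => 'k upoly laur"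
  where "Z u = (if fst u < m \<and> u = (fst u, al (fst u)) then - (sgl (- emb (al (fst u))) 1 * g (fst u))
   else sgl 0 (mpoly_var u))" for u
 let ?\<phi> = "%k. sgl 0 (mpoly_const k) :: 'k upoly laur"
 let ?\<chi> = "%a. sgl a 1 :: 'k upoly laur"
 define \<theta> where "\<theta> = sub_eval Z ?\<phi> ?\<chi>"
 note E = sub_eval[OF rhom_const mhom_sgl, of Z, folded \<theta>_def]
 have \<theta>g: "\<theta> (g i) = g i" for i unfolding g_def rhomD(7)[OF E(1)] E(4)
  by (intro sum.cong refl) (auto simp: Z_def mult_single)
 have \<theta>F: "\<theta> (F i) = (if i < m then 0 else F i)" if i: "i \<le> N" for i
 proof -
  have "\<theta> (F i) = Z (i, al i) * sgl (emb (al i)) 1 + g i" unfolding Fg[OF i] by (simp only: rhomD(3)[OF E(1)] E(4) \<theta>g)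
  also have "\<dots> = (if i < m then - (g i * (sgl (- emb (al i)) 1 * sgl (emb (al i)) 1)) + g i else F i)"
   by (simp add: Z_def Fg[OF i] mult_single mult_ac)
  also have "\<dots> = (if i < m then 0 else F i)" by (simp add: mult_single)
  finally show ?thesis .
 qed
 let ?I = "ideal_of (LR W) F m"
 have Iadd: "a + b \<in> ?I" if "a \<in> ?I" "b \<in> ?I" for a b
 proof -
  from that obtain h h' where "\<forall>i<m. h i \<in> LR W" "a = (\<Sum>i<m. h i * F i)"
   "\<forall>i<m. h' i \<in> LR W" "b = (\<Sum>i<m. h' i * F i)" by (auto simp: ideal_of_def)
  thus ?thesis unfolding ideal_of_def by (intro CollectI exI[of _ "%i. h i + h' i"]) (simp add: distrib_right sum.distrib Lring_add)
 qed
 have Imult: "s * a \<in> ?I" if "a \<in> ?I" "s \<in> LR W" for a s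
 proof -
  from that obtain h where "\<forall>i<m. h i \<in> LR W" "a = (\<Sum>i<m. h i * F i)" by (auto simp: ideal_of_def)
  thus ?thesis unfolding ideal_of_def using that(2)
   by (intro CollectI exI[of _ "%i. s * h i"]) (simp add: sum_distrib_left mult.assoc Lring_mult)
 qed
 have I0: "0 \<in> ?I" unfolding ideal_of_def by (intro CollectI exI[of _ "%i. 0"]) simp
 have IF: "F i \<in> ?I" if "i < m" for i unfolding ideal_of_def
  using that by (intro CollectI exI[of _ "%j. if j = i then 1 else 0"]) (simp add: if_distrib[of "%x. x * _"] cong: if_cong)
 \<comment> \<open>Congruence to the identity is checked on generators; at a solved coefficient the
   difference is a unit multiple of F i.\<close>
 have D: "w \<in> LR W ==> \<theta> w \<in> LR W \<and> \<theta> w - w \<in> ?I" for w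
 proof -
  assume w: "w \<in> LR W"
  have "w \<in> LR W \<and> \<theta> w \<in> LR W \<and> \<theta> w - w \<in> ?I"
  proof (induction w rule: upoly_pm_induct)
   case (var u)
   show ?case
   proof (cases "fst u < m \<and> u = (fst u, al (fst u))")
    case True
    define i where "i = fst u"
    have i: "i < m" "u = (i, al i)" using True by (auto simp: i_def)
    have "\<theta> (sgl 0 (mpoly_var u)) = - (sgl (- emb (al i)) 1 * g i)" using i by (simp add: E Z_def)
    moreover have "- (sgl (- emb (al i)) 1 * g i) - sgl 0 (mpoly_var u) = - sgl (- emb (al i)) 1 * F i"
    proof -
     have "i \<le> N" using i m by simp
     moreover have "sgl (- emb (al i)) 1 * sgl (emb (al i)) (mpoly_var u) = (sgl 0 (mpoly_var u) :: 'k upoly laur)"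
      by (simp add: mult_single)
     ultimately show ?thesis using i by (simp add: Fg distrib_left)
    qed
    moreover have "- sgl (- emb (al i)) 1 * F i \<in> ?I" using i by (intro Imult IF Lring_minus Lring_single e) auto
    moreover have "- (sgl (- emb (al i)) 1 * g i) \<in> LR W" by (intro Lring_minus Lring_mult Lring_single e gS)
    ultimately show ?thesis by (simp add: Lring_single)
   next
    case False
    hence "Z u = sgl 0 (mpoly_var u)" unfolding Z_def by auto
    thus ?thesis by (simp add: E I0 Lring_single)
   qed
  next
   case (mono a)
   hence "a \<in> Lexp r n W" using w by (auto simp: Lring_def)
   thus ?case by (simp add: E I0 Lring_single)
  next
   case (add a b)
   have "\<theta> (a + b) - (a + b) = (\<theta> a - a) + (\<theta> b - b)" by (simp add: rhomD[OF E(1)])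
   thus ?case using add Iadd by (metis Lring_add rhomD(3)[OF E(1)])
  next
   case (mult a b)
   have "\<theta> (a * b) - (a * b) = \<theta> a * (\<theta> b - b) + b * (\<theta> a - a)" by (simp add: rhomD[OF E(1)] algebra_simps)
   thus ?case using mult Iadd Imult by (metis Lring_mult rhomD(4)[OF E(1)])
  qed (simp_all add: E I0 rhomD[OF E(1)] Lring_single)
  thus ?thesis by blast
 qed
 have "\<theta> w = 0" if w: "w \<in> ?I" for w
 proof -
  from w obtain h where "w = (\<Sum>i<m. h i * F i)" by (auto simp: ideal_of_def)
  thus ?thesis using m by (simp add: rhomD[OF E(1)] \<theta>F)
 qed
 hence "F m * \<theta> v = 0" using Fv \<theta>F[OF m] rhomD(4)[OF E(1)] by (metis less_irrefl)
 hence "\<theta> v = 0" unfolding Fg[OF m] by (rule generic_nzd[OF g_def[of m], rotated 2]) auto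
 hence "- v \<in> ?I" using D[OF v] by simp
 thus ?thesis using Imult[of "- v" "- 1"] by (simp add: Lring_minus)
qed

end

section \<open>The double complex of the generic forms\<close>

lemma restrict_sg: "pm_restrict P (sg x S p) = sg x S (pm_restrict P (p::_ \<Rightarrow>\<^sub>0 'c::ab_group_add))"
 by (rule poly_mapping_eqI) (simp add: lkp_restrict lkp_sg)

lemma restrict_in_Lring: "p \<in> Lring r n W ==> pm_restrict P p \<in> Lring r n W" by (auto simp: Lring_def keys_restrict)

lemma Lhom_eq_restrict: "p \<in> Lring r n W ==> pm_restrict (%a. ldeg n a = \<mu>) p \<in> Lhom r n W \<mu>"
 by (auto simp: Lhom_def restrict_in_Lring keys_restrict)

lemma Lhom_restrict_id: "p \<in> Lhom r n W \<mu> ==> pm_restrict (%a. ldeg n a = \<mu>) p = p"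
 by (rule restrict_id) (auto simp: Lhom_def)

lemma card_xvars: "card (xvars r n) = ntot r n + r" by (simp add: xvars_def ntot_def sum_Suc)

lemma card_cell_le: "W \<in> cells r n ==> card W \<le> ntot r n + r"
 using card_mono[OF finite_xvars[of r n], of W] by (simp add: cells_def card_xvars)

text \<open>The augmentation followed by the coboundary. Only edges matter, and there it is
  \<open>cell_bd_edge_const\<close>.\<close>

lemma const_cocycle:
 assumes "W \<subseteq> xvars r n"
 shows "cobd (%W. if W \<in> cells r n \<and> card W = r then p else 0) W = 0"
proof (cases "card W = Suc r \<and> W \<in> cells r n")
 case True
 have fin: "finite W" using assms finite_subset by (metis finite_xvars)
 have "cobd (%W. if W \<in> cells r n \<and> card W = r then p else 0) W = cell_bd r n (%_. p) W"
  unfolding cell_bd_def using True fin by (intro cobd_cong) simp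
 thus ?thesis using cell_bd_edge_const[of W r n p] True by simp
next
 case False
 have fin: "finite W" using assms finite_subset by (metis finite_xvars)
 have nc: "~ (W - {x} \<in> cells r n \<and> card (W - {x}) = r)" if "x \<in> W" for x
  using False that card_Suc_Diff1[OF fin that] assms cells_mono[of "W - {x}" r n W] by auto
 show ?thesis unfolding cobd_def
 proof (rule sum.neutral, intro ballI)
  fix x assume "x \<in> W"
  hence "(if W - {x} \<in> cells r n \<and> card (W - {x}) = r then p else 0) = 0" by (intro if_not_P nc)
  thus "sg x W (if W - {x} \<in> cells r n \<and> card (W - {x}) = r then p else 0) = 0" by (simp only: sg_zero)
 qed
qed

context multiproj
begin

text \<open>Column 0 holds the polynomial ring itself, placed at the empty set; column q > 0 holds
  the cells of dimension q - 1.\<close>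

definition spot :: "nat => xvar set => bool" where
 "spot q W \<longleftrightarrow> (if q = 0 then W = {} else W \<in> cells r n \<and> Suc (card W) = r + q)"

definition dg :: "(nat => int) => nat set => nat => int" where
 "dg \<nu> L = (%j. \<nu> j - (\<Sum>i\<in>L. d i j))"

text \<open>Entries away from the spot are zero, so a bidegree is a set of functions on all pairs
  and the differentials need no domains. The twist of the Koszul term of L appears as the shift
  \<open>dg\<close>.\<close>

definition dcx :: "(nat => int) => nat => nat => (nat set => xvar set => 'k::comm_ring_1 upoly laur) set" where
 "dcx \<nu> p q = {z. \<forall>L W. z L W \<in> LH W (dg \<nu> L) \<and>
   (z L W ~= 0 --> L \<subseteq> {..<Suc N} \<and> card L = p \<and> spot q W)}"

definition dK :: "(nat set => xvar set => 'k::comm_ring_1 upoly laur) => nat set => xvar set => 'k upoly laur" where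
 "dK z = (%L W. if L \<subseteq> {..<Suc N} then kos F (Suc N) (%L. z L W) L else 0)"

text \<open>At q = 0 this is the augmentation, which spreads a polynomial as a constant over the
  vertices.\<close>

definition dT :: "nat => (nat set => xvar set => 'k::comm_ring_1 upoly laur) => nat set => xvar set => 'k upoly laur" where
 "dT q z = (%L W. if q = 0 then (if spot 1 W then z L {} else 0)
   else if W \<subseteq> VV then cobd (z L) W else 0)"

lemma dcxD:
 assumes "z \<in> dcx \<nu> p q"
 shows "z L W \<in> LH W (dg \<nu> L)" "z L W ~= 0 ==> L \<subseteq> {..<Suc N}" "z L W ~= 0 ==> card L = p"
  "z L W ~= 0 ==> spot q W" using assms by (auto simp: dcx_def)

lemma spot1: "spot 1 W \<longleftrightarrow> W \<in> cells r n \<and> card W = r" by (auto simp: spot_def)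

lemma spot_sub: "spot q W ==> W \<subseteq> VV" by (auto simp: spot_def cells_def split: if_splits)

lemma dg_insert: "finite L ==> i \<notin> L ==> dg \<nu> (insert i L) j = dg \<nu> L j - d i j" by (simp add: dg_def)

lemma dT_dcx:
 assumes z: "z \<in> dcx \<nu> p q"
 shows "dT q z \<in> dcx \<nu> p (Suc q)" unfolding dcx_def
proof (intro CollectI allI conjI impI)
 fix L W
 note zD = dcxD[OF z]
 show "dT q z L W \<in> LH W (dg \<nu> L)"
 proof (cases "q = 0")
  case True
  thus ?thesis using zD(1)[of L "{}"] Lhom_mono[of "{}" W] by (auto simp: dT_def)
 next
  case False
  have "z L (W - {x}) \<in> LH W (dg \<nu> L)" for x using zD(1)[of L "W - {x}"] Lhom_mono[of "W - {x}" W] by blast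
  thus ?thesis using False by (auto simp: dT_def cobd_def intro!: Lhom_sum Lhom_sg)
 qed
 assume nz: "dT q z L W ~= 0"
 have "L \<subseteq> {..<Suc N} \<and> card L = p \<and> spot (Suc q) W"
 proof (cases "q = 0")
  case True
  hence "spot 1 W" "z L {} ~= 0" using nz by (auto simp: dT_def split: if_splits)
  thus ?thesis using zD[of L "{}"] True by simp
 next
  case False
  hence W: "W \<subseteq> VV" "cobd (z L) W ~= 0" using nz by (auto simp: dT_def split: if_splits)
  then obtain x where x: "x \<in> W" "z L (W - {x}) ~= 0" using cobd_supported by blast
  have fin: "finite W" using W finite_subset by (metis finite_xvars)
  have "spot q (W - {x})" using zD x by blast
  hence "W - {x} \<in> cells r n" "Suc (card (W - {x})) = r + q" using False by (auto simp: spot_def)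
  hence "spot (Suc q) W" using x W fin cells_mono[of "W - {x}" r n W] card_Suc_Diff1[OF fin x(1)] by (auto simp: spot_def)
  thus ?thesis using zD x by blast
 qed
 thus "L \<subseteq> {..<Suc N}" "card L = p" "spot (Suc q) W" by auto
qed

lemma dT_dT:
 assumes z: "z \<in> dcx \<nu> p q"
 shows "dT (Suc q) (dT q z) = 0"
proof (intro ext)
 fix L W
 show "dT (Suc q) (dT q z) L W = 0 L W"
 proof (cases "W \<subseteq> VV")
  case W: True
  have fin: "finite W" using W finite_subset by (metis finite_xvars)
  show ?thesis
  proof (cases "q = 0")
   case True
   have "dT (Suc q) (dT q z) L W = cobd (%W. if W \<in> cells r n \<and> card W = r then z L {} else 0) W"
    using W True by (simp add: dT_def spot1[unfolded One_nat_def])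
   thus ?thesis using const_cocycle[OF W] by simp
  next
   case False
   have "dT (Suc q) (dT q z) L W = cobd (cobd (z L)) W" using W False by (auto simp: dT_def intro!: cobd_cong)
   thus ?thesis using cobd_cobd[OF fin] by simp
  qed
 qed (simp add: dT_def)
qed

lemma dT_dK: "dT q (dK z) = dK (dT q z)"
proof (intro ext)
 fix L W
 show "dT q (dK z) L W = dK (dT q z) L W"
 proof (cases "L \<subseteq> {..<Suc N}")
  case L: True
  show ?thesis
  proof (cases "q = 0 \<or> ~ W \<subseteq> VV")
   case True
   thus ?thesis using L by (auto simp: dT_def dK_def kos_def)
  next
   case False
   have "cobd (%W. kos F (Suc N) (%L. z L W) L) W = kos F (Suc N) (%L. cobd (z L) W) L"
    unfolding cobd_def kos_def sg_sum sum_distrib_left by (subst sum.swap) (simp only: sg_mult_right sg_comm[of _ W _ L])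
   thus ?thesis using L False by (simp add: dT_def dK_def)
  qed
 next
  case False
  thus ?thesis by (auto simp: dT_def dK_def cobd_def)
 qed
qed

lemma dK_dcx:
 assumes z: "z \<in> dcx \<nu> (Suc p) q"
 shows "dK z \<in> dcx \<nu> p q" unfolding dcx_def
proof (intro CollectI allI conjI impI)
 fix L W
 note zD = dcxD[OF z]
 have tm: "F i * z (insert i L) W \<in> LH W (dg \<nu> L)" if "i \<in> {..<Suc N} - L" "L \<subseteq> {..<Suc N}" for i
  using that finite_subset[OF that(2)] by (intro Lhom_mult[OF F_in_Lhom zD(1)]) (simp add: dg_insert)
 from tm show "dK z L W \<in> LH W (dg \<nu> L)" by (auto simp: dK_def kos_def intro!: Lhom_sum Lhom_sg)
 assume "dK z L W ~= 0"
 hence L: "L \<subseteq> {..<Suc N}" and "kos F (Suc N) (%L. z L W) L ~= 0" by (auto simp: dK_def split: if_splits)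
 hence "\<exists>i\<in>{..<Suc N} - L. sg i L (F i * z (insert i L) W) ~= 0" unfolding kos_def by (meson sum.neutral)
 then obtain i where i: "i \<notin> L" "z (insert i L) W ~= 0" by (metis Diff_iff mult_zero_right sg_zero)
 show "L \<subseteq> {..<Suc N}" by (rule L)
 show "spot q W" using zD(4)[OF i(2)] .
 show "card L = p" using zD(3)[OF i(2)] i(1) finite_subset[OF L] by simp
qed

lemma dK_dK: "dK (dK z) = 0"
proof (intro ext)
 fix L W
 show "dK (dK z) L W = 0 L W"
 proof (cases "L \<subseteq> {..<Suc N}")
  case True
  have "dK (dK z) L W = kos F (Suc N) (kos F (Suc N) (%L. z L W)) L" using True by (auto simp: dK_def intro!: kos_cong)
  thus ?thesis using kos_kos[OF True] by simp
 qed (simp add: dK_def)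
qed

lemma dK_diff: "dK (x - y) = dK x - dK y" by (auto simp: fun_eq_iff dK_def kos_diff)

lemma dT_diff: "dT q (x - y) = dT q x - dT q y" by (auto simp: fun_eq_iff dT_def cobd_def sg_diff sum_subtractf)

lemma dcx_diff: "x \<in> dcx \<nu> p q ==> y \<in> dcx \<nu> p q ==> x - y \<in> dcx \<nu> p q"
proof -
 assume x: "x \<in> dcx \<nu> p q" and y: "y \<in> dcx \<nu> p q"
 have "L \<subseteq> {..<Suc N} \<and> card L = p \<and> spot q W" if "(x - y) L W ~= 0" for L W
  using that dcxD[OF x, of L W] dcxD[OF y, of L W] by (cases "x L W = 0") auto
 moreover have "(x - y) L W \<in> LH W (dg \<nu> L)" for L W using Lhom_diff[OF dcxD(1)[OF x] dcxD(1)[OF y]] by simp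
 ultimately show ?thesis unfolding dcx_def by blast
qed

text \<open>Cell by cell this is Koszul exactness over a localization in which the forms are
  regular. That result ignores degrees, so the preimage is cut down to the right degree
  afterwards.\<close>

lemma dK_exact:
 assumes z: "z \<in> dcx \<nu> (Suc p) (Suc q)" and cyc: "dK z = 0"
 shows "\<exists>y\<in>dcx \<nu> (Suc (Suc p)) (Suc q). dK y = z"
proof -
 note zD = dcxD[OF z]
 have "\<exists>y. (\<forall>L. y L \<in> LR W) \<and> (\<forall>L. y L ~= 0 --> L \<subseteq> {..<Suc N} \<and> card L = Suc (Suc p)) \<and>
   (\<forall>L. L \<subseteq> {..<Suc N} --> kos F (Suc N) y L = z L W)" if W: "spot (Suc q) W" for W
 proof -
  interpret S: subring_on "LR W" by (rule subring_on_Lring)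
  have cell: "W \<in> cells r n" using W by (simp add: spot_def)
  show ?thesis
  proof (rule S.koszul_exact)
   show "v \<in> ideal_of (LR W) F m" if "m < Suc N" "v \<in> LR W" "F m * v \<in> ideal_of (LR W) F m"
    for m v using generic_regular[OF cell _ that(2,3)] that(1) by simp
   show "kos F (Suc N) (%L. z L W) L = 0" if "L \<subseteq> {..<Suc N}" for L
    using fun_cong[OF fun_cong[OF cyc], of L W] that by (simp add: dK_def)
   show "z L W \<in> LR W" for L using zD(1)[of L W] by (auto simp: Lhom_def)
  qed (use zD F_in_Lring in auto)
 qed
 then obtain y where y: "!!W L. spot (Suc q) W ==> y W L \<in> LR W"
  "!!W L. spot (Suc q) W ==> y W L ~= 0 ==> L \<subseteq> {..<Suc N} \<and> card L = Suc (Suc p)"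
  "!!W L. spot (Suc q) W ==> L \<subseteq> {..<Suc N} ==> kos F (Suc N) (y W) L = z L W" by metis
 define y' where "y' L W = (if spot (Suc q) W then pm_restrict (%a. ldeg n a = dg \<nu> L) (y W L) else 0)" for L W
 have "y' \<in> dcx \<nu> (Suc (Suc p)) (Suc q)" unfolding dcx_def
 proof (intro CollectI allI conjI)
  fix L W
  show "y' L W \<in> LH W (dg \<nu> L)" using y(1) by (auto simp: y'_def Lhom_eq_restrict)
  show "y' L W ~= 0 --> L \<subseteq> {..<Suc N} \<and> card L = Suc (Suc p) \<and> spot (Suc q) W"
  proof
   assume "y' L W ~= 0"
   hence "spot (Suc q) W" "y W L ~= 0" by (auto simp: y'_def split: if_splits)
   thus "L \<subseteq> {..<Suc N} \<and> card L = Suc (Suc p) \<and> spot (Suc q) W" using y(2) by blast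
  qed
 qed
 moreover have "dK y' = z"
 proof (intro ext)
  fix L W
  show "dK y' L W = z L W"
  proof (cases "L \<subseteq> {..<Suc N} \<and> spot (Suc q) W")
   case True
   hence L: "L \<subseteq> {..<Suc N}" and W: "spot (Suc q) W" by auto
   have fL: "finite L" using L finite_subset by blast
   have "pm_restrict (%a. ldeg n a = dg \<nu> L) (F i * y W (insert i L)) = F i * y' (insert i L) W" if i: "i \<notin> L" for i
   proof -
    have "pm_restrict (%a. ldeg n a = dg \<nu> L) (F i * y W (insert i L))
     = F i * pm_restrict (%a. ldeg n a = dg \<nu> (insert i L)) (y W (insert i L))"
    proof (rule restrict_mult)
     fix m m' assume "m \<in> pkeys (F i)"
     hence "ldeg n m = d i" using F_in_Lhom[of i W] by (auto simp: Lhom_def)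
     thus "ldeg n (m + m') = dg \<nu> L \<longleftrightarrow> ldeg n m' = dg \<nu> (insert i L)"
      by (simp add: fun_eq_iff ldeg_add dg_insert[OF fL i] eq_diff_eq add.commute)
    qed
    thus ?thesis using W by (simp add: y'_def)
   qed
   hence "pm_restrict (%a. ldeg n a = dg \<nu> L) (kos F (Suc N) (y W) L) = kos F (Suc N) (%L. y' L W) L"
    unfolding kos_def restrict_sum restrict_sg by (intro sum.cong) auto
   hence "kos F (Suc N) (%L. y' L W) L = pm_restrict (%a. ldeg n a = dg \<nu> L) (z L W)" using y(3)[OF W L] by simp
   also have "\<dots> = z L W" using zD(1) by (rule Lhom_restrict_id)
   finally show ?thesis using L by (simp add: dK_def)
  next
   case False
   hence "z L W = 0" using zD by blast
   moreover have "dK y' L W = 0" using False by (auto simp: dK_def y'_def kos_def)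
   ultimately show ?thesis by simp
  qed
 qed
 ultimately show ?thesis by blast
qed

lemma vertex_exists: "\<exists>W. spot 1 W"
proof -
 let ?W = "(%j. (j, 0::nat)) ` {1..r}"
 have "?W \<in> cells r n" by (auto simp: cells_def xvars_def grp_def)
 moreover have "card ?W = r" by (subst card_image) (auto simp: inj_on_def)
 ultimately show ?thesis using spot1 by blast
qed

lemma dT_exact0:
 assumes z: "z \<in> dcx \<nu> 0 0" and "dT 0 z = 0"
 shows "z = 0"
proof (intro ext)
 fix L W
 obtain U where "spot 1 U" using vertex_exists by blast
 hence "z L {} = 0" using fun_cong[OF fun_cong[OF assms(2)], of L U] by (simp add: dT_def)
 thus "z L W = 0 L W" using dcxD(4)[OF z, of L W] by (auto simp: spot_def)
qed

text \<open>For q = 0 the augmentation is exact without exception. For q > 0 the set J = {} is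
  harmless, as it would require a cell of dimension q to be a vertex.\<close>

lemma dT_exact:
 assumes z: "z \<in> dcx \<nu> p (Suc q)" and cyc: "dT (Suc q) z = 0"
  and good: "!!L W a J. a \<in> pkeys (z L W) ==> J \<subseteq> {1..r} ==> J ~= {} ==>
    neg_part a = (\<Union>j\<in>J. grp n j) ==> q ~= (\<Sum>j\<in>J. n j)"
 shows "\<exists>y\<in>dcx \<nu> p q. dT q y = z"
proof -
 note zD = dcxD[OF z]
 have cyc': "cobd (z L) W = 0" if "W \<subseteq> VV" for L W
  using fun_cong[OF fun_cong[OF cyc], of L W] that by (simp add: dT_def)
 show ?thesis
 proof (cases "q = 0")
  case True
  have "\<exists>y\<in>LH {} (dg \<nu> L). \<forall>W\<in>cells r n. card W = r --> z L W = y" for L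
   using zD cyc' True by (intro laur_exact_augmentation n1) (auto simp: spot_def)
  then obtain y where y: "!!L. y L \<in> LH {} (dg \<nu> L)" "!!L W. spot 1 W ==> z L W = y L" by (metis spot1)
  obtain U where U: "spot 1 U" using vertex_exists by blast
  define y' where "y' L W = (if W = {} then y L else 0)" for L and W :: "xvar set"
  have "y' \<in> dcx \<nu> p q" unfolding dcx_def
  proof (intro CollectI allI conjI)
   fix L W
   show "y' L W \<in> LH W (dg \<nu> L)" using y(1) by (simp add: y'_def)
   show "y' L W ~= 0 --> L \<subseteq> {..<Suc N} \<and> card L = p \<and> spot q W"
   proof
    assume "y' L W ~= 0"
    hence "W = {}" "z L U ~= 0" using y(2)[OF U] by (auto simp: y'_def split: if_splits)
    thus "L \<subseteq> {..<Suc N} \<and> card L = p \<and> spot q W" using zD True by (auto simp: spot_def)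
   qed
  qed
  moreover have "dT q y' = z"
  proof (intro ext)
   fix L W show "dT q y' L W = z L W" using True y(2)[of W L] zD(4)[of L W] by (auto simp: dT_def y'_def)
  qed
  ultimately show ?thesis by blast
 next
  case False
  have "\<exists>e. (\<forall>W. e W \<in> LH W (dg \<nu> L)) \<and> (\<forall>W. e W ~= 0 --> W \<in> cells r n \<and> Suc (card W) = r + q) \<and>
    (\<forall>W. W \<subseteq> VV --> cobd e W = z L W)" for L
  proof (rule laur_exact)
   show "r + q ~= (\<Sum>j\<in>J. n j) + r" if "a \<in> pkeys (z L W)" "J \<subseteq> {1..r}" "neg_part a = (\<Union>j\<in>J. grp n j)" for W a J
    using good[OF that(1,2) _ that(3)] False by (cases "J = {}") auto
  qed (use zD cyc' in \<open>auto simp: spot_def\<close>)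
  then obtain e where e: "!!L W. e L W \<in> LH W (dg \<nu> L)"
   "!!L W. e L W ~= 0 ==> W \<in> cells r n \<and> Suc (card W) = r + q"
   "!!L W. W \<subseteq> VV ==> cobd (e L) W = z L W" by metis
  define e' where "e' L W = (if L \<subseteq> {..<Suc N} \<and> card L = p then e L W else 0)" for L W
  have "e' \<in> dcx \<nu> p q" unfolding dcx_def using e False by (auto simp: e'_def spot_def)
  moreover have "dT q e' = z"
  proof (intro ext)
   fix L W
   show "dT q e' L W = z L W"
   proof (cases "L \<subseteq> {..<Suc N} \<and> card L = p")
    case True
    hence "e' L = e L" by (auto simp: e'_def)
    thus ?thesis using e(3)[of W L] False zD(4)[of L W] spot_sub[of "Suc q" W] by (auto simp: dT_def)
   next
    case F: False
    hence "z L W = 0" using zD by blast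
    moreover have "e' L W = 0" for W unfolding e'_def by (rule if_not_P[OF F])
    hence "dT q e' L W = 0" using False by (simp add: dT_def cobd_def)
    ultimately show ?thesis by simp
   qed
  qed
  ultimately show ?thesis by blast
 qed
qed

text \<open>A combinatorial condition, independent of the base ring: no monomial in the degree of a
  Koszul summand with q indices is exceptional for the cells of dimension q - 1. Only diagonal spots
  are visited when the chase runs down.\<close>

definition good_spot :: "(nat => int) => nat => bool" where
 "good_spot \<nu> q \<longleftrightarrow> (\<forall>L a J. L \<subseteq> {..N} --> card L = q --> pkeys a \<subseteq> VV --> ldeg n a = dg \<nu> L -->
   J \<subseteq> {1..r} --> J ~= {} --> neg_part a = (\<Union>j\<in>J. grp n j) --> q ~= (\<Sum>j\<in>J. n j) + 1)"

lemma dT_exact_good: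
 assumes z: "z \<in> dcx \<nu> (Suc q) (Suc q)" and cyc: "dT (Suc q) z = 0" and good: "good_spot \<nu> (Suc q)"
 shows "\<exists>y\<in>dcx \<nu> (Suc q) q. dT q y = z"
proof (rule dT_exact[OF z cyc])
 fix L W a J assume *: "a \<in> pkeys (z L W)" "J \<subseteq> {1..r}" "J ~= {}" "neg_part a = (\<Union>j\<in>J. grp n j)"
 hence nz: "z L W ~= 0" by auto
 have "pkeys a \<subseteq> VV" "ldeg n a = dg \<nu> L"
  using dcxD(1)[OF z, of L W] *(1) by (auto simp: Lhom_def Lring_def Lexp_alt subset_iff)
 moreover have "L \<subseteq> {..N}" "card L = Suc q" using dcxD[OF z] nz by (auto simp: lessThan_Suc_atMost)
 ultimately have "Suc q ~= (\<Sum>j\<in>J. n j) + 1" using good[unfolded good_spot_def, rule_format, OF _ _ _ _ *(2,3,4)] by blast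
 thus "q ~= (\<Sum>j\<in>J. n j)" by simp
qed

section \<open>The saturation of the generic ideal\<close>

text \<open>The multipliers may contain any coefficient variables of the type, also ones foreign to
  \<open>coeffs_A\<close>; \<open>in_ideal_C\<close> brings them back.\<close>

definition in_ideal :: "'k::comm_ring_1 cpoly => bool" where
 "in_ideal p \<longleftrightarrow> (\<exists>h. (\<forall>i\<le>N. h i \<in> mpolys (VV) UNIV) \<and> p = (\<Sum>i\<le>N. h i * FG i))"

text \<open>Saturation tested on one generator of the irrelevant ideal at a time;
  \<open>ideal_Isat_iff\<close> relates it to the ideal quotient.\<close>

definition in_sat :: "'k::comm_ring_1 cpoly => bool" where
 "in_sat p \<longleftrightarrow> (\<forall>\<sigma>. (\<forall>j\<in>{1..r}. \<sigma> j \<le> n j) --> (\<exists>k. in_ideal (sgl (vmono r \<sigma> (%_. k)) 1 * p)))"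

definition base0 :: "'k::comm_ring_1 cpoly => nat set => xvar set => 'k upoly laur" where
 "base0 p L W = (if L = {} \<and> W = {} then to_laur p else 0)"

lemma base0_dcx: "p \<in> XD UNIV \<nu> ==> base0 p \<in> dcx \<nu> 0 0"
 by (auto simp: dcx_def base0_def spot_def dg_def to_laur_in_Lhom)

text \<open>The monomial x_\<sigma> is a unit on any cell that contains the transversal \<sigma>, so
  its power can be divided out.\<close>

lemma local_membership:
 fixes p :: "'k::comm_ring_1 cpoly"
 assumes "in_sat p" "W \<in> cells r n"
 shows "\<exists>h. (\<forall>i<Suc N. h i \<in> LR W) \<and> to_laur p = (\<Sum>i<Suc N. F i * h i)"
proof -
 obtain \<sigma> where \<sigma>: "!!j. j \<in> {1..r} ==> \<sigma> j \<le> n j \<and> (j, \<sigma> j) \<in> W" using cell_transversal[OF assms(2)] by blast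
 hence "\<exists>k. in_ideal (sgl (vmono r \<sigma> (%_. k)) 1 * p)" using assms(1) unfolding in_sat_def by blast
 then obtain k where "in_ideal (sgl (vmono r \<sigma> (%_. k)) 1 * p)" by blast
 then obtain h where h: "!!i. i \<le> N ==> h i \<in> mpolys (VV) UNIV"
  "sgl (vmono r \<sigma> (%_. k)) 1 * p = (\<Sum>i\<le>N. h i * FG i)" unfolding in_ideal_def by blast
 let ?a = "emb (vmono r \<sigma> (%_. k))"
 have "pkeys (vmono r \<sigma> (%_. k)) \<subseteq> W" using keys_vmono \<sigma> by fast
 hence a: "- ?a \<in> Lexp r n W" unfolding Lexp_def using assms(2) by (auto simp: in_keys_iff subset_iff cells_def)
 have "sgl ?a 1 * to_laur p = (\<Sum>i\<le>N. to_laur (h i) * F i)"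
  using arg_cong[OF h(2), of to_laur] by (simp add: rhomD[OF rhom_to_laur] F_laur_def)
 hence "sgl (- ?a) 1 * (sgl ?a 1 * to_laur p) = sgl (- ?a) 1 * (\<Sum>i\<le>N. to_laur (h i) * F i)" by simp
 hence "to_laur p = (\<Sum>i\<le>N. F i * (sgl (- ?a) 1 * to_laur (h i)))"
  by (simp add: mult.assoc[symmetric] mult_single sum_distrib_left) (simp add: mult_ac)
 moreover have "sgl (- ?a) 1 * to_laur (h i) \<in> LR W" if "i \<le> N" for i
 proof -
  have "to_laur (h i) \<in> LR {}" using h(1)[OF that] to_laur_in_Lring by blast
  hence "to_laur (h i) \<in> LR W" using Lring_mono[of "{}" W r n] by blast
  thus ?thesis by (intro Lring_mult Lring_single a)
 qed
 ultimately show ?thesis by (intro exI[of _ "%i. sgl (- ?a) 1 * to_laur (h i)"]) (auto simp: lessThan_Suc_atMost)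
qed

text \<open>The first lift of the zigzag, chosen on each vertex separately and cut to degree
  \<nu>.\<close>

lemma base1_exists:
 fixes p :: "'k::comm_ring_1 cpoly"
 assumes p: "p \<in> XD UNIV \<nu>" and sat: "in_sat p"
 shows "\<exists>c\<in>dcx \<nu> 1 1. dK c = dT 0 (base0 p)"
proof -
 have "\<forall>W. \<exists>h. spot 1 W --> (\<forall>i<Suc N. h i \<in> LR W) \<and> to_laur p = (\<Sum>i<Suc N. F i * h i)"
  using local_membership[OF sat] unfolding spot1 by blast
 from choice[OF this] obtain h where h: "!!W i. spot 1 W ==> i < Suc N ==> h W i \<in> LR W"
  "!!W. spot 1 W ==> to_laur p = (\<Sum>i<Suc N. F i * h W i)" by blast
 define c where "c L W = (if spot 1 W \<and> (\<exists>i<Suc N. L = {i}) then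
   pm_restrict (%a. ldeg n a = dg \<nu> L) (h W (the_elem L)) else 0)" for L W
 have "c \<in> dcx \<nu> 1 1" unfolding dcx_def
 proof (intro CollectI allI conjI)
  fix L W
  show "c L W \<in> LH W (dg \<nu> L)" using h(1) by (auto simp: c_def intro!: Lhom_eq_restrict)
  show "c L W ~= 0 --> L \<subseteq> {..<Suc N} \<and> card L = 1 \<and> spot 1 W" by (auto simp: c_def)
 qed
 moreover have "dK c = dT 0 (base0 p)"
 proof (intro ext)
  fix L W
  show "dK c L W = dT 0 (base0 p) L W"
  proof (cases "L = {} \<and> spot 1 W")
   case True
   hence W: "spot 1 W" by simp
   have "F i * c {i} W = pm_restrict (%a. ldeg n a = \<nu>) (F i * h W i)" if i: "i < Suc N" for i
   proof -
    have "pm_restrict (%a. ldeg n a = \<nu>) (F i * h W i)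
     = F i * pm_restrict (%a. ldeg n a = dg \<nu> {i}) (h W i)"
    proof (rule restrict_mult)
     fix m m' assume "m \<in> pkeys (F i)"
     hence "ldeg n m = d i" using F_in_Lhom[of i W] by (auto simp: Lhom_def)
     thus "ldeg n (m + m') = \<nu> \<longleftrightarrow> ldeg n m' = dg \<nu> {i}"
      by (simp add: fun_eq_iff ldeg_add dg_def eq_diff_eq add.commute)
    qed
    thus ?thesis using W i by (simp add: c_def)
   qed
   hence "(\<Sum>i<Suc N. F i * c {i} W) = pm_restrict (%a. ldeg n a = \<nu>) (to_laur p)"
    unfolding h(2)[OF W] restrict_sum by (intro sum.cong) auto
   also have "\<dots> = to_laur p" using p by (intro Lhom_restrict_id) (simp add: to_laur_in_Lhom)
   finally show ?thesis using True by (simp add: dK_def dT_def kos_def base0_def)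
  next
   case False
   have "c (insert i L) W = 0" if "i \<notin> L" for i using that False by (auto simp: c_def)
   hence "dK c L W = 0" by (simp add: dK_def kos_def)
   moreover have "dT 0 (base0 p) L W = 0" using False by (auto simp: dT_def base0_def)
   ultimately show ?thesis by simp
  qed
 qed
 ultimately show ?thesis by blast
qed

lemma zigzag_exists:
 fixes p :: "'k::comm_ring_1 cpoly"
 assumes "p \<in> XD UNIV \<nu>" "in_sat p"
 shows "\<exists>c. c 0 = base0 p \<and> (\<forall>q\<le>t. c q \<in> dcx \<nu> q q) \<and> (\<forall>q<t. dK (c (Suc q)) = dT q (c q))"
proof -
 obtain c1 where "c1 \<in> dcx \<nu> 1 1" "dK c1 = dT 0 (base0 p)" using base1_exists[OF assms] by blast
 thus ?thesis by (intro chase_up[where G = "dcx \<nu>"] dT_dcx dT_dT dT_dK dK_exact base0_dcx[OF assms(1)])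
qed

definition in_ideal_deg :: "(nat => int) => 'k::comm_ring_1 cpoly => bool" where
 "in_ideal_deg \<nu> p \<longleftrightarrow> (\<exists>h. (\<forall>i\<le>N. h i \<in> XD UNIV (\<nu> - d i)) \<and> p = (\<Sum>i\<le>N. h i * FG i))"

lemma dg_single: "dg \<nu> {i} = \<nu> - d i" by (simp add: dg_def fun_eq_iff)

text \<open>Chasing down from the corner ends at the empty set, where Laurent polynomials have no
  denominators; the entries found there are the multipliers of the forms.\<close>

lemma zigzag_trivial:
 fixes c :: "nat => nat set => xvar set => 'k::comm_ring_1 upoly laur"
 assumes "c 0 = base0 p" "!!q. q \<le> Suc N ==> c q \<in> dcx \<nu> q q" "!!q. q < Suc N ==> dK (c (Suc q)) = dT q (c q)"
  and good: "!!q. 1 \<le> q ==> q \<le> N ==> good_spot \<nu> q"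
  and top: "e \<in> dcx \<nu> (Suc N) N" "dT N e = c (Suc N)"
 shows "in_ideal_deg \<nu> p"
proof -
 have "\<exists>e\<in>dcx \<nu> 1 0. dK e = c 0"
 proof (rule chase_down[where G = "dcx \<nu>" and t = N and dT = dT and dK = dK and c = c and e = e])
  show "x \<in> dcx \<nu> (Suc p) q ==> dK x \<in> dcx \<nu> p q"
   and "x \<in> dcx \<nu> p q ==> y \<in> dcx \<nu> p q ==> x - y \<in> dcx \<nu> p q"
   and "x \<in> dcx \<nu> 0 0 ==> dT 0 x = 0 ==> x = 0"
   for p q and x y :: "nat set => xvar set => 'k upoly laur" by (fact dK_dcx, fact dcx_diff, fact dT_exact0)
  show "\<exists>y\<in>dcx \<nu> (Suc q) q. dT q y = x"
   if "Suc q \<le> N" "x \<in> dcx \<nu> (Suc q) (Suc q)" "dT (Suc q) x = 0"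
   for q and x :: "nat set => xvar set => 'k upoly laur" using that good[of "Suc q"] by (intro dT_exact_good) auto
 qed (use assms in \<open>simp_all add: dK_diff dT_diff dK_dK dT_dK\<close>)
 then obtain e where e: "e \<in> dcx \<nu> 1 0" "dK e = base0 p" using assms(1) by auto
 have "\<exists>h. to_laur h = e {i} {} \<and> h \<in> mpolys (VV) UNIV" for i
 proof -
  have "e {i} {} \<in> LR {}" using dcxD(1)[OF e(1), of "{i}" "{}"] by (simp add: Lhom_def)
  thus ?thesis using Lring_empty_to_laur by metis
 qed
 then obtain h where h: "!!i. to_laur (h i) = e {i} {}" by metis
 have "h i \<in> XD UNIV (\<nu> - d i)" for i
  using dcxD(1)[OF e(1), of "{i}" "{}"] by (simp add: to_laur_in_Lhom h dg_single)
 moreover have "p = (\<Sum>i\<le>N. h i * FG i)"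
 proof -
  have "to_laur p = (\<Sum>i<Suc N. F i * e {i} {})"
   using fun_cong[OF fun_cong[OF e(2)], of "{}" "{}"] by (simp add: base0_def dK_def kos_def)
  also have "\<dots> = to_laur (\<Sum>i\<le>N. h i * FG i)"
   by (simp add: rhomD[OF rhom_to_laur] h F_laur_def lessThan_Suc_atMost mult.commute)
  finally show ?thesis by simp
 qed
 ultimately show ?thesis unfolding in_ideal_deg_def by blast
qed

text \<open>A nonzero coboundary would live on a cell with more than all \<open>N + r\<close>
  variables.\<close>

lemma top_cocycle: "z \<in> dcx \<nu> (Suc N) (Suc N) ==> dT (Suc N) z = 0"
proof -
 assume "z \<in> dcx \<nu> (Suc N) (Suc N)"
 hence w: "dT (Suc N) z \<in> dcx \<nu> (Suc N) (Suc (Suc N))" by (rule dT_dcx)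
 show ?thesis
 proof (intro ext, rule ccontr)
  fix L W assume "dT (Suc N) z L W ~= 0 L W"
  hence "spot (Suc (Suc N)) W" using dcxD(4)[OF w] by simp
  thus False using card_cell_le[of W r n] by (simp add: spot_def)
 qed
qed

theorem sat_in_ideal:
 fixes p :: "'k::comm_ring_1 cpoly"
 assumes "!!q. 1 \<le> q ==> q \<le> Suc N ==> good_spot \<nu> q"
  and "p \<in> XD UNIV \<nu>" "in_sat p"
 shows "in_ideal_deg \<nu> p"
proof -
 obtain c where c: "c 0 = base0 p" "!!q. q \<le> Suc N ==> c q \<in> dcx \<nu> q q"
  "!!q. q < Suc N ==> dK (c (Suc q)) = dT q (c q)" using zigzag_exists[OF assms(2,3), of "Suc N"] by blast
 obtain e where e: "e \<in> dcx \<nu> (Suc N) N" "dT N e = c (Suc N)"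
  using dT_exact_good[of "c (Suc N)" \<nu> N] c(2)[of "Suc N"] top_cocycle assms(1)[of "Suc N"] by auto
 show ?thesis by (rule zigzag_trivial[OF c _ e]) (use assms(1) in auto)
qed

end

section \<open>Sylvester forms\<close>

subsection \<open>The decomposition of the generic forms\<close>

definition pre_exp :: "(nat => nat) => xmono => nat => xmono" where
 "pre_exp n \<alpha> l = (\<Sum>i\<in>{1..<l}. sgl (i, n i) (lkp \<alpha> (i, n i) + 1))"

text \<open>The exponent of the monomial in front of \<open>F\<^sup>(\<^sup>l\<^sup>)\<^sub>j\<close> in the nested decomposition.\<close>

definition yexp :: "(nat => nat) => xmono => xvar => xmono" where
 "yexp n \<alpha> c = pre_exp n \<alpha> (fst c) + sgl c (lkp \<alpha> c + 1)"

abbreviation scl :: "nat => (nat => nat) => xvar set" where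
 "scl r n \<equiv> scols {1..r} r n"

lemma mpoly_var_power: "mpoly_var v ^ k = (sgl (sgl v k) 1 :: ('v \<Rightarrow>\<^sub>0 nat) \<Rightarrow>\<^sub>0 'a::comm_ring_1)"
proof (induction k)
 case (Suc k)
 have "sgl v (Suc k) = sgl v 1 + sgl v k" by (simp add: single_add[symmetric])
 thus ?case using Suc by (simp add: mpoly_var_def mult_single)
qed simp

lemma lkp_pre_exp: "lkp (pre_exp n \<alpha> l) (i, j) = (if 1 \<le> i \<and> i < l \<and> j = n i then lkp \<alpha> (i, j) + 1 else 0)"
proof -
 have "lkp (pre_exp n \<alpha> l) (i, j) = (\<Sum>k\<in>{1..<l}. if k = i then (if j = n i then lkp \<alpha> (i, j) + 1 else 0) else 0)"
  unfolding pre_exp_def lookup_sum by (intro sum.cong) (auto simp: lookup_single when_def)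
 thus ?thesis by auto
qed

lemma lkp_yexp: "lkp (yexp n \<alpha> c) v = (if v = c then lkp \<alpha> v + 1 else 0)
  + (if 1 \<le> fst v \<and> fst v < fst c \<and> snd v = n (fst v) then lkp \<alpha> v + 1 else 0)"
 by (cases v) (simp add: yexp_def lookup_add lkp_pre_exp lookup_single when_def)

text \<open>Multiplying by the prefix monomials opens the nested brackets, starting from the last
  group.\<close>

lemma nested_expand:
 assumes "1 \<le> l" "l \<le> r"
 shows "sgl (pre_exp n \<alpha> l) 1 * nested r n \<alpha> G l
    = (\<Sum>c\<in>{c\<in>scl r n. l \<le> fst c}. sgl (yexp n \<alpha> c) 1 * (G (fst c) (snd c) :: 'a::comm_ring_1 xpoly))"
 using assms(2,1)
proof (induction l rule: inc_induct)
 case base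
 have 1: "{c\<in>scl r n. r \<le> fst c} = Pair r ` {..n r}" using base by (auto simp: scols_def last_col_def)
 have "sgl (pre_exp n \<alpha> r) 1 * nested r n \<alpha> G r
   = (\<Sum>j\<le>n r. sgl (yexp n \<alpha> (r, j)) 1 * G r j)" unfolding nested.simps[of r n \<alpha> G r] mpoly_var_power
  by (simp add: sum_distrib_left mult.assoc[symmetric] mult_single yexp_def)
 also have "\<dots> = (\<Sum>c\<in>Pair r ` {..n r}. sgl (yexp n \<alpha> c) 1 * G (fst c) (snd c))"
  by (subst sum.reindex) (auto simp: inj_on_def)
 finally show ?case unfolding 1 .
next
 case (step l)
 have 1: "{c\<in>scl r n. l \<le> fst c} = Pair l ` {..<n l} \<union> {c\<in>scl r n. Suc l \<le> fst c}"
  using step by (fastforce simp: scols_def last_col_def Suc_le_eq le_eq_less_or_eq)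
 have pre: "pre_exp n \<alpha> (Suc l) = pre_exp n \<alpha> l + sgl (l, n l) (lkp \<alpha> (l, n l) + 1)"
  using step by (simp add: pre_exp_def)
 have "sgl (pre_exp n \<alpha> l) 1 * nested r n \<alpha> G l
   = (\<Sum>j<n l. sgl (yexp n \<alpha> (l, j)) 1 * G l j) + sgl (pre_exp n \<alpha> (Suc l)) 1 * nested r n \<alpha> G (Suc l)"
  using step unfolding nested.simps[of r n \<alpha> G l] mpoly_var_power
  by (simp add: sum_distrib_left mult.assoc[symmetric] mult_single yexp_def distrib_left pre)
 also have "(\<Sum>j<n l. sgl (yexp n \<alpha> (l, j)) 1 * G l j)
   = (\<Sum>c\<in>Pair l ` {..<n l}. sgl (yexp n \<alpha> c) 1 * G (fst c) (snd c))" by (subst sum.reindex) (auto simp: inj_on_def)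
 also have "sgl (pre_exp n \<alpha> (Suc l)) 1 * nested r n \<alpha> G (Suc l)
   = (\<Sum>c\<in>{c\<in>scl r n. Suc l \<le> fst c}. sgl (yexp n \<alpha> c) 1 * G (fst c) (snd c))" by (rule step.IH) simp
 finally show ?case unfolding 1 by (subst sum.union_disjoint) (auto simp: finite_scols)
qed

text \<open>The columns are listed in lexicographic order, as \<open>det_eq_minr\<close>
  requires.\<close>

lemma sylv_cols:
 assumes "r \<ge> 1"
 shows set_sylv_cols: "set (sylv_cols r n) = scl r n"
  and sorted_sylv_cols: "sorted_wrt (<) (sylv_cols r n)"
  and length_sylv_cols: "length (sylv_cols r n) = ntot r n + 1"
proof -
 show set: "set (sylv_cols r n) = scl r n" by (auto simp: sylv_cols_def scols_def last_col_def)
 have "sorted_wrt (<) (concat (map (%l. map (Pair l) [0..<n l]) [1..<Suc k]))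
  \<and> length (concat (map (%l. map (Pair l) [0..<n l]) [1..<Suc k])) = (\<Sum>j=1..k. n j)" for k
 proof (induction k)
  case (Suc k)
  have "sorted_wrt (<) (map (Pair (Suc k)) [0..<n (Suc k)])"
   by (auto simp: sorted_wrt_map intro: sorted_wrt_mono_rel[OF _ strict_sorted_list_of_set] simp: sorted_wrt_iff_nth_less)
  thus ?case using Suc by (auto simp: sorted_wrt_append)
 qed simp
 from this[of r] show "sorted_wrt (<) (sylv_cols r n)" "length (sylv_cols r n) = ntot r n + 1"
  using assms by (auto simp: sylv_cols_def sorted_wrt_append ntot_def)
qed

lemma sylv_det_minr:
 assumes "r \<ge> 1"
 shows "sylv_det r n G = minr (ntot r n + 1) (%i c. G i (fst c) (snd c)) {..<ntot r n + 1} (scl r n)"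
proof -
 let ?k = "ntot r n + 1"
 have "mat ?k ?k (%(i, c). case sylv_cols r n ! c of (l, j) => G i l j)
   = mat ?k ?k (%(i, c). G ([0..<?k] ! i) (fst (sylv_cols r n ! c)) (snd (sylv_cols r n ! c)))"
  by (intro eq_matI) (auto simp: case_prod_unfold simp del: upt_Suc)
 hence "sylv_det r n G = det (mat ?k ?k (%(i, c). (%i c. G i (fst c) (snd c)) ([0..<?k] ! i) (sylv_cols r n ! c)))"
  by (simp add: sylv_det_def)
 also have "\<dots> = minr ?k (%i c. G i (fst c) (snd c)) (set [0..<?k]) (set (sylv_cols r n))"
  using sylv_cols[OF assms, of n] by (intro det_eq_minr) (simp_all del: upt_Suc)
 finally show ?thesis by (simp only: set_sylv_cols[OF assms] set_upt atLeast0LessThan)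
qed

definition sylv_exp :: "nat => (nat => nat) => xmono => xmono" where
 "sylv_exp r n \<alpha> = (\<Sum>i\<in>{1..<r}. sgl (i, n i) ((lkp \<alpha> (i, n i) + 1) * (\<Sum>j=i+1..r. n j)))"

lemma prod_sgl: "finite A ==> (\<Prod>i\<in>A. sgl (f i) 1) = (sgl (\<Sum>i\<in>A. f i) 1 :: 'm::comm_monoid_add \<Rightarrow>\<^sub>0 'a::comm_ring_1)"
 by (induction A rule: finite_induct) (simp_all add: mult_single)

lemma sylv_eq: "sylv r n \<alpha> G = sgl (sylv_exp r n \<alpha>) 1 * sylv_det r n G"
 unfolding sylv_def sylv_exp_def mpoly_var_power by (simp add: prod_sgl)

lemma lkp_sylv_exp:
 "lkp (sylv_exp r n \<alpha>) (i, j) = (if 1 \<le> i \<and> i < r \<and> j = n i then (lkp \<alpha> (i, j) + 1) * (\<Sum>k=i+1..r. n k) else 0)"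
proof -
 have "lkp (sylv_exp r n \<alpha>) (i, j) = (\<Sum>k\<in>{1..<r}. if k = i then (if j = n i then (lkp \<alpha> (i, j) + 1) * (\<Sum>k=i+1..r. n k) else 0) else 0)"
  unfolding sylv_exp_def lookup_sum by (intro sum.cong) (auto simp: lookup_single when_def)
 thus ?thesis by auto
qed

definition ones :: "nat => (nat => nat) => xmono" where
 "ones r n = (\<Sum>v\<in>xvars r n. sgl v 1)"

lemma lkp_ones: "lkp (ones r n) v = (if v \<in> xvars r n then 1 else 0)" by (simp add: ones_def lookup_sum lookup_single when_def)

text \<open>For i < r the last variable of group i stands in front of every column of a later group,
  and there are n_{i+1} + ... + n_r + 1 of these. This is the origin of the exponents in the
  monomial factor of a Sylvester form: what remains after them is exactly x^\<alpha> times the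
  product of all variables.\<close>

lemma sum_yexp:
 assumes "r \<ge> 1" "pkeys \<alpha> \<subseteq> xvars r n"
 shows "(\<Sum>c\<in>scl r n. yexp n \<alpha> c) = sylv_exp r n \<alpha> + \<alpha> + ones r n"
proof (rule poly_mapping_eqI)
 fix v :: xvar
 obtain i j where v: "v = (i, j)" by (cases v)
 have fin: "finite (scl r n)" by (rule finite_scols) simp
 let ?a = "lkp \<alpha> (i, j) + 1"
 have "lkp (\<Sum>c\<in>scl r n. yexp n \<alpha> c) v
  = (if v \<in> scl r n then ?a else 0) + (if 1 \<le> i \<and> j = n i then ?a * card {c\<in>scl r n. i < fst c} else 0)"
  using fin by (simp add: lookup_sum lkp_yexp sum.distrib v sum.If_cases Int_def mult.commute)
 also have "\<dots> = lkp (sylv_exp r n \<alpha> + \<alpha> + ones r n) v"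
 proof (cases "v \<in> xvars r n")
  case False
  hence "v \<notin> pkeys \<alpha>" using assms by blast
  hence "lkp \<alpha> v = 0" by (simp add: in_keys_iff)
  moreover have "v \<notin> scl r n" using False assms by (auto simp: scols_def last_col_def xvars_def)
  moreover have "card {c\<in>scl r n. i < fst c} = 0" if "1 \<le> i" "j = n i"
  proof -
   have "i > r" using False that by (auto simp: v xvars_def)
   hence "{c\<in>scl r n. i < fst c} = {}" by (auto simp: scols_def last_col_def)
   thus ?thesis by (simp only: card.empty)
  qed
  moreover have "~ (1 \<le> i \<and> i < r \<and> j = n i)" using False by (auto simp: v xvars_def)
  ultimately show ?thesis using False unfolding lookup_add lkp_sylv_exp lkp_ones v by (auto simp del: sum_eq_0_iff)
 next
  case True
  hence i: "1 \<le> i" "i \<le> r" "j \<le> n i" by (auto simp: v xvars_def)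
  show ?thesis
  proof (cases "i < r")
   case ir: True
   have "{c\<in>scl r n. i < fst c} = insert (last_col r n) (SIGMA l:{i+1..r}. {..<n l})"
    using ir by (auto simp: scols_def last_col_def)
   hence "card {c\<in>scl r n. i < fst c} = (\<Sum>k=i+1..r. n k) + 1" by (simp add: last_col_def)
   thus ?thesis using i ir True by (auto simp: lookup_add lkp_sylv_exp lkp_ones v scols_def last_col_def algebra_simps)
  next
   case False
   hence "{c\<in>scl r n. i < fst c} = {}" using i by (auto simp: scols_def last_col_def)
   thus ?thesis using i False True by (auto simp: lookup_add lkp_sylv_exp lkp_ones v scols_def last_col_def)
  qed
 qed
 finally show "lkp (\<Sum>c\<in>scl r n. yexp n \<alpha> c) v = lkp (sylv_exp r n \<alpha> + \<alpha> + ones r n) v" .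
qed

context multiproj
begin

lemma lkp_F_gen:
 "lkp (FG i :: 'k::comm_ring_1 cpoly) \<beta> = (if \<beta> \<in> Mon (d i) then mpoly_var (i, \<beta>) else 0)"
proof -
 have "FG i = (\<Sum>\<alpha>\<in>Mon (d i). sgl \<alpha> (mpoly_var (i, \<alpha>) :: 'k upoly))"
  by (simp add: F_gen_def mpoly_const_def mult_single)
 thus ?thesis by (simp add: lookup_sum lookup_single when_def)
qed

lemma F_gen_expand:
 assumes "sylv_decomp r n d \<alpha> G" "i \<le> N"
 shows "FG i = (\<Sum>c\<in>scl r n. sgl (yexp n \<alpha> c) 1 * G i (fst c) (snd c))"
proof -
 have "{c\<in>scl r n. 1 \<le> fst c} = scl r n" using r1 by (auto simp: scols_def last_col_def)
 thus ?thesis using assms nested_expand[of 1 r n \<alpha> "G i"] r1 by (simp add: sylv_decomp_def pre_exp_def)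
qed

text \<open>The columns are a priori homogeneous of some degree only; it is the right one because the
 monomial \<open>\<Prod> x\<^sub>l\<^sub>,\<^sub>\<sigma>\<^sub>l ^ d\<^sub>i\<^sub>l\<close> of the generic form is divisible by a single \<open>yexp\<close>.\<close>

lemma column_degree:
 fixes G :: "nat => nat => nat => 'k::comm_ring_1 cpoly"
 assumes dec: "sylv_decomp r n d \<alpha> G" and i: "i \<le> N" and c: "c \<in> scl r n"
 shows "to_laur (G i (fst c) (snd c)) \<in> LH {} (%j. d i j - xmono_deg n (yexp n \<alpha> c) j)"
proof -
 \<comment> \<open>The transversal that \<open>col_of\<close> sends to c.\<close>
 define \<sigma> where "\<sigma> l = (if l = fst c then snd c else n l)" for l
 have cb: "fst c \<in> {1..r}" "snd c \<le> n (fst c)" "snd c = n (fst c) ==> c = last_col r n"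
  using c r1 by (auto simp: scols_def last_col_def)
 let ?\<beta> = "vmono r \<sigma> (%j. nat (d i j))"
 have "?\<beta> \<in> Mon (d i)" using cb dN[OF i] by (intro vmono_in_xmonos) (auto simp: \<sigma>_def)
 hence "lkp (FG i) ?\<beta> = mpoly_var (i, ?\<beta>)" "xmono_deg n ?\<beta> = d i" by (auto simp: lkp_F_gen xmonos_def)
 moreover have "mpoly_var (i, ?\<beta>) ~= (0 :: 'k upoly)"
  by (simp add: mpoly_var_def) (metis lookup_single_eq lookup_zero zero_neq_one)
 moreover have "lkp (FG i) ?\<beta> = (\<Sum>c\<in>scl r n. lkp (sgl (yexp n \<alpha> c) 1 * G i (fst c) (snd c)) ?\<beta>)"
  by (simp only: F_gen_expand[OF dec i] lookup_sum)
 ultimately have "(\<Sum>c\<in>scl r n. lkp (sgl (yexp n \<alpha> c) 1 * G i (fst c) (snd c)) ?\<beta>) ~= 0" by metis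
 then obtain c' where c': "c' \<in> scl r n" "lkp (sgl (yexp n \<alpha> c') 1 * G i (fst c') (snd c')) ?\<beta> ~= 0"
  by (meson sum.neutral)
 hence "?\<beta> \<in> pkeys (sgl (yexp n \<alpha> c') 1 * G i (fst c') (snd c'))" by (simp add: in_keys_iff)
 then obtain g where g: "g \<in> pkeys (G i (fst c') (snd c'))" "?\<beta> = yexp n \<alpha> c' + g"
  using Poly_Mapping.keys_mult[of "sgl (yexp n \<alpha> c') 1" "G i (fst c') (snd c')"] by (auto split: if_splits)
 have pos: "snd v = \<sigma> (fst v)" if "lkp (yexp n \<alpha> c') v > 0" for v
 proof -
  have "lkp ?\<beta> v > 0" using that by (simp add: g(2) lookup_add)
  thus ?thesis by (cases v) (auto simp: lkp_vmono split: if_splits)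
 qed
 have c'b: "fst c' \<in> {1..r}" "snd c' = n (fst c') ==> c' = last_col r n" using c' r1 by (auto simp: scols_def last_col_def)
 have "snd c' = \<sigma> (fst c')" by (rule pos) (simp add: lkp_yexp)
 \<comment> \<open>All variables of \<open>yexp n \<alpha> c'\<close> lie on the transversal
   \<sigma>, which excludes every other column.\<close>
 have "c' = c"
 proof (cases "fst c' = fst c")
  case True
  thus ?thesis using \<open>snd c' = \<sigma> (fst c')\<close> by (simp add: \<sigma>_def prod_eq_iff)
 next
  case False
  hence "c' = last_col r n" using \<open>snd c' = \<sigma> (fst c')\<close> c'b by (simp add: \<sigma>_def)
  hence "fst c < fst c'" using False cb by (auto simp: last_col_def)
  hence "lkp (yexp n \<alpha> c') (fst c, n (fst c)) > 0" using cb by (simp add: lkp_yexp)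
  from pos[OF this] have "n (fst c) = snd c" by (simp add: \<sigma>_def)
  thus ?thesis using cb \<open>c' = last_col r n\<close> by simp
 qed
 with g have g: "g \<in> pkeys (G i (fst c) (snd c))" "?\<beta> = yexp n \<alpha> c + g" by auto
 have "\<exists>\<mu>. G i (fst c) (snd c) \<in> comp_C r n d \<mu>"
 proof -
  have "c \<in> set (sylv_cols r n)" using c set_sylv_cols[OF r1, of n] by simp
  hence "case c of (l, j) => \<exists>\<mu>. G i l j \<in> comp_C r n d \<mu>" using dec i unfolding sylv_decomp_def by blast
  thus ?thesis by (cases c) simp
 qed
 then obtain \<mu> where \<mu>: "G i (fst c) (snd c) \<in> XD UNIV \<mu>"
  by (auto simp: comp_C_def xpolys_deg_def mpolys_def)
 have "\<mu> = (%j. d i j - xmono_deg n (yexp n \<alpha> c) j)"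
 proof
  fix j
  have "\<mu> = xmono_deg n g" using \<mu> g by (auto simp: xpolys_deg_def)
  moreover have "d i j = xmono_deg n (yexp n \<alpha> c + g) j" using \<open>xmono_deg n ?\<beta> = d i\<close> g(2) by simp
  ultimately show "\<mu> j = d i j - xmono_deg n (yexp n \<alpha> c) j" by (simp add: xmono_deg_add)
 qed
 thus ?thesis using \<mu> to_laur_in_Lhom by blast
qed

end

subsection \<open>Vertices as positions in the list of generators\<close>

text \<open>The variables in each entry of \<open>b_gens\<close>, in the same order. In
  \<open>vtx_of\<close> the index is shifted because groups count from 1 and list positions from
  0.\<close>

definition vlist :: "nat => (nat => nat) => xvar list list" where
 "vlist r n = product_lists (map (%j. map (Pair j) [0..<Suc (n j)]) [1..<Suc r])"

definition vtx_of :: "nat => (nat => nat) => nat => nat => nat" where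
 "vtx_of r n s j = snd (vlist r n ! s ! (j - 1))"

lemma vlist_nth:
 assumes "s < length (vlist r n)"
 shows "vlist r n ! s = map (%j. (j, vtx_of r n s j)) [1..<Suc r]"
  and "j \<in> {1..r} ==> vtx_of r n s j \<le> n j"
proof -
 have "vlist r n ! s \<in> set (vlist r n)" using assms by (rule nth_mem)
 hence l: "list_all2 (%x ys. x \<in> set ys) (vlist r n ! s) (map (%j. map (Pair j) [0..<Suc (n j)]) [1..<Suc r])"
  unfolding vlist_def product_lists_set by simp
 hence len: "length (vlist r n ! s) = r" by (auto dest: list_all2_lengthD simp del: upt_Suc)
 have el: "fst (vlist r n ! s ! i) = Suc i \<and> snd (vlist r n ! s ! i) \<le> n (Suc i)" if "i < r" for i
  using list_all2_nthD2[OF l, of i] that by (auto simp del: upt_Suc)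
 show "vlist r n ! s = map (%j. (j, vtx_of r n s j)) [1..<Suc r]"
  using len el by (intro nth_equalityI) (auto simp: vtx_of_def prod_eq_iff simp del: upt_Suc)
 show "vtx_of r n s j \<le> n j" if "j \<in> {1..r}" using el[of "j - 1"] that by (auto simp: vtx_of_def)
qed

sublocale multiproj \<subseteq> V: cell_vertices r n "length (vlist r n)" "vtx_of r n"
proof
 fix \<sigma> assume \<sigma>: "!!j. j \<in> {1..r} ==> \<sigma> j \<le> n j"
 let ?xs = "map (%j. (j, \<sigma> j)) [1..<Suc r]"
 have "?xs \<in> set (vlist r n)" unfolding vlist_def product_lists_set using \<sigma>
  by (auto simp: list_all2_conv_all_nth less_Suc_eq_le intro!: imageI simp del: upt_Suc)
 then obtain s where s: "s < length (vlist r n)" "vlist r n ! s = ?xs" by (auto simp: in_set_conv_nth)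
 have "vtx_of r n s j = \<sigma> j" if "j \<in> {1..r}" for j
 proof -
  have "?xs ! (j - 1) = (j, \<sigma> j)" using that by (subst nth_map) (auto simp del: upt_Suc)
  thus ?thesis using s by (simp add: vtx_of_def)
 qed
 thus "\<exists>s<length (vlist r n). \<forall>j\<in>{1..r}. vtx_of r n s j = \<sigma> j" using s by blast
qed

subsection \<open>The zigzag of a Sylvester form\<close>

lemma sg_one: "sg x S p = sg x S 1 * (p::'b::comm_ring_1)" by (simp add: sg_def)

lemma sg_split:
 assumes "finite A" "L \<subseteq> A"
 shows "sg i L (sg i (A - L) p) = sg i A p"
proof -
 have "{y\<in>A. y < i} = {y\<in>L. y < i} \<union> {y\<in>A - L. y < i}" using assms by auto
 moreover have "finite L" using assms finite_subset by blast
 ultimately have "card {y\<in>A. y < i} = card {y\<in>L. y < i} + card {y\<in>A - L. y < i}"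
  using assms by (simp only:) (rule card_Un_disjoint, auto)
 thus ?thesis by (simp add: sg_def)
qed

lemma Lhom_one: "1 \<in> Lhom r n W (%j. 0)" by (simp add: Lhom_def fun_eq_iff)

lemma minr_Lhom:
 assumes "finite P" "finite R" "card P = k" "card R = k"
  and "!!i c. i \<in> P ==> c \<in> R ==> g i c \<in> Lhom r n {} (%j. a i j - b c j)"
 shows "minr k g P R \<in> Lhom r n {} (%j. (\<Sum>i\<in>P. a i j) - (\<Sum>c\<in>R. b c j))" using assms
proof (induction k arbitrary: P R)
 case 0
 thus ?case using Lhom_one by simp
next
 case (Suc k)
 have P: "Min P \<in> P" using Suc.prems by (intro Min_in) auto
 show ?case unfolding minr.simps
 proof (intro Lhom_sum Lhom_sg)
  fix c assume c: "c \<in> R"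
  have "minr k g (P - {Min P}) (R - {c}) \<in> Lhom r n {} (%j. (\<Sum>i\<in>P - {Min P}. a i j) - (\<Sum>c\<in>R - {c}. b c j))"
   using Suc.prems P c by (intro Suc.IH) auto
  thus "g (Min P) c * minr k g (P - {Min P}) (R - {c}) \<in> Lhom r n {} (%j. (\<Sum>i\<in>P. a i j) - (\<Sum>c\<in>R. b c j))"
   by (rule Lhom_mult[OF Suc.prems(5)[OF P c]]) (use Suc.prems P c in \<open>simp add: sum.remove[of P "Min P"] sum.remove[of R c]\<close>)
 qed
qed

lemma Lhom_sgl0: "sgl 0 a \<in> Lhom r n W (%j. 0)" by (rule Lhom_single) (auto simp: fun_eq_iff)

lemma Lhom_of_int:
 assumes "p \<in> Lhom r n W \<mu>" shows "of_int z * p \<in> Lhom r n W \<mu>"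
proof (rule Lhom_mult[OF _ assms])
 show "(of_int z :: 'a laur) \<in> Lhom r n W (%j. 0)" using Lhom_sgl0[of "of_int z"] by simp
qed simp

context multiproj
begin

text \<open>A zigzag from p down the whole diagonal to the corner. Zigzags can be added and scaled
  by coefficients, so those of Sylvester forms can be subtracted from that of a given p.\<close>

definition zig :: "(nat => int) => (nat => nat set => xvar set => 'k::comm_ring_1 upoly laur) => 'k cpoly => bool" where
 "zig \<nu> c p \<longleftrightarrow> c 0 = base0 p \<and> (\<forall>q\<le>Suc N. c q \<in> dcx \<nu> q q) \<and> (\<forall>q<Suc N. dK (c (Suc q)) = dT q (c q))"

lemma zig_diff:
 assumes "zig \<nu> c p" "zig \<nu> c' p'"
 shows "zig \<nu> (%q. c q - c' q) (p - p')"
proof -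
 have "base0 (p - p') = base0 p - base0 p'" by (simp add: fun_eq_iff base0_def rhomD[OF rhom_to_laur])
 thus ?thesis using assms by (auto simp: zig_def dK_diff dT_diff dcx_diff)
qed

lemma zig_zero: "zig \<nu> (%q. 0 :: nat set => xvar set => 'k::comm_ring_1 upoly laur) 0"
proof -
 let ?z = "0 :: nat set => xvar set => 'k upoly laur"
 have "base0 0 = ?z" by (simp add: fun_eq_iff base0_def rhomD[OF rhom_to_laur])
 moreover have "dK ?z = 0" "dT q ?z = 0" for q by (simp_all add: fun_eq_iff dK_def dT_def kos_def cobd_def)
 moreover have "?z \<in> dcx \<nu> p q" for p q by (simp add: dcx_def)
 ultimately show ?thesis by (simp add: zig_def)
qed

lemma zig_add:
 assumes "zig \<nu> c p" "zig \<nu> c' p'"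
 shows "zig \<nu> (%q. c q + c' q) (p + p')" using zig_diff[OF assms(1) zig_diff[OF zig_zero assms(2)]] by simp

lemma zig_sum:
 assumes "finite A" "!!x. x \<in> A ==> zig \<nu> (c x) (p x)"
 shows "zig \<nu> (%q. \<Sum>x\<in>A. c x q) (\<Sum>x\<in>A. p x)"
 using assms by (induction A rule: finite_induct) (simp_all add: zig_zero zig_add)

lemma zig_smult:
 assumes "zig \<nu> c p"
 shows "zig \<nu> (%q L W. sgl 0 a * c q L W) (sgl 0 a * p)"
proof -
 have K: "dK (%L W. sgl 0 a * z L W) = (%L W. sgl 0 a * dK z L W)" for z
  by (auto simp: fun_eq_iff dK_def kos_def sum_distrib_left sg_mult_right mult.left_commute)
 have T: "dT q (%L W. sgl 0 a * z L W) = (%L W. sgl 0 a * dT q z L W)" for q z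
  by (auto simp: fun_eq_iff dT_def cobd_def sum_distrib_left sg_mult_right)
 have "base0 (sgl 0 a * p) = (%L W. sgl 0 a * base0 p L W)" by (simp add: fun_eq_iff base0_def rhomD[OF rhom_to_laur])
 moreover have "(%L W. sgl 0 a * z L W) \<in> dcx \<nu> p q" if z: "z \<in> dcx \<nu> p q" for z p q unfolding dcx_def
 proof (intro CollectI allI conjI)
  fix L W
  show "sgl 0 a * z L W \<in> LH W (dg \<nu> L)" by (rule Lhom_mult[OF Lhom_sgl0 dcxD(1)[OF z]]) simp
  show "sgl 0 a * z L W ~= 0 --> L \<subseteq> {..<Suc N} \<and> card L = p \<and> spot q W"
   using dcxD(2-4)[OF z, of L W] by (metis mult_zero_right)
 qed
 ultimately show ?thesis using assms by (auto simp: zig_def K T)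
qed

text \<open>The complementary minors of the matrix of columns, with signs such that they form a chain
 map from the Koszul complex of the \<open>yexp\<close> to the one of the generic forms.\<close>

definition cminor :: "(nat => xvar => 'k::comm_ring_1 upoly laur) => nat set => xvar set => 'k upoly laur" where
 "cminor g L Q = (\<Prod>i\<in>L. sg i {..<Suc N} 1) * (\<Prod>c\<in>Q. sg c (scl r n) 1)
   * minr (Suc N - card Q) g ({..<Suc N} - L) (scl r n - Q)"

lemma card_scl: "card (scl r n) = Suc N" by (simp add: card_scols ntot_def)

text \<open>\<open>minr_expand\<close> for the rows outside L and the columns outside Q;
  \<open>sg_split\<close> and the two products of signs turn signs relative to the complements into
  signs relative to L and Q.\<close>

lemma cminor_kos:
 fixes g :: "nat => xvar => 'k::comm_ring_1 upoly laur"
 assumes F: "!!i. i < Suc N ==> F i = (\<Sum>c\<in>scl r n. g i c * y c)"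
  and L: "L \<subseteq> {..<Suc N}" and Q: "Q \<subseteq> scl r n" "card Q = Suc (card L)"
 shows "kos F (Suc N) (%L. cminor g L Q) L = (\<Sum>c\<in>Q. sg c Q (y c * cminor g L (Q - {c})))"
proof -
 let ?A = "{..<Suc N}" and ?C = "scl r n"
 define k where "k = Suc N - card Q"
 define \<epsilon> where "\<epsilon> = ((\<Prod>i\<in>L. sg i ?A 1) * (\<Prod>c\<in>Q. sg c ?C 1) :: 'k upoly laur)"
 have finC: "finite ?C" by (rule finite_scols) simp
 have finQ: "finite Q" using Q finC finite_subset by blast
 have finL: "finite L" using L finite_subset by blast
 have le: "card Q \<le> Suc N" using card_mono[OF finC Q(1)] card_scl by simp
 have cP: "card (?A - L) = Suc k" using L finL Q le by (simp add: card_Diff_subset k_def)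
 have cR: "card (?C - Q) = k" using Q finQ by (simp add: card_Diff_subset card_scl[simplified] k_def)
 have CQ: "?C - (?C - Q) = Q" using Q by auto
 have "kos F (Suc N) (%L. cminor g L Q) L
   = \<epsilon> * (\<Sum>i\<in>?A - L. sg i (?A - L) (F i * minr k g (?A - L - {i}) (?C - Q)))" unfolding kos_def sum_distrib_left
 proof (rule sum.cong[OF refl])
  fix i assume i: "i \<in> ?A - L"
  have "?A - insert i L = ?A - L - {i}" by auto
  hence "cminor g (insert i L) Q = sg i ?A (\<epsilon> * minr k g (?A - L - {i}) (?C - Q))"
   using i finL unfolding cminor_def k_def[symmetric] \<epsilon>_def by (simp add: sg_mult_left mult.assoc)
  thus "sg i L (F i * cminor g (insert i L) Q) = \<epsilon> * sg i (?A - L) (F i * minr k g (?A - L - {i}) (?C - Q))"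
   using sg_split[of ?A L i] L by (simp add: sg_mult_right sg_split[symmetric] mult.left_commute)
 qed
 also have "(\<Sum>i\<in>?A - L. sg i (?A - L) (F i * minr k g (?A - L - {i}) (?C - Q)))
   = (\<Sum>c\<in>?C - (?C - Q). sg c (?C - Q) (y c * minr (Suc k) g (?A - L) (insert c (?C - Q))))"
  using cP cR finC F by (intro minr_expand) auto
 also have "\<epsilon> * \<dots> = (\<Sum>c\<in>Q. sg c Q (y c * cminor g L (Q - {c})))" unfolding CQ sum_distrib_left
 proof (rule sum.cong[OF refl])
  fix c assume c: "c \<in> Q"
  have e: "\<epsilon> = sg c ?C ((\<Prod>i\<in>L. sg i ?A 1) * (\<Prod>c\<in>Q - {c}. sg c ?C 1))"
   using c finQ unfolding \<epsilon>_def by (simp add: prod.remove[of Q c] sg_mult_left sg_mult_right)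
  have s: "?C - (Q - {c}) = insert c (?C - Q)" using c Q by auto
  have k: "Suc N - card (Q - {c}) = Suc k" using c finQ le Q by (simp add: k_def)
  have "sg c (?C - Q) p = sg c Q (sg c ?C p)" for p :: "'k upoly laur" using sg_split[OF finC Q(1), of c p] by (metis sg_sg)
  moreover have "sg c ?C (sg c Q (sg c ?C p)) = sg c Q p" for p :: "'k upoly laur" by (metis sg_comm sg_sg)
  ultimately show "\<epsilon> * sg c (?C - Q) (y c * minr (Suc k) g (?A - L) (insert c (?C - Q))) = sg c Q (y c * cminor g L (Q - {c}))"
   unfolding cminor_def s k e by (simp add: sg_mult_left sg_mult_right mult_ac del: minr.simps One_nat_def)
 qed
 finally show ?thesis .
qed

end

section \<open>The Sylvester zigzag as a composite of two chain maps\<close>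

context multiproj
begin

text \<open>The monomial factor of the Sylvester form divided by the monomials of the columns in Q.
  For the set of all columns the quotient is x^(-\<alpha>-1).\<close>

definition cmono :: "xmono => xvar set => (xvar \<Rightarrow>\<^sub>0 int)" where
 "cmono \<alpha> Q = emb (sylv_exp r n \<alpha>) - (\<Sum>c\<in>Q. emb (yexp n \<alpha> c))"

definition gmat :: "(nat => nat => nat => 'k::comm_ring_1 cpoly) => nat => xvar => 'k upoly laur" where
 "gmat G i c = to_laur (G i (fst c) (snd c))"

text \<open>From cells W to sets Q of columns by \<open>Lam\<close>, from these to index sets L by
  \<open>cminor\<close>. A set of q columns is a simplex of dimension q - 1, hence the shift. By
  \<open>to_laur_sylv\<close> the Sylvester form is the summand with Q = L = {}.\<close>

definition sylv_zig :: "xmono => (nat => nat => nat => 'k::comm_ring_1 cpoly) => nat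
  => nat set => xvar set => 'k upoly laur" where
 "sylv_zig \<alpha> G q L W = (if q = 0 then base0 (sylv r n \<alpha> G) L W
   else if L \<subseteq> {..<Suc N} \<and> card L = q \<and> spot q W
   then \<Sum>Q\<in>{Q. Q \<subseteq> scl r n \<and> card Q = q}.
    of_int (V.Lam {1..r} (q - 1) W Q) * (sgl (cmono \<alpha> Q) 1 * cminor (gmat G) L Q)
   else 0)"

lemma to_laur_det:
 assumes "finite P" "finite R"
 shows "to_laur (minr k g P R) = minr k (%i c. to_laur (g i c)) P R" using assms
proof (induction k arbitrary: P R)
 case 0
 thus ?case by (simp add: rhomD[OF rhom_to_laur])
next
 case (Suc k)
 have "to_laur (sg x S p) = sg x S (to_laur p)" for x :: 'b and S and p :: "('c \<Rightarrow>\<^sub>0 nat) \<Rightarrow>\<^sub>0 'd"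
  by (simp add: sg_def rhomD[OF rhom_to_laur])
 thus ?case using Suc by (simp add: rhomD[OF rhom_to_laur])
qed

lemma to_laur_sylv: "to_laur (sylv r n \<alpha> G) = sgl (cmono \<alpha> {}) 1 * cminor (gmat G) {} {}"
 unfolding sylv_eq sylv_det_minr[OF r1] cminor_def gmat_def cmono_def
 by (simp add: rhomD[OF rhom_to_laur] to_laur_det finite_scols del: minr.simps)

lemma F_columns:
 assumes "sylv_decomp r n d \<alpha> G" "i < Suc N"
 shows "F i = (\<Sum>c\<in>scl r n. gmat G i c * sgl (emb (yexp n \<alpha> c)) 1)" using F_gen_expand[OF assms(1), of i] assms(2)
 by (simp add: F_laur_def gmat_def rhomD[OF rhom_to_laur] mult.commute)

lemma finite_subsets_scl: "finite {Q. Q \<subseteq> scl r n \<and> card Q = q}"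
 by (rule finite_subset[of _ "Pow (scl r n)"]) (auto simp: finite_scols)

lemma cmono_remove:
 assumes "finite Q" "c \<in> Q"
 shows "sgl (cmono \<alpha> Q) 1 * (sgl (emb (yexp n \<alpha> c)) 1 * x) = sgl (cmono \<alpha> (Q - {c})) 1 * (x :: 'k::comm_ring_1 laur)"
proof -
 have "cmono \<alpha> Q + emb (yexp n \<alpha> c) = cmono \<alpha> (Q - {c})"
  using assms by (simp add: cmono_def sum.remove[of Q c] algebra_simps)
 hence "sgl (cmono \<alpha> Q) 1 * sgl (emb (yexp n \<alpha> c)) 1 = (sgl (cmono \<alpha> (Q - {c})) 1 :: 'k laur)"
  by (simp add: mult_single)
 thus ?thesis by (simp add: mult.assoc[symmetric])
qed

lemma sum_flags:
 fixes f :: "xvar set => xvar => 'b::comm_monoid_add"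
 shows "(\<Sum>Q\<in>{Q. Q \<subseteq> scl r n \<and> card Q = Suc q}. \<Sum>c\<in>Q. f Q c)
   = (\<Sum>Q\<in>{Q. Q \<subseteq> scl r n \<and> card Q = q}. \<Sum>c\<in>scl r n - Q. f (insert c Q) c)"
proof -
 have finC: "finite (scl r n)" by (rule finite_scols) simp
 have fin: "finite Q" if "Q \<subseteq> scl r n" for Q using that finC finite_subset by blast
 have "(\<Sum>Q\<in>{Q. Q \<subseteq> scl r n \<and> card Q = Suc q}. \<Sum>c\<in>Q. f Q c)
   = (\<Sum>(Q, c)\<in>(SIGMA Q:{Q. Q \<subseteq> scl r n \<and> card Q = Suc q}. Q). f Q c)"
  using fin by (intro sum.Sigma finite_subsets_scl) auto
 also have "\<dots> = (\<Sum>(Q, c)\<in>(SIGMA Q:{Q. Q \<subseteq> scl r n \<and> card Q = q}. scl r n - Q). f (insert c Q) c)"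
  by (rule sum.reindex_bij_witness[of _ "%(Q, c). (insert c Q, c)" "%(Q, c). (Q - {c}, c)"])
    (auto simp: insert_absorb fin)
 also have "\<dots> = (\<Sum>Q\<in>{Q. Q \<subseteq> scl r n \<and> card Q = q}. \<Sum>c\<in>scl r n - Q. f (insert c Q) c)"
  using finC by (intro sum.Sigma[symmetric] finite_subsets_scl) auto
 finally show ?thesis .
qed

text \<open>\<open>cminor_kos\<close> moves the Koszul differential from L to the removal of a
  column from Q, and reordering the sum moves it on to the insertion of a column under
  \<open>Lam\<close>.\<close>

lemma sylv_zig_step:
 fixes G :: "nat => nat => nat => 'k::comm_ring_1 cpoly"
 assumes dec: "sylv_decomp r n d \<alpha> G" and L: "L \<subseteq> {..<Suc N}" "card L = q" and W: "spot (Suc q) W"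
 shows "kos F (Suc N) (%L. sylv_zig \<alpha> G (Suc q) L W) L
   = (\<Sum>Q\<in>{Q. Q \<subseteq> scl r n \<and> card Q = q}.
     of_int (\<Sum>c\<in>scl r n - Q. sg c Q (V.Lam {1..r} q W (insert c Q))) * (sgl (cmono \<alpha> Q) 1 * cminor (gmat G) L Q))"
proof -
 let ?S = "%q. {Q. Q \<subseteq> scl r n \<and> card Q = q}"
 let ?l = "V.Lam {1..r} q W"
 have finC: "finite (scl r n)" by (rule finite_scols) simp
 have fin: "finite Q" if "Q \<subseteq> scl r n" for Q using that finC finite_subset by blast
 have finL: "finite L" using L finite_subset by blast
 have "kos F (Suc N) (%L. sylv_zig \<alpha> G (Suc q) L W) L
   = kos F (Suc N) (%L. \<Sum>Q\<in>?S (Suc q). of_int (?l Q) * (sgl (cmono \<alpha> Q) 1 * cminor (gmat G) L Q)) L"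
  using L finL W by (intro kos_cong) (auto simp: sylv_zig_def)
 also have "\<dots> = (\<Sum>Q\<in>?S (Suc q). of_int (?l Q) * (sgl (cmono \<alpha> Q) 1 * kos F (Suc N) (%L. cminor (gmat G) L Q) L))"
  unfolding kos_def sum_distrib_left sg_sum by (subst sum.swap) (simp add: sg_mult_right mult.left_commute)
 also have "\<dots> = (\<Sum>Q\<in>?S (Suc q). \<Sum>c\<in>Q. of_int (sg c (Q - {c}) (?l Q)) * (sgl (cmono \<alpha> (Q - {c})) 1 * cminor (gmat G) L (Q - {c})))"
 proof (rule sum.cong[OF refl])
  fix Q assume Q: "Q \<in> ?S (Suc q)"
  have "kos F (Suc N) (%L. cminor (gmat G) L Q) L
    = (\<Sum>c\<in>Q. sg c Q (sgl (emb (yexp n \<alpha> c)) 1 * cminor (gmat G) L (Q - {c})))"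
   using Q L F_columns[OF dec] by (intro cminor_kos) auto
  hence "of_int (?l Q) * (sgl (cmono \<alpha> Q) 1 * kos F (Suc N) (%L. cminor (gmat G) L Q) L)
   = (\<Sum>c\<in>Q. sg c Q (of_int (?l Q) * (sgl (cmono \<alpha> (Q - {c})) 1 * cminor (gmat G) L (Q - {c}))))"
   using Q fin by (simp add: sum_distrib_left sg_mult_right cmono_remove)
  also have "\<dots> = (\<Sum>c\<in>Q. of_int (sg c (Q - {c}) (?l Q)) * (sgl (cmono \<alpha> (Q - {c})) 1 * cminor (gmat G) L (Q - {c})))"
   using Q fin by (intro sum.cong refl) (simp add: sg_remove, simp add: sg_def)
  finally show "of_int (?l Q) * (sgl (cmono \<alpha> Q) 1 * kos F (Suc N) (%L. cminor (gmat G) L Q) L) = \<dots>" .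
 qed
 also have "\<dots> = (\<Sum>Q\<in>?S q. \<Sum>c\<in>scl r n - Q. of_int (sg c (insert c Q - {c}) (?l (insert c Q)))
   * (sgl (cmono \<alpha> (insert c Q - {c})) 1 * cminor (gmat G) L (insert c Q - {c})))" by (rule sum_flags)
 also have "\<dots> = (\<Sum>Q\<in>?S q. of_int (\<Sum>c\<in>scl r n - Q. sg c Q (?l (insert c Q))) * (sgl (cmono \<alpha> Q) 1 * cminor (gmat G) L Q))"
 proof (rule sum.cong[OF refl])
  fix Q assume "Q \<in> ?S q"
  have eq: "insert c Q - {c} = Q" if "c \<in> scl r n - Q" for c using that by auto
  show "(\<Sum>c\<in>scl r n - Q. of_int (sg c (insert c Q - {c}) (?l (insert c Q)))
   * (sgl (cmono \<alpha> (insert c Q - {c})) 1 * cminor (gmat G) L (insert c Q - {c})))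
   = of_int (\<Sum>c\<in>scl r n - Q. sg c Q (?l (insert c Q))) * (sgl (cmono \<alpha> Q) 1 * cminor (gmat G) L Q)"
   unfolding of_int_sum sum_distrib_right by (rule sum.cong[OF refl]) (simp only: eq)
 qed
 finally show ?thesis .
qed

text \<open>By \<open>Lam_support\<close> each column in Q comes from a transversal contained in W,
  and the monomial of such a column uses only variables of the transversal. So the denominators stay
  inside W; this is what forces the choice of \<open>col_of\<close>.\<close>

lemma cmono_Lexp:
 assumes lam: "V.Lam {1..r} q W Q ~= 0" and W: "spot (Suc q) W" and Q: "card Q = Suc q"
 shows "cmono \<alpha> Q \<in> Lexp r n W"
proof -
 have cell: "W \<in> cells r n" "card W = r + q" using W by (auto simp: spot_def)
 have Wx: "W \<subseteq> VV" using cell by (simp add: cells_def)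
 have sup: "Q \<subseteq> (%s. col_of {1..r} r n (vtx_of r n s)) ` V.verts W" by (rule V.Lam_support[OF cell Q lam])
 have y: "v \<in> W" if c: "c \<in> Q" and v: "v \<in> pkeys (yexp n \<alpha> c)" for c v
 proof -
  obtain s where s: "s \<in> V.verts W" "c = col_of {1..r} r n (vtx_of r n s)" using sup c by blast
  let ?\<sigma> = "vtx_of r n s"
  have sW: "(j, ?\<sigma> j) \<in> W" if "j \<in> {1..r}" for j using s that by (simp add: V.verts_def)
  have fin: "finite {1..r}" by simp
  have vv: "v = c \<or> (1 \<le> fst v \<and> fst v < fst c \<and> snd v = n (fst v))"
   using v by (auto simp: in_keys_iff lkp_yexp split: if_splits)
  show ?thesis
  proof (cases rule: col_of_cases[OF fin, of ?\<sigma> n r])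
   case 1
   hence "c = (r, n r)" using s by (simp add: last_col_def)
   hence "fst v \<in> {1..r}" "snd v = n (fst v)" using vv r1 by auto
   thus ?thesis using sW[of "fst v"] 1 by (metis prod.collapse)
  next
   case (2 j)
   hence c': "c = (j, ?\<sigma> j)" using s by simp
   hence "fst v \<in> {1..r}" "snd v = ?\<sigma> (fst v)" using vv 2 by auto
   thus ?thesis using sW[of "fst v"] by (metis prod.collapse)
  qed
 qed
 have m: "pkeys (sylv_exp r n \<alpha>) \<subseteq> VV" by (auto simp: in_keys_iff lkp_sylv_exp xvars_def split: if_splits)
 have lk: "lkp (cmono \<alpha> Q) v = int (lkp (sylv_exp r n \<alpha>) v) - (\<Sum>c\<in>Q. int (lkp (yexp n \<alpha> c) v))" for v
  by (simp add: cmono_def lookup_minus lookup_sum)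
 have z: "(\<Sum>c\<in>Q. int (lkp (yexp n \<alpha> c) v)) = 0" if "v \<notin> W" for v
 proof (rule sum.neutral, intro ballI)
  fix c assume "c \<in> Q"
  hence "v \<notin> pkeys (yexp n \<alpha> c)" using y that by blast
  thus "int (lkp (yexp n \<alpha> c) v) = 0" by (simp add: in_keys_iff)
 qed
 have "v \<in> VV" if "v \<in> pkeys (cmono \<alpha> Q)" for v
 proof (cases "v \<in> W")
  case False
  hence "v \<in> pkeys (sylv_exp r n \<alpha>)" using that z by (simp add: in_keys_iff lk)
  thus ?thesis using m by blast
 qed (use Wx in blast)
 moreover have "v \<in> W" if "lkp (cmono \<alpha> Q) v < 0" for v using that z by (cases "v \<in> W") (auto simp: lk)
 ultimately show ?thesis by (auto simp: Lexp_def)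
qed

lemma ldeg_sum: "ldeg n (sum f A) j = (\<Sum>x\<in>A. ldeg n (f x) j)" unfolding ldeg_def by (simp add: lookup_sum) (rule sum.swap)

lemma xmono_deg_ones: "xmono_deg n (ones r n) j = (if j \<in> {1..r} then int (n j) + 1 else 0)"
 by (simp add: xmono_deg_def lkp_ones xvars_def)

text \<open>By \<open>sum_yexp\<close> all column monomials together have the degree of the monomial
  factor, of \<alpha> and of the product of all variables. With \<alpha> of degree \<delta> - \<nu>,
  the definition of \<delta> leaves \<nu>.\<close>

lemma cmono_degree:
 assumes "\<alpha> \<in> Mon (dlt - \<nu>)" "\<nu> \<in> Zvec r"
 shows "ldeg n (cmono \<alpha> Q) j + (\<Sum>i\<in>{..<Suc N}. d i j) + (\<Sum>c\<in>Q. xmono_deg n (yexp n \<alpha> c) j)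
    - (\<Sum>c\<in>scl r n. xmono_deg n (yexp n \<alpha> c) j) = \<nu> j"
proof -
 have \<alpha>: "pkeys \<alpha> \<subseteq> VV" "xmono_deg n \<alpha> j = dlt j - \<nu> j"
  using assms by (auto simp: xmonos_def)
 have "(\<Sum>c\<in>scl r n. xmono_deg n (yexp n \<alpha> c) j) = ldeg n (emb (\<Sum>c\<in>scl r n. yexp n \<alpha> c)) j"
 proof -
  have "emb (sum f A) = (\<Sum>c\<in>A. emb (f c))" for f :: "xvar => xmono" and A
   by (induction A rule: infinite_finite_induct) (simp_all add: emb_add)
  thus ?thesis by (simp add: ldeg_sum ldeg_emb)
 qed
 also have "\<dots> = xmono_deg n (sylv_exp r n \<alpha>) j + xmono_deg n \<alpha> j + xmono_deg n (ones r n) j"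
  unfolding sum_yexp[OF r1 \<alpha>(1)] ldeg_emb by (simp add: xmono_deg_add)
 finally have "(\<Sum>c\<in>scl r n. xmono_deg n (yexp n \<alpha> c) j) = \<dots>" .
 moreover have "ldeg n (cmono \<alpha> Q) j = xmono_deg n (sylv_exp r n \<alpha>) j - (\<Sum>c\<in>Q. xmono_deg n (yexp n \<alpha> c) j)"
  by (simp add: cmono_def ldeg_diff ldeg_sum ldeg_emb)
 moreover have "(\<Sum>i\<in>{..<Suc N}. d i j) = (if j \<in> {1..r} then dlt j + int (n j) + 1 else 0)"
 proof (cases "j \<in> {1..r}")
  case False
  hence "!!i. i < Suc N ==> d i j = 0" using dZ by (auto simp: Zvec_def)
  thus ?thesis unfolding if_not_P[OF False] by (intro sum.neutral) simp
 qed (simp add: delta_def lessThan_Suc_atMost)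
 moreover have "dlt j = 0 \<and> \<nu> j = 0" if "j \<notin> {1..r}"
  unfolding delta_def if_not_P[OF that] using that assms(2) by (simp add: Zvec_def)
 ultimately show ?thesis using \<alpha>(2) by (auto simp: xmono_deg_ones)
qed

lemma cminor_Lhom:
 assumes dec: "sylv_decomp r n d \<alpha> G" and L: "L \<subseteq> {..<Suc N}" and Q: "Q \<subseteq> scl r n" "card Q = card L"
 shows "cminor (gmat G) L Q \<in> LH {} (%j. (\<Sum>i\<in>{..<Suc N} - L. d i j) - (\<Sum>c\<in>scl r n - Q. xmono_deg n (yexp n \<alpha> c) j))"
proof -
 have finC: "finite (scl r n)" by (rule finite_scols) simp
 have finQ: "finite Q" using Q finC finite_subset by blast
 have finL: "finite L" using L finite_subset by blast
 have sgn: "(\<Prod>i\<in>A. sg i B 1) \<in> LH {} (%j. 0)" if "finite A" for A B using that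
 proof (induction A rule: finite_induct)
  case (insert x A)
  thus ?case unfolding prod.insert[OF insert.hyps] by (intro Lhom_mult[OF Lhom_sg[OF Lhom_one] insert.IH]) simp
 qed (simp add: Lhom_one)
 have "minr (Suc N - card Q) (gmat G) ({..<Suc N} - L) (scl r n - Q)
  \<in> LH {} (%j. (\<Sum>i\<in>{..<Suc N} - L. d i j) - (\<Sum>c\<in>scl r n - Q. xmono_deg n (yexp n \<alpha> c) j))"
  using L Q finL finQ finC column_degree[OF dec] by (intro minr_Lhom) (auto simp: card_Diff_subset card_scl[simplified] gmat_def)
 thus ?thesis unfolding cminor_def by (intro Lhom_mult[OF Lhom_mult[OF sgn[OF finL] sgn[OF finQ]]]) auto
qed

lemma sylv_zig_dcx:
 fixes G :: "nat => nat => nat => 'k::comm_ring_1 cpoly"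
 assumes dec: "sylv_decomp r n d \<alpha> G" and \<alpha>: "\<alpha> \<in> Mon (dlt - \<nu>)" and \<nu>: "\<nu> \<in> Zvec r"
 shows "sylv_zig \<alpha> G q \<in> dcx \<nu> q q" and "sylv r n \<alpha> G \<in> XD UNIV \<nu>"
proof -
 have finC: "finite (scl r n)" by (rule finite_scols) simp
 have mem: "sgl (cmono \<alpha> Q) 1 * cminor (gmat G) L Q \<in> LH W (dg \<nu> L)"
  if L: "L \<subseteq> {..<Suc N}" and Q: "Q \<subseteq> scl r n" "card Q = card L" and m: "cmono \<alpha> Q \<in> Lexp r n W" for L Q W
 proof (rule Lhom_mult)
  show "sgl (cmono \<alpha> Q) 1 \<in> LH W (ldeg n (cmono \<alpha> Q))" by (rule Lhom_single[OF m refl])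
  show "cminor (gmat G) L Q \<in> LH W (%j. (\<Sum>i\<in>{..<Suc N} - L. d i j) - (\<Sum>c\<in>scl r n - Q. xmono_deg n (yexp n \<alpha> c) j))"
   using cminor_Lhom[OF dec L Q] Lhom_mono[of "{}" W] by blast
  fix j
  have "(\<Sum>i\<in>{..<Suc N} - L. d i j) = (\<Sum>i\<in>{..<Suc N}. d i j) - (\<Sum>i\<in>L. d i j)"
   using L by (intro sum_diff) auto
  moreover have "(\<Sum>c\<in>scl r n - Q. xmono_deg n (yexp n \<alpha> c) j)
    = (\<Sum>c\<in>scl r n. xmono_deg n (yexp n \<alpha> c) j) - (\<Sum>c\<in>Q. xmono_deg n (yexp n \<alpha> c) j)"
   using Q finC by (intro sum_diff) auto
  ultimately show "ldeg n (cmono \<alpha> Q) j + ((\<Sum>i\<in>{..<Suc N} - L. d i j) - (\<Sum>c\<in>scl r n - Q. xmono_deg n (yexp n \<alpha> c) j)) = dg \<nu> L j"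
   using cmono_degree[OF \<alpha> \<nu>, of Q j] by (simp add: dg_def)
 qed
 have "pkeys (sylv_exp r n \<alpha>) \<subseteq> VV" by (auto simp: in_keys_iff lkp_sylv_exp xvars_def split: if_splits)
 hence "cmono \<alpha> {} \<in> Lexp r n {}" by (simp add: cmono_def)
 from mem[OF _ _ _ this, of "{}"] have "to_laur (sylv r n \<alpha> G) \<in> LH {} \<nu>"
  unfolding to_laur_sylv by (simp add: dg_def)
 thus s: "sylv r n \<alpha> G \<in> XD UNIV \<nu>" by (simp add: to_laur_in_Lhom)
 show "sylv_zig \<alpha> G q \<in> dcx \<nu> q q"
 proof (cases "q = 0")
  case True
  hence "sylv_zig \<alpha> G q = base0 (sylv r n \<alpha> G)" by (simp add: fun_eq_iff sylv_zig_def)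
  thus ?thesis using base0_dcx[OF s] True by simp
 next
  case False
  show ?thesis unfolding dcx_def
  proof (intro CollectI allI conjI)
   fix L W
   show "sylv_zig \<alpha> G q L W ~= 0 --> L \<subseteq> {..<Suc N} \<and> card L = q \<and> spot q W"
    using False by (auto simp: sylv_zig_def)
   have "of_int (V.Lam {1..r} (q - 1) W Q) * (sgl (cmono \<alpha> Q) 1 * cminor (gmat G) L Q) \<in> LH W (dg \<nu> L)"
    if LW: "L \<subseteq> {..<Suc N}" "card L = q" "spot q W" and Q: "Q \<subseteq> scl r n" "card Q = q" for Q
   proof (cases "V.Lam {1..r} (q - 1) W Q = 0")
    case nz: False
    have "cmono \<alpha> Q \<in> Lexp r n W" using cmono_Lexp[OF nz] LW Q False by simp
    thus ?thesis using LW Q by (intro Lhom_of_int mem) auto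
   qed simp
   thus "sylv_zig \<alpha> G q L W \<in> LH W (dg \<nu> L)" using False by (auto simp: sylv_zig_def intro!: Lhom_sum)
  qed
 qed
qed

text \<open>After \<open>sylv_zig_step\<close> an identity between integers remains for each Q: the
  chain map property of \<open>Lam\<close>, and for q = 0 the augmentation identity
  \<open>Lam_vertex_sum\<close>.\<close>

lemma sylv_zig:
 fixes G :: "nat => nat => nat => 'k::comm_ring_1 cpoly"
 assumes dec: "sylv_decomp r n d \<alpha> G" and \<alpha>: "\<alpha> \<in> Mon (dlt - \<nu>)" and \<nu>: "\<nu> \<in> Zvec r"
 shows "zig \<nu> (sylv_zig \<alpha> G) (sylv r n \<alpha> G)" unfolding zig_def
proof (intro conjI allI impI)
 show "sylv_zig \<alpha> G 0 = base0 (sylv r n \<alpha> G)" by (simp add: fun_eq_iff sylv_zig_def)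
 show mem: "sylv_zig \<alpha> G q \<in> dcx \<nu> q q" for q by (rule sylv_zig_dcx[OF assms])
 let ?S = "%q. {Q. Q \<subseteq> scl r n \<and> card Q = q}"
 fix q assume "q < Suc N"
 show "dK (sylv_zig \<alpha> G (Suc q)) = dT q (sylv_zig \<alpha> G q)"
 proof (intro ext)
  fix L W
  have m1: "dK (sylv_zig \<alpha> G (Suc q)) \<in> dcx \<nu> q (Suc q)" by (rule dK_dcx[OF mem])
  have m2: "dT q (sylv_zig \<alpha> G q) \<in> dcx \<nu> q (Suc q)" by (rule dT_dcx[OF mem])
  show "dK (sylv_zig \<alpha> G (Suc q)) L W = dT q (sylv_zig \<alpha> G q) L W"
  proof (cases "L \<subseteq> {..<Suc N} \<and> card L = q \<and> spot (Suc q) W")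
   case False
   hence "dK (sylv_zig \<alpha> G (Suc q)) L W = 0" "dT q (sylv_zig \<alpha> G q) L W = 0"
    using dcxD[OF m1, of L W] dcxD[OF m2, of L W] by blast+
   thus ?thesis by simp
  next
   case True
   hence L: "L \<subseteq> {..<Suc N}" "card L = q" and W: "spot (Suc q) W" by auto
   have cell: "W \<in> cells r n" "card W = r + q" using W by (auto simp: spot_def)
   have Wx: "W \<subseteq> VV" and finW: "finite W" using cell cells_finite by (auto simp: cells_def)
   let ?X = "%Q. sgl (cmono \<alpha> Q) 1 * cminor (gmat G) L Q"
   have lhs: "dK (sylv_zig \<alpha> G (Suc q)) L W
    = (\<Sum>Q\<in>?S q. of_int (\<Sum>c\<in>scl r n - Q. sg c Q (V.Lam {1..r} q W (insert c Q))) * ?X Q)"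
    using sylv_zig_step[OF dec L W] L by (simp add: dK_def)
   show ?thesis
   proof (cases q)
    case 0
    have finC: "finite (scl r n)" by (rule finite_scols) simp
    have S0: "?S 0 = {{}}" using finite_subset[OF _ finC] by (auto simp: card_eq_0_iff simp del: One_nat_def)
    have "(\<Sum>c\<in>scl r n. V.Lam {1..r} 0 W {c}) = 1" using cell by (intro V.Lam_vertex_sum) auto
    moreover have "L = {}" using L 0 finite_subset by fastforce
    moreover have "spot 1 W" using W 0 by simp
    ultimately show ?thesis unfolding lhs unfolding 0 S0 by (simp add: dT_def to_laur_sylv sylv_zig_def base0_def del: One_nat_def)
   next
    case (Suc q')
    have spotw: "spot q (W - {w}) \<longleftrightarrow> W - {w} \<in> cells r n" if "w \<in> W" for w
     using that finW cell Suc by (auto simp: spot_def card_Suc_Diff1)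
    have "dT q (sylv_zig \<alpha> G q) L W = (\<Sum>w\<in>W. sg w W (sylv_zig \<alpha> G q L (W - {w})))"
     using Wx Suc by (simp add: dT_def cobd_def)
    also have "\<dots> = (\<Sum>w\<in>W. \<Sum>Q\<in>?S q. of_int (sg w W (if W - {w} \<in> cells r n then V.Lam {1..r} q' (W - {w}) Q else 0)) * ?X Q)"
    proof (rule sum.cong[OF refl])
     fix w assume w: "w \<in> W"
     have "sg w W (sylv_zig \<alpha> G q L (W - {w}))
      = (\<Sum>Q\<in>?S q. sg w W (of_int (if W - {w} \<in> cells r n then V.Lam {1..r} q' (W - {w}) Q else 0) * ?X Q))"
      using L spotw[OF w] Suc by (simp add: sylv_zig_def sg_sum)
     also have "\<dots> = (\<Sum>Q\<in>?S q. of_int (sg w W (if W - {w} \<in> cells r n then V.Lam {1..r} q' (W - {w}) Q else 0)) * ?X Q)"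
      by (intro sum.cong refl) (simp add: sg_def)
     finally show "sg w W (sylv_zig \<alpha> G q L (W - {w})) = \<dots>" .
    qed
    also have "\<dots> = (\<Sum>Q\<in>?S q. of_int (cell_bd r n (%W. V.Lam {1..r} q' W Q) W) * ?X Q)"
     by (subst sum.swap) (simp only: cell_bd_eq of_int_sum sum_distrib_right)
    also have "\<dots> = (\<Sum>Q\<in>?S q. of_int (\<Sum>c\<in>scl r n - Q. sg c Q (V.Lam {1..r} q W (insert c Q))) * ?X Q)"
    proof (rule sum.cong[OF refl])
     fix Q assume "Q \<in> ?S q"
     hence "(\<Sum>c\<in>scl r n - Q. sg c Q (V.Lam {1..r} (Suc q') W (insert c Q))) = cell_bd r n (%W. V.Lam {1..r} q' W Q) W"
      using cell Suc by (intro V.Lam_chain_map) auto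
     thus "of_int (cell_bd r n (%W. V.Lam {1..r} q' W Q) W) * ?X Q
      = of_int (\<Sum>c\<in>scl r n - Q. sg c Q (V.Lam {1..r} q W (insert c Q))) * ?X Q" by (simp only: Suc)
    qed
    finally show ?thesis unfolding lhs ..
   qed
  qed
 qed
qed

end

lemma prod_unit: "(!!i. i \<in> A ==> f i = 1 \<or> f i = - 1) ==> prod f A = 1 \<or> prod f A = (- 1 :: 'a::comm_ring_1)"
proof (induction A rule: infinite_finite_induct)
 case (insert x A)
 hence "f x = 1 \<or> f x = - 1" "prod f A = 1 \<or> prod f A = - 1" by auto
 thus ?case unfolding prod.insert[OF insert.hyps] by (elim disjE) simp_all
qed simp_all

lemma emb_sum: "emb (sum f A) = (\<Sum>c\<in>A. emb (f c))" by (induction A rule: infinite_finite_induct) (simp_all add: emb_add)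

lemma clear_denominators:
 assumes h: "h \<in> Lring r n ((%j. (j, \<sigma> j)) ` {1..r})" and \<sigma>: "!!j. j \<in> {1..r} ==> \<sigma> j \<le> n j"
 shows "\<exists>k0. \<forall>k\<ge>k0. sgl (emb (vmono r \<sigma> (%_. k))) 1 * h \<in> Lring r n {}"
proof -
 let ?V = "xvars r n"
 define k0 where "k0 = Max (insert 0 ((%(a, v). nat (- lkp a v)) ` (pkeys h \<times> ?V)))"
 have k0: "- lkp a v \<le> int k0" if a: "a \<in> pkeys h" for a v
 proof (cases "v \<in> ?V")
  case True
  hence "nat (- lkp a v) \<le> k0" unfolding k0_def using a by (intro Max_ge) auto
  thus ?thesis by simp
 next
  case False
  hence "v \<notin> pkeys a" using h a by (auto simp: Lring_def Lexp_def)
  thus ?thesis by (simp add: in_keys_iff)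
 qed
 have "sgl (emb (vmono r \<sigma> (%_. k))) 1 * h \<in> Lring r n {}" if k: "k \<ge> k0" for k unfolding Lring_def
 proof (intro CollectI subsetI)
  let ?e = "emb (vmono r \<sigma> (%_. k))"
  fix b assume "b \<in> pkeys (sgl ?e 1 * h)"
  then obtain a where a: "a \<in> pkeys h" "b = ?e + a" using Poly_Mapping.keys_mult[of "sgl ?e 1" h] by (auto split: if_splits)
  have aL: "pkeys a \<subseteq> ?V" "neg_part a \<subseteq> (%j. (j, \<sigma> j)) ` {1..r}"
   using h a by (auto simp: Lring_def subset_iff Lexp_alt)
  have "pkeys ?e \<subseteq> ?V" using keys_vmono[of r \<sigma> "%_. k"] \<sigma> by (fastforce simp: xvars_def)
  hence "pkeys b \<subseteq> ?V" using aL a Poly_Mapping.keys_add[of ?e a] by blast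
  moreover have "lkp b v \<ge> 0" for v
  proof (cases "lkp a v < 0")
   case True
   hence "v \<in> (%j. (j, \<sigma> j)) ` {1..r}" using aL by (auto simp: neg_part_def)
   hence "lkp (vmono r \<sigma> (%_. k)) v = k" by (auto simp: lkp_vmono)
   thus ?thesis using k0[OF a(1), of v] k by (simp add: a(2) lookup_add)
  next
   case False
   thus ?thesis by (simp add: a(2) lookup_add)
  qed
  ultimately show "b \<in> Lexp r n {}" by (auto simp: Lexp_def not_less)
 qed
 thus ?thesis by blast
qed

section \<open>Sylvester forms in the saturation, and the corner of a zigzag\<close>

context multiproj
begin

text \<open>The first step of the zigzag at the vertex \<sigma> writes p as a combination of the
  forms with powers of x_\<sigma> as denominators.\<close>

lemma zig_in_sat:
 assumes "zig \<nu> c p"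
 shows "in_sat p" unfolding in_sat_def
proof (intro allI impI)
 fix \<sigma> assume \<sigma>: "\<forall>j\<in>{1..r}. \<sigma> j \<le> n j"
 let ?W = "(%j. (j, \<sigma> j)) ` {1..r}"
 have W: "spot 1 ?W"
 proof -
  have "?W \<in> cells r n" using \<sigma> by (auto simp: cells_def xvars_def grp_def)
  moreover have "card ?W = r" by (subst card_image) (auto simp: inj_on_def)
  ultimately show ?thesis using spot1 by blast
 qed
 have "c 0 = base0 p" "dK (c (Suc 0)) = dT 0 (c 0)" "c (Suc 0) \<in> dcx \<nu> (Suc 0) (Suc 0)"
  using assms unfolding zig_def by auto
 hence "dK (c 1) {} ?W = to_laur p" using W by (simp add: dT_def base0_def)
 hence p: "to_laur p = (\<Sum>i<Suc N. F i * c 1 {i} ?W)" by (simp add: dK_def kos_def)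
 have h: "c 1 {i} ?W \<in> LR ?W" for i
  using dcxD(1)[OF \<open>c (Suc 0) \<in> _\<close>, of "{i}" ?W] by (simp add: Lhom_def)
 have "\<forall>i. \<exists>k0. \<forall>k\<ge>k0. sgl (emb (vmono r \<sigma> (%_. k))) 1 * c 1 {i} ?W \<in> LR {}"
  using clear_denominators[OF h] \<sigma> by blast
 from choice[OF this] obtain k0 where k0: "!!i k. k \<ge> k0 i ==> sgl (emb (vmono r \<sigma> (%_. k))) 1 * c 1 {i} ?W \<in> LR {}"
  by blast
 define k where "k = Max (k0 ` {..N})"
 let ?m = "vmono r \<sigma> (%_. k)"
 have k: "sgl (emb ?m) 1 * c 1 {i} ?W \<in> LR {}" if "i \<le> N" for i using that by (intro k0) (auto simp: k_def)
 have "\<forall>i. \<exists>g. i \<le> N --> to_laur g = sgl (emb ?m) 1 * c 1 {i} ?W \<and> g \<in> mpolys (VV) UNIV"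
 proof
  fix i
  show "\<exists>g. i \<le> N --> to_laur g = sgl (emb ?m) 1 * c 1 {i} ?W \<and> g \<in> mpolys (VV) UNIV"
  proof (cases "i \<le> N")
   case True
   from Lring_empty_to_laur[OF k[OF this]] show ?thesis by blast
  qed simp
 qed
 from choice[OF this] obtain g where g: "!!i. i \<le> N ==> to_laur (g i) = sgl (emb ?m) 1 * c 1 {i} ?W"
  "!!i. i \<le> N ==> g i \<in> mpolys (VV) UNIV" by blast
 have "to_laur (sgl ?m 1 * p) = to_laur (\<Sum>i\<le>N. g i * FG i)"
 proof -
  have "to_laur (sgl ?m 1 * p) = (\<Sum>i\<le>N. sgl (emb ?m) 1 * (F i * c 1 {i} ?W))"
   by (simp only: rhomD[OF rhom_to_laur] p lessThan_Suc_atMost sum_distrib_left to_laur_single)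
  also have "\<dots> = (\<Sum>i\<le>N. to_laur (g i) * F i)" using g(1) by (intro sum.cong refl) (simp add: mult_ac)
  finally show ?thesis by (simp only: rhomD[OF rhom_to_laur] F_laur_def)
 qed
 hence "in_ideal (sgl ?m 1 * p)" unfolding in_ideal_def using g(2) to_laur_eq_iff by blast
 thus "\<exists>k. in_ideal (sgl (vmono r \<sigma> (%_. k)) 1 * p)" by blast
qed

lemma cmono_top:
 assumes "pkeys \<alpha> \<subseteq> VV"
 shows "cmono \<alpha> (scl r n) = - (emb \<alpha> + emb (ones r n))"
 using arg_cong[OF sum_yexp[OF r1 assms], of emb] by (simp add: cmono_def emb_add emb_sum[symmetric])

lemma spot_top: "spot (Suc N) W \<longleftrightarrow> W = VV"
proof
 assume "spot (Suc N) W"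
 hence "W \<subseteq> VV" "card W = card (VV)" by (auto simp: spot_def cells_def card_xvars)
 thus "W = VV" by (intro card_subset_eq) auto
next
 assume "W = VV"
 moreover have "VV \<in> cells r n" by (auto simp: cells_def xvars_def grp_def)
 ultimately show "spot (Suc N) W" by (simp add: spot_def card_xvars)
qed

text \<open>With J the set of all groups, the columns other than the last are exactly the variables
  off the top vertex, so \<open>Lam_unit\<close> applies.\<close>

lemma Lam_top: "\<bar>V.Lam {1..r} N (VV) (scl r n)\<bar> = 1"
proof -
 have "scl r n = insert (last_col r n) (VV - V.top_vertex)" by (auto simp: scols_def V.top_vertex_def xvars_def)
 moreover have "\<bar>V.Lam {1..r} N (VV) (insert (last_col r n) (VV - V.top_vertex))\<bar> = 1"
 proof (rule V.Lam_unit)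
  show "card (VV) = r + N" by (simp add: card_xvars)
 qed (auto simp: V.top_vertex_def xvars_def grp_def)
 ultimately show ?thesis by simp
qed

text \<open>The same for every \<alpha> and every decomposition; that it is 1 or -1 comes from
  \<open>Lam_top\<close>.\<close>

definition top_sign :: "'k::comm_ring_1 upoly laur" where
 "top_sign = of_int (V.Lam {1..r} N (VV) (scl r n)) *
   ((\<Prod>i\<in>{..<Suc N}. sg i {..<Suc N} 1) * (\<Prod>c\<in>scl r n. sg c (scl r n) 1))"

lemma top_sign: "top_sign = (1 :: 'k upoly laur) \<or> top_sign = (- 1 :: 'k::comm_ring_1 upoly laur)"
proof -
 have 2: "(\<Prod>i\<in>A. sg i B (1 :: 'k upoly laur)) = 1 \<or> (\<Prod>i\<in>A. sg i B (1 :: 'k upoly laur)) = - 1"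
  for A B :: "xvar set" by (rule prod_unit) (simp add: sg_def)
 have 1: "(\<Prod>i\<in>A. sg i B (1 :: 'k upoly laur)) = 1 \<or> (\<Prod>i\<in>A. sg i B (1 :: 'k upoly laur)) = - 1"
  for A B :: "nat set" by (rule prod_unit) (simp add: sg_def)
 have 3: "V.Lam {1..r} N (VV) (scl r n) = 1 \<or> V.Lam {1..r} N (VV) (scl r n) = - 1" using Lam_top by linarith
 have 4: "of_int z * (x * y) = 1 \<or> of_int z * (x * y) = (- 1 :: 'k upoly laur)"
  if "z = 1 \<or> z = - 1" "x = 1 \<or> x = - 1" "y = 1 \<or> y = - 1" for z x y using that by (elim disjE) simp_all
 show ?thesis unfolding top_sign_def by (rule 4[OF 3 1 2])
qed

text \<open>In the corner the complementary minor has size 0, so the chosen decomposition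
  disappears.\<close>

lemma sylv_zig_top:
 assumes "pkeys \<alpha> \<subseteq> VV"
 shows "sylv_zig \<alpha> G (Suc N) {..<Suc N} (VV) = top_sign * sgl (- (emb \<alpha> + emb (ones r n))) 1"
proof -
 have finC: "finite (scl r n)" by (rule finite_scols) simp
 have "{Q. Q \<subseteq> scl r n \<and> card Q = Suc N} = {scl r n}" using card_scl card_subset_eq[OF finC] by auto
 moreover have "spot (Suc N) (VV)" by (simp add: spot_top)
 ultimately have "sylv_zig \<alpha> G (Suc N) {..<Suc N} (VV)
   = of_int (V.Lam {1..r} N (VV) (scl r n)) * (sgl (cmono \<alpha> (scl r n)) 1 * cminor (gmat G) {..<Suc N} (scl r n))"
  by (simp add: sylv_zig_def del: One_nat_def)
 also have "cminor (gmat G) {..<Suc N} (scl r n) = (\<Prod>i\<in>{..<Suc N}. sg i {..<Suc N} 1) * (\<Prod>c\<in>scl r n. sg c (scl r n) 1)"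
  unfolding cminor_def card_scl by simp
 finally show ?thesis unfolding top_sign_def cmono_top[OF assms] by (simp only: mult_ac)
qed

text \<open>Some form i is missing from L, and d i j exceeds \<delta> j - \<nu> j. The degree in a
  group j of J is then too large for all its exponents to be negative.\<close>

lemma good_spot_below_delta:
 assumes \<mu>: "!!i j. i \<le> N ==> j \<in> {1..r} ==> dlt j - \<nu> j < d i j"
  and q: "q \<le> N"
 shows "good_spot \<nu> q" unfolding good_spot_def
proof (intro allI impI)
 fix L a J assume L: "L \<subseteq> {..N}" "card L = q" and a: "pkeys a \<subseteq> VV" "ldeg n a = dg \<nu> L"
  and J: "J \<subseteq> {1..r}" "J ~= {}" "neg_part a = (\<Union>j\<in>J. grp n j)"
 obtain j where j: "j \<in> J" using J by blast
 hence jr: "j \<in> {1..r}" using J by blast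
 have "ldeg n a j \<le> (\<Sum>l\<le>n j. - 1)" unfolding ldeg_def
 proof (rule sum_mono)
  fix l assume "l \<in> {..n j}"
  hence "(j, l) \<in> neg_part a" using J j by (auto simp: grp_def)
  thus "lkp a (j, l) \<le> - 1" by (simp add: neg_part_def)
 qed
 hence 1: "\<nu> j - (\<Sum>i\<in>L. d i j) \<le> - int (n j) - 1" using a by (simp add: dg_def)
 have finL: "finite L" using L finite_subset by blast
 have "L ~= {..N}" using L q by auto
 then obtain i where i: "i \<le> N" "i \<notin> L" using L by auto
 have "(\<Sum>i\<le>N. d i j) = (\<Sum>i\<in>L. d i j) + (\<Sum>i\<in>{..N} - L. d i j)"
  using L by (simp add: sum.subset_diff[of L "{..N}"] add.commute)
 moreover have "(\<Sum>k\<in>{..N} - L. d k j) \<ge> d i j"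
 proof (rule member_le_sum)
  show "0 \<le> d k j" if "k \<in> {..N} - L - {i}" for k using d1[of k j] that jr by auto
 qed (use i in auto)
 moreover have "dlt j = (\<Sum>i\<le>N. d i j) - (int (n j) + 1)" using jr by (simp add: delta_def)
 ultimately have False using 1 \<mu>[OF i(1) jr] by linarith
 thus "q ~= (\<Sum>j\<in>J. n j) + 1" ..
qed

text \<open>In the corner the fully negative monomials of the right degree are exactly the
  x^(-\<alpha>-1) of the Sylvester forms, and subtracting suitable multiples clears them. What is
  left is exact there, because a proper subset J has too small a dimension, and further down by
  \<open>good_spot_below_delta\<close>.\<close>

theorem sat_sylvester:
 fixes p :: "'k::comm_ring_1 cpoly"
 assumes \<mu>: "!!i j. i \<le> N ==> j \<in> {1..r} ==> dlt j - \<nu> j < d i j"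
  and \<nu>: "\<nu> \<in> Zvec r"
  and dec: "!!\<alpha>. \<alpha> \<in> Mon (dlt - \<nu>) ==> sylv_decomp r n d \<alpha> (G \<alpha>)"
  and p: "p \<in> XD UNIV \<nu>" "in_sat p"
 shows "\<exists>a. in_ideal_deg \<nu> (p - (\<Sum>\<alpha>\<in>Mon (dlt - \<nu>). sgl 0 (a \<alpha>) * sylv r n \<alpha> (G \<alpha>)))"
proof -
 let ?S = "Mon (dlt - \<nu>)"
 let ?L = "{..<Suc N}" and ?V = "VV"
 let ?b = "%\<alpha>. - (emb \<alpha> + emb (ones r n))"
 obtain c where c: "zig \<nu> c p" using zigzag_exists[OF p, of "Suc N"] unfolding zig_def by blast
 define t where "t = c (Suc N) ?L ?V"
 \<comment> \<open>The corner coefficient of p at x^(-\<alpha>-1), corrected by the common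
   sign.\<close>
 define a where "a \<alpha> = (if top_sign = (1 :: 'k upoly laur) then lkp t (?b \<alpha>) else - lkp t (?b \<alpha>))" for \<alpha>
 have sa: "sgl 0 (a \<alpha>) * (top_sign * sgl (?b \<alpha>) 1) = sgl (?b \<alpha>) (lkp t (?b \<alpha>))" for \<alpha>
 proof (cases "top_sign = (1 :: 'k upoly laur)")
  case True
  thus ?thesis by (simp add: a_def mult_single)
 next
  case False
  hence "top_sign = (- 1 :: 'k upoly laur)" using top_sign by blast
  thus ?thesis using False by (simp add: a_def mult_single single_uminus)
 qed
 define c' where "c' q = c q - (\<Sum>\<alpha>\<in>?S. (%L W. sgl 0 (a \<alpha>) * sylv_zig \<alpha> (G \<alpha>) q L W))" for q
 let ?p = "p - (\<Sum>\<alpha>\<in>?S. sgl 0 (a \<alpha>) * sylv r n \<alpha> (G \<alpha>))"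
 have c': "zig \<nu> c' ?p" unfolding c'_def using dec \<nu> by (intro zig_diff[OF c] zig_sum finite_xmonos zig_smult sylv_zig) auto
 have sum_app: "(\<Sum>\<alpha>\<in>A. f \<alpha>) L W = (\<Sum>\<alpha>\<in>A. f \<alpha> L W)" for A L W
  and f :: "xmono => nat set => xvar set => 'k upoly laur" by (induction A rule: infinite_finite_induct) simp_all
 have top: "c' (Suc N) ?L ?V = t - (\<Sum>\<alpha>\<in>?S. sgl (?b \<alpha>) (lkp t (?b \<alpha>)))"
 proof -
  have "c' (Suc N) ?L ?V = t - (\<Sum>\<alpha>\<in>?S. sgl 0 (a \<alpha>) * sylv_zig \<alpha> (G \<alpha>) (Suc N) ?L ?V)"
   unfolding c'_def t_def by (simp add: sum_app)
  also have "(\<Sum>\<alpha>\<in>?S. sgl 0 (a \<alpha>) * sylv_zig \<alpha> (G \<alpha>) (Suc N) ?L ?V) = (\<Sum>\<alpha>\<in>?S. sgl (?b \<alpha>) (lkp t (?b \<alpha>)))"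
  proof (rule sum.cong[OF refl])
   fix \<alpha> assume "\<alpha> \<in> ?S"
   hence "pkeys \<alpha> \<subseteq> ?V" by (simp add: xmonos_def)
   thus "sgl 0 (a \<alpha>) * sylv_zig \<alpha> (G \<alpha>) (Suc N) ?L ?V = sgl (?b \<alpha>) (lkp t (?b \<alpha>))"
    unfolding sylv_zig_top[OF \<open>pkeys \<alpha> \<subseteq> ?V\<close>] by (intro sa)
  qed
  finally show ?thesis .
 qed
 have z: "c' (Suc N) \<in> dcx \<nu> (Suc N) (Suc N)" using c' by (simp add: zig_def)
 have "\<exists>e\<in>dcx \<nu> (Suc N) N. dT N e = c' (Suc N)"
 proof (rule dT_exact[OF z top_cocycle[OF z]])
  fix L W b J assume b: "b \<in> pkeys (c' (Suc N) L W)" and J: "J \<subseteq> {1..r}" "J ~= {}" "neg_part b = (\<Union>j\<in>J. grp n j)"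
  have nz: "c' (Suc N) L W ~= 0" using b by auto
  have "W = ?V" using dcxD(4)[OF z nz] spot_top by simp
  moreover have "L = ?L" using dcxD(2,3)[OF z nz] by (intro card_subset_eq) auto
  ultimately have b: "b \<in> pkeys (c' (Suc N) ?L ?V)" using b by simp
  \<comment> \<open>With all exponents negative, b would be x^(-\<alpha>-1) for some \<alpha> of
    degree \<delta> - \<nu>, whose coefficient has just been cleared.\<close>
  have "J ~= {1..r}"
  proof
   assume "J = {1..r}"
   hence neg: "neg_part b = ?V" using J by (simp add: xvars_eq)
   have bk: "pkeys b \<subseteq> ?V" "ldeg n b = dg \<nu> ?L"
    using dcxD(1)[OF z, of ?L ?V] b by (auto simp: Lhom_def Lring_def subset_iff Lexp_alt)
   have "lkp (- b - emb (ones r n)) v \<ge> 0" for v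
   proof (cases "v \<in> ?V")
    case True
    hence "lkp b v < 0" using neg by (auto simp: neg_part_def)
    thus ?thesis using True by (simp add: lookup_minus lkp_ones)
   next
    case False
    hence "v \<notin> pkeys b" using bk by blast
    thus ?thesis using False by (simp add: lookup_minus lkp_ones in_keys_iff)
   qed
   then obtain \<alpha> where \<alpha>: "emb \<alpha> = - b - emb (ones r n)" using emb_surj by blast
   hence b\<alpha>: "b = ?b \<alpha>" by simp
   have "\<alpha> \<in> ?S" unfolding xmonos_def
   proof (intro CollectI conjI)
    have "pkeys \<alpha> \<subseteq> pkeys b \<union> pkeys (ones r n)"
    proof
     fix v assume "v \<in> pkeys \<alpha>"
     hence "lkp (emb \<alpha>) v ~= 0" by (simp add: in_keys_iff)
     thus "v \<in> pkeys b \<union> pkeys (ones r n)" unfolding \<alpha> by (auto simp: lookup_minus in_keys_iff)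
    qed
    thus "pkeys \<alpha> \<subseteq> ?V" using bk by (auto simp: in_keys_iff lkp_ones split: if_splits)
    show "xmono_deg n \<alpha> = dlt - \<nu>"
    proof
     fix j
     have "xmono_deg n \<alpha> j = - ldeg n b j - xmono_deg n (ones r n) j"
      using arg_cong[OF \<alpha>, of "%a. ldeg n a j"] by (simp add: ldeg_emb ldeg_diff) (simp add: ldeg_def sum_negf)
     also have "\<dots> = (\<Sum>i\<in>?L. d i j) - \<nu> j - (if j \<in> {1..r} then int (n j) + 1 else 0)"
      unfolding bk(2) xmono_deg_ones by (simp add: dg_def)
     also have "\<dots> = dlt j - \<nu> j"
     proof (cases "j \<in> {1..r}")
      case True
      thus ?thesis by (simp add: delta_def lessThan_Suc_atMost)
     next
      case False
      hence "!!i. i < Suc N ==> d i j = 0" using dZ by (auto simp: Zvec_def)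
      thus ?thesis unfolding delta_def if_not_P[OF False] by simp
     qed
     finally show "xmono_deg n \<alpha> j = (dlt - \<nu>) j" by simp
    qed
   qed
   hence "lkp (\<Sum>\<alpha>\<in>?S. sgl (?b \<alpha>) (lkp t (?b \<alpha>))) b = lkp t b"
    unfolding b\<alpha> by (simp add: lookup_sum lookup_single when_def)
   hence "lkp (c' (Suc N) ?L ?V) b = 0" unfolding top by (simp add: lookup_minus)
   thus False using b by (simp add: in_keys_iff)
  qed
  then obtain j where j: "j \<in> {1..r}" "j \<notin> J" using J by blast
  have "(\<Sum>j\<in>J. n j) < (\<Sum>j\<in>{1..r}. n j)" using J j n1[OF j(1)] by (intro sum_strict_mono2[of _ _ j]) auto
  thus "N ~= (\<Sum>j\<in>J. n j)" by (simp add: ntot_def)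
 qed
 then obtain e where e: "e \<in> dcx \<nu> (Suc N) N" "dT N e = c' (Suc N)" by blast
 have "in_ideal_deg \<nu> ?p"
  by (rule zigzag_trivial[of c', OF _ _ _ _ e]) (use c' good_spot_below_delta[OF \<mu>] in \<open>auto simp: zig_def\<close>)
 thus ?thesis by blast
qed

lemma sylv_in_sat:
 assumes "sylv_decomp r n d \<alpha> G" "\<alpha> \<in> Mon (dlt - \<nu>)" "\<nu> \<in> Zvec r"
 shows "in_sat (sylv r n \<alpha> G)" by (rule zig_in_sat[OF sylv_zig[OF assms]])

end

section \<open>Nonvanishing local cohomology\<close>

subsection \<open>Rings on subsets of a type\<close>

locale subring1_on = subring_on +
 assumes S1: "1 \<in> S"
begin

lemma cring_ring_on: "cring (ring_on S)"
proof (rule cringI)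
 show "abelian_group (ring_on S)"
 proof (rule abelian_groupI)
  show "\<exists>y\<in>carrier (ring_on S). y \<oplus>\<^bsub>ring_on S\<^esub> x = \<zero>\<^bsub>ring_on S\<^esub>" if "x \<in> carrier (ring_on S)" for x
   using that by (intro bexI[of _ "- x"]) (auto simp: ring_on_def Sminus)
 qed (auto simp: ring_on_def Sadd S0 add_ac)
 show "comm_monoid (ring_on S)" by (rule comm_monoidI) (auto simp: ring_on_def Smult S1 mult_ac)
qed (auto simp: ring_on_def distrib_right)

lemma carrier_ring_on [simp]: "carrier (ring_on S) = S"
 and add_ring_on [simp]: "add (ring_on S) = (+)"
 and mult_ring_on [simp]: "monoid.mult (ring_on S) = (*)"
 and zero_ring_on [simp]: "zero (ring_on S) = 0"
 and one_ring_on [simp]: "one (ring_on S) = 1" by (simp_all add: ring_on_def)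

lemma pow_ring_on [simp]: "x [^]\<^bsub>ring_on S\<^esub> (k::nat) = x ^ k"
 by (induction k) (simp_all add: nat_pow_def mult.commute)

lemma finsum_ring_on: "(!!x. x \<in> A ==> f x \<in> S) ==> (\<Oplus>\<^bsub>ring_on S\<^esub>x\<in>A. f x) = (\<Sum>x\<in>A. f x)"
proof -
 interpret cring "ring_on S" by (rule cring_ring_on)
 show "(!!x. x \<in> A ==> f x \<in> S) ==> (\<Oplus>\<^bsub>ring_on S\<^esub>x\<in>A. f x) = (\<Sum>x\<in>A. f x)"
  by (induction A rule: infinite_finite_induct) (simp_all add: Pi_def)
qed

lemma finprod_ring_on: "(!!x. x \<in> A ==> f x \<in> S) ==> (\<Otimes>\<^bsub>ring_on S\<^esub>x\<in>A. f x) = (\<Prod>x\<in>A. f x)"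
proof -
 interpret cring "ring_on S" by (rule cring_ring_on)
 show "(!!x. x \<in> A ==> f x \<in> S) ==> (\<Otimes>\<^bsub>ring_on S\<^esub>x\<in>A. f x) = (\<Prod>x\<in>A. f x)"
  by (induction A rule: infinite_finite_induct) (simp_all add: Pi_def)
qed

lemma Spow: "x \<in> S ==> x ^ k \<in> S" by (induction k) (simp_all add: S1 Smult)

end

lemma subring1_on_mpolys:
 assumes "subring1_on A"
 shows "subring1_on (mpolys V A)"
proof -
 interpret A: subring1_on A by fact
 have lk: "lkp p m \<in> A" if "p \<in> mpolys V A" for p m
  using that A.S0 by (cases "m \<in> pkeys p") (auto simp: mpolys_def in_keys_iff)
 have keysI: "p \<in> mpolys V A" if "!!m. m \<in> pkeys p ==> pkeys m \<subseteq> V" "!!m. lkp p m \<in> A" for p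
  using that by (auto simp: mpolys_def)
 show ?thesis
 proof
  show "0 \<in> mpolys V A" by (simp add: mpolys_def)
  show "1 \<in> mpolys V A" by (rule keysI) (auto simp: lookup_one when_def A.S0 A.S1)
  fix p q assume p: "p \<in> mpolys V A" and q: "q \<in> mpolys V A"
  show "- p \<in> mpolys V A" using p lk[OF p] by (intro keysI) (auto simp: mpolys_def in_keys_iff A.Sminus)
  show "p + q \<in> mpolys V A"
  proof (rule keysI)
   fix m assume "m \<in> pkeys (p + q)"
   hence "m \<in> pkeys p \<or> m \<in> pkeys q" using Poly_Mapping.keys_add[of p q] by blast
   thus "pkeys m \<subseteq> V" using p q by (auto simp: mpolys_def)
  qed (simp add: lookup_add A.Sadd lk[OF p] lk[OF q])
  show "p * q \<in> mpolys V A"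
  proof (rule keysI)
   fix m assume "m \<in> pkeys (p * q)"
   then obtain a b where "m = a + b" "a \<in> pkeys p" "b \<in> pkeys q" using Poly_Mapping.keys_mult[of p q] by blast
   thus "pkeys m \<subseteq> V" using p q Poly_Mapping.keys_add[of a b] by (fastforce simp: mpolys_def)
  next
   fix m
   have "lkp (sgl a c * r) m \<in> A" if "c \<in> A" "r = q" for a c r
   proof -
    have "lkp (sgl a c * q) m \<in> A"
    proof -
     have "lkp (\<Sum>b\<in>pkeys q. sgl (a + b) (c * lkp q b)) m \<in> A" unfolding lookup_sum using lk[OF q] that
      by (intro A.Ssum) (auto simp: lookup_single when_def A.S0 A.Smult)
     moreover have "sgl a c * q = (\<Sum>b\<in>pkeys q. sgl (a + b) (c * lkp q b))"
      by (subst (1) pm_expand[of q]) (simp add: sum_distrib_left mult_single)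
     ultimately show ?thesis by simp
    qed
    thus ?thesis using that by simp
   qed
   hence "lkp (\<Sum>a\<in>pkeys p. sgl a (lkp p a) * q) m \<in> A" unfolding lookup_sum using lk[OF p] by (intro A.Ssum) auto
   moreover have "p * q = (\<Sum>a\<in>pkeys p. sgl a (lkp p a) * q)" by (subst (1) pm_expand[of p]) (simp add: sum_distrib_right)
   ultimately show "lkp (p * q) m \<in> A" by simp
  qed
 qed
qed

lemma subring1_on_UNIV: "subring1_on UNIV" by unfold_locales auto

lemma subring1_on_coeffs_A: "subring1_on (coeffs_A r n d)" unfolding coeffs_A_def by (rule subring1_on_mpolys[OF subring1_on_UNIV])

abbreviation carr_C :: "nat => (nat => nat) => (nat => nat => int) => 'k::comm_ring_1 cpoly set" where
 "carr_C r n d \<equiv> mpolys (xvars r n) (coeffs_A r n d)"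

lemma subring1_on_carr_C: "subring1_on (carr_C r n d)" by (rule subring1_on_mpolys[OF subring1_on_coeffs_A])

subsection \<open>Localizations of free modules\<close>

text \<open>Free modules of which the Koszul terms are instances. Fractions at a monomial are
  handled through their Laurent coordinates \<open>phi\<close>.\<close>

locale free_loc = subring1_on CC for CC :: "'a::comm_ring_1 xpoly set" +
 fixes K :: "'i set" and M :: "('a xpoly, 'i => 'a xpoly) gr_module"
 assumes carrier_M: "carrier M = K \<rightarrow>\<^sub>E CC"
  and add_M: "v \<oplus>\<^bsub>M\<^esub> w = (\<lambda>i\<in>K. v i + w i)"
  and zero_M: "\<zero>\<^bsub>M\<^esub> = (\<lambda>i\<in>K. 0)"
  and smult_M: "a \<odot>\<^bsub>M\<^esub> v = (\<lambda>i\<in>K. a * v i)"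
begin

abbreviation "RR \<equiv> ring_on CC"

definition phi :: "xmono => ('i => 'a xpoly) \<times> nat => 'i => 'a laur" where
 "phi e x L = to_laur (fst x L) * sgl (- emb e) 1 ^ snd x"

lemma unit_pow: "sgl (emb e) 1 ^ k * sgl (- emb e) 1 ^ k = (1 :: 'a laur)" by (simp add: power_mult_distrib[symmetric] mult_single)

lemma to_laur_pow: "to_laur (sgl e 1 ^ k) = (sgl (emb e) 1 ^ k :: 'a laur)" by (simp add: rhomD[OF rhom_to_laur])

text \<open>Monomials are units in the Laurent ring, so the power t in the definition of equal
  fractions can be cancelled; conversely t = 0 suffices, since passing to Laurent polynomials is
  injective.\<close>

lemma mem_loc_frac:
 assumes e: "sgl e 1 \<in> CC" and m: "m \<in> carrier M"
 shows "(m', k') \<in> loc_frac RR M (sgl e 1) m k \<longleftrightarrow> m' \<in> carrier M \<and> (\<forall>L\<in>K. phi e (m', k') L = phi e (m, k) L)"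
proof
 let ?u = "sgl (emb e) 1 :: 'a laur" and ?w = "sgl (- emb e) 1 :: 'a laur"
 assume "(m', k') \<in> loc_frac RR M (sgl e 1) m k"
 then obtain t where m': "m' \<in> carrier M"
  and eq: "sgl e 1 ^ (t + k') \<odot>\<^bsub>M\<^esub> m = sgl e 1 ^ (t + k) \<odot>\<^bsub>M\<^esub> m'"
  by (auto simp: loc_frac_def)
 have "phi e (m', k') L = phi e (m, k) L" if L: "L \<in> K" for L
 proof -
  have "sgl e 1 ^ (t + k') * m L = sgl e 1 ^ (t + k) * m' L" using fun_cong[OF eq, of L] L by (simp add: smult_M)
  from arg_cong[OF this, of to_laur]
  have "?u ^ (t + k') * to_laur (m L) = ?u ^ (t + k) * to_laur (m' L)" by (simp only: rhomD(4)[OF rhom_to_laur] to_laur_pow)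
  hence *: "?u ^ t * ?u ^ k' * to_laur (m L) = ?u ^ t * ?u ^ k * to_laur (m' L)" by (simp only: power_add)
  have "(?u ^ t * ?w ^ t) * (?u ^ k' * ?w ^ k') * (to_laur (m L) * ?w ^ k)
    = (?u ^ t * ?u ^ k' * to_laur (m L)) * (?w ^ t * ?w ^ k * ?w ^ k')" by (simp only: mult_ac)
  also have "\<dots> = (?u ^ t * ?w ^ t) * (?u ^ k * ?w ^ k) * (to_laur (m' L) * ?w ^ k')" unfolding * by (simp only: mult_ac)
  finally have "(?u ^ t * ?w ^ t) * (?u ^ k' * ?w ^ k') * (to_laur (m L) * ?w ^ k)
    = (?u ^ t * ?w ^ t) * (?u ^ k * ?w ^ k) * (to_laur (m' L) * ?w ^ k')" .
  thus ?thesis by (simp add: unit_pow phi_def)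
 qed
 thus "m' \<in> carrier M \<and> (\<forall>L\<in>K. phi e (m', k') L = phi e (m, k) L)" using m' by blast
next
 let ?u = "sgl (emb e) 1 :: 'a laur" and ?w = "sgl (- emb e) 1 :: 'a laur"
 assume a: "m' \<in> carrier M \<and> (\<forall>L\<in>K. phi e (m', k') L = phi e (m, k) L)"
 have "sgl e 1 ^ (0 + k') \<odot>\<^bsub>M\<^esub> m = sgl e 1 ^ (0 + k) \<odot>\<^bsub>M\<^esub> m'" unfolding smult_M
 proof (rule restrict_ext)
  fix L assume "L \<in> K"
  hence "to_laur (m' L) * ?w ^ k' = to_laur (m L) * ?w ^ k" using a by (simp add: phi_def)
  hence "?u ^ k * ?u ^ k' * (to_laur (m' L) * ?w ^ k') = ?u ^ k * ?u ^ k' * (to_laur (m L) * ?w ^ k)" by simp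
  hence "(?u ^ k' * ?w ^ k') * (?u ^ k * to_laur (m' L)) = (?u ^ k * ?w ^ k) * (?u ^ k' * to_laur (m L))" by (simp only: mult_ac)
  hence "to_laur (sgl e 1 ^ k * m' L) = to_laur (sgl e 1 ^ k' * m L)" by (simp add: unit_pow rhomD[OF rhom_to_laur])
  thus "sgl e 1 ^ (0 + k') * m L = sgl e 1 ^ (0 + k) * m' L" by simp
 qed
 thus "(m', k') \<in> loc_frac RR M (sgl e 1) m k" using a unfolding loc_frac_def
  by (simp only: pow_ring_on mem_Collect_eq prod.case) blast
qed

lemma loc_frac_self: "sgl e 1 \<in> CC ==> m \<in> carrier M ==> (m, k) \<in> loc_frac RR M (sgl e 1) m k"
 by (simp add: mem_loc_frac)

lemma loc_frac_eqI:
 assumes e: "sgl e 1 \<in> CC" and "m \<in> carrier M" "m' \<in> carrier M"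
  and "!!L. L \<in> K ==> phi e (m, k) L = phi e (m', k') L"
 shows "loc_frac RR M (sgl e 1) m k = loc_frac RR M (sgl e 1) m' k'"
proof -
 have "x \<in> loc_frac RR M (sgl e 1) m k \<longleftrightarrow> x \<in> loc_frac RR M (sgl e 1) m' k'" for x
  using assms mem_loc_frac[OF e, of m "fst x" "snd x" k] mem_loc_frac[OF e, of m' "fst x" "snd x" k'] by simp
 thus ?thesis by blast
qed

text \<open>Any representative may be taken, as \<open>PHI_mem\<close> shows.\<close>

definition PHI :: "xmono => (('i => 'a xpoly) \<times> nat) set => 'i => 'a laur" where
 "PHI e T L = phi e (SOME x. x \<in> T) L"

lemma PHI_mem:
 assumes e: "sgl e 1 \<in> CC" and m: "m \<in> carrier M" and x: "x \<in> loc_frac RR M (sgl e 1) m k" and L: "L \<in> K"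
 shows "phi e x L = PHI e (loc_frac RR M (sgl e 1) m k) L" "phi e x L = phi e (m, k) L"
proof -
 have *: "phi e y L = phi e (m, k) L" if "y \<in> loc_frac RR M (sgl e 1) m k" for y
  using mem_loc_frac[OF e m, of "fst y" "snd y" k] that L by simp
 have "(SOME y. y \<in> loc_frac RR M (sgl e 1) m k) \<in> loc_frac RR M (sgl e 1) m k" using x by (rule someI)
 thus "phi e x L = PHI e (loc_frac RR M (sgl e 1) m k) L" "phi e x L = phi e (m, k) L" using *[OF x] * by (auto simp: PHI_def)
qed

lemma PHI_loc_frac:
 assumes "sgl e 1 \<in> CC" "m \<in> carrier M" "L \<in> K"
 shows "PHI e (loc_frac RR M (sgl e 1) m k) L = phi e (m, k) L"
 using PHI_mem(1)[OF assms(1,2) loc_frac_self[OF assms(1,2)] assms(3)] by simp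

abbreviation "lcl e e' \<equiv> localization RR M (sgl e 1) e'"

lemma carrier_lcl: "carrier (lcl e e') = {loc_frac RR M (sgl e 1) m k | m k. m \<in> carrier M}" by (simp add: localization_def)

lemma PHI_inj:
 assumes e: "sgl e 1 \<in> CC" and "T \<in> carrier (lcl e e')" "T' \<in> carrier (lcl e e')"
  and "!!L. L \<in> K ==> PHI e T L = PHI e T' L"
 shows "T = T'"
proof -
 obtain m k m' k' where T: "T = loc_frac RR M (sgl e 1) m k" "m \<in> carrier M"
  and T': "T' = loc_frac RR M (sgl e 1) m' k'" "m' \<in> carrier M" using assms(2,3) by (auto simp: carrier_lcl)
 show ?thesis unfolding T T' using assms(4) T T' PHI_loc_frac[OF e] by (intro loc_frac_eqI[OF e]) auto
qed

lemma mem_carrier_lcl: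
 assumes e: "sgl e 1 \<in> CC" and T: "T \<in> carrier (lcl e e')" and x: "x \<in> T"
 shows "fst x \<in> carrier M" "!!L. L \<in> K ==> phi e x L = PHI e T L"
proof -
 obtain m k where *: "T = loc_frac RR M (sgl e 1) m k" "m \<in> carrier M" using T by (auto simp: carrier_lcl)
 show "fst x \<in> carrier M" using x unfolding *(1) by (auto simp: loc_frac_def)
 show "phi e x L = PHI e T L" if "L \<in> K" for L using PHI_mem(1)[OF e *(2)] x that unfolding *(1) by blast
qed

lemma carrier_M_add: "v \<in> carrier M ==> w \<in> carrier M ==> v \<oplus>\<^bsub>M\<^esub> w \<in> carrier M"
 by (auto simp: carrier_M add_M intro!: Sadd dest: PiE_mem)

lemma carrier_M_smult: "a \<in> CC ==> v \<in> carrier M ==> a \<odot>\<^bsub>M\<^esub> v \<in> carrier M"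
 by (auto simp: carrier_M smult_M intro!: Smult dest: PiE_mem)

lemma phi_add:
 assumes "L \<in> K"
 shows "phi e (sgl e 1 ^ k' \<odot>\<^bsub>M\<^esub> m \<oplus>\<^bsub>M\<^esub> sgl e 1 ^ k \<odot>\<^bsub>M\<^esub> m', k + k') L = phi e (m, k) L + phi e (m', k') L"
proof -
 let ?u = "sgl (emb e) 1 :: 'a laur" and ?w = "sgl (- emb e) 1 :: 'a laur"
 have "phi e (sgl e 1 ^ k' \<odot>\<^bsub>M\<^esub> m \<oplus>\<^bsub>M\<^esub> sgl e 1 ^ k \<odot>\<^bsub>M\<^esub> m', k + k') L
  = (?u ^ k' * to_laur (m L) + ?u ^ k * to_laur (m' L)) * (?w ^ k * ?w ^ k')"
  using assms by (simp only: phi_def smult_M add_M restrict_apply if_True rhomD[OF rhom_to_laur] power_add to_laur_single fst_conv snd_conv)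
 also have "\<dots> = (?u ^ k' * ?w ^ k') * (to_laur (m L) * ?w ^ k) + (?u ^ k * ?w ^ k) * (to_laur (m' L) * ?w ^ k')"
  unfolding distrib_right by (simp only: mult_ac)
 finally show ?thesis by (simp add: unit_pow phi_def)
qed

text \<open>Addition is \<open>the_elem\<close> of a union over representatives; all of them give
  one class, so the union is a singleton.\<close>

lemma lcl_add:
 assumes e: "sgl e 1 \<in> CC" and T: "T \<in> carrier (lcl e e')" and T': "T' \<in> carrier (lcl e e')"
 shows "T \<oplus>\<^bsub>lcl e e'\<^esub> T' \<in> carrier (lcl e e')"
  and "L \<in> K ==> PHI e (T \<oplus>\<^bsub>lcl e e'\<^esub> T') L = PHI e T L + PHI e T' L"
proof -
 obtain m k m' k' where t: "T = loc_frac RR M (sgl e 1) m k" "m \<in> carrier M"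
  and t': "T' = loc_frac RR M (sgl e 1) m' k'" "m' \<in> carrier M" using assms(2,3) by (auto simp: carrier_lcl)
 let ?f = "%m k m' k'. loc_frac RR M (sgl e 1) (sgl e 1 ^ k' \<odot>\<^bsub>M\<^esub> m \<oplus>\<^bsub>M\<^esub> sgl e 1 ^ k \<odot>\<^bsub>M\<^esub> m') (k + k')"
 have cl: "sgl e 1 ^ k' \<odot>\<^bsub>M\<^esub> m \<oplus>\<^bsub>M\<^esub> sgl e 1 ^ k \<odot>\<^bsub>M\<^esub> m' \<in> carrier M"
  if "m \<in> carrier M" "m' \<in> carrier M" for m m' k k' using that e by (intro carrier_M_add carrier_M_smult Spow)
 have eq: "?f (fst x) (snd x) (fst y) (snd y) = ?f m k m' k'" if "x \<in> T" "y \<in> T'" for x y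
 proof (rule loc_frac_eqI[OF e])
  show "sgl e 1 ^ snd y \<odot>\<^bsub>M\<^esub> fst x \<oplus>\<^bsub>M\<^esub> sgl e 1 ^ snd x \<odot>\<^bsub>M\<^esub> fst y \<in> carrier M"
   using mem_carrier_lcl(1)[OF e] T T' that by (intro cl) auto
  fix L assume L: "L \<in> K"
  have "phi e x L = phi e (m, k) L" "phi e y L = phi e (m', k') L"
   using PHI_mem(2)[OF e t(2) _ L] PHI_mem(2)[OF e t'(2) _ L] that unfolding t t' by blast+
  thus "phi e (sgl e 1 ^ snd y \<odot>\<^bsub>M\<^esub> fst x \<oplus>\<^bsub>M\<^esub> sgl e 1 ^ snd x \<odot>\<^bsub>M\<^esub> fst y, snd x + snd y) L
   = phi e (sgl e 1 ^ k' \<odot>\<^bsub>M\<^esub> m \<oplus>\<^bsub>M\<^esub> sgl e 1 ^ k \<odot>\<^bsub>M\<^esub> m', k + k') L"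
   using L by (simp add: phi_add)
 qed (use cl t t' in auto)
 have ne: "(m, k) \<in> T" "(m', k') \<in> T'" using loc_frac_self[OF e] t t' by auto
 have "(\<Union>(m, k)\<in>T. \<Union>(m', k')\<in>T'. {?f m k m' k'}) = {?f m k m' k'}"
 proof
  show "(\<Union>(m, k)\<in>T. \<Union>(m', k')\<in>T'. {?f m k m' k'}) \<subseteq> {?f m k m' k'}" using eq by fastforce
  show "{?f m k m' k'} \<subseteq> (\<Union>(m, k)\<in>T. \<Union>(m', k')\<in>T'. {?f m k m' k'})" using ne by blast
 qed
 hence sum: "T \<oplus>\<^bsub>lcl e e'\<^esub> T' = ?f m k m' k'" by (simp add: localization_def)
 thus "T \<oplus>\<^bsub>lcl e e'\<^esub> T' \<in> carrier (lcl e e')" using cl t t' unfolding carrier_lcl by blast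
 show "L \<in> K ==> PHI e (T \<oplus>\<^bsub>lcl e e'\<^esub> T') L = PHI e T L + PHI e T' L"
  unfolding sum using cl t t' by (simp add: PHI_loc_frac[OF e] phi_add)
qed

lemma lcl_zero:
 assumes e: "sgl e 1 \<in> CC"
 shows "\<zero>\<^bsub>lcl e e'\<^esub> \<in> carrier (lcl e e')" and "L \<in> K ==> PHI e \<zero>\<^bsub>lcl e e'\<^esub> L = 0"
proof -
 have 0: "\<zero>\<^bsub>M\<^esub> \<in> carrier M" by (auto simp: carrier_M zero_M S0)
 have eq: "\<zero>\<^bsub>lcl e e'\<^esub> = loc_frac RR M (sgl e 1) \<zero>\<^bsub>M\<^esub> 0" by (simp add: localization_def)
 show "\<zero>\<^bsub>lcl e e'\<^esub> \<in> carrier (lcl e e')" unfolding eq carrier_lcl using 0 by blast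
 show "L \<in> K ==> PHI e \<zero>\<^bsub>lcl e e'\<^esub> L = 0"
  unfolding eq using 0 by (simp add: PHI_loc_frac[OF e] phi_def zero_M rhomD[OF rhom_to_laur])
qed

text \<open>The axioms are pulled back along the injective Laurent coordinates. The group structure
  is needed to unfold the finite sums and negatives in \<open>cech_diff\<close>.\<close>

lemma lcl_abelian_group:
 assumes e: "sgl e 1 \<in> CC"
 shows "abelian_group (lcl e e')"
proof (rule abelian_groupI)
 note A = lcl_add[OF e, where e' = e'] and Z = lcl_zero[OF e, where e' = e']
 note inj = PHI_inj[OF e, where e' = e']
 show "!!x y. x \<in> carrier (lcl e e') ==> y \<in> carrier (lcl e e') ==> x \<oplus>\<^bsub>lcl e e'\<^esub> y \<in> carrier (lcl e e')"
  by (rule A)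
 show "\<zero>\<^bsub>lcl e e'\<^esub> \<in> carrier (lcl e e')" by (rule Z)
 show "x \<oplus>\<^bsub>lcl e e'\<^esub> y \<oplus>\<^bsub>lcl e e'\<^esub> z = x \<oplus>\<^bsub>lcl e e'\<^esub> (y \<oplus>\<^bsub>lcl e e'\<^esub> z)"
  if "x \<in> carrier (lcl e e')" "y \<in> carrier (lcl e e')" "z \<in> carrier (lcl e e')" for x y z
  by (rule inj) (simp_all add: A that add.assoc)
 show "x \<oplus>\<^bsub>lcl e e'\<^esub> y = y \<oplus>\<^bsub>lcl e e'\<^esub> x"
  if "x \<in> carrier (lcl e e')" "y \<in> carrier (lcl e e')" for x y by (rule inj) (simp_all add: A that add.commute)
 show "\<zero>\<^bsub>lcl e e'\<^esub> \<oplus>\<^bsub>lcl e e'\<^esub> x = x" if "x \<in> carrier (lcl e e')" for x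
  by (rule inj) (simp_all add: A Z that)
 show "\<exists>y\<in>carrier (lcl e e'). y \<oplus>\<^bsub>lcl e e'\<^esub> x = \<zero>\<^bsub>lcl e e'\<^esub>" if x: "x \<in> carrier (lcl e e')" for x
 proof -
  obtain m k where mk: "x = loc_frac RR M (sgl e 1) m k" "m \<in> carrier M" using x by (auto simp: carrier_lcl)
  define m' where "m' = (- 1) \<odot>\<^bsub>M\<^esub> m"
  have m': "m' \<in> carrier M" unfolding m'_def using mk S1 by (intro carrier_M_smult Sminus)
  let ?y = "loc_frac RR M (sgl e 1) m' k"
  have y: "?y \<in> carrier (lcl e e')" unfolding carrier_lcl using m' by blast
  have "PHI e ?y L = - PHI e x L" if "L \<in> K" for L unfolding mk(1) PHI_loc_frac[OF e m' that] PHI_loc_frac[OF e mk(2) that]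
   using that by (simp add: phi_def m'_def smult_M rhomD[OF rhom_to_laur])
  hence "?y \<oplus>\<^bsub>lcl e e'\<^esub> x = \<zero>\<^bsub>lcl e e'\<^esub>" by (intro inj) (simp_all add: A Z x y)
  thus ?thesis using y by blast
 qed
qed

lemma lcl_a_inv:
 assumes e: "sgl e 1 \<in> CC" and T: "T \<in> carrier (lcl e e')"
 shows "\<ominus>\<^bsub>lcl e e'\<^esub> T \<in> carrier (lcl e e')" and "L \<in> K ==> PHI e (\<ominus>\<^bsub>lcl e e'\<^esub> T) L = - PHI e T L"
proof -
 interpret G: abelian_group "lcl e e'" by (rule lcl_abelian_group[OF e])
 show c: "\<ominus>\<^bsub>lcl e e'\<^esub> T \<in> carrier (lcl e e')" by (rule G.a_inv_closed[OF T])
 show "PHI e (\<ominus>\<^bsub>lcl e e'\<^esub> T) L = - PHI e T L" if L: "L \<in> K"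
  using lcl_add(2)[OF e T c L] lcl_zero(2)[OF e L, of e'] G.r_neg[OF T] by (simp add: eq_neg_iff_add_eq_0 add.commute)
qed

lemma lcl_finsum:
 assumes e: "sgl e 1 \<in> CC" and "finite A" "!!i. i \<in> A ==> f i \<in> carrier (lcl e e')"
 shows "(\<Oplus>\<^bsub>lcl e e'\<^esub>i\<in>A. f i) \<in> carrier (lcl e e') \<and>
  (\<forall>L\<in>K. PHI e (\<Oplus>\<^bsub>lcl e e'\<^esub>i\<in>A. f i) L = (\<Sum>i\<in>A. PHI e (f i) L))"
proof -
 interpret G: abelian_group "lcl e e'" by (rule lcl_abelian_group[OF e])
 show ?thesis using assms(2,3)
 proof (induction A rule: finite_induct)
  case empty
  show ?case using lcl_zero[OF e] by simp
 next
  case (insert x F)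
  hence "(\<Oplus>\<^bsub>lcl e e'\<^esub>i\<in>insert x F. f i) = f x \<oplus>\<^bsub>lcl e e'\<^esub> (\<Oplus>\<^bsub>lcl e e'\<^esub>i\<in>F. f i)"
   by (intro G.finsum_insert) auto
  thus ?case using insert lcl_add[OF e] by simp
 qed
qed

text \<open>In Laurent coordinates the map between localizations is the identity.\<close>

lemma lcl_map:
 assumes e: "sgl e 1 \<in> CC" and u: "sgl f 1 \<in> CC" and ef: "sgl (e + f) 1 \<in> CC" and T: "T \<in> carrier (lcl e e')"
 shows "loc_map RR M (sgl (e + f) 1) (sgl f 1) T \<in> carrier (lcl (e + f) e'')"
  and "L \<in> K ==> PHI (e + f) (loc_map RR M (sgl (e + f) 1) (sgl f 1) T) L = PHI e T L"
proof -
 obtain m k where t: "T = loc_frac RR M (sgl e 1) m k" "m \<in> carrier M" using T by (auto simp: carrier_lcl)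
 let ?g = "%m k. loc_frac RR M (sgl (e + f) 1) (sgl f 1 ^ k \<odot>\<^bsub>M\<^esub> m) k"
 have ph: "phi (e + f) (sgl f 1 ^ k \<odot>\<^bsub>M\<^esub> m, k) L = phi e (m, k) L" if "L \<in> K" for m k L
 proof -
  have "phi (e + f) (sgl f 1 ^ k \<odot>\<^bsub>M\<^esub> m, k) L = sgl (emb f) 1 ^ k * to_laur (m L) * sgl (- emb e + - emb f) 1 ^ k"
   using that by (simp add: phi_def smult_M rhomD[OF rhom_to_laur] emb_add)
  also have "sgl (- emb e + - emb f) (1::'a) = sgl (- emb e) 1 * sgl (- emb f) 1" by (simp add: mult_single)
  also have "sgl (emb f) 1 ^ k * to_laur (m L) * (sgl (- emb e) 1 * sgl (- emb f) 1) ^ k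
   = (sgl (emb f) 1 ^ k * sgl (- emb f) 1 ^ k) * (to_laur (m L) * sgl (- emb e) 1 ^ k)" by (simp only: power_mult_distrib mult_ac)
  finally show ?thesis by (simp add: unit_pow phi_def)
 qed
 have cl: "sgl f 1 ^ k \<odot>\<^bsub>M\<^esub> m \<in> carrier M" if "m \<in> carrier M" for m k
  using that u by (intro carrier_M_smult Spow)
 have eq: "?g (fst x) (snd x) = ?g m k" if "x \<in> T" for x
 proof (rule loc_frac_eqI[OF ef])
  show "sgl f 1 ^ snd x \<odot>\<^bsub>M\<^esub> fst x \<in> carrier M" using mem_carrier_lcl(1)[OF e T that] cl by blast
  fix L assume L: "L \<in> K"
  show "phi (e + f) (sgl f 1 ^ snd x \<odot>\<^bsub>M\<^esub> fst x, snd x) L = phi (e + f) (sgl f 1 ^ k \<odot>\<^bsub>M\<^esub> m, k) L"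
   using PHI_mem(2)[OF e t(2) _ L, of x k] that unfolding t ph[OF L] by simp
 qed (use cl t in auto)
 have ne: "(m, k) \<in> T" using loc_frac_self[OF e] t by auto
 have "(\<Union>(m, k)\<in>T. {?g m k}) = {?g m k}"
 proof
  show "(\<Union>(m, k)\<in>T. {?g m k}) \<subseteq> {?g m k}" using eq by fastforce
  show "{?g m k} \<subseteq> (\<Union>(m, k)\<in>T. {?g m k})" using ne by blast
 qed
 hence m: "loc_map RR M (sgl (e + f) 1) (sgl f 1) T = ?g m k" by (simp add: loc_map_def)
 show "loc_map RR M (sgl (e + f) 1) (sgl f 1) T \<in> carrier (lcl (e + f) e'')" unfolding m carrier_lcl using cl t by blast
 show "L \<in> K ==> PHI (e + f) (loc_map RR M (sgl (e + f) 1) (sgl f 1) T) L = PHI e T L"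
  unfolding m unfolding t(1) using PHI_loc_frac[OF ef cl[OF t(2)]] PHI_loc_frac[OF e t(2)] ph by simp
qed

end

subsection \<open>The Cech complex of the Koszul terms\<close>

lemma product_lists_map: "product_lists (map (map f) xss) = map (map f) (product_lists xss)"
 by (induction xss) (simp_all add: map_concat comp_def)

definition gexp :: "nat => (nat => nat) => nat => xmono" where
 "gexp r n s = vmono r (vtx_of r n s) (%_. 1)"

lemma b_gens_eq:
 "(b_gens r n :: ('k::comm_ring_1 cpoly \<times> _) list) =
  map (%ps. (prod_list (map mpoly_var ps), %j. if j \<in> {1..r} then 1 else 0)) (vlist r n)"
proof -
 let ?v = "mpoly_var :: _ => 'k cpoly"
 have "map (%j. map (%l. ?v (j, l)) [0..<Suc (n j)]) [1..<Suc r]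
  = map (map ?v) (map (%j. map (Pair j) [0..<Suc (n j)]) [1..<Suc r])" by (simp del: upt_Suc)
 hence "product_lists (map (%j. map (%l. ?v (j, l)) [0..<Suc (n j)]) [1..<Suc r]) = map (map ?v) (vlist r n)"
  unfolding vlist_def by (simp only: product_lists_map)
 thus ?thesis unfolding b_gens_def by (simp only: map_map comp_def)
qed

lemma length_b_gens [simp]: "length (b_gens r n) = length (vlist r n)" by (simp add: b_gens_eq)

lemma fst_b_gens:
 assumes "s < length (vlist r n)"
 shows "fst (b_gens r n ! s) = (sgl (gexp r n s) 1 :: 'k::comm_ring_1 cpoly)"
  and "snd (b_gens r n ! s :: 'k cpoly \<times> _) = (%j. if j \<in> {1..r} then 1 else 0)"
proof -
 have "fst (b_gens r n ! s :: 'k cpoly \<times> _) = prod_list (map mpoly_var (map (%j. (j, vtx_of r n s j)) [1..<Suc r]))"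
  using assms vlist_nth(1)[OF assms] by (simp add: b_gens_eq del: upt_Suc)
 also have "\<dots> = (\<Prod>j\<in>{1..<Suc r}. mpoly_var (j, vtx_of r n s j))"
  by (simp add: prod.distinct_set_conv_list[symmetric] comp_def del: upt_Suc)
 also have "\<dots> = sgl (gexp r n s) 1"
  unfolding gexp_def vmono_def mpoly_var_def by (subst prod_sgl) (simp_all add: atLeastLessThanSuc_atLeastAtMost)
 finally show "fst (b_gens r n ! s) = (sgl (gexp r n s) 1 :: 'k cpoly)" .
 show "snd (b_gens r n ! s :: 'k cpoly \<times> _) = (%j. if j \<in> {1..r} then 1 else 0)"
  using assms by (simp add: b_gens_eq)
qed

text \<open>The evaluation of a coboundary on W only uses simplices with vertices in the facets of
  W.\<close>

lemma (in cell_vertices) ev_cobd_zero: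
 assumes W: "W \<in> cells r n" "card W = r + k" and k: "k > 0"
  and e: "!!w S. w \<in> W ==> W - {w} \<in> cells r n ==> S \<subseteq> verts (W - {w}) ==> e S = 0"
 shows "ev k (cobd e) W = 0"
proof -
 obtain k' where k': "k = Suc k'" using k by (cases k) auto
 have fin: "finite W" using cells_finite[OF W(1)] .
 have "ev k (cobd e) W = cell_bd r n (ev k' e) W" unfolding k' using W k' by (intro ev_cobd) auto
 also have "\<dots> = cell_bd r n (%_. 0) W"
 proof (rule cell_bd_cong)
  fix w assume w: "w \<in> W" "W - {w} \<in> cells r n"
  have "ev k' e (W - {w}) = ev k' (%S. 0) (W - {w})" using w W k' fin e by (intro ev_cong) auto
  thus "ev k' e (W - {w}) = 0" by (simp add: ev_zero)
 qed
 also have "\<dots> = 0" by (simp add: cell_bd_eq)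
 finally show ?thesis .
qed

context multiproj
begin

abbreviation "CA \<equiv> carr_C r n d"

lemma gexp_keys: "s < length (vlist r n) ==> pkeys (gexp r n s) \<subseteq> VV"
 using keys_vmono[of r "vtx_of r n s" "%_. 1"] vlist_nth(2)[of s r n] unfolding gexp_def by (fastforce simp: xvars_def)

lemma free_loc_koszul:
 "free_loc (CA) (koszul_index N p) (koszul r n d p :: ('k::comm_ring_1 cpoly, nat set => 'k cpoly) gr_module)"
proof -
 interpret C: subring1_on "CA :: 'k cpoly set" by (rule subring1_on_carr_C)
 show ?thesis by unfold_locales
   (simp_all add: koszul_def module.defs free_module_def ring_C_def)
qed

lemma vmono1_degree: "s < length (vlist r n) ==> xmono_deg n (gexp r n s) j = (if j \<in> {1..r} then 1 else 0)"
proof -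
 assume s: "s < length (vlist r n)"
 show ?thesis
 proof (cases "j \<in> {1..r}")
  case True
  hence "xmono_deg n (gexp r n s) j = (\<Sum>l\<le>n j. if l = vtx_of r n s j then 1 else 0)"
   unfolding xmono_deg_def gexp_def by (intro sum.cong) (auto simp: lkp_vmono)
  thus ?thesis using True vlist_nth(2)[OF s True] by simp
 next
  case False
  thus ?thesis using xmono_deg_outside[OF gexp_keys[OF s]] by simp
 qed
qed

text \<open>If the class were zero, \<kappa> would be the coboundary of a cochain e that is nonzero
  only on sets of generators covering \<open>neg_part a\<close>. On the cell W0 formed by the top
  vertex and the groups in J, \<kappa> evaluates to a unit by \<open>Lam_unit\<close>; e contributes
  nothing, since each facet of W0 lacks a variable of \<open>neg_part a\<close>.\<close>

lemma bad_spot_in_Gamma: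
 assumes L0: "L0 \<subseteq> {..N}" "card L0 = q" and a: "pkeys a \<subseteq> VV" "ldeg n a = dg \<nu> L0"
  and J: "J \<subseteq> {1..r}" "J ~= {}" "neg_part a = (\<Union>j\<in>J. grp n j)" and q: "q = (\<Sum>j\<in>J. n j) + 1" "q \<le> N"
 shows "\<nu> \<in> Gamma TYPE('k::comm_ring_1) 1 r n d"
proof -
 let ?K = "koszul_index N (int q)"
 let ?M = "koszul r n d (int q) :: ('k cpoly, nat set => 'k cpoly) gr_module"
 let ?gs = "b_gens r n :: ('k cpoly \<times> (nat => int)) list"
 let ?CC = "CA :: 'k cpoly set"
 let ?R = "ring_C r n d :: 'k cpoly ring"
 interpret K: free_loc ?CC ?K ?M by (rule free_loc_koszul)
 have R: "?R = ring_on ?CC" by (simp add: ring_C_def)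
 define P where "P = length (vlist r n)"
 define E where "E \<sigma> = (\<Sum>s\<in>\<sigma>. gexp r n s)" for \<sigma>
 have L0K: "L0 \<in> ?K" using L0 by (simp add: koszul_index_def)
 have finJ: "finite J" using J finite_subset by blast
 have idx: "\<sigma> \<subseteq> {..<P}" "finite \<sigma>" if "\<sigma> \<in> cech_index ?gs k" for \<sigma> k
  using that finite_subset by (auto simp: cech_index_def P_def)
 have oneA: "(1 :: 'k upoly) \<in> AA" using subring1_on_coeffs_A subring1_on.S1 by blast
 have zeroA: "(0 :: 'k upoly) \<in> AA" using subring1_on_coeffs_A subring1_on_def subring_on.S0 by blast
 have mono_CC: "sgl e c \<in> ?CC" if "pkeys e \<subseteq> VV" "c \<in> AA" for e c
  using that by (auto simp: mpolys_def)
 have E_keys: "pkeys (E \<sigma>) \<subseteq> VV" if "\<sigma> \<subseteq> {..<P}" for \<sigma>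
  unfolding E_def using that gexp_keys Poly_Mapping.keys_sum[of "gexp r n" \<sigma>] unfolding P_def by fastforce
 have E_CC: "sgl (E \<sigma>) 1 \<in> ?CC" if "\<sigma> \<subseteq> {..<P}" for \<sigma> using mono_CC[OF E_keys[OF that] oneA] .
 have g_CC: "sgl (gexp r n s) 1 \<in> ?CC" if "s < P" for s using that gexp_keys oneA by (intro mono_CC) (auto simp: P_def)
 have sprod: "(\<Otimes>\<^bsub>?R\<^esub>s\<in>\<sigma>. fst (?gs ! s)) = sgl (E \<sigma>) 1" if "\<sigma> \<subseteq> {..<P}" for \<sigma>
 proof -
  have f: "fst (?gs ! s) = sgl (gexp r n s) 1" if "s \<in> \<sigma>" for s
   using that \<open>\<sigma> \<subseteq> {..<P}\<close> fst_b_gens(1)[of s r n] by (auto simp: P_def)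
  have "(\<Otimes>\<^bsub>?R\<^esub>s\<in>\<sigma>. fst (?gs ! s)) = (\<Prod>s\<in>\<sigma>. fst (?gs ! s))"
   unfolding R using that g_CC f by (intro K.finprod_ring_on) auto
  also have "\<dots> = (\<Prod>s\<in>\<sigma>. sgl (gexp r n s) 1)" using f by (intro prod.cong) auto
  also have "\<dots> = sgl (E \<sigma>) 1" unfolding E_def using that finite_subset by (intro prod_sgl) auto
  finally show ?thesis .
 qed
 define dv where "dv \<sigma> = (%j. \<Sum>s\<in>\<sigma>. snd (?gs ! s) j)" for \<sigma> :: "nat set"
 have cl: "cech_loc ?R ?M ?gs \<sigma> = K.lcl (E \<sigma>) (dv \<sigma>)" if "\<sigma> \<subseteq> {..<P}" for \<sigma>
  unfolding cech_loc_def sprod[OF that] dv_def unfolding R ..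
 have dvE: "dv \<sigma> j = xmono_deg n (E \<sigma>) j" if "\<sigma> \<subseteq> {..<P}" for \<sigma> j
 proof -
  have "xmono_deg n (E \<sigma>) j = (\<Sum>s\<in>\<sigma>. xmono_deg n (gexp r n s) j)"
   unfolding E_def xmono_deg_def by (simp add: lookup_sum) (rule sum.swap)
  also have "\<dots> = dv \<sigma> j" unfolding dv_def using that fst_b_gens(2)[where 'k = 'k] vmono1_degree
   by (intro sum.cong refl) (auto simp: P_def subset_iff)
  finally show ?thesis ..
 qed
 define ph where "ph c \<sigma> L = K.PHI (E \<sigma>) (c \<sigma>) L" for c :: "nat set => ((nat set => 'k cpoly) \<times> nat) set" and \<sigma> L
 have memc: "c \<sigma> \<in> carrier (K.lcl (E \<sigma>) (dv \<sigma>))"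
  if "c \<in> carrier (cech ?R ?M ?gs k)" "\<sigma> \<in> cech_index ?gs k" for c \<sigma> k
  using that cl[OF idx(1)[OF that(2)]] by (auto simp: cech_def dest: PiE_mem)
 \<comment> \<open>In Laurent coordinates the Cech differential becomes \<open>cobd\<close> on sets
   of generators.\<close>
 have diff: "cech_diff ?R ?M ?gs k c \<tau> \<in> carrier (K.lcl (E \<tau>) (dv \<tau>)) \<and>
   (\<forall>L\<in>?K. ph (cech_diff ?R ?M ?gs k c) \<tau> L = cobd (%\<sigma>. ph c \<sigma> L) \<tau>)"
  if c: "c \<in> carrier (cech ?R ?M ?gs k)" and \<tau>: "\<tau> \<in> cech_index ?gs (Suc k)" for c k \<tau>
 proof -
  have \<tau>P: "\<tau> \<subseteq> {..<P}" and fin: "finite \<tau>" using idx[OF \<tau>] .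
  let ?l = "K.lcl (E \<tau>) (dv \<tau>)"
  let ?y = "%i. loc_map ?R ?M (sgl (E \<tau>) 1) (fst (?gs ! i)) (c (\<tau> - {i}))"
  let ?f = "%i. if even (card {i'\<in>\<tau>. i' < i}) then ?y i else \<ominus>\<^bsub>?l\<^esub> ?y i"
  have e: "sgl (E \<tau>) 1 \<in> ?CC" by (rule E_CC[OF \<tau>P])
  have y: "?y i \<in> carrier ?l \<and> (\<forall>L\<in>?K. K.PHI (E \<tau>) (?y i) L = ph c (\<tau> - {i}) L)" if i: "i \<in> \<tau>" for i
  proof -
   have ti: "\<tau> - {i} \<in> cech_index ?gs k" using \<tau> i fin by (auto simp: cech_index_def)
   have E\<tau>: "E \<tau> = E (\<tau> - {i}) + gexp r n i" unfolding E_def using i fin by (simp add: sum.remove add.commute)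
   have gi: "fst (?gs ! i) = sgl (gexp r n i) 1" using i \<tau>P fst_b_gens(1)[of i r n] by (auto simp: P_def)
   show ?thesis unfolding gi E\<tau> R ph_def
    using K.lcl_map(1)[OF E_CC[OF idx(1)[OF ti]] g_CC[of i] _ memc[OF c ti], where e'' = "dv \<tau>"]
     K.lcl_map(2)[OF E_CC[OF idx(1)[OF ti]] g_CC[of i] _ memc[OF c ti]] e i \<tau>P unfolding E\<tau> by auto
  qed
  have f: "?f i \<in> carrier ?l \<and> (\<forall>L\<in>?K. K.PHI (E \<tau>) (?f i) L = sg i \<tau> (ph c (\<tau> - {i}) L))" if i: "i \<in> \<tau>" for i
   using y[OF i] K.lcl_a_inv[OF e, of "?y i" "dv \<tau>"] by (simp add: sg_def)
  have "cech_diff ?R ?M ?gs k c \<tau> = (\<Oplus>\<^bsub>?l\<^esub>i\<in>\<tau>. ?f i)"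
   unfolding cech_diff_def restrict_apply if_P[OF \<tau>] Let_def sprod[OF \<tau>P] cl[OF \<tau>P] ..
  thus ?thesis unfolding ph_def[of "cech_diff ?R ?M ?gs k c"]
   using K.lcl_finsum[OF e fin, of ?f "dv \<tau>"] f by (simp add: cobd_def)
 qed
 text \<open>The cocycle is the pullback of the top simplex on the columns, times the monomial \<open>a\<close>.\<close>
 define Q where "Q = scols J r n"
 define col where "col s = col_of J r n (vtx_of r n s)" for s
 define \<kappa> where "\<kappa> \<sigma> = minr q (ind_mat col) \<sigma> Q" for \<sigma>
 define vars where "vars \<sigma> = (\<Union>s\<in>\<sigma>. (%j. (j, vtx_of r n s j)) ` {1..r})" for \<sigma>
 have vars_I: "(j, vtx_of r n s j) \<in> vars \<sigma>" if "s \<in> \<sigma>" "j \<in> {1..r}" for s j \<sigma>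
  unfolding vars_def using that by (intro UN_I[of s] imageI)
 have vars_E: "\<exists>s j. s \<in> \<sigma> \<and> v = (j, vtx_of r n s j) \<and> j \<in> {1..r}" if "v \<in> vars \<sigma>" for v \<sigma>
  using that unfolding vars_def by blast
 have finQ: "finite Q" and cardQ: "card Q = q" unfolding Q_def using finJ q by (auto simp: finite_scols card_scols)
 have colQ: "col s \<in> Q" if "s < P" for s
 proof -
  have "vtx_of r n s j \<le> n j" if "j \<in> J" for j using that \<open>s < P\<close> vlist_nth(2) J by (auto simp: P_def)
  thus ?thesis unfolding col_def Q_def
   by (cases rule: col_of_cases[OF finJ, of "vtx_of r n s" n r]) (auto simp: scols_def order_le_neq_trans)
 qed
 \<comment> \<open>A nonzero \<kappa> hits all columns, hence involves all variables of the groups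
   in J; this is what makes x^a an element of the localization at \<sigma>.\<close>
 have cover: "neg_part a \<subseteq> vars \<sigma>" if \<sigma>: "\<kappa> \<sigma> ~= 0" "card \<sigma> = q" for \<sigma>
 proof
  fix v assume "v \<in> neg_part a"
  then obtain j where j: "j \<in> J" "fst v = j" "snd v \<le> n j" unfolding J(3) grp_def by (cases v) auto
  have Qs: "Q \<subseteq> col ` \<sigma>" using \<sigma> cardQ finQ unfolding \<kappa>_def by (intro minr_ind_mat_support)
  have jr: "j \<in> {1..r}" using j J by blast
  show "v \<in> vars \<sigma>"
  proof (cases "snd v = n j")
   case True
   have "last_col r n \<in> Q" by (simp add: Q_def scols_def)
   then obtain s where s: "s \<in> \<sigma>" "last_col r n = col s" using Qs by blast
   have "vtx_of r n s j = n j"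
   proof (cases rule: col_of_cases[OF finJ, of "vtx_of r n s" n r])
    case (2 i)
    have "last_col r n = (i, vtx_of r n s i)" unfolding s(2) col_def by (rule 2(3))
    hence "r = i" "n r = vtx_of r n s i" unfolding last_col_def by blast+
    hence "vtx_of r n s i = n i" by metis
    thus ?thesis using 2(2) by contradiction
   qed (use j in auto)
   hence "v = (j, vtx_of r n s j)" using True j by (cases v) simp
   thus ?thesis using vars_I[OF s(1) jr] by simp
  next
   case False
   hence "v \<in> Q" using j by (cases v) (auto simp: Q_def scols_def)
   then obtain s where s: "s \<in> \<sigma>" "v = col s" using Qs by blast
   have "v = (j, vtx_of r n s j)"
   proof (cases rule: col_of_cases[OF finJ, of "vtx_of r n s" n r])
    case 1
    hence "v = (r, n r)" using s by (simp add: col_def last_col_def)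
    thus ?thesis using False j by auto
   next
    case (2 i)
    thus ?thesis using s j by (simp add: col_def)
   qed
   thus ?thesis using vars_I[OF s(1) jr] by simp
  qed
 qed
 have Evars: "lkp (E \<sigma>) v \<ge> 1" if vs: "v \<in> vars \<sigma>" and fs: "finite \<sigma>" for \<sigma> v
 proof -
  obtain s j where s: "s \<in> \<sigma>" "v = (j, vtx_of r n s j)" "j \<in> {1..r}" using vars_E[OF vs] by blast
  hence "lkp (gexp r n s) v = 1" by (simp add: gexp_def lkp_vmono)
  moreover have "lkp (gexp r n s) v \<le> (\<Sum>s\<in>\<sigma>. lkp (gexp r n s) v)" using s fs by (intro member_le_sum) auto
  ultimately show ?thesis by (simp add: E_def lookup_sum)
 qed
 \<comment> \<open>Clears the denominator of x^a at every \<sigma> covering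
   \<open>neg_part a\<close>, because there the product of the generators contains each of these
   variables at least once.\<close>
 define kk where "kk = Max (insert 0 ((%v. nat (- lkp a v)) ` VV))"
 have kk: "- lkp a v \<le> int kk" for v
 proof (cases "v \<in> VV")
  case True
  hence "nat (- lkp a v) \<le> kk" unfolding kk_def by (intro Max_ge) auto
  thus ?thesis by simp
 next
  case False
  hence "v \<notin> pkeys a" using a by blast
  thus ?thesis by (simp add: in_keys_iff)
 qed
 let ?mult = "%\<sigma>. (\<Sum>i<kk. E \<sigma>)"
 have lkm: "lkp (?mult \<sigma>) v = kk * lkp (E \<sigma>) v" for \<sigma> v by (simp add: lookup_sum)
 have "\<exists>b. emb b = a + emb (?mult \<sigma>)" if "neg_part a \<subseteq> vars \<sigma>" "finite \<sigma>" for \<sigma>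
 proof -
  have "lkp (a + emb (?mult \<sigma>)) v \<ge> 0" for v
  proof (cases "lkp a v < 0")
   case True
   hence "v \<in> vars \<sigma>" using that unfolding neg_part_def by blast
   hence "lkp (E \<sigma>) v \<ge> 1" using that Evars by blast
   hence "int kk * int (lkp (E \<sigma>) v) \<ge> int kk * 1" by (intro mult_left_mono) auto
   thus ?thesis using kk[of v] by (simp add: lookup_add lkm)
  qed (simp add: lookup_add lkm)
  thus ?thesis using emb_surj by metis
 qed
 then obtain B where B: "!!\<sigma>. neg_part a \<subseteq> vars \<sigma> ==> finite \<sigma> ==> emb (B \<sigma>) = a + emb (?mult \<sigma>)" by metis
 \<comment> \<open>The numerator for which the fraction over the kk-th power has the coordinate
   \<kappa> \<sigma> x^a at L0 and 0 elsewhere.\<close>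
 define mm where "mm \<sigma> = (\<lambda>L\<in>?K. if L = L0 \<and> \<kappa> \<sigma> ~= 0 then sgl (B \<sigma>) (of_int (\<kappa> \<sigma>)) else (0 :: 'k cpoly))" for \<sigma>
 define x where "x = (\<lambda>\<sigma>\<in>cech_index ?gs q. loc_frac ?R ?M (sgl (E \<sigma>) 1) (mm \<sigma>) kk)"
 have B_keys: "pkeys (B \<sigma>) \<subseteq> VV" if "neg_part a \<subseteq> vars \<sigma>" "\<sigma> \<subseteq> {..<P}" for \<sigma>
 proof -
  have fin: "finite \<sigma>" using that finite_subset by blast
  have "pkeys (emb (B \<sigma>)) \<subseteq> pkeys a \<union> pkeys (emb (?mult \<sigma>))"
   unfolding B[OF that(1) fin] by (rule Poly_Mapping.keys_add)
  moreover have "pkeys (?mult \<sigma>) \<subseteq> pkeys (E \<sigma>)" by (auto simp: in_keys_iff lkm)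
  ultimately show ?thesis using a E_keys[OF that(2)] by auto
 qed
 have of_intA: "(of_int z :: 'k upoly) \<in> AA" for z
 proof -
  interpret A: subring1_on "AA :: 'k upoly set" by (rule subring1_on_coeffs_A)
  have "(of_nat m :: 'k upoly) \<in> AA" for m by (induction m) (simp_all add: A.S0 A.S1 A.Sadd)
  thus ?thesis by (cases z rule: int_cases2) (simp_all add: A.Sminus)
 qed
 have mm_deg: "mm \<sigma> L \<in> comp_C r n d (%j. \<nu> j + int kk * dv \<sigma> j - (\<Sum>i\<in>L. d i j))"
  if \<sigma>: "\<sigma> \<in> cech_index ?gs q" and L: "L \<in> ?K" for \<sigma> L
 proof (cases "L = L0 \<and> \<kappa> \<sigma> ~= 0")
  case True
  have s: "\<sigma> \<subseteq> {..<P}" "finite \<sigma>" using idx[OF \<sigma>] .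
  have cov: "neg_part a \<subseteq> vars \<sigma>" using True \<sigma> by (intro cover) (auto simp: cech_index_def)
  have "xmono_deg n (B \<sigma>) j = \<nu> j + int kk * dv \<sigma> j - (\<Sum>i\<in>L. d i j)" for j
  proof -
   have "xmono_deg n (B \<sigma>) j = ldeg n a j + xmono_deg n (?mult \<sigma>) j"
    using arg_cong[OF B[OF cov s(2)], of "%b. ldeg n b j"] by (simp add: ldeg_emb ldeg_add)
   also have "xmono_deg n (?mult \<sigma>) j = int kk * dv \<sigma> j"
    unfolding dvE[OF s(1)] by (simp add: xmono_deg_def lkm sum_distrib_left)
   finally show ?thesis using a True by (simp add: dg_def)
  qed
  thus ?thesis using True L B_keys[OF cov s(1)] of_intA by (auto simp: mm_def comp_C_def xpolys_deg_def mpolys_def fun_eq_iff)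
 qed (use L in \<open>auto simp: mm_def comp_C_def xpolys_deg_def mpolys_def\<close>)
 have mmM: "mm \<sigma> \<in> carrier ?M" if "\<sigma> \<in> cech_index ?gs q" for \<sigma> unfolding K.carrier_M
 proof (rule PiE_I)
  show "mm \<sigma> L \<in> ?CC" if "L \<in> ?K" for L
   using mm_deg[OF \<open>\<sigma> \<in> _\<close> that] by (auto simp: comp_C_def xpolys_deg_def)
 qed (simp add: mm_def)
 have xc: "x \<in> carrier (cech ?R ?M ?gs q)"
 proof -
  have "x \<sigma> \<in> carrier (cech_loc ?R ?M ?gs \<sigma>)" if \<sigma>: "\<sigma> \<in> cech_index ?gs q" for \<sigma>
   unfolding cl[OF idx(1)[OF \<sigma>]] K.carrier_lcl using \<sigma> mmM[OF \<sigma>] by (auto simp: x_def R)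
  thus ?thesis by (auto simp: cech_def x_def)
 qed
 have phx: "ph x \<sigma> L = (if L = L0 then sgl a (of_int (\<kappa> \<sigma>)) else 0)"
  if \<sigma>: "\<sigma> \<in> cech_index ?gs q" and L: "L \<in> ?K" for \<sigma> L
 proof -
  have s: "\<sigma> \<subseteq> {..<P}" "finite \<sigma>" using idx[OF \<sigma>] .
  have "ph x \<sigma> L = K.phi (E \<sigma>) (mm \<sigma>, kk) L"
   using \<sigma> K.PHI_loc_frac[OF E_CC[OF s(1)] mmM[OF \<sigma>] L, of kk] by (simp add: ph_def x_def R)
  also have "\<dots> = (if L = L0 then sgl a (of_int (\<kappa> \<sigma>)) else 0)"
  proof (cases "L = L0 \<and> \<kappa> \<sigma> ~= 0")
   case True
   have cov: "neg_part a \<subseteq> vars \<sigma>" using True \<sigma> by (intro cover) (auto simp: cech_index_def)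
   have "sgl (- emb (E \<sigma>)) 1 ^ k = (sgl (- (\<Sum>i<k. emb (E \<sigma>))) 1 :: 'k upoly laur)" for k
    by (induction k) (simp_all add: mult_single add.commute)
   moreover have "emb (B \<sigma>) - (\<Sum>i<kk. emb (E \<sigma>)) = a" unfolding B[OF cov s(2)] by (simp add: emb_sum)
   ultimately show ?thesis using True L by (simp add: K.phi_def mm_def mult_single)
  qed (use L in \<open>auto simp: K.phi_def mm_def rhomD[OF rhom_to_laur]\<close>)
  finally show ?thesis .
 qed
 have x_cocycle: "x \<in> cech_cocycles ?R ?M ?gs q"
 proof -
  have "cech_diff ?R ?M ?gs q x = \<zero>\<^bsub>cech ?R ?M ?gs (Suc q)\<^esub>"
  proof
   fix \<tau>
   show "cech_diff ?R ?M ?gs q x \<tau> = \<zero>\<^bsub>cech ?R ?M ?gs (Suc q)\<^esub> \<tau>"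
   proof (cases "\<tau> \<in> cech_index ?gs (Suc q)")
    case \<tau>: True
    have t: "\<tau> \<subseteq> {..<P}" "finite \<tau>" using idx[OF \<tau>] .
    have z: "\<zero>\<^bsub>cech ?R ?M ?gs (Suc q)\<^esub> \<tau> = \<zero>\<^bsub>K.lcl (E \<tau>) (dv \<tau>)\<^esub>"
     using \<tau> cl[OF t(1)] by (simp add: cech_def)
    \<comment> \<open>All columns are used up by Q, so the expansion has no column left: the top
      simplex is a cocycle.\<close>
    have k0: "cobd \<kappa> \<tau> = 0"
    proof -
     have "(\<Sum>i\<in>\<tau>. sg i \<tau> (1 * minr q (ind_mat col) (\<tau> - {i}) Q))
      = (\<Sum>c\<in>Q - Q. sg c Q (1 * minr (Suc q) (ind_mat col) \<tau> (insert c Q)))"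
      using \<tau> t finQ cardQ colQ by (intro minr_expand) (auto simp: cech_index_def ind_mat_def)
     thus ?thesis by (simp add: cobd_def \<kappa>_def)
    qed
    have sm: "\<tau> - {i} \<in> cech_index ?gs q" if "i \<in> \<tau>" for i using \<tau> that t by (auto simp: cech_index_def)
    show ?thesis unfolding z
    proof (rule K.PHI_inj[OF E_CC[OF t(1)], where e' = "dv \<tau>"])
     show "cech_diff ?R ?M ?gs q x \<tau> \<in> carrier (K.lcl (E \<tau>) (dv \<tau>))" using diff[OF xc \<tau>] by blast
     show "\<zero>\<^bsub>K.lcl (E \<tau>) (dv \<tau>)\<^esub> \<in> carrier (K.lcl (E \<tau>) (dv \<tau>))" by (rule K.lcl_zero[OF E_CC[OF t(1)]])
     fix L assume L: "L \<in> ?K"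
     have "K.PHI (E \<tau>) (cech_diff ?R ?M ?gs q x \<tau>) L = cobd (%\<sigma>. ph x \<sigma> L) \<tau>"
      using diff[OF xc \<tau>] L by (simp add: ph_def)
     also have "\<dots> = cobd (%\<sigma>. if L = L0 then sgl a (of_int (\<kappa> \<sigma>)) else 0) \<tau>"
      using phx[OF sm L] by (intro cobd_cong) auto
     also have "\<dots> = (if L = L0 then sgl a (of_int (cobd \<kappa> \<tau>)) else 0)"
     proof -
      have "sg i \<tau> (sgl a (of_int z)) = (sgl a (of_int (sg i \<tau> z)) :: 'k upoly laur)" for i z
       by (simp add: sg_def single_uminus)
      moreover have "(\<Sum>i\<in>A. sgl a (f i)) = (sgl a (\<Sum>i\<in>A. f i) :: 'k upoly laur)" for f and A :: "nat set"
       by (induction A rule: infinite_finite_induct) (simp_all add: single_add)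
      ultimately show ?thesis by (simp add: cobd_def of_int_sum)
     qed
     also have "\<dots> = 0" by (simp add: k0)
     finally show "K.PHI (E \<tau>) (cech_diff ?R ?M ?gs q x \<tau>) L = K.PHI (E \<tau>) \<zero>\<^bsub>K.lcl (E \<tau>) (dv \<tau>)\<^esub> L"
      using K.lcl_zero(2)[OF E_CC[OF t(1)] L] by simp
    qed
   qed (simp add: cech_diff_def cech_def)
  qed
  thus ?thesis using xc by (simp add: cech_cocycles_def)
 qed
 have x_hom: "x \<in> hcomp (cech ?R ?M ?gs q) \<nu>"
 proof -
  have "x \<sigma> \<in> hcomp (cech_loc ?R ?M ?gs \<sigma>) \<nu>" if \<sigma>: "\<sigma> \<in> cech_index ?gs q" for \<sigma>
  proof -
   have "mm \<sigma> \<in> hcomp ?M (%j. \<nu> j + int kk * dv \<sigma> j)"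
    using mm_deg[OF \<sigma>] by (auto simp: koszul_def module.defs gr_module.defs mm_def)
   thus ?thesis unfolding cl[OF idx(1)[OF \<sigma>]] localization_def using \<sigma> by (auto simp: x_def R)
  qed
  thus ?thesis by (auto simp: cech_def x_def)
 qed
 obtain q' where q': "q = Suc q'" "q' = (\<Sum>j\<in>J. n j)" using q by simp
 have q'pos: "q' > 0"
 proof -
  obtain j where "j \<in> J" using J by blast
  hence "n j \<ge> 1" "n j \<le> (\<Sum>j\<in>J. n j)" using n1 J finJ by (auto intro: member_le_sum)
  thus ?thesis using q' by simp
 qed
 \<comment> \<open>Denominators of fractions at \<sigma> involve only the variables of the
   generators in \<sigma>.\<close>
 have phi_in: "ph c \<sigma> L \<in> LR (vars \<sigma>)"
  if c: "c \<in> carrier (cech ?R ?M ?gs q')" and \<sigma>: "\<sigma> \<in> cech_index ?gs q'" and L: "L \<in> ?K" for c \<sigma> L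
 proof -
  have s: "\<sigma> \<subseteq> {..<P}" "finite \<sigma>" using idx[OF \<sigma>] .
  obtain m k where mk: "c \<sigma> = loc_frac K.RR ?M (sgl (E \<sigma>) 1) m k" "m \<in> carrier ?M"
   using memc[OF c \<sigma>] by (auto simp: K.carrier_lcl)
  have "ph c \<sigma> L = to_laur (m L) * sgl (- emb (E \<sigma>)) 1 ^ k"
   unfolding ph_def mk(1) K.PHI_loc_frac[OF E_CC[OF s(1)] mk(2) L] by (simp add: K.phi_def)
  moreover have "to_laur (m L) \<in> LR (vars \<sigma>)"
  proof -
   have "m L \<in> mpolys (VV) UNIV" using mk(2) L unfolding K.carrier_M by (auto simp: mpolys_def dest: PiE_mem)
   thus ?thesis using to_laur_in_Lring Lring_mono[of "{}" "vars \<sigma>" r n] by blast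
  qed
  moreover have "(sgl (- emb (E \<sigma>)) 1 :: 'k upoly laur) ^ k \<in> LR (vars \<sigma>)"
  proof -
   have "- emb (E \<sigma>) \<in> Lexp r n (vars \<sigma>)"
   proof -
    have "pkeys (- emb (E \<sigma>)) \<subseteq> VV" using E_keys[OF s(1)] by simp
    moreover have "v \<in> vars \<sigma>" if "lkp (E \<sigma>) v > 0" for v
    proof -
     have "(\<Sum>s\<in>\<sigma>. lkp (gexp r n s) v) ~= 0" using that by (simp add: E_def lookup_sum)
     then obtain s where "s \<in> \<sigma>" "lkp (gexp r n s) v ~= 0" by (meson sum.neutral)
     hence "v \<in> (%j. (j, vtx_of r n s j)) ` {1..r}"
      using keys_vmono[of r "vtx_of r n s" "%_. 1"] unfolding gexp_def by (auto simp: in_keys_iff)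
     thus ?thesis using \<open>s \<in> \<sigma>\<close> unfolding vars_def by blast
    qed
    ultimately show ?thesis by (auto simp: Lexp_def)
   qed
   hence "(sgl (- emb (E \<sigma>)) 1 :: 'k upoly laur) \<in> LR (vars \<sigma>)" by (rule Lring_single)
   thus ?thesis by (induction k) (simp_all add: Lring_mult)
  qed
  ultimately show ?thesis by (simp add: Lring_mult)
 qed
 let ?N = "cech_coboundaries ?R ?M ?gs q"
 have Neq: "?N = cech_diff ?R ?M ?gs q' ` carrier (cech ?R ?M ?gs q')" by (simp add: cech_coboundaries_def q')
 let ?Z = "cech ?R ?M ?gs q\<lparr>carrier := cech_cocycles ?R ?M ?gs q,
    hcomp := (%\<mu>. cech_cocycles ?R ?M ?gs q \<inter> hcomp (cech ?R ?M ?gs q) \<mu>)\<rparr>"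
 have ne: "?N +>\<^bsub>?Z\<^esub> x ~= ?N"
 proof
  assume eq: "?N +>\<^bsub>?Z\<^esub> x = ?N"
  have "(\<lambda>\<sigma>\<in>cech_index ?gs q'. \<zero>\<^bsub>cech_loc ?R ?M ?gs \<sigma>\<^esub>) \<in> carrier (cech ?R ?M ?gs q')"
   using K.lcl_zero(1)[OF E_CC] cl idx by (auto simp: cech_def)
  then obtain c0 where c0: "c0 \<in> carrier (cech ?R ?M ?gs q')" by blast
  let ?h = "cech_diff ?R ?M ?gs q' c0"
  have "?h \<oplus>\<^bsub>?Z\<^esub> x \<in> ?N +>\<^bsub>?Z\<^esub> x" using c0 unfolding a_r_coset_def r_coset_def Neq by auto
  hence "?h \<oplus>\<^bsub>?Z\<^esub> x \<in> ?N" unfolding eq .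
  then obtain c1 where c1: "c1 \<in> carrier (cech ?R ?M ?gs q')" "?h \<oplus>\<^bsub>?Z\<^esub> x = cech_diff ?R ?M ?gs q' c1"
   unfolding Neq by blast
  \<comment> \<open>Reading off the coefficient of x^a at L0 turns an equation of Cech cochains into
    one between scalar cochains.\<close>
  define e where "e \<sigma> = (if \<sigma> \<in> cech_index ?gs q' then lkp (ph c1 \<sigma> L0 - ph c0 \<sigma> L0) a else 0)" for \<sigma>
  have e0: "neg_part a \<subseteq> vars \<sigma>" if "e \<sigma> ~= 0" for \<sigma>
  proof -
   have \<sigma>: "\<sigma> \<in> cech_index ?gs q'" and k: "a \<in> pkeys (ph c1 \<sigma> L0 - ph c0 \<sigma> L0)"
    using that by (auto simp: e_def in_keys_iff split: if_splits)
   have "ph c1 \<sigma> L0 - ph c0 \<sigma> L0 \<in> LR (vars \<sigma>)" by (intro Lring_diff phi_in c0 c1 \<sigma> L0K)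
   thus ?thesis using k by (auto simp: Lring_def subset_iff Lexp_alt)
  qed
  have ke: "of_int (\<kappa> \<sigma>) = cobd e \<sigma>" if \<sigma>: "\<sigma> \<in> cech_index ?gs q" for \<sigma>
  proof -
   have s: "\<sigma> \<subseteq> {..<P}" "finite \<sigma>" using idx[OF \<sigma>] .
   have \<sigma>': "\<sigma> \<in> cech_index ?gs (Suc q')" using \<sigma> q' by simp
   have "(?h \<oplus>\<^bsub>?Z\<^esub> x) \<sigma> = ?h \<sigma> \<oplus>\<^bsub>K.lcl (E \<sigma>) (dv \<sigma>)\<^esub> x \<sigma>"
    using \<sigma> cl[OF s(1)] by (simp add: cech_def)
   hence "K.PHI (E \<sigma>) (?h \<sigma> \<oplus>\<^bsub>K.lcl (E \<sigma>) (dv \<sigma>)\<^esub> x \<sigma>) L0 = ph (cech_diff ?R ?M ?gs q' c1) \<sigma> L0"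
    using c1(2) by (simp add: ph_def)
   hence "ph ?h \<sigma> L0 + ph x \<sigma> L0 = ph (cech_diff ?R ?M ?gs q' c1) \<sigma> L0"
    using K.lcl_add(2)[OF E_CC[OF s(1)] _ memc[OF xc \<sigma>] L0K, of "?h \<sigma>"] diff[OF c0 \<sigma>'] by (simp add: ph_def)
   hence "cobd (%\<sigma>. ph c0 \<sigma> L0) \<sigma> + sgl a (of_int (\<kappa> \<sigma>)) = cobd (%\<sigma>. ph c1 \<sigma> L0) \<sigma>"
    using diff[OF c0 \<sigma>'] diff[OF c1(1) \<sigma>'] phx[OF \<sigma> L0K] L0K by simp
   hence "sgl a (of_int (\<kappa> \<sigma>)) = cobd (%\<sigma>. ph c1 \<sigma> L0 - ph c0 \<sigma> L0) \<sigma>"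
    by (simp add: cobd_diff algebra_simps)
   hence "of_int (\<kappa> \<sigma>) = lkp (cobd (%\<sigma>. ph c1 \<sigma> L0 - ph c0 \<sigma> L0) \<sigma>) a"
    by (metis lookup_single_eq)
   also have "\<dots> = cobd e \<sigma>" unfolding lkp_cobd using \<sigma>' s by (intro cobd_cong) (auto simp: e_def cech_index_def)
   finally show ?thesis .
  qed
  define W0 where "W0 = V.top_vertex \<union> (\<Union>j\<in>J. grp n j)"
  have tx: "V.top_vertex \<in> cells r n" by (auto simp: V.top_vertex_def cells_def grp_def xvars_def)
  have W0x: "W0 \<subseteq> VV" using tx J by (auto simp: W0_def cells_def xvars_eq)
  have W0c: "W0 \<in> cells r n" using cells_mono[OF tx _ W0x] by (auto simp: W0_def)
  have W0card: "card W0 = r + q'"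
  proof -
   have "card W0 = (\<Sum>j\<in>{1..r}. card (W0 \<inter> grp n j))" by (rule card_by_groups[OF W0x])
   also have "\<dots> = (\<Sum>j\<in>{1..r}. if j \<in> J then n j + 1 else 1)"
   proof (rule sum.cong[OF refl])
    fix j assume j: "j \<in> {1..r}"
    have "W0 \<inter> grp n j = (if j \<in> J then grp n j else {(j, n j)})" using j by (auto simp: W0_def V.top_vertex_def grp_def)
    thus "card (W0 \<inter> grp n j) = (if j \<in> J then n j + 1 else 1)" by simp
   qed
   also have "\<dots> = (\<Sum>j\<in>{1..r}. 1 + (if j \<in> J then n j else 0))" by (intro sum.cong) auto
   also have "\<dots> = r + (\<Sum>j\<in>J. n j)" using J by (simp add: sum.distrib sum.If_cases Int_absorb1 del: One_nat_def)
   finally show ?thesis using q' by simp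
  qed
  have Qeq: "insert (last_col r n) (W0 - V.top_vertex) = Q"
   unfolding Q_def W0_def scols_def using J by (auto simp: V.top_vertex_def grp_def le_less)
  have unit: "\<bar>V.Lam J q' W0 Q\<bar> = 1"
   unfolding Qeq[symmetric] by (rule V.Lam_unit[OF finJ J(1)]) (auto simp: W0_def W0card[unfolded W0_def])
  have "of_int (V.Lam J q' W0 Q) = V.ev q' (%\<sigma>. of_int (\<kappa> \<sigma>) :: 'k upoly) W0"
   unfolding V.Lam_def \<kappa>_def q'(1) col_def by (rule V.ev_hom) simp
  also have "\<dots> = V.ev q' (cobd e) W0"
  proof (rule V.ev_cong[OF W0c W0card])
   fix S assume "S \<subseteq> V.verts W0" "card S = Suc q'"
   hence "S \<in> cech_index ?gs q" using q' by (auto simp: cech_index_def V.verts_def)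
   thus "of_int (\<kappa> S) = cobd e S" by (rule ke)
  qed
  also have "\<dots> = 0"
  proof (rule V.ev_cobd_zero[OF W0c W0card q'pos])
   fix w S assume w: "w \<in> W0" "W0 - {w} \<in> cells r n" and S: "S \<subseteq> V.verts (W0 - {w})"
   \<comment> \<open>A facet is a cell only if the removed variable belongs to a group of J; in
     every other group of W0 the variable is alone.\<close>
   have "w \<in> neg_part a"
   proof (rule ccontr)
    assume nw: "w \<notin> neg_part a"
    then obtain j where j: "j \<in> {1..r}" "w = (j, n j)" using w J by (auto simp: W0_def V.top_vertex_def)
    hence "j \<notin> J" using nw J by (auto simp: grp_def)
    hence "(W0 - {w}) \<inter> grp n j = {}" using j by (auto simp: W0_def V.top_vertex_def grp_def)
    thus False using w j by (auto simp: cells_def)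
   qed
   moreover have "w \<notin> vars S"
   proof
    assume "w \<in> vars S"
    then obtain s j where "s \<in> S" "w = (j, vtx_of r n s j)" "j \<in> {1..r}" using vars_E by blast
    moreover have "(j, vtx_of r n s j) \<in> W0 - {w}" if "s \<in> S" "j \<in> {1..r}" for s j
     using S that unfolding V.verts_def by blast
    ultimately show False by blast
   qed
   ultimately show "e S = 0" using e0 by blast
  qed
  finally have "(of_int (V.Lam J q' W0 Q) :: 'k upoly) = 0" .
  \<comment> \<open>Being 1 or -1, the integer is nonzero in every base ring.\<close>
  moreover have "V.Lam J q' W0 Q = 1 \<or> V.Lam J q' W0 Q = - 1" using unit by linarith
  ultimately show False by auto
 qed
 have "\<nu> \<in> Supp (local_cohomology ?R ?M ?gs q)"
 proof -
  let ?H = "local_cohomology ?R ?M ?gs q"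
  have "hcomp ?H \<nu> = (%x. ?N +>\<^bsub>?Z\<^esub> x) ` (cech_cocycles ?R ?M ?gs q \<inter> hcomp (cech ?R ?M ?gs q) \<nu>)"
   unfolding local_cohomology_def quot_gr_module_def by (simp add: module.defs gr_module.defs quot_module_def)
  moreover have "\<zero>\<^bsub>?H\<^esub> = ?N"
   unfolding local_cohomology_def quot_gr_module_def by (simp add: module.defs gr_module.defs quot_module_def)
  ultimately show ?thesis using x_cocycle x_hom ne by (auto simp: Supp_def)
 qed
 \<comment> \<open>The index in the union is p = q - 1: local cohomology of degree p + 1 of the
   Koszul term p + 1.\<close>
 moreover have "int q - 1 \<in> {- 1..int N - 1}" using q(2) by (simp del: One_nat_def add: atLeastAtMost_iff)
 moreover have "int q - 1 + 1 = int q" "nat (int q) = q" by simp_all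
 ultimately show ?thesis unfolding Gamma_def by (intro UN_I[of "int q - 1"]) simp_all
qed

text \<open>For q \<le> N an exceptional degree yields a nonzero local cohomology class. For q = N +
  1 the dimension forces J to contain all groups and L all forms; all exponents are then at most -1,
  and comparing degrees shows that \<delta> - \<nu> is nonnegative.\<close>

lemma good_spot_of_Gamma:
 assumes \<nu>: "\<nu> \<in> Zvec r" and "\<nu> \<notin> {dlt - \<beta> | \<beta>. \<beta> \<in> Nvec r}" "\<nu> \<notin> Gamma TYPE('k::comm_ring_1) 1 r n d"
  and q: "1 \<le> q" "q \<le> Suc N"
 shows "good_spot \<nu> q"
proof (rule ccontr)
 assume "~ good_spot \<nu> q"
 then obtain L a J where L: "L \<subseteq> {..N}" "card L = q" and a: "pkeys a \<subseteq> VV" "ldeg n a = dg \<nu> L"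
  and J: "J \<subseteq> {1..r}" "J ~= {}" "neg_part a = (\<Union>j\<in>J. grp n j)" and qJ: "q = (\<Sum>j\<in>J. n j) + 1"
  unfolding good_spot_def by blast
 show False
 proof (cases "q \<le> N")
  case True
  thus False using bad_spot_in_Gamma[OF L a J qJ, where 'k = 'k] assms by blast
 next
  case False
  hence qN: "q = Suc N" using q by simp
  have "J = {1..r}"
  proof (rule ccontr)
   assume "J ~= {1..r}"
   then obtain j where j: "j \<in> {1..r}" "j \<notin> J" using J by blast
   have "(\<Sum>j\<in>J. n j) < (\<Sum>j\<in>{1..r}. n j)" using J j n1[OF j(1)] by (intro sum_strict_mono2[of _ _ j]) auto
   thus False using qN qJ by (simp add: ntot_def)
  qed
  have LN: "L = {..N}" using L qN by (intro card_subset_eq) auto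
  define \<beta> where "\<beta> = dlt - \<nu>"
  have "\<beta> j \<ge> 0" if j: "j \<in> {1..r}" for j
  proof -
   have "ldeg n a j \<le> (\<Sum>l\<le>n j. - 1)" unfolding ldeg_def
   proof (rule sum_mono)
    fix l assume "l \<in> {..n j}"
    hence "(j, l) \<in> neg_part a" using J \<open>J = {1..r}\<close> j by (auto simp: grp_def)
    thus "lkp a (j, l) \<le> - 1" by (simp add: neg_part_def)
   qed
   thus ?thesis using a LN j by (simp add: \<beta>_def dg_def delta_def)
  qed
  moreover have "\<beta> j = 0" if "j \<notin> {1..r}" for j
   unfolding \<beta>_def fun_diff_def delta_def if_not_P[OF that] using \<nu> that by (simp add: Zvec_def)
  ultimately have "\<beta> j \<ge> 0 \<and> (j \<notin> {1..r} --> \<beta> j = 0)" for j by (cases "j \<in> {1..r}") simp_all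
  hence "\<beta> \<in> Nvec r" unfolding Nvec_def Zvec_def by blast
  moreover have "\<nu> = dlt - \<beta>" by (simp add: \<beta>_def fun_eq_iff)
  ultimately show False using assms by blast
 qed
qed

end

section \<open>Saturation and presentation matrices\<close>

lemma lkp_const_mult: "lkp (sgl 0 a * q) m = a * lkp (q :: 'm::comm_monoid_add \<Rightarrow>\<^sub>0 'a::comm_ring_1) m"
proof (induction q rule: pm_induct)
 case (single k)
 thus ?case by (simp add: mult_single lookup_single when_def)
qed (simp_all add: distrib_left lookup_add)

lemma rhom_mpoly_const: "rhom mpoly_const" using rhom_single0 by (simp add: mpoly_const_def[abs_def])

lemma mpoly_const_in: "c \<in> A ==> mpoly_const c \<in> mpolys V A" by (auto simp: mpoly_const_def mpolys_def)

lemma mpoly_var_in: "subring1_on A ==> v \<in> V ==> mpoly_var v \<in> mpolys V A"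
 by (auto simp: mpoly_var_def mpolys_def lookup_single subring1_on.S1)

lemma monomial_eq: "(\<Prod>v\<in>pkeys m. mpoly_var v ^ lkp m v) = (sgl m 1 :: ('v \<Rightarrow>\<^sub>0 nat) \<Rightarrow>\<^sub>0 'a::comm_ring_1)"
proof -
 have "mpoly_var v ^ k = (sgl (sgl v k) 1 :: ('v \<Rightarrow>\<^sub>0 nat) \<Rightarrow>\<^sub>0 'a)" for v k
  by (induction k) (simp_all add: mpoly_var_def mult_single single_add[symmetric])
 thus ?thesis by (simp add: prod_sgl pm_expand[symmetric])
qed

definition pmap :: "('c::comm_ring_1 => 'b::comm_ring_1) => ('m::comm_monoid_add \<Rightarrow>\<^sub>0 'c) => ('m \<Rightarrow>\<^sub>0 'b)" where
 "pmap \<phi> = pm_eval (%c. sgl 0 (\<phi> c)) (%m. sgl m 1)"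

lemma rhom_pmap: "rhom \<phi> ==> rhom (pmap \<phi>)"
 unfolding pmap_def by (intro rhom_pm_eval rhom_compose[OF rhom_single0] mhom_sgl)

lemma lkp_pmap:
 assumes "rhom \<phi>" shows "lkp (pmap \<phi> p) m = \<phi> (lkp p m)"
proof -
 have "lkp (pmap \<phi> p) m = (\<Sum>k\<in>pkeys p. if k = m then \<phi> (lkp p k) else 0)"
  by (simp add: pmap_def pm_eval_def mult_single lookup_sum lookup_single when_def)
 thus ?thesis by (simp add: in_keys_iff rhomD(1)[OF assms])
qed

lemma pmap_single: "rhom \<phi> ==> pmap \<phi> (sgl m c) = sgl m (\<phi> c)"
 by (rule poly_mapping_eqI) (simp add: lkp_pmap lookup_single when_def rhomD(1))

lemma keys_pmap: "rhom \<phi> ==> pkeys (pmap \<phi> p) \<subseteq> pkeys p" by (auto simp: in_keys_iff lkp_pmap rhomD(1))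

lemma pmap_deg: "rhom \<phi> ==> p \<in> xpolys_deg r n A \<mu> ==> pmap \<phi> p \<in> xpolys_deg r n UNIV \<mu>"
 using keys_pmap[of \<phi> p] by (auto simp: xpolys_deg_def mpolys_def)

context subring1_on
begin

lemma Sprod: "(!!x. x \<in> A ==> f x \<in> S) ==> (\<Prod>x\<in>A. f x) \<in> S"
 by (induction A rule: infinite_finite_induct) (simp_all add: S1 Smult)

lemma det_in:
 assumes "!!i j. i < k ==> j < k ==> M i j \<in> S"
 shows "det (mat k k (%(i, j). M i j)) \<in> S"
proof -
 have "(\<Prod>i = 0..<k. mat k k (%(i, j). M i j) $$ (i, p i)) \<in> S" if "p permutes {0..<k}" for p
  using assms permutes_in_image[OF that] by (intro Sprod) auto
 moreover have "signof p \<in> S" for p using S1 Sminus[OF S1] by (simp add: sign_def)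
 ultimately show ?thesis by (subst det_def'[of _ k]) (auto intro!: Ssum Smult)
qed

lemma ring_ring_on: "ring (ring_on S)" using cring_ring_on by (rule cring.axioms(1))

lemma ideal_ring_on:
 assumes "J \<subseteq> S" "0 \<in> J" "!!a b. a \<in> J ==> b \<in> J ==> a + b \<in> J" "!!s a. s \<in> S ==> a \<in> J ==> s * a \<in> J"
 shows "ideal J (ring_on S)"
proof (rule idealI[OF ring_ring_on])
 interpret R: cring "ring_on S" by (rule cring_ring_on)
 have m: "\<ominus>\<^bsub>ring_on S\<^esub> a = - a" if "a \<in> S" for a
  using that Sminus[OF that] by (intro R.minus_equality) simp_all
 have "- a \<in> J" if "a \<in> J" for a using assms(4)[OF Sminus[OF S1] that] by simp
 hence "\<ominus>\<^bsub>ring_on S\<^esub> a \<in> J" if "a \<in> J" for a using that m assms(1) by auto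
 thus "subgroup J (add_monoid (ring_on S))" using assms unfolding a_inv_def by unfold_locales auto
 show "x \<otimes>\<^bsub>ring_on S\<^esub> a \<in> J" "a \<otimes>\<^bsub>ring_on S\<^esub> x \<in> J" if "a \<in> J" "x \<in> carrier (ring_on S)" for a x
  using assms(4)[of x a] that by (simp_all add: mult.commute)
qed

lemma ideal_onD:
 assumes "ideal J (ring_on S)"
 shows "J \<subseteq> S" "0 \<in> J" "a \<in> J ==> b \<in> J ==> a + b \<in> J" "s \<in> S ==> a \<in> J ==> s * a \<in> J"
proof -
 interpret ideal J "ring_on S" by fact
 show "J \<subseteq> S" "0 \<in> J" "a \<in> J ==> b \<in> J ==> a + b \<in> J" "s \<in> S ==> a \<in> J ==> s * a \<in> J"
  using a_subset additive_subgroup.zero_closed[OF is_additive_subgroup] I_l_closed[of a s]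
   additive_subgroup.a_closed[OF is_additive_subgroup, of a b] by simp_all
qed

lemma ideal_on_sum: "ideal J (ring_on S) ==> (!!x. x \<in> A ==> f x \<in> J) ==> (\<Sum>x\<in>A. f x) \<in> J"
 by (induction A rule: infinite_finite_induct) (simp_all add: ideal_onD(2,3))

lemma genideal_on:
 assumes "Y \<subseteq> S"
 shows "ideal (genideal (ring_on S) Y) (ring_on S)" "Y \<subseteq> genideal (ring_on S) Y"
  and "ideal J (ring_on S) ==> Y \<subseteq> J ==> genideal (ring_on S) Y \<subseteq> J"
proof -
 interpret ring "ring_on S" by (rule ring_ring_on)
 show "ideal (genideal (ring_on S) Y) (ring_on S)" "Y \<subseteq> genideal (ring_on S) Y"
  "ideal J (ring_on S) ==> Y \<subseteq> J ==> genideal (ring_on S) Y \<subseteq> J"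
  using assms genideal_ideal[of Y] genideal_self[of Y] genideal_minimal[of J Y] by simp_all
qed

lemma ideal_prod_on_minimal:
 assumes D: "ideal D (ring_on S)" and "!!a b. a \<in> I ==> b \<in> J ==> a * b \<in> D"
 shows "ideal_prod (ring_on S) I J \<subseteq> D"
proof
 fix x assume "x \<in> ideal_prod (ring_on S) I J"
 thus "x \<in> D" by induction (simp_all add: assms(2) ideal_onD(3)[OF D])
qed

end

lemma (in abelian_subgroup) a_coset_eq_iff:
 assumes "x \<in> carrier G" "y \<in> carrier G"
 shows "H +> x = H +> y \<longleftrightarrow> x \<ominus> y \<in> H"
proof -
 have "H +> x = H +> y \<longleftrightarrow> x \<in> H +> y"
  using assms a_rcos_self a_repr_independence[of x H y] a_subgroup by blast
 also have "\<dots> \<longleftrightarrow> x \<ominus> y \<in> H" using assms by (simp add: a_rcos_module minus_eq)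
 finally show ?thesis .
qed

text \<open>Scalar multiplication in \<open>quot_module\<close> is a union over representatives,
  which this evaluates.\<close>

lemma (in abelian_subgroup) a_coset_Union:
 assumes v: "v \<in> carrier G" and eq: "!!x. x \<in> carrier G ==> x \<ominus> v \<in> H ==> g x = g v"
 shows "(\<Union>x\<in>H +> v. g x) = g v"
proof -
 have "x \<in> carrier G \<and> x \<ominus> v \<in> H" if "x \<in> H +> v" for x
  using that a_elemrcos_carrier[OF v that] v by (simp add: a_rcos_module minus_eq)
 thus ?thesis using eq a_rcos_self[OF v] by blast
qed

context multiproj
begin

subsection \<open>Setting foreign coefficient variables to zero\<close>

text \<open>The coefficient type has variables \<open>(i, \<alpha>)\<close> that do not belong to A.
  This retraction fixes A and the generic forms, so applying it to a relation with foreign variables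
  gives a relation over A.\<close>

definition retU :: "'k::comm_ring_1 upoly => 'k upoly" where
 "retU = mpoly_eval mpoly_const (%v. if v \<in> (SIGMA i:{..N}. Mon (d i)) then mpoly_var v else 0)"

abbreviation "ret \<equiv> pmap retU"

lemma rhom_retU: "rhom retU" unfolding retU_def by (rule rhom_mpoly_eval[OF rhom_mpoly_const])

lemmas rhom_ret = rhom_pmap[OF rhom_retU]
 and lkp_ret = lkp_pmap[OF rhom_retU]
 and keys_ret = keys_pmap[OF rhom_retU]

lemma retU_in: "retU c \<in> AA"
proof -
 interpret A: subring1_on "AA :: 'a upoly set" by (rule subring1_on_coeffs_A)
 have "(mpoly_const a :: 'a upoly) \<in> AA" for a unfolding coeffs_A_def by (rule mpoly_const_in) simp
 moreover have "(mpoly_var v :: 'a upoly) \<in> AA" if "v \<in> (SIGMA i:{..N}. Mon (d i))" for v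
  unfolding coeffs_A_def using that by (intro mpoly_var_in subring1_on_UNIV)
 ultimately show ?thesis
  unfolding retU_def mpoly_eval_def by (intro A.Ssum A.Smult A.Sprod A.Spow) (auto simp: A.S0 simp del: mem_Sigma_iff)
qed

lemma retU_id:
 assumes "c \<in> AA" shows "retU c = c"
proof -
 have "retU c = (\<Sum>m\<in>pkeys c. mpoly_const (lkp c m) * (\<Prod>v\<in>pkeys m. mpoly_var v ^ lkp m v))"
  unfolding retU_def mpoly_eval_def
 proof (intro sum.cong arg_cong2[where f = "(*)"] prod.cong refl)
  fix m v assume "m \<in> pkeys c" "v \<in> pkeys m"
  hence "v \<in> (SIGMA i:{..N}. Mon (d i))" using assms unfolding coeffs_A_def mpolys_def by blast
  thus "(if v \<in> (SIGMA i:{..N}. Mon (d i)) then mpoly_var v else 0) ^ lkp m v = mpoly_var v ^ lkp m v" by simp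
 qed
 also have "\<dots> = c" unfolding monomial_eq by (subst (3) pm_expand[of c]) (simp add: mpoly_const_def mult_single)
 finally show ?thesis .
qed

lemma mpolys_lkp: "p \<in> mpolys V (AA) ==> lkp p m \<in> AA"
 using subring_on.S0[OF subring1_on.axioms(1)[OF subring1_on_coeffs_A]]
 by (cases "m \<in> pkeys p") (auto simp: mpolys_def in_keys_iff)

lemma ret_id: "p \<in> mpolys V (AA) ==> ret p = p" by (rule poly_mapping_eqI) (simp add: lkp_ret retU_id mpolys_lkp)

lemma ret_in: "p \<in> mpolys V UNIV ==> ret p \<in> mpolys V (AA)"
 using keys_ret[of p] by (auto simp: mpolys_def lkp_ret retU_in)

lemma ret_deg: "p \<in> XD UNIV \<mu> ==> ret p \<in> XD (AA) \<mu>"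
 using keys_ret[of p] ret_in[of p "VV"] by (auto simp: xpolys_deg_def)

lemma F_gen_deg: "i \<le> N ==> FG i \<in> XD (AA) (d i)"
proof -
 assume i: "i \<le> N"
 have "m \<in> Mon (d i)" if "m \<in> pkeys (FG i)" for m
  using that by (auto simp: in_keys_iff lkp_F_gen split: if_splits)
 moreover have "lkp (FG i) m \<in> AA" if "m \<in> Mon (d i)" for m
  unfolding coeffs_A_def using that i by (auto simp: lkp_F_gen intro!: mpoly_var_in[OF subring1_on_UNIV])
 ultimately have "m \<in> Mon (d i) \<and> lkp (FG i) m \<in> AA" if "m \<in> pkeys (FG i)" for m
  using that by blast
 thus ?thesis unfolding xpolys_deg_def mpolys_def xmonos_def by blast
qed

lemma F_gen_C: "i \<le> N ==> FG i \<in> CA" using F_gen_deg by (auto simp: xpolys_deg_def)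

lemma in_ideal_C:
 assumes "in_ideal p" "p \<in> CA"
 shows "\<exists>h. (\<forall>i\<le>N. h i \<in> CA) \<and> p = (\<Sum>i\<le>N. h i * FG i)"
proof -
 obtain h where h: "\<forall>i\<le>N. h i \<in> mpolys (VV) UNIV" "p = (\<Sum>i\<le>N. h i * FG i)"
  using assms(1) unfolding in_ideal_def by blast
 have "p = ret p" using ret_id[OF assms(2)] by simp
 also have "\<dots> = (\<Sum>i\<le>N. ret (h i) * FG i)"
  unfolding h(2) rhomD(4,7)[OF rhom_ret] by (intro sum.cong) (simp_all add: ret_id[OF F_gen_C])
 finally show ?thesis using h(1) ret_in by (intro exI[of _ "%i. ret (h i)"]) blast
qed

lemma in_ideal_add: "in_ideal p ==> in_ideal q ==> in_ideal (p + q)"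
proof -
 interpret U: subring1_on "mpolys (VV) (UNIV :: 'a upoly set)" by (rule subring1_on_mpolys[OF subring1_on_UNIV])
 assume "in_ideal p" "in_ideal q"
 then obtain h h' where "\<forall>i\<le>N. h i \<in> mpolys (VV) UNIV" "p = (\<Sum>i\<le>N. h i * FG i)"
  "\<forall>i\<le>N. h' i \<in> mpolys (VV) UNIV" "q = (\<Sum>i\<le>N. h' i * FG i)" unfolding in_ideal_def by blast
 thus ?thesis unfolding in_ideal_def by (intro exI[of _ "%i. h i + h' i"]) (simp add: distrib_right sum.distrib U.Sadd)
qed

lemma in_ideal_mult: "in_ideal p ==> s \<in> mpolys (VV) UNIV ==> in_ideal (s * p)"
proof -
 interpret U: subring1_on "mpolys (VV) (UNIV :: 'a upoly set)" by (rule subring1_on_mpolys[OF subring1_on_UNIV])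
 assume "in_ideal p" and s: "s \<in> mpolys (VV) UNIV"
 then obtain h where "\<forall>i\<le>N. h i \<in> mpolys (VV) UNIV" "p = (\<Sum>i\<le>N. h i * FG i)" unfolding in_ideal_def by blast
 thus ?thesis unfolding in_ideal_def using s by (intro exI[of _ "%i. s * h i"]) (simp add: sum_distrib_left mult.assoc U.Smult)
qed

lemma in_ideal_zero: "in_ideal 0" unfolding in_ideal_def by (intro exI[of _ "%_. 0"]) (simp add: mpolys_def)

lemma in_ideal_sum: "(!!x. x \<in> A ==> in_ideal (f x)) ==> in_ideal (\<Sum>x\<in>A. f x)"
 by (induction A rule: infinite_finite_induct) (simp_all add: in_ideal_zero in_ideal_add)

lemma carr_C_UNIV: "CA \<subseteq> mpolys (VV) UNIV" by (auto simp: mpolys_def)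

lemma ideal_I_iff: "p \<in> ideal_I r n d \<longleftrightarrow> p \<in> CA \<and> in_ideal p"
proof -
 interpret C: subring1_on "CA :: 'a cpoly set" by (rule subring1_on_carr_C)
 have Y: "FG ` {..N} \<subseteq> (CA :: 'a cpoly set)" using F_gen_C by auto
 let ?J = "{p :: 'a cpoly. p \<in> CA \<and> in_ideal p}"
 have J: "ideal ?J (ring_on (CA))"
  using carr_C_UNIV by (intro C.ideal_ring_on) (auto simp: C.S0 C.Sadd C.Smult in_ideal_zero in_ideal_add in_ideal_mult)
 have "in_ideal (FG i :: 'a cpoly)" if i: "i \<le> N" for i
 proof -
  have "FG i = (\<Sum>k\<le>N. (if k = i then 1 else 0) * (FG k :: 'a cpoly))"
   using i by (simp add: if_distrib[of "%x. x * _"] cong: if_cong)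
  thus ?thesis unfolding in_ideal_def using subring1_on.S1[OF subring1_on_mpolys[OF subring1_on_UNIV]]
   by (intro exI[of _ "%k. if k = i then 1 else 0"]) (auto simp: mpolys_def)
 qed
 hence "FG ` {..N} \<subseteq> ?J" using Y by auto
 hence 1: "ideal_I r n d \<subseteq> ?J" unfolding ideal_I_def ring_C_def by (rule C.genideal_on(3)[OF Y J])
 have "p \<in> ideal_I r n d" if p: "p \<in> CA" "in_ideal p"
 proof -
  obtain h where h: "\<forall>i\<le>N. h i \<in> CA" "p = (\<Sum>i\<le>N. h i * FG i)"
   using in_ideal_C[OF p(2,1)] by blast
  have I: "ideal (ideal_I r n d :: 'a cpoly set) (ring_on (CA))" "FG ` {..N} \<subseteq> (ideal_I r n d :: 'a cpoly set)"
   unfolding ideal_I_def ring_C_def by (rule C.genideal_on[OF Y])+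
  show ?thesis unfolding h(2) using h(1) I(2) by (intro C.ideal_on_sum[OF I(1)] C.ideal_onD(4)[OF I(1)]) auto
 qed
 thus ?thesis using 1 by blast
qed

subsection \<open>Powers of the irrelevant ideal\<close>

text \<open>A bound from above for the M-th power of the irrelevant ideal; from below,
  \<open>ideal_b_pow\<close> supplies the elements x_\<sigma>^M.\<close>

definition high :: "nat set => nat => 'k::comm_ring_1 cpoly set" where
 "high T M = {q \<in> CA. \<forall>m\<in>pkeys q. \<forall>j\<in>T. int M \<le> xmono_deg n m j}"

lemma xmono_deg_add: "xmono_deg n (a + b) j = xmono_deg n a j + xmono_deg n b j" by (simp add: xmono_deg_def lookup_add sum.distrib)

lemma xmono_deg_ge0: "xmono_deg n a j \<ge> 0" by (simp add: xmono_deg_def sum_nonneg)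

lemma ideal_high: "ideal (high T M) (ring_on (CA))"
proof -
 interpret C: subring1_on "CA :: 'a cpoly set" by (rule subring1_on_carr_C)
 show ?thesis
 proof (rule C.ideal_ring_on)
  fix a b :: "'a cpoly" assume ab: "a \<in> high T M" "b \<in> high T M"
  thus "a + b \<in> high T M" using Poly_Mapping.keys_add[of a b] unfolding high_def by (fastforce simp: C.Sadd)
 next
  fix s a :: "'a cpoly" assume s: "s \<in> CA" and a: "a \<in> high T M"
  have "int M \<le> xmono_deg n m j" if m: "m \<in> pkeys (s * a)" "j \<in> T" for m j
  proof -
   obtain u v where uv: "m = u + v" "v \<in> pkeys a" using m Poly_Mapping.keys_mult[of s a] by blast
   have "int M \<le> xmono_deg n v j" using a uv m by (auto simp: high_def)
   thus ?thesis using xmono_deg_ge0[of u j] by (simp add: uv xmono_deg_add)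
  qed
  thus "s * a \<in> high T M" using s a by (auto simp: high_def C.Smult)
 qed (auto simp: high_def C.S0)
qed

lemma high_mult:
 assumes "a \<in> high T M" "b \<in> high T' M'" and "!!j. j \<in> U ==> K \<le> (if j \<in> T then M else 0) + (if j \<in> T' then M' else 0)"
 shows "a * b \<in> (high U K :: 'k::comm_ring_1 cpoly set)"
proof -
 interpret C: subring1_on "CA :: 'k cpoly set" by (rule subring1_on_carr_C)
 have "int K \<le> xmono_deg n m j" if m: "m \<in> pkeys (a * b)" "j \<in> U" for m j
 proof -
  obtain u v where uv: "m = u + v" "u \<in> pkeys a" "v \<in> pkeys b" using m Poly_Mapping.keys_mult[of a b] by blast
  have "int (if j \<in> T then M else 0) \<le> xmono_deg n u j" "int (if j \<in> T' then M' else 0) \<le> xmono_deg n v j"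
   using assms(1,2) uv xmono_deg_ge0 by (auto simp: high_def)
  thus ?thesis using assms(3)[OF m(2)] by (simp only: uv xmono_deg_add)
 qed
 thus ?thesis using assms by (auto simp: high_def C.Smult)
qed

lemma ideals_set_simps: "carrier (ideals_set R) = {I. ideal I R}" "monoid.mult (ideals_set R) = ideal_prod R" "one (ideals_set R) = carrier R"
 by (simp_all add: ideals_set_def)

lemma ideal_m_props:
 assumes j: "j \<in> {1..r}"
 shows "ideal (ideal_m r n d j) (ring_on (CA :: 'k::comm_ring_1 cpoly set))"
  and "ideal_m r n d j \<subseteq> (high {j} 1 :: 'k cpoly set)"
  and "l \<le> n j ==> mpoly_var (j, l) \<in> (ideal_m r n d j :: 'k cpoly set)"
proof -
 interpret C: subring1_on "CA :: 'k cpoly set" by (rule subring1_on_carr_C)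
 have c: "mpoly_var (j, l) \<in> (CA :: 'k cpoly set)" if "l \<le> n j" for l
  using that j by (intro mpoly_var_in[OF subring1_on_coeffs_A]) (auto simp: xvars_def)
 hence Y: "(%l. mpoly_var (j, l)) ` {..n j} \<subseteq> (CA :: 'k cpoly set)" by auto
 have "int 1 \<le> xmono_deg n (sgl (j, l) 1) j" if "l \<le> n j" for l
 proof -
  have "xmono_deg n (sgl (j, l) 1) j = (\<Sum>l'\<le>n j. if l' = l then 1 else 0)"
   unfolding xmono_deg_def by (intro sum.cong) (auto simp: lookup_single when_def)
  thus ?thesis using that by simp
 qed
 hence "(%l. mpoly_var (j, l)) ` {..n j} \<subseteq> (high {j} 1 :: 'k cpoly set)"
  using c by (auto simp: high_def mpoly_var_def)
 thus "ideal_m r n d j \<subseteq> (high {j} 1 :: 'k cpoly set)"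
  unfolding ideal_m_def ring_C_def by (rule C.genideal_on(3)[OF Y ideal_high])
 show "ideal (ideal_m r n d j :: 'k cpoly set) (ring_on (CA))"
  unfolding ideal_m_def ring_C_def by (rule C.genideal_on(1)[OF Y])
 show "l \<le> n j ==> mpoly_var (j, l) \<in> (ideal_m r n d j :: 'k cpoly set)"
  using C.genideal_on(2)[OF Y] unfolding ideal_m_def ring_C_def by auto
qed

text \<open>Induction over the groups yields both bounds together: positive degree in each group
  treated so far, and the product of one variable from each.\<close>

lemma ideal_b_props:
 shows "ideal (ideal_b r n d) (ring_on (CA :: 'k::comm_ring_1 cpoly set))"
  and "ideal_b r n d \<subseteq> (high {1..r} 1 :: 'k cpoly set)"
  and "(!!j. j \<in> {1..r} ==> \<sigma> j \<le> n j) ==> sgl (vmono r \<sigma> (%_. 1)) 1 \<in> (ideal_b r n d :: 'k cpoly set)"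
proof -
 interpret C: subring1_on "CA :: 'k cpoly set" by (rule subring1_on_carr_C)
 let ?R = "ring_on (CA :: 'k cpoly set)"
 interpret I: comm_monoid "ideals_set ?R" by (rule cring.ideals_set_is_comm_monoid[OF C.cring_ring_on])
 let ?P = "%T. \<Otimes>\<^bsub>ideals_set ?R\<^esub>j\<in>T. ideal_m r n d j"
 have main: "ideal (?P T) ?R \<and> ?P T \<subseteq> high T 1 \<and>
  ((\<forall>j\<in>T. \<sigma> j \<le> n j) --> (\<Prod>j\<in>T. mpoly_var (j, \<sigma> j)) \<in> ?P T)" if "finite T" "T \<subseteq> {1..r}" for T \<sigma>
  using that
 proof (induction T rule: finite_induct)
  case empty
  have "ideal (CA) ?R" using ring.oneideal[OF C.ring_ring_on] by simp
  thus ?case by (simp add: ideals_set_simps high_def C.S1)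
 next
  case (insert j T)
  have j: "j \<in> {1..r}" using insert by simp
  have cl: "?P (insert j T) = ideal_prod ?R (ideal_m r n d j) (?P T)"
   using insert ideal_m_props(1) by (subst I.finprod_insert) (auto simp: ideals_set_simps Pi_def)
  have I: "ideal (?P (insert j T)) ?R"
   unfolding cl using insert ideal_m_props(1)[OF j] by (intro ring.ideal_prod_is_ideal[OF C.ring_ring_on]) auto
  moreover have "?P (insert j T) \<subseteq> high (insert j T) 1" unfolding cl
  proof (rule C.ideal_prod_on_minimal[OF ideal_high])
   fix a b assume "a \<in> (ideal_m r n d j :: 'k cpoly set)" "b \<in> ?P T"
   hence "a \<in> high {j} 1" "b \<in> high T 1" using ideal_m_props(2)[OF j, where 'k = 'k] insert by auto
   thus "a * b \<in> high (insert j T) 1" by (rule high_mult) auto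
  qed
  moreover have "(\<Prod>j\<in>insert j T. mpoly_var (j, \<sigma> j)) \<in> ?P (insert j T)" if "\<forall>j\<in>insert j T. \<sigma> j \<le> n j"
  proof -
   have "mpoly_var (j, \<sigma> j) \<otimes>\<^bsub>?R\<^esub> (\<Prod>j\<in>T. mpoly_var (j, \<sigma> j)) \<in> ?P (insert j T)"
    unfolding cl using insert that ideal_m_props(3)[OF j] by (intro ideal_prod.prod) auto
   thus ?thesis using insert by simp
  qed
  ultimately show ?case by blast
 qed
 show "ideal (ideal_b r n d) ?R" "ideal_b r n d \<subseteq> (high {1..r} 1 :: 'k cpoly set)"
  using main[of "{1..r}"] by (simp_all add: ideal_b_def ring_C_def)
 assume "!!j. j \<in> {1..r} ==> \<sigma> j \<le> n j"
 hence "(\<Prod>j\<in>{1..r}. mpoly_var (j, \<sigma> j)) \<in> (ideal_b r n d :: 'k cpoly set)"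
  using main[of "{1..r}" \<sigma>] by (simp add: ideal_b_def ring_C_def)
 moreover have "(\<Prod>j\<in>{1..r}. mpoly_var (j, \<sigma> j)) = (sgl (vmono r \<sigma> (%_. 1)) 1 :: 'k cpoly)"
  by (simp add: vmono_def mpoly_var_def prod_sgl)
 ultimately show "sgl (vmono r \<sigma> (%_. 1)) 1 \<in> (ideal_b r n d :: 'k cpoly set)" by simp
qed

lemma vmono_Suc: "vmono r \<sigma> (%_. Suc k) = vmono r \<sigma> (%_. k) + vmono r \<sigma> (%_. 1)"
 by (rule poly_mapping_eqI) (auto simp: lookup_add lkp_vmono split: prod.split)

lemma ideal_b_pow:
 fixes M :: nat
 defines "B \<equiv> ideal_b r n d [^]\<^bsub>ideals_set (ring_C r n d)\<^esub> M"
 shows "B \<subseteq> (high {1..r} M :: 'k::comm_ring_1 cpoly set)"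
  and "(!!j. j \<in> {1..r} ==> \<sigma> j \<le> n j) ==> sgl (vmono r \<sigma> (%_. M)) 1 \<in> B"
proof -
 interpret C: subring1_on "CA :: 'k cpoly set" by (rule subring1_on_carr_C)
 let ?R = "ring_on (CA :: 'k cpoly set)"
 let ?B = "%M::nat. ideal_b r n d [^]\<^bsub>ideals_set ?R\<^esub> M"
 have "?B M \<subseteq> high {1..r} M \<and> ((\<forall>j\<in>{1..r}. \<sigma> j \<le> n j) --> sgl (vmono r \<sigma> (%_. M)) 1 \<in> ?B M)"
 proof (induction M)
  case 0
  have "vmono r \<sigma> (%_. 0) = 0" by (simp add: vmono_def)
  thus ?case using C.S1 xmono_deg_ge0 by (auto simp: nat_pow_def ideals_set_simps high_def)
 next
  case (Suc M)
  have B: "?B (Suc M) = ideal_prod ?R (?B M) (ideal_b r n d)" by (simp add: nat_pow_def ideals_set_simps)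
  have "?B (Suc M) \<subseteq> high {1..r} (Suc M)" unfolding B
  proof (rule C.ideal_prod_on_minimal[OF ideal_high])
   fix a b assume "a \<in> ?B M" "b \<in> (ideal_b r n d :: 'k cpoly set)"
   hence "a \<in> high {1..r} M" "b \<in> high {1..r} 1" using Suc ideal_b_props(2) by blast+
   thus "a * b \<in> high {1..r} (Suc M)" by (rule high_mult) auto
  qed
  moreover have "sgl (vmono r \<sigma> (%_. Suc M)) 1 \<in> ?B (Suc M)" if "\<forall>j\<in>{1..r}. \<sigma> j \<le> n j"
  proof -
   have "sgl (vmono r \<sigma> (%_. M)) 1 \<otimes>\<^bsub>?R\<^esub> sgl (vmono r \<sigma> (%_. 1)) 1 \<in> ?B (Suc M)"
    unfolding B using Suc that ideal_b_props(3)[of \<sigma>] by (intro ideal_prod.prod) auto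
   thus ?thesis by (simp only: C.mult_ring_on mult_single vmono_Suc mult_1)
  qed
  ultimately show ?case by blast
 qed
 thus "B \<subseteq> (high {1..r} M :: 'k cpoly set)"
  "(!!j. j \<in> {1..r} ==> \<sigma> j \<le> n j) ==> sgl (vmono r \<sigma> (%_. M)) 1 \<in> B" by (simp_all add: B_def ring_C_def)
qed

text \<open>Pigeonhole: of \<open>n j + 1\<close> exponents with sum at least
  \<open>(n j + 1) * K\<close> one is at least K. The transversal is taken extensional, so that it
  ranges over a finite set and exponents depending on it have a common bound.\<close>

lemma large_monomial:
 assumes m: "pkeys m \<subseteq> VV" and deg: "!!j. j \<in> {1..r} ==> int ((n j + 1) * K) \<le> xmono_deg n m j"
 shows "\<exists>\<sigma>\<in>\<Pi>\<^sub>E j\<in>{1..r}. {..n j}. \<forall>k\<le>K. \<exists>m'. m = m' + vmono r \<sigma> (%_. k) \<and> pkeys m' \<subseteq> pkeys m"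
proof -
 have "\<exists>l. l \<le> n j \<and> K \<le> lkp m (j, l)" if j: "j \<in> {1..r}" for j
 proof (rule ccontr)
  assume "~ ?thesis"
  hence lt: "lkp m (j, l) < K" if "l \<le> n j" for l using that by force
  have "(\<Sum>l\<le>n j. lkp m (j, l)) < (\<Sum>l\<le>n j. K)" using lt by (intro sum_strict_mono) auto
  hence "(\<Sum>l\<le>n j. lkp m (j, l)) < (n j + 1) * K" by simp
  hence "xmono_deg n m j < int ((n j + 1) * K)" unfolding xmono_deg_def by (simp only: of_nat_sum[symmetric] of_nat_less_iff)
  thus False using deg[OF j] by simp
 qed
 hence "\<forall>j\<in>{1..r}. \<exists>l. l \<le> n j \<and> K \<le> lkp m (j, l)" by (intro ballI)
 hence "\<exists>f. \<forall>j\<in>{1..r}. f j \<le> n j \<and> K \<le> lkp m (j, f j)" by (rule bchoice)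
 then obtain f where f: "!!j. j \<in> {1..r} ==> f j \<le> n j \<and> K \<le> lkp m (j, f j)" by blast
 define \<sigma> where "\<sigma> = restrict f {1..r}"
 have "\<exists>m'. m = m' + vmono r \<sigma> (%_. k) \<and> pkeys m' \<subseteq> pkeys m" if k: "k \<le> K" for k
 proof (intro exI[of _ "m - vmono r \<sigma> (%_. k)"] conjI)
  have "lkp (vmono r \<sigma> (%_. k)) v \<le> lkp m v" for v
  proof (cases v)
   case (Pair j l)
   have "k \<le> lkp m (j, f j)" if "j \<in> {1..r}" using f[OF that] k by simp
   thus ?thesis by (simp add: Pair lkp_vmono \<sigma>_def)
  qed
  thus "m = m - vmono r \<sigma> (%_. k) + vmono r \<sigma> (%_. k)" by (intro poly_mapping_eqI) (simp add: lookup_add lookup_minus)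
  show "pkeys (m - vmono r \<sigma> (%_. k)) \<subseteq> pkeys m" by (auto simp: in_keys_iff lookup_minus)
 qed
 moreover have "\<sigma> \<in> (\<Pi>\<^sub>E j\<in>{1..r}. {..n j})" using f by (auto simp: \<sigma>_def)
 ultimately show ?thesis by blast
qed

text \<open>One direction tests with x_\<sigma>^M, an element of the M-th power. For the other, the
  finitely many transversals have a common exponent K, and each monomial in a high power of the
  ideal is divisible by some x_\<sigma>^K.\<close>

lemma ideal_Isat_iff: "p \<in> ideal_Isat r n d \<longleftrightarrow> p \<in> CA \<and> in_sat (p :: 'k::comm_ring_1 cpoly)"
proof -
 interpret C: subring1_on "CA :: 'k cpoly set" by (rule subring1_on_carr_C)
 let ?b = "%M::nat. ideal_b r n d [^]\<^bsub>ideals_set (ring_C r n d)\<^esub> M :: 'k cpoly set"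
 have eq: "p \<in> ideal_Isat r n d \<longleftrightarrow> p \<in> CA \<and> (\<exists>M. \<forall>q\<in>?b M. q * p \<in> ideal_I r n d)"
  by (simp add: ideal_Isat_def ring_C_def)
 have "in_sat p" if "\<forall>q\<in>?b M. q * p \<in> ideal_I r n d" for M unfolding in_sat_def
 proof (intro allI impI exI[of _ M])
  fix \<sigma> :: "nat => nat" assume "\<forall>j\<in>{1..r}. \<sigma> j \<le> n j"
  hence "sgl (vmono r \<sigma> (%_. M)) 1 \<in> ?b M" by (intro ideal_b_pow(2)) blast
  thus "in_ideal (sgl (vmono r \<sigma> (%_. M)) 1 * p)" using that by (simp add: ideal_I_iff)
 qed
 moreover have "\<exists>M. \<forall>q\<in>?b M. q * p \<in> ideal_I r n d" if p: "p \<in> CA" and s: "in_sat p"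
 proof -
  let ?\<Sigma> = "\<Pi>\<^sub>E j\<in>{1..r}. {..n j}"
  have "\<forall>\<sigma>\<in>?\<Sigma>. \<exists>k. in_ideal (sgl (vmono r \<sigma> (%_. k)) 1 * p)"
   using s unfolding in_sat_def by (auto simp: PiE_iff)
  then obtain k where k: "!!\<sigma>. \<sigma> \<in> ?\<Sigma> ==> in_ideal (sgl (vmono r \<sigma> (%_. k \<sigma>)) 1 * p)"
   unfolding bchoice_iff by blast
  have fin: "finite ?\<Sigma>" by (intro finite_PiE) auto
  define K where "K = (\<Sum>\<sigma>\<in>?\<Sigma>. k \<sigma>)"
  have K: "k \<sigma> \<le> K" if "\<sigma> \<in> ?\<Sigma>" for \<sigma> unfolding K_def using that fin by (intro member_le_sum) auto
  \<comment> \<open>At least \<open>(n j + 1) * K\<close> for each group j, as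
    \<open>large_monomial\<close> requires.\<close>
  define M where "M = (\<Sum>j\<in>{1..r}. (n j + 1) * K)"
  have "q * p \<in> ideal_I r n d" if q: "q \<in> ?b M" for q
  proof -
   have qh: "q \<in> high {1..r} M" using q ideal_b_pow(1) by blast
   have "in_ideal (sgl m (lkp q m) * p)" if m: "m \<in> pkeys q" for m
   proof -
    have mx: "pkeys m \<subseteq> VV" using qh m by (auto simp: high_def mpolys_def)
    have "int ((n j + 1) * K) \<le> xmono_deg n m j" if j: "j \<in> {1..r}" for j
    proof -
     have "(n j + 1) * K \<le> M" unfolding M_def using j by (intro member_le_sum) auto
     hence "int ((n j + 1) * K) \<le> int M" by (simp only: of_nat_le_iff)
     also have "\<dots> \<le> xmono_deg n m j" using qh m j unfolding high_def by blast
     finally show ?thesis .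
    qed
    from large_monomial[OF mx this] obtain \<sigma> where \<sigma>: "\<sigma> \<in> ?\<Sigma>"
     and ex: "\<forall>k\<le>K. \<exists>m'. m = m' + vmono r \<sigma> (%_. k) \<and> pkeys m' \<subseteq> pkeys m" by blast
    obtain m' where mm: "m = m' + vmono r \<sigma> (%_. k \<sigma>)" and "pkeys m' \<subseteq> pkeys m" using ex K[OF \<sigma>] by blast
    hence "sgl m' (lkp q m) \<in> mpolys (VV) UNIV" using mx by (auto simp: mpolys_def)
    from in_ideal_mult[OF k[OF \<sigma>] this] show ?thesis by (simp add: mult.assoc[symmetric] mult_single mm[symmetric])
   qed
   hence "in_ideal (\<Sum>m\<in>pkeys q. sgl m (lkp q m) * p)" by (rule in_ideal_sum)
   hence "in_ideal (q * p)" unfolding sum_distrib_right[symmetric] pm_expand[symmetric] .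
   thus ?thesis using qh p by (simp add: ideal_I_iff high_def C.Smult)
  qed
  thus ?thesis by blast
 qed
 ultimately show ?thesis using eq by blast
qed

lemma in_ideal_deg_imp: "in_ideal_deg \<nu> p ==> in_ideal p" unfolding in_ideal_deg_def in_ideal_def xpolys_deg_def by blast

lemma in_ideal_imp_sat: "in_ideal p ==> in_sat p" unfolding in_sat_def by (intro allI impI exI[of _ 0]) (simp add: vmono_def)

lemma in_sat_add:
 assumes "in_sat p" "in_sat q" shows "in_sat (p + q)" unfolding in_sat_def
proof (intro allI impI)
 fix \<sigma> :: "nat => nat" assume \<sigma>: "\<forall>j\<in>{1..r}. \<sigma> j \<le> n j"
 obtain k l where kl: "in_ideal (sgl (vmono r \<sigma> (%_. k)) 1 * p)" "in_ideal (sgl (vmono r \<sigma> (%_. l)) 1 * q)"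
  using assms \<sigma> unfolding in_sat_def by blast
 have v: "sgl (vmono r \<sigma> (%_. a)) 1 \<in> mpolys (VV) UNIV" for a
  using keys_vmono[of r \<sigma> "%_. a"] \<sigma> by (fastforce simp: mpolys_def xvars_def)
 have s: "vmono r \<sigma> (%_. k) + vmono r \<sigma> (%_. l) = vmono r \<sigma> (%_. k + l)"
  by (rule poly_mapping_eqI) (auto simp: lookup_add lkp_vmono split: prod.split)
 have "in_ideal (sgl (vmono r \<sigma> (%_. l)) 1 * (sgl (vmono r \<sigma> (%_. k)) 1 * p)
  + sgl (vmono r \<sigma> (%_. k)) 1 * (sgl (vmono r \<sigma> (%_. l)) 1 * q))" by (intro in_ideal_add in_ideal_mult kl v)
 hence "in_ideal (sgl (vmono r \<sigma> (%_. k + l)) 1 * (p + q))"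
  by (simp add: mult.assoc[symmetric] mult_single s add.commute[of "vmono r \<sigma> (%_. l)"] distrib_left)
 thus "\<exists>k. in_ideal (sgl (vmono r \<sigma> (%_. k)) 1 * (p + q))" by blast
qed

lemma in_sat_mult:
 assumes "in_sat p" "s \<in> mpolys (VV) UNIV" shows "in_sat (s * p)" unfolding in_sat_def
proof (intro allI impI)
 fix \<sigma> :: "nat => nat" assume "\<forall>j\<in>{1..r}. \<sigma> j \<le> n j"
 then obtain k where "in_ideal (sgl (vmono r \<sigma> (%_. k)) 1 * p)" using assms unfolding in_sat_def by blast
 from in_ideal_mult[OF this assms(2)] show "\<exists>k. in_ideal (sgl (vmono r \<sigma> (%_. k)) 1 * (s * p))"
  by (auto simp: mult.left_commute)
qed

lemma in_sat_sum: "(!!x. x \<in> A ==> in_sat (f x)) ==> in_sat (\<Sum>x\<in>A. f x)"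
 by (induction A rule: infinite_finite_induct) (simp_all add: in_ideal_imp_sat in_ideal_zero in_sat_add)

subsection \<open>Cokernels of elimination matrices\<close>

lemma abelian_group_module_C: "abelian_group (module_C r n d :: ('k::comm_ring_1 cpoly, _) gr_module)"
proof -
 interpret C: subring1_on "CA :: 'k cpoly set" by (rule subring1_on_carr_C)
 let ?M = "module_C r n d :: ('k cpoly, _) gr_module"
 show ?thesis
 proof (rule abelian_groupI)
  show "\<exists>y\<in>carrier ?M. y \<oplus>\<^bsub>?M\<^esub> x = \<zero>\<^bsub>?M\<^esub>" if "x \<in> carrier ?M" for x
   using that by (intro bexI[of _ "- x"]) (auto simp: module_C_def ring_C_def C.Sminus)
 qed (auto simp: module_C_def ring_C_def C.Sadd C.S0 add_ac)
qed

lemma abelian_group_free_module: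
 assumes "subring1_on A"
 shows "abelian_group (free_module (ring_on A) K)"
proof (rule abelian_groupI)
 interpret A: subring1_on A by fact
 let ?M = "free_module (ring_on A) K"
 show "\<exists>y\<in>carrier ?M. y \<oplus>\<^bsub>?M\<^esub> x = \<zero>\<^bsub>?M\<^esub>" if "x \<in> carrier ?M" for x
  using that by (intro bexI[of _ "\<lambda>i\<in>K. - x i"]) (auto simp: free_module_def A.Sminus PiE_iff)
 show "\<zero>\<^bsub>?M\<^esub> \<oplus>\<^bsub>?M\<^esub> x = x" if "x \<in> carrier ?M" for x
  using that by (auto simp: free_module_def PiE_iff extensional_def fun_eq_iff)
qed (use assms in \<open>auto simp: free_module_def add_ac PiE_iff fun_eq_iff subring_on.Sadd[OF subring1_on.axioms(1)]
  subring_on.S0[OF subring1_on.axioms(1)] ring_on_def\<close>)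

lemma additive_subgroupI_minus:
 assumes G: "abelian_group G" and "H \<subseteq> carrier G" "\<zero>\<^bsub>G\<^esub> \<in> H" "!!x y. x \<in> H ==> y \<in> H ==> x \<oplus>\<^bsub>G\<^esub> y \<in> H"
  and inv: "!!x. x \<in> H ==> \<exists>y\<in>H. y \<oplus>\<^bsub>G\<^esub> x = \<zero>\<^bsub>G\<^esub>"
 shows "abelian_subgroup H G"
proof (rule abelian_subgroupI3[OF additive_subgroup.intro G])
 interpret G: abelian_group G by fact
 have "\<ominus>\<^bsub>G\<^esub> x \<in> H" if x: "x \<in> H" for x
 proof -
  obtain y where y: "y \<in> H" "y \<oplus>\<^bsub>G\<^esub> x = \<zero>\<^bsub>G\<^esub>" using inv[OF x] by blast
  hence "\<ominus>\<^bsub>G\<^esub> x = y" using x assms(2) by (intro G.minus_equality) auto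
  thus ?thesis using y by simp
 qed
 thus "subgroup H (add_monoid G)" using assms(2-4) unfolding a_inv_def by unfold_locales auto
qed

definition vec_poly :: "(nat => int) => (xmono => 'a::comm_ring_1) => 'a xpoly" where
 "vec_poly \<nu> v = (\<Sum>\<gamma>\<in>Mon \<nu>. sgl \<gamma> (v \<gamma>))"

lemma lkp_vec_poly: "lkp (vec_poly \<nu> v) \<gamma> = (if \<gamma> \<in> Mon \<nu> then v \<gamma> else 0)"
proof -
 have "lkp (vec_poly \<nu> v) \<gamma> = (\<Sum>\<gamma>'\<in>Mon \<nu>. if \<gamma>' = \<gamma> then v \<gamma>' else 0)"
  by (simp add: vec_poly_def lookup_sum lookup_single when_def)
 thus ?thesis by simp
qed

lemma vec_poly_deg: "vec_poly \<nu> v \<in> XD UNIV \<nu>"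
proof -
 have "m \<in> Mon \<nu>" if "m \<in> pkeys (vec_poly \<nu> v)" for m
  using that by (simp add: in_keys_iff lkp_vec_poly split: if_splits)
 thus ?thesis unfolding xpolys_deg_def mpolys_def xmonos_def by blast
qed

lemma vec_poly_lkp: "p \<in> XD A \<nu> ==> vec_poly \<nu> (lkp p) = p"
proof (rule poly_mapping_eqI)
 fix m assume p: "p \<in> XD A \<nu>"
 have "m \<in> pkeys p ==> m \<in> Mon \<nu>" using p unfolding xpolys_deg_def mpolys_def xmonos_def by blast
 thus "lkp (vec_poly \<nu> (lkp p)) m = lkp p m" by (auto simp: lkp_vec_poly in_keys_iff)
qed

lemma vec_poly_mat_map:
 assumes A: "subring1_on A" and J: "finite J" and g: "!!c. c \<in> J ==> g c \<in> XD A \<nu>" and w: "w \<in> J \<rightarrow>\<^sub>E A"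
 shows "vec_poly \<nu> (mat_map (ring_on A) (Mon \<nu>) J (%\<gamma> c. lkp (g c) \<gamma>) w) = (\<Sum>c\<in>J. sgl 0 (w c) * g c)"
proof (rule poly_mapping_eqI)
 interpret A: subring1_on A by fact
 have lk: "lkp (g c) \<gamma> \<in> A" if "c \<in> J" for c \<gamma>
  using g[OF that] A.S0 by (cases "\<gamma> \<in> pkeys (g c)") (auto simp: xpolys_deg_def mpolys_def in_keys_iff)
 fix \<gamma>
 have R: "lkp (\<Sum>c\<in>J. sgl 0 (w c) * g c) \<gamma> = (\<Sum>c\<in>J. w c * lkp (g c) \<gamma>)" by (simp add: lookup_sum lkp_const_mult)
 show "lkp (vec_poly \<nu> (mat_map (ring_on A) (Mon \<nu>) J (%\<gamma> c. lkp (g c) \<gamma>) w)) \<gamma> = lkp (\<Sum>c\<in>J. sgl 0 (w c) * g c) \<gamma>"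
 proof (cases "\<gamma> \<in> Mon \<nu>")
  case True
  have "(\<Oplus>\<^bsub>ring_on A\<^esub>c\<in>J. lkp (g c) \<gamma> \<otimes>\<^bsub>ring_on A\<^esub> w c) = (\<Sum>c\<in>J. lkp (g c) \<gamma> * w c)"
   using lk w by (subst A.finsum_ring_on) (auto intro!: A.Smult)
  thus ?thesis using True by (simp add: lkp_vec_poly mat_map_def R) (simp add: mult.commute)
 next
  case False
  hence "lkp (g c) \<gamma> = 0" if "c \<in> J" for c
   using g[OF that] by (auto simp: xpolys_deg_def mpolys_def xmonos_def in_keys_iff)
  thus ?thesis using False by (simp add: lkp_vec_poly R)
 qed
qed

text \<open>By \<open>sat\<close> the saturated ideal in degree \<nu> is the A-span of the columns.
  Under \<open>vec_poly\<close> coefficient vectors become forms and the image of the matrix becomes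
  that span, so the induced map on cosets is the isomorphism.\<close>

lemma presentation_matrixI:
 fixes g :: "'c => 'k::comm_ring_1 cpoly"
 assumes J: "finite J" and g: "!!c. c \<in> J ==> g c \<in> XD (AA) \<nu>"
  and sat: "!!p. p \<in> XD (AA) \<nu> ==>
   in_sat p \<longleftrightarrow> (\<exists>w\<in>J \<rightarrow>\<^sub>E AA. p = (\<Sum>c\<in>J. sgl 0 (w c) * g c))"
 shows "presentation_matrix (ring_A r n d) (Mon \<nu>) J (%\<gamma> c. lkp (g c) \<gamma>) (B_sat_piece r n d \<nu>)"
proof -
 let ?A = "AA :: 'k upoly set" and ?I = "Mon \<nu>"
 let ?F = "free_module (ring_on ?A) ?I" and ?M = "module_C r n d :: ('k cpoly, 'k cpoly) gr_module"
 let ?S = "ideal_Isat r n d :: 'k cpoly set"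
 let ?f = "mat_map (ring_on ?A) ?I J (%\<gamma> c. lkp (g c) \<gamma>)"
 let ?N = "?f ` carrier (free_module (ring_on ?A) J)"
 interpret A: subring1_on ?A by (rule subring1_on_coeffs_A)
 interpret C: subring1_on "CA :: 'k cpoly set" by (rule subring1_on_carr_C)
 interpret F: abelian_group ?F by (rule abelian_group_free_module[OF A.subring1_on_axioms])
 interpret M: abelian_group ?M by (rule abelian_group_module_C)
 have cF: "carrier (free_module (ring_on ?A) K) = K \<rightarrow>\<^sub>E ?A" for K :: "'z set" by (simp add: free_module_def)
 have cM [simp]: "carrier ?M = CA" "add ?M = (+)" "zero ?M = 0" by (simp_all add: module_C_def ring_C_def)
 have vp: "vec_poly \<nu> v \<in> XD ?A \<nu>" if "v \<in> ?I \<rightarrow>\<^sub>E ?A" for v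
 proof -
  have "m \<in> ?I" if "m \<in> pkeys (vec_poly \<nu> v)" for m using that by (simp add: in_keys_iff lkp_vec_poly split: if_splits)
  moreover have "lkp (vec_poly \<nu> v) m \<in> ?A" for m using that by (auto simp: lkp_vec_poly A.S0)
  ultimately show ?thesis unfolding xpolys_deg_def mpolys_def xmonos_def by blast
 qed
 have vpC: "vec_poly \<nu> v \<in> CA" if "v \<in> ?I \<rightarrow>\<^sub>E ?A" for v using vp[OF that] by (simp add: xpolys_deg_def)
 have vadd: "vec_poly \<nu> (v \<oplus>\<^bsub>?F\<^esub> w) = vec_poly \<nu> v + vec_poly \<nu> w" for v w
  by (rule poly_mapping_eqI) (simp add: lkp_vec_poly free_module_def lookup_add)
 have vsm: "vec_poly \<nu> (a \<odot>\<^bsub>?F\<^esub> v) = sgl 0 a * vec_poly \<nu> v" for a v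
  by (rule poly_mapping_eqI) (simp add: lkp_vec_poly free_module_def lkp_const_mult)
 have vinj: "v = w" if "vec_poly \<nu> v = vec_poly \<nu> w" "v \<in> ?I \<rightarrow>\<^sub>E ?A" "w \<in> ?I \<rightarrow>\<^sub>E ?A" for v w
 proof (rule PiE_ext[OF that(2,3)])
  fix \<gamma> assume "\<gamma> \<in> ?I"
  thus "v \<gamma> = w \<gamma>" using arg_cong[OF that(1), of "%p. lkp p \<gamma>"] by (simp add: lkp_vec_poly)
 qed
 have vsurj: "\<exists>v\<in>?I \<rightarrow>\<^sub>E ?A. p = vec_poly \<nu> v" if p: "p \<in> XD ?A \<nu>" for p
 proof (intro bexI[of _ "\<lambda>\<gamma>\<in>?I. lkp p \<gamma>"])
  have "p \<in> mpolys (VV) ?A" using p by (simp add: xpolys_deg_def)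
  thus "(\<lambda>\<gamma>\<in>?I. lkp p \<gamma>) \<in> ?I \<rightarrow>\<^sub>E ?A" by (auto intro: mpolys_lkp)
  show "p = vec_poly \<nu> (\<lambda>\<gamma>\<in>?I. lkp p \<gamma>)"
   by (rule poly_mapping_eqI) (use p in \<open>auto simp: lkp_vec_poly xpolys_deg_def mpolys_def xmonos_def in_keys_iff\<close>)
 qed
 have fF: "?f w \<in> ?I \<rightarrow>\<^sub>E ?A" if w: "w \<in> J \<rightarrow>\<^sub>E ?A" for w
 proof -
  have "lkp (g c) \<gamma> * w c \<in> ?A" if "c \<in> J" for c \<gamma>
   using g[OF that] w that by (intro A.Smult mpolys_lkp[of _ "VV"]) (auto simp: xpolys_deg_def)
  thus ?thesis by (auto simp: mat_map_def A.finsum_ring_on intro!: A.Ssum)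
 qed
 \<comment> \<open>The hypothesis \<open>sat\<close> is used here; everything after it is transport
   along \<open>vec_poly\<close>.\<close>
 have NS: "v \<in> ?N \<longleftrightarrow> vec_poly \<nu> v \<in> ?S" if v: "v \<in> ?I \<rightarrow>\<^sub>E ?A" for v
 proof -
  have "vec_poly \<nu> v \<in> ?S \<longleftrightarrow> (\<exists>w\<in>J \<rightarrow>\<^sub>E ?A. vec_poly \<nu> v = vec_poly \<nu> (?f w))"
   using vpC[OF v] sat[OF vp[OF v]] vec_poly_mat_map[OF A.subring1_on_axioms J g] by (simp add: ideal_Isat_iff cong: bex_cong)
  also have "\<dots> \<longleftrightarrow> v \<in> ?N" unfolding cF using vinj[OF _ v fF] by blast
  finally show ?thesis ..
 qed
 have S0: "0 \<in> ?S" by (simp add: ideal_Isat_iff C.S0 in_ideal_imp_sat in_ideal_zero)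
 have Sadd: "a + b \<in> ?S" if "a \<in> ?S" "b \<in> ?S" for a b using that by (auto simp: ideal_Isat_iff C.Sadd in_sat_add)
 have Smult: "s * a \<in> ?S" if "s \<in> CA" "a \<in> ?S" for s a
  using that carr_C_UNIV by (auto simp: ideal_Isat_iff C.Smult intro!: in_sat_mult)
 have NF: "?N \<subseteq> carrier ?F" unfolding cF using fF by blast
 have z: "vec_poly \<nu> \<zero>\<^bsub>?F\<^esub> = 0" by (rule poly_mapping_eqI) (simp add: lkp_vec_poly free_module_def)
 have Smin: "- a \<in> ?S" if "a \<in> ?S" for a using Smult[OF C.Sminus[OF C.S1] that] by simp
 interpret S: abelian_subgroup ?S ?M
 proof (rule additive_subgroupI_minus[OF M.abelian_group_axioms])
  show "?S \<subseteq> carrier ?M" by (auto simp: ideal_Isat_iff)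
  show "\<exists>y\<in>?S. y \<oplus>\<^bsub>?M\<^esub> x = \<zero>\<^bsub>?M\<^esub>" if "x \<in> ?S" for x using Smin[OF that] by (intro bexI[of _ "- x"]) simp_all
 qed (simp_all add: S0 Sadd)
 have vm: "vec_poly \<nu> (v \<ominus>\<^bsub>?F\<^esub> w) = vec_poly \<nu> v - vec_poly \<nu> w" if "v \<in> carrier ?F" "w \<in> carrier ?F" for v w
 proof -
  have "(v \<ominus>\<^bsub>?F\<^esub> w) \<oplus>\<^bsub>?F\<^esub> w = v" using that by (simp add: F.minus_eq F.a_assoc F.l_neg)
  thus ?thesis using vadd[of "v \<ominus>\<^bsub>?F\<^esub> w" w] by simp
 qed
 interpret N: abelian_subgroup ?N ?F
 proof (rule additive_subgroupI_minus[OF F.abelian_group_axioms NF])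
  show "\<zero>\<^bsub>?F\<^esub> \<in> ?N" using F.zero_closed NS[of "\<zero>\<^bsub>?F\<^esub>"] S0 by (simp add: cF z)
  fix x assume x: "x \<in> ?N"
  hence xF: "x \<in> carrier ?F" "\<ominus>\<^bsub>?F\<^esub> x \<in> carrier ?F" using NF by auto
  have "vec_poly \<nu> (\<ominus>\<^bsub>?F\<^esub> x) = - vec_poly \<nu> x"
   using vadd[of "\<ominus>\<^bsub>?F\<^esub> x" x] xF by (simp add: F.l_neg z add_eq_0_iff2)
  hence "\<ominus>\<^bsub>?F\<^esub> x \<in> ?N" using x NS xF Smin unfolding cF by auto
  thus "\<exists>y\<in>?N. y \<oplus>\<^bsub>?F\<^esub> x = \<zero>\<^bsub>?F\<^esub>" using xF F.l_neg by blast
  fix y assume y: "y \<in> ?N"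
  hence "x \<oplus>\<^bsub>?F\<^esub> y \<in> carrier ?F" "y \<in> carrier ?F" using NF xF by auto
  thus "x \<oplus>\<^bsub>?F\<^esub> y \<in> ?N" using x y xF NS Sadd unfolding cF by (simp add: vadd)
 qed
 have dM: "x \<ominus>\<^bsub>?M\<^esub> y = x - y" if "x \<in> CA" "y \<in> CA" for x y
 proof -
  have "\<ominus>\<^bsub>?M\<^esub> y = - y" using that C.Sminus by (intro M.minus_equality) auto
  thus ?thesis by (simp add: a_minus_def)
 qed
 have Neq: "?N +>\<^bsub>?F\<^esub> v = ?N +>\<^bsub>?F\<^esub> w \<longleftrightarrow> ?S +>\<^bsub>?M\<^esub> vec_poly \<nu> v = ?S +>\<^bsub>?M\<^esub> vec_poly \<nu> w"
  if "v \<in> ?I \<rightarrow>\<^sub>E ?A" "w \<in> ?I \<rightarrow>\<^sub>E ?A" for v w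
 proof -
  have c: "v \<in> carrier ?F" "w \<in> carrier ?F" using that by (simp_all only: cF)
  have "?N +>\<^bsub>?F\<^esub> v = ?N +>\<^bsub>?F\<^esub> w \<longleftrightarrow> v \<ominus>\<^bsub>?F\<^esub> w \<in> ?N" by (rule N.a_coset_eq_iff[OF c])
  also have "\<dots> \<longleftrightarrow> vec_poly \<nu> v - vec_poly \<nu> w \<in> ?S"
   using NS[of "v \<ominus>\<^bsub>?F\<^esub> w"] F.minus_closed[OF c] unfolding cF vm[OF c] by blast
  also have "\<dots> \<longleftrightarrow> ?S +>\<^bsub>?M\<^esub> vec_poly \<nu> v = ?S +>\<^bsub>?M\<^esub> vec_poly \<nu> w"
   using S.a_coset_eq_iff[of "vec_poly \<nu> v" "vec_poly \<nu> w"] vpC that by (simp add: dM)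
  finally show ?thesis .
 qed
 \<comment> \<open>On a coset this is a union of copies of one set, so no representative has to be
   chosen.\<close>
 define h where "h T = (\<Union>v\<in>T. ?S +>\<^bsub>?M\<^esub> vec_poly \<nu> v)" for T
 have h: "h (?N +>\<^bsub>?F\<^esub> v) = ?S +>\<^bsub>?M\<^esub> vec_poly \<nu> v" if v: "v \<in> ?I \<rightarrow>\<^sub>E ?A" for v
  unfolding h_def
 proof (rule N.a_coset_Union)
  show vc: "v \<in> carrier ?F" using v by (simp only: cF)
  fix w assume w: "w \<in> carrier ?F" "w \<ominus>\<^bsub>?F\<^esub> v \<in> ?N"
  thus "?S +>\<^bsub>?M\<^esub> vec_poly \<nu> w = ?S +>\<^bsub>?M\<^esub> vec_poly \<nu> v"
   using Neq[of w v] v N.a_coset_eq_iff[OF w(1) vc] by (simp only: cF)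
 qed
 have R: "a_rcosets\<^bsub>?F\<^esub> ?N = (%v. ?N +>\<^bsub>?F\<^esub> v) ` (?I \<rightarrow>\<^sub>E ?A)"
  unfolding A_RCOSETS_def' cF by blast
 let ?Q = "mat_cokernel (ring_A r n d) ?I J (%\<gamma> c. lkp (g c) \<gamma>)"
 let ?B = "B_sat_piece r n d \<nu> :: ('k upoly, _) module"
 have Q: "carrier ?Q = (%v. ?N +>\<^bsub>?F\<^esub> v) ` (?I \<rightarrow>\<^sub>E ?A)" "add ?Q = set_add ?F"
  "module.smult ?Q = (%a T. \<Union>x\<in>T. ?N +>\<^bsub>?F\<^esub> (a \<odot>\<^bsub>?F\<^esub> x))"
  by (simp_all add: mat_cokernel_def quot_module_def ring_A_def R)
 have B: "carrier ?B = (%p. ?S +>\<^bsub>?M\<^esub> p) ` XD ?A \<nu>" "add ?B = set_add ?M"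
  "module.smult ?B = (%a T. \<Union>x\<in>T. ?S +>\<^bsub>?M\<^esub> (sgl 0 a * x))"
  by (simp_all add: B_sat_piece_def B_sat_def quot_gr_module_def module.defs gr_module.defs quot_module_def
    module_C_def comp_C_def mpoly_const_def)
 have smF: "a \<odot>\<^bsub>?F\<^esub> v \<in> ?I \<rightarrow>\<^sub>E ?A" if "a \<in> ?A" "v \<in> ?I \<rightarrow>\<^sub>E ?A" for a v
  using that by (auto simp: free_module_def intro!: A.Smult)
 have aC: "sgl 0 a \<in> CA" if "a \<in> ?A" for a using that by (auto simp: mpolys_def)
 have smS: "(\<Union>x\<in>?S +>\<^bsub>?M\<^esub> p. ?S +>\<^bsub>?M\<^esub> (sgl 0 a * x)) = ?S +>\<^bsub>?M\<^esub> (sgl 0 a * p)"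
  if a: "a \<in> ?A" and p: "p \<in> CA" for a p
 proof (rule S.a_coset_Union)
  fix x assume x: "x \<in> carrier ?M" "x \<ominus>\<^bsub>?M\<^esub> p \<in> ?S"
  hence "sgl 0 a * (x - p) \<in> ?S" using p by (intro Smult aC a) (simp add: dM)
  thus "?S +>\<^bsub>?M\<^esub> (sgl 0 a * x) = ?S +>\<^bsub>?M\<^esub> (sgl 0 a * p)"
   using x p aC[OF a] by (subst S.a_coset_eq_iff) (simp_all add: dM C.Smult right_diff_distrib)
 qed (use p in simp)
 have smN: "(\<Union>x\<in>?N +>\<^bsub>?F\<^esub> v. ?N +>\<^bsub>?F\<^esub> (a \<odot>\<^bsub>?F\<^esub> x)) = ?N +>\<^bsub>?F\<^esub> (a \<odot>\<^bsub>?F\<^esub> v)"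
  if a: "a \<in> ?A" and v: "v \<in> ?I \<rightarrow>\<^sub>E ?A" for a v
 proof (rule N.a_coset_Union)
  show vc: "v \<in> carrier ?F" using v by (simp only: cF)
  fix x assume x: "x \<in> carrier ?F" "x \<ominus>\<^bsub>?F\<^esub> v \<in> ?N"
  hence xF: "x \<in> ?I \<rightarrow>\<^sub>E ?A" by (simp only: cF)
  have "?N +>\<^bsub>?F\<^esub> x = ?N +>\<^bsub>?F\<^esub> v" using N.a_coset_eq_iff[OF x(1) vc] x by simp
  hence "?S +>\<^bsub>?M\<^esub> vec_poly \<nu> x = ?S +>\<^bsub>?M\<^esub> vec_poly \<nu> v" using Neq[OF xF v] by simp
  hence "?S +>\<^bsub>?M\<^esub> (sgl 0 a * vec_poly \<nu> x) = ?S +>\<^bsub>?M\<^esub> (sgl 0 a * vec_poly \<nu> v)"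
   using smS[OF a vpC[OF xF]] smS[OF a vpC[OF v]] by simp
  thus "?N +>\<^bsub>?F\<^esub> (a \<odot>\<^bsub>?F\<^esub> x) = ?N +>\<^bsub>?F\<^esub> (a \<odot>\<^bsub>?F\<^esub> v)"
   using Neq[OF smF[OF a xF] smF[OF a v]] by (simp add: vsm)
 qed
 show ?thesis unfolding presentation_matrix_def module_isomorphic_def
 proof (intro exI[of _ h] conjI ballI)
  show "bij_betw h (carrier ?Q) (carrier ?B)" unfolding bij_betw_def
  proof
   show "inj_on h (carrier ?Q)" unfolding Q
   proof (rule inj_onI, elim imageE)
    fix T U v w
    assume "h T = h U" and T: "T = ?N +>\<^bsub>?F\<^esub> v" "v \<in> ?I \<rightarrow>\<^sub>E ?A" and U: "U = ?N +>\<^bsub>?F\<^esub> w" "w \<in> ?I \<rightarrow>\<^sub>E ?A"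
    hence "?S +>\<^bsub>?M\<^esub> vec_poly \<nu> v = ?S +>\<^bsub>?M\<^esub> vec_poly \<nu> w" unfolding T(1) U(1) h[OF T(2)] h[OF U(2)] by simp
    thus "T = U" unfolding T(1) U(1) using Neq[OF T(2) U(2)] by blast
   qed
   have "h ` carrier ?Q = (%v. ?S +>\<^bsub>?M\<^esub> vec_poly \<nu> v) ` (?I \<rightarrow>\<^sub>E ?A)" unfolding Q image_image by (intro image_cong) (auto simp: h)
   also have "\<dots> = carrier ?B" unfolding B using vp vsurj by blast
   finally show "h ` carrier ?Q = carrier ?B" .
  qed
  fix x assume "x \<in> carrier ?Q"
  then obtain v where v: "v \<in> ?I \<rightarrow>\<^sub>E ?A" "x = ?N +>\<^bsub>?F\<^esub> v" unfolding Q by blast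
  {
   fix y assume "y \<in> carrier ?Q"
   then obtain w where w: "w \<in> ?I \<rightarrow>\<^sub>E ?A" "y = ?N +>\<^bsub>?F\<^esub> w" unfolding Q by blast
   have "x \<oplus>\<^bsub>?Q\<^esub> y = ?N +>\<^bsub>?F\<^esub> (v \<oplus>\<^bsub>?F\<^esub> w)" unfolding Q v w using v w by (intro N.a_rcos_sum) (simp_all only: cF)
   moreover have "v \<oplus>\<^bsub>?F\<^esub> w \<in> ?I \<rightarrow>\<^sub>E ?A" using F.a_closed[of v w] v w by (simp only: cF)
   ultimately have "h (x \<oplus>\<^bsub>?Q\<^esub> y) = ?S +>\<^bsub>?M\<^esub> (vec_poly \<nu> v \<oplus>\<^bsub>?M\<^esub> vec_poly \<nu> w)" by (simp add: h vadd)
   also have "\<dots> = h x \<oplus>\<^bsub>?B\<^esub> h y" unfolding B v w h[OF v(1)] h[OF w(1)] using v w vpC by (intro S.a_rcos_sum[symmetric]) simp_all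
   finally show "h (x \<oplus>\<^bsub>?Q\<^esub> y) = h x \<oplus>\<^bsub>?B\<^esub> h y" .
  }
  fix a assume "a \<in> carrier (ring_A r n d :: 'k upoly ring)"
  hence a: "a \<in> ?A" by (simp add: ring_A_def)
  show "h (a \<odot>\<^bsub>?Q\<^esub> x) = a \<odot>\<^bsub>?B\<^esub> h x"
   unfolding Q B v smN[OF a v(1)] h[OF smF[OF a v(1)]] h[OF v(1)] smS[OF a vpC[OF v(1)]] vsm ..
 qed
qed

section \<open>The columns of the two matrices as polynomials\<close>

lemma finite_M_cols: "finite (MC \<nu>)" by (simp add: M_cols_def)

lemma finite_H_cols: "finite (HC \<nu>)" by (simp add: H_cols_def finite_M_cols)

definition M_poly :: "nat \<times> xmono => 'k::comm_ring_1 cpoly" where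
 "M_poly c = sgl (snd c) 1 * FG (fst c)"

definition H_poly :: "(xmono => nat => nat => nat => 'k::comm_ring_1 cpoly) => nat \<times> xmono + xmono => 'k cpoly" where
 "H_poly G c = (case c of Inl c' => M_poly c' | Inr \<alpha> => sylv r n \<alpha> (G \<alpha>))"

lemma M_mat_eq: "M_mat r n d \<gamma> c = lkp (M_poly c) \<gamma>" by (cases c) (simp add: M_mat_def M_poly_def)

lemma H_mat_eq: "H_mat r n d G \<gamma> c = lkp (H_poly G c) \<gamma>" by (cases c) (simp_all add: H_mat_def H_poly_def M_mat_eq)

lemma xpolys_deg_mult:
 assumes "subring1_on A" "p \<in> XD A \<mu>" "q \<in> XD A \<mu>'"
 shows "p * q \<in> XD A (\<mu> + \<mu>')"
proof -
 interpret subring1_on "mpolys (VV) A" by (rule subring1_on_mpolys[OF assms(1)])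
 have "xmono_deg n m = \<mu> + \<mu>'" if m: "m \<in> pkeys (p * q)" for m
 proof -
  obtain u v where "m = u + v" "u \<in> pkeys p" "v \<in> pkeys q" using m Poly_Mapping.keys_mult[of p q] by blast
  thus ?thesis using assms by (simp add: xpolys_deg_def fun_eq_iff xmono_deg_add)
 qed
 thus ?thesis using assms by (simp add: xpolys_deg_def Smult)
qed

lemma M_poly_deg:
 assumes c: "c \<in> MC \<nu>"
 shows "M_poly c \<in> XD (AA :: 'k::comm_ring_1 upoly set) \<nu>"
proof -
 obtain i \<beta> where ib: "c = (i, \<beta>)" "i \<le> N" "\<beta> \<in> Mon (\<nu> - d i)" using c by (auto simp: M_cols_def)
 have "sgl \<beta> 1 \<in> XD (AA :: 'k upoly set) (\<nu> - d i)"
  using ib(3) subring1_on.S1[OF subring1_on_coeffs_A] by (auto simp: xpolys_deg_def mpolys_def xmonos_def)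
 from xpolys_deg_mult[OF subring1_on_coeffs_A this F_gen_deg[OF ib(2)]]
 show ?thesis by (simp add: M_poly_def ib(1))
qed

text \<open>Multipliers of degree \<nu> - d i expand into the monomials indexing the columns, and
  \<open>ret\<close> moves their coefficients into A.\<close>

lemma M_poly_span:
 "(\<exists>w\<in>MC \<nu> \<rightarrow>\<^sub>E AA. p = (\<Sum>c\<in>MC \<nu>. sgl 0 (w c) * M_poly c))
  \<longleftrightarrow> p \<in> CA \<and> in_ideal_deg \<nu> (p :: 'k::comm_ring_1 cpoly)"
proof -
 let ?A = "AA :: 'k upoly set" and ?J = "MC \<nu>"
 interpret A: subring1_on ?A by (rule subring1_on_coeffs_A)
 interpret C: subring1_on "CA :: 'k cpoly set" by (rule subring1_on_carr_C)
 have eq: "(\<Sum>c\<in>?J. sgl 0 (w c) * M_poly c) = (\<Sum>i\<le>N. (\<Sum>\<beta>\<in>Mon (\<nu> - d i). sgl \<beta> (w (i, \<beta>))) * FG i)" for w :: "_ => 'k upoly"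
 proof -
  have "(\<Sum>c\<in>?J. sgl 0 (w c) * M_poly c) = (\<Sum>i\<le>N. \<Sum>\<beta>\<in>Mon (\<nu> - d i). sgl 0 (w (i, \<beta>)) * M_poly (i, \<beta>))"
   unfolding M_cols_def by (subst sum.Sigma) (simp_all add: case_prod_unfold)
  thus ?thesis by (simp add: M_poly_def sum_distrib_right mult.assoc[symmetric] mult_single)
 qed
 show ?thesis
 proof
  assume "\<exists>w\<in>?J \<rightarrow>\<^sub>E ?A. p = (\<Sum>c\<in>?J. sgl 0 (w c) * M_poly c)"
  then obtain w where w: "w \<in> ?J \<rightarrow>\<^sub>E ?A" "p = (\<Sum>c\<in>?J. sgl 0 (w c) * M_poly c)" by blast
  have "sgl 0 (w c) * M_poly c \<in> CA" if "c \<in> ?J" for c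
   using M_poly_deg[OF that, where 'k = 'k] w that by (intro C.Smult) (auto simp: xpolys_deg_def mpolys_def)
  hence "p \<in> CA" unfolding w(2) by (rule C.Ssum)
  moreover have "in_ideal_deg \<nu> p" unfolding in_ideal_deg_def w(2) eq
   using vec_poly_deg[of "\<nu> - d i" "%\<beta>. w (i, \<beta>)" for i, unfolded vec_poly_def]
   by (intro exI[of _ "%i. \<Sum>\<beta>\<in>Mon (\<nu> - d i). sgl \<beta> (w (i, \<beta>))"]) simp
  ultimately show "p \<in> CA \<and> in_ideal_deg \<nu> p" ..
 next
  assume p: "p \<in> CA \<and> in_ideal_deg \<nu> p"
  then obtain h where h: "\<forall>i\<le>N. h i \<in> XD UNIV (\<nu> - d i)" "p = (\<Sum>i\<le>N. h i * FG i)"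
   unfolding in_ideal_deg_def by blast
  have "p = ret p" using p ret_id[of p "VV"] by simp
  also have "\<dots> = (\<Sum>i\<le>N. ret (h i) * FG i)"
   unfolding h(2) rhomD(4,7)[OF rhom_ret] by (intro sum.cong) (simp_all add: ret_id[OF F_gen_C])
  finally have pe: "p = (\<Sum>i\<le>N. ret (h i) * FG i)" .
  define w where "w = (\<lambda>c\<in>?J. lkp (ret (h (fst c))) (snd c))"
  have hi: "ret (h i) = (\<Sum>\<beta>\<in>Mon (\<nu> - d i). sgl \<beta> (w (i, \<beta>)))" if i: "i \<le> N" for i
  proof -
   have "ret (h i) = vec_poly (\<nu> - d i) (lkp (ret (h i)))" using vec_poly_lkp[OF ret_deg[of "h i"]] h(1) i by simp
   also have "\<dots> = (\<Sum>\<beta>\<in>Mon (\<nu> - d i). sgl \<beta> (w (i, \<beta>)))"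
    unfolding vec_poly_def using i by (intro sum.cong) (auto simp: w_def M_cols_def)
   finally show ?thesis .
  qed
  have "p = (\<Sum>c\<in>?J. sgl 0 (w c) * M_poly c)" unfolding eq pe by (intro sum.cong) (simp_all add: hi)
  moreover have "w \<in> ?J \<rightarrow>\<^sub>E ?A" by (auto simp: w_def lkp_ret retU_in)
  ultimately show "\<exists>w\<in>?J \<rightarrow>\<^sub>E ?A. p = (\<Sum>c\<in>?J. sgl 0 (w c) * M_poly c)" by blast
 qed
qed

lemma sat_span_M:
 assumes good: "!!q. 1 \<le> q ==> q \<le> Suc N ==> good_spot \<nu> q"
  and p: "p \<in> XD (AA :: 'k::comm_ring_1 upoly set) \<nu>"
 shows "in_sat p \<longleftrightarrow> (\<exists>w\<in>MC \<nu> \<rightarrow>\<^sub>E AA. p = (\<Sum>c\<in>MC \<nu>. sgl 0 (w c) * M_poly c))"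
proof -
 have pC: "p \<in> CA" and pU: "p \<in> XD UNIV \<nu>" using p by (auto simp: xpolys_deg_def mpolys_def)
 show ?thesis unfolding M_poly_span using sat_in_ideal[OF good pU] in_ideal_imp_sat[OF in_ideal_deg_imp] pC by blast
qed

theorem presentation_M:
 assumes good: "!!q. 1 \<le> q ==> q \<le> Suc N ==> good_spot \<nu> q"
 shows "presentation_matrix (ring_A r n d :: 'k::comm_ring_1 upoly ring) (Mon \<nu>) (MC \<nu>) (M_mat r n d) (B_sat_piece r n d \<nu>)"
 using presentation_matrixI[OF finite_M_cols M_poly_deg sat_span_M[OF good]] by (simp add: M_mat_eq[abs_def, symmetric])

lemma sylv_deg:
 fixes G :: "nat => nat => nat => 'k::comm_ring_1 cpoly"
 assumes dec: "sylv_decomp r n d \<alpha> G" and \<alpha>: "\<alpha> \<in> Mon (dlt - \<nu>)" and \<nu>: "\<nu> \<in> Zvec r"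
 shows "sylv r n \<alpha> G \<in> XD (AA) \<nu>"
proof -
 interpret C: subring1_on "CA :: 'k cpoly set" by (rule subring1_on_carr_C)
 have G: "G i l j \<in> CA" if "i \<le> N" "(l, j) \<in> set (sylv_cols r n)" for i l j
  using dec that unfolding sylv_decomp_def comp_C_def xpolys_deg_def by blast
 have "sylv_det r n G \<in> CA" unfolding sylv_det_def
 proof (rule C.det_in)
  fix i c assume ic: "i < ntot r n + 1" "c < ntot r n + 1"
  hence "sylv_cols r n ! c \<in> set (sylv_cols r n)" by (intro nth_mem) (simp add: length_sylv_cols[OF r1])
  thus "(case sylv_cols r n ! c of (l, j) => G i l j) \<in> CA"
   using ic G[of i "fst (sylv_cols r n ! c)" "snd (sylv_cols r n ! c)"] by (simp add: case_prod_unfold)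
 qed
 moreover have "sgl (sylv_exp r n \<alpha>) 1 \<in> CA"
 proof -
  have "pkeys (sylv_exp r n \<alpha>) \<subseteq> VV" by (auto simp: in_keys_iff lkp_sylv_exp xvars_def split: if_splits)
  thus ?thesis using subring1_on.S1[OF subring1_on_coeffs_A] by (auto simp: mpolys_def)
 qed
 ultimately have "sylv r n \<alpha> G \<in> CA" unfolding sylv_eq by (intro C.Smult)
 thus ?thesis using sylv_zig_dcx(2)[OF assms] by (simp add: xpolys_deg_def)
qed

text \<open>The coefficients from \<open>sat_sylvester\<close> may involve foreign variables.
  Applying \<open>ret\<close> to the whole relation repairs this, since it fixes p, the forms and
  the Sylvester forms.\<close>

lemma sat_span_H:
 fixes G :: "xmono => nat => nat => nat => 'k::comm_ring_1 cpoly"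
 assumes \<mu>: "!!i j. i \<le> N ==> j \<in> {1..r} ==> dlt j - \<nu> j < d i j"
  and \<nu>: "\<nu> \<in> Zvec r"
  and dec: "!!\<alpha>. \<alpha> \<in> Mon (dlt - \<nu>) ==> sylv_decomp r n d \<alpha> (G \<alpha>)"
  and p: "p \<in> XD (AA) \<nu>"
 shows "in_sat p \<longleftrightarrow> (\<exists>w\<in>HC \<nu> \<rightarrow>\<^sub>E AA. p = (\<Sum>c\<in>HC \<nu>. sgl 0 (w c) * H_poly G c))"
proof -
 let ?A = "AA :: 'k upoly set" and ?J = "MC \<nu>" and ?X = "Mon (dlt - \<nu>)"
 interpret C: subring1_on "CA :: 'k cpoly set" by (rule subring1_on_carr_C)
 have split: "(\<Sum>c\<in>HC \<nu>. sgl 0 (w c) * H_poly G c) =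
  (\<Sum>c\<in>?J. sgl 0 (w (Inl c)) * M_poly c) + (\<Sum>\<alpha>\<in>?X. sgl 0 (w (Inr \<alpha>)) * sylv r n \<alpha> (G \<alpha>))" for w
  unfolding H_cols_def using finite_M_cols by (subst sum.union_disjoint) (auto simp: sum.reindex H_poly_def)
 have SC: "sgl 0 a * sylv r n \<alpha> (G \<alpha>) \<in> CA" if "a \<in> ?A" "\<alpha> \<in> ?X" for a \<alpha>
  using sylv_deg[OF dec[OF that(2)] that(2) \<nu>] that by (intro C.Smult) (auto simp: xpolys_deg_def mpolys_def)
 have pC: "p \<in> CA" and pU: "p \<in> XD UNIV \<nu>" using p by (auto simp: xpolys_deg_def mpolys_def)
 show ?thesis
  proof
   assume "in_sat p"
   then obtain a where a: "in_ideal_deg \<nu> (p - (\<Sum>\<alpha>\<in>?X. sgl 0 (a \<alpha>) * sylv r n \<alpha> (G \<alpha>)))"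
    using sat_sylvester[OF \<mu> \<nu> dec pU] by blast
   let ?q = "p - (\<Sum>\<alpha>\<in>?X. sgl 0 (retU (a \<alpha>)) * sylv r n \<alpha> (G \<alpha>))"
   have S: "ret (sylv r n \<alpha> (G \<alpha>)) = sylv r n \<alpha> (G \<alpha>)" if "\<alpha> \<in> ?X" for \<alpha>
    using sylv_deg[OF dec[OF that] that \<nu>] by (intro ret_id[of _ "VV"]) (simp add: xpolys_deg_def)
   have r0: "ret (sgl 0 b) = sgl 0 (retU b)" for b :: "'k upoly"
    by (rule poly_mapping_eqI) (simp add: lkp_ret lookup_single when_def rhomD[OF rhom_retU])
   have q: "?q = ret (p - (\<Sum>\<alpha>\<in>?X. sgl 0 (a \<alpha>) * sylv r n \<alpha> (G \<alpha>)))"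
    by (simp add: rhomD[OF rhom_ret] ret_id[OF pC] r0 S)
   obtain h where h: "\<forall>i\<le>N. h i \<in> XD UNIV (\<nu> - d i)" "p - (\<Sum>\<alpha>\<in>?X. sgl 0 (a \<alpha>) * sylv r n \<alpha> (G \<alpha>)) = (\<Sum>i\<le>N. h i * FG i)"
    using a unfolding in_ideal_deg_def by blast
   have "?q = (\<Sum>i\<le>N. ret (h i) * FG i)"
    unfolding q h(2) rhomD(4,7)[OF rhom_ret] by (intro sum.cong) (simp_all add: ret_id[OF F_gen_C])
   moreover have "ret (h i) \<in> XD UNIV (\<nu> - d i)" if "i \<le> N" for i
    using h(1) that by (intro pmap_deg[OF rhom_retU]) blast
   ultimately have id: "in_ideal_deg \<nu> ?q" unfolding in_ideal_deg_def by (intro exI[of _ "%i. ret (h i)"] conjI allI impI)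
   have "?q \<in> CA" by (intro C.Sdiff C.Ssum pC SC retU_in)
   hence "\<exists>w\<in>?J \<rightarrow>\<^sub>E ?A. ?q = (\<Sum>c\<in>?J. sgl 0 (w c) * M_poly c)"
    using id by (intro M_poly_span[THEN iffD2] conjI)
   then obtain w where w: "w \<in> ?J \<rightarrow>\<^sub>E ?A" "?q = (\<Sum>c\<in>?J. sgl 0 (w c) * M_poly c)" by blast
   define w' where "w' = (\<lambda>c\<in>HC \<nu>. case c of Inl c' => w c' | Inr \<alpha> => retU (a \<alpha>))"
   have "(\<Sum>c\<in>HC \<nu>. sgl 0 (w' c) * H_poly G c) = ?q + (\<Sum>\<alpha>\<in>?X. sgl 0 (retU (a \<alpha>)) * sylv r n \<alpha> (G \<alpha>))"
    unfolding split w(2)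
   proof (intro arg_cong2[where f = "(+)"] sum.cong refl)
    fix c assume "c \<in> ?J"
    hence "Inl c \<in> HC \<nu>" unfolding H_cols_def by (intro UnI1 imageI)
    thus "sgl 0 (w' (Inl c)) * M_poly c = sgl 0 (w c) * (M_poly c :: 'k cpoly)" by (simp add: w'_def)
   next
    fix \<alpha> assume "\<alpha> \<in> ?X"
    hence "Inr \<alpha> \<in> HC \<nu>" unfolding H_cols_def by (intro UnI2 imageI)
    thus "sgl 0 (w' (Inr \<alpha>)) * sylv r n \<alpha> (G \<alpha>) = sgl 0 (retU (a \<alpha>)) * sylv r n \<alpha> (G \<alpha>)" by (simp add: w'_def)
   qed
   hence "p = (\<Sum>c\<in>HC \<nu>. sgl 0 (w' c) * H_poly G c)" unfolding diff_add_cancel by (rule sym)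
   moreover have "w' \<in> HC \<nu> \<rightarrow>\<^sub>E ?A" unfolding w'_def
   proof (rule restrict_PiE_iff[THEN iffD2], intro ballI)
    fix c assume "c \<in> HC \<nu>"
    thus "(case c of Inl c' => w c' | Inr \<alpha> => retU (a \<alpha>)) \<in> ?A"
     using PiE_mem[OF w(1)] retU_in unfolding H_cols_def by (cases c) auto
   qed
   ultimately show "\<exists>w\<in>HC \<nu> \<rightarrow>\<^sub>E ?A. p = (\<Sum>c\<in>HC \<nu>. sgl 0 (w c) * H_poly G c)" by blast
  next
   assume "\<exists>w\<in>HC \<nu> \<rightarrow>\<^sub>E ?A. p = (\<Sum>c\<in>HC \<nu>. sgl 0 (w c) * H_poly G c)"
   then obtain w where w: "w \<in> HC \<nu> \<rightarrow>\<^sub>E ?A" "p = (\<Sum>c\<in>HC \<nu>. sgl 0 (w c) * H_poly G c)" by blast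
   have "in_sat (sgl 0 (w c) * H_poly G c)" if c: "c \<in> HC \<nu>" for c
   proof (rule in_sat_mult)
    show "in_sat (H_poly G c)"
    proof (cases c)
     case (Inl c')
     hence c': "c' \<in> ?J" using c by (auto simp: H_cols_def)
     have "(\<Sum>b\<in>?J. sgl 0 (if b = c' then 1 else 0) * M_poly b) = (\<Sum>b\<in>?J. if b = c' then M_poly b else (0 :: 'k cpoly))"
      by (intro sum.cong) auto
     also have "\<dots> = M_poly c'" using c' finite_M_cols by simp
     finally have "\<exists>w\<in>?J \<rightarrow>\<^sub>E ?A. M_poly c' = (\<Sum>b\<in>?J. sgl 0 (w b) * M_poly b)"
      using subring1_on.S1[OF subring1_on_coeffs_A] subring_on.S0[OF subring1_on.axioms(1)[OF subring1_on_coeffs_A]]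
      by (intro bexI[of _ "\<lambda>b\<in>?J. if b = c' then 1 else 0"]) auto
     hence "in_ideal_deg \<nu> (M_poly c' :: 'k cpoly)" using M_poly_span by blast
     thus ?thesis using Inl by (simp add: H_poly_def in_ideal_imp_sat in_ideal_deg_imp)
    next
     case (Inr \<alpha>)
     thus ?thesis using c sylv_in_sat[OF dec _ \<nu>] by (auto simp: H_poly_def H_cols_def)
    qed
   qed (simp add: mpolys_def)
   thus "in_sat p" unfolding w(2) by (rule in_sat_sum)
  qed
qed

lemma H_poly_deg:
 assumes "\<nu> \<in> Zvec r" "!!\<alpha>. \<alpha> \<in> Mon (dlt - \<nu>) ==> sylv_decomp r n d \<alpha> (G \<alpha>)" "c \<in> HC \<nu>"
 shows "H_poly G c \<in> XD (AA) \<nu>"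
 using assms M_poly_deg sylv_deg[OF assms(2) _ assms(1)] by (auto simp: H_cols_def H_poly_def)

theorem presentation_H:
 fixes G :: "xmono => nat => nat => nat => 'k::comm_ring_1 cpoly"
 assumes \<mu>: "!!i j. i \<le> N ==> j \<in> {1..r} ==> dlt j - \<nu> j < d i j"
  and \<nu>: "\<nu> \<in> Zvec r"
  and dec: "!!\<alpha>. \<alpha> \<in> Mon (dlt - \<nu>) ==> sylv_decomp r n d \<alpha> (G \<alpha>)"
 shows "presentation_matrix (ring_A r n d) (Mon \<nu>) (HC \<nu>) (H_mat r n d G) (B_sat_piece r n d \<nu>)"
proof -
 have "presentation_matrix (ring_A r n d) (Mon \<nu>) (HC \<nu>) (%\<gamma> c. lkp (H_poly G c) \<gamma>) (B_sat_piece r n d \<nu>)"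
  by (rule presentation_matrixI[OF finite_H_cols H_poly_deg[OF \<nu> dec] sat_span_H[OF \<mu> \<nu> dec]])
 moreover have "(%\<gamma> c. lkp (H_poly G c) \<gamma>) = H_mat r n d G" by (intro ext) (rule H_mat_eq[symmetric])
 ultimately show ?thesis by simp
qed

end

section \<open>A Nullstellensatz\<close>

definition prime_set :: "'a::comm_ring_1 set => bool" where
 "prime_set P \<longleftrightarrow> 0 \<in> P \<and> 1 \<notin> P \<and> (\<forall>a\<in>P. \<forall>b\<in>P. a + b \<in> P) \<and> (\<forall>s. \<forall>a\<in>P. s * a \<in> P) \<and>
  (\<forall>a b. a * b \<in> P --> a \<in> P \<or> b \<in> P)"

text \<open>Zorn gives a maximal ideal among those containing no power of s. For a and b outside it,
  some power of s is congruent to a multiple of a, and some power to a multiple of b; the product of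
  these powers shows that a b is outside as well.\<close>

lemma avoiding_prime:
 fixes I :: "'a::comm_ring_1 set"
 assumes I: "0 \<in> I" "!!a b. a \<in> I ==> b \<in> I ==> a + b \<in> I" "!!s a. a \<in> I ==> s * a \<in> I" and s: "!!k. s ^ k \<notin> I"
 shows "\<exists>P. prime_set P \<and> I \<subseteq> P \<and> s \<notin> P"
proof -
 define \<I> where "\<I> = {J. I \<subseteq> J \<and> (\<forall>a\<in>J. \<forall>b\<in>J. a + b \<in> J) \<and> (\<forall>u. \<forall>a\<in>J. u * a \<in> J) \<and> (\<forall>k. s ^ k \<notin> J)}"
 have "\<exists>M\<in>\<I>. \<forall>J\<in>\<I>. M \<subseteq> J --> J = M"
 proof (rule subset_Zorn_nonempty)
  have "I \<in> \<I>" by (simp add: \<I>_def I s)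
  thus "\<I> ~= {}" by blast
  fix \<C> assume ne: "\<C> ~= {}" and ch: "subset.chain \<I> \<C>"
  have sub: "\<C> \<subseteq> \<I>" and tot: "!!J K. J \<in> \<C> ==> K \<in> \<C> ==> J \<subseteq> K \<or> K \<subseteq> J"
   using ch by (auto simp: subset.chain_def)
  have "a + b \<in> \<Union>\<C>" if ab: "a \<in> \<Union>\<C>" "b \<in> \<Union>\<C>" for a b
  proof -
   obtain J K where JK: "J \<in> \<C>" "a \<in> J" "K \<in> \<C>" "b \<in> K" using ab by blast
   obtain L where L: "L \<in> \<C>" "a \<in> L" "b \<in> L" using tot[OF JK(1,3)] JK by blast
   hence "a + b \<in> L" using sub unfolding \<I>_def by blast
   thus ?thesis using L by blast
  qed
  moreover have "u * a \<in> \<Union>\<C>" if "a \<in> \<Union>\<C>" for u a using that sub by (auto simp: \<I>_def)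
  moreover have "I \<subseteq> \<Union>\<C>"
  proof -
   obtain J where J: "J \<in> \<C>" using ne by blast
   hence "I \<subseteq> J" using sub unfolding \<I>_def by blast
   thus ?thesis using J by blast
  qed
  moreover have "s ^ k \<notin> \<Union>\<C>" for k using sub by (auto simp: \<I>_def)
  ultimately show "\<Union>\<C> \<in> \<I>" unfolding \<I>_def by blast
 qed
 then obtain P where P: "P \<in> \<I>" and max: "!!J. J \<in> \<I> ==> P \<subseteq> J ==> J = P" by blast
 have IP: "I \<subseteq> P" and Padd: "!!a b. a \<in> P ==> b \<in> P ==> a + b \<in> P" and Pmult: "!!u a. a \<in> P ==> u * a \<in> P"
  and sP: "!!k. s ^ k \<notin> P" using P unfolding \<I>_def by blast+
 have ext: "\<exists>k p t. p \<in> P \<and> s ^ k = p + t * a" if a: "a \<notin> P" for a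
 proof (rule ccontr)
  assume no: "~ ?thesis"
  define J where "J = {p + t * a | p t. p \<in> P}"
  have 0: "0 \<in> P" using I IP by blast
  have Jadd: "x + y \<in> J" if x: "x \<in> J" and y: "y \<in> J" for x y
  proof -
   obtain p t p' t' where "x = p + t * a" "p \<in> P" "y = p' + t' * a" "p' \<in> P" using x y unfolding J_def by blast
   hence "x + y = (p + p') + (t + t') * a" "p + p' \<in> P" using Padd by (simp_all add: algebra_simps)
   thus ?thesis unfolding J_def by blast
  qed
  have Jmult: "u * x \<in> J" if x: "x \<in> J" for u x
  proof -
   obtain p t where "x = p + t * a" "p \<in> P" using x unfolding J_def by blast
   hence "u * x = u * p + (u * t) * a" "u * p \<in> P" using Pmult by (simp_all add: algebra_simps)
   thus ?thesis unfolding J_def by blast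
  qed
  have PJ: "P \<subseteq> J"
  proof
   fix p assume "p \<in> P"
   thus "p \<in> J" unfolding J_def by (intro CollectI exI[of _ p] exI[of _ 0]) simp
  qed
  have "s ^ k \<notin> J" for k using no unfolding J_def by blast
  hence "J \<in> \<I>" unfolding \<I>_def by (intro CollectI conjI ballI allI Jadd Jmult order.trans[OF IP PJ])
  hence "J = P" using PJ by (rule max)
  moreover have "a \<in> J" unfolding J_def using 0 by (intro CollectI exI[of _ 0] exI[of _ 1]) simp
  ultimately show False using a by blast
 qed
 have "a \<in> P \<or> b \<in> P" if ab: "a * b \<in> P" for a b
 proof (rule ccontr)
  assume "~ ?thesis"
  then obtain k p t l q u where *: "p \<in> P" "s ^ k = p + t * a" "q \<in> P" "s ^ l = q + u * b" using ext by blast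
  have "s ^ (k + l) = s ^ l * p + ((t * a) * q + (t * u) * (a * b))" by (simp add: power_add *) (simp add: algebra_simps)
  also have "\<dots> \<in> P" by (intro Padd Pmult[OF *(1)] Pmult[OF *(3)] Pmult[OF ab])
  finally show False using sP by blast
 qed
 hence "prime_set P" using I(1) IP Padd Pmult sP[of 0] unfolding prime_set_def by auto
 thus ?thesis using IP sP[of 1] by auto
qed

text \<open>One step of elimination: A plays the ring without the variable x, P a prime of the full
  ring. Elements are polynomials over A evaluated at x, and \<open>pP\<close> means that all
  coefficients vanish modulo P.\<close>

locale simple_ext =
 fixes P A :: "'r::comm_ring_1 set" and x :: 'r
 assumes P: "prime_set P" and A: "subring1_on A"
begin

sublocale A: subring1_on A by (rule A)

abbreviation "pA p \<equiv> (\<forall>i. coeff p i \<in> A)"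
abbreviation "pP p \<equiv> (\<forall>i. coeff p i \<in> P)"

lemma P0: "0 \<in> P" and Padd: "a \<in> P ==> b \<in> P ==> a + b \<in> P" and Pmult: "a \<in> P ==> s * a \<in> P"
 and Pprime: "a * b \<in> P ==> a \<in> P \<or> b \<in> P" and P1: "1 \<notin> P" using P by (auto simp: prime_set_def)

lemma Pdiff: "a \<in> P ==> b \<in> P ==> a - b \<in> P" using Padd[of a "- b"] Pmult[of b "- 1"] by simp

lemma Psum: "(!!i. i \<in> S ==> f i \<in> P) ==> sum f S \<in> P"
 by (induction S rule: infinite_finite_induct) (simp_all add: P0 Padd)

lemma Ppow: "a ^ k \<in> P ==> a \<in> P" using P1 by (induction k) (auto dest: Pprime)

lemma pA_add: "pA p ==> pA q ==> pA (p + q)" and pA_diff: "pA p ==> pA q ==> pA (p - q)"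
 and pA_mult: "pA p ==> pA q ==> pA (p * q)" and pA_smult: "a \<in> A ==> pA p ==> pA (smult a p)"
 and pA_monom: "a \<in> A ==> pA (monom a k)" by (auto simp: coeff_mult A.Sadd A.Sdiff A.S0 intro!: A.Ssum A.Smult)

lemma pP_eval: "pP p ==> poly p x \<in> P"
 unfolding poly_altdef by (intro Psum) (use Pmult in \<open>simp add: mult.commute[of "coeff p _"]\<close>)

text \<open>Leading terms with coefficient in P are dropped, which changes the value at x only by
  elements of P.\<close>

lemma trim:
 "pA p ==> ~ pP p ==> \<exists>q. pA q \<and> lead_coeff q \<notin> P \<and> degree q \<le> degree p \<and> poly p x - poly q x \<in> P"
proof (induction "degree p" arbitrary: p rule: less_induct)
 case less
 show ?case
 proof (cases "lead_coeff p \<in> P")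
  case False
  thus ?thesis using less.prems P0 by (intro exI[of _ p]) auto
 next
  case True
  let ?q = "p - monom (lead_coeff p) (degree p)"
  obtain i where i: "coeff p i \<notin> P" using less.prems by blast
  hence ip: "i < degree p" using True P0 by (metis le_degree le_neq_implies_less)
  have "coeff ?q i \<notin> P" using i ip by simp
  hence nP: "~ pP ?q" by blast
  have q: "pA ?q" using less.prems by (intro pA_diff pA_monom) auto
  have "degree ?q \<le> degree p" by (intro degree_diff_le) (auto simp: degree_monom_le)
  moreover have "coeff ?q (degree p) = 0" by simp
  moreover have "?q ~= 0" using nP P0 by (metis coeff_0)
  ultimately have dq: "degree ?q < degree p" by (metis le_neq_implies_less leading_coeff_0_iff)
  obtain q' where q': "pA q'" "lead_coeff q' \<notin> P" "degree q' \<le> degree ?q" "poly ?q x - poly q' x \<in> P"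
   using less.hyps[OF dq q nP] by blast
  have "poly p x - poly q' x = (poly ?q x - poly q' x) + x ^ degree p * lead_coeff p" by (simp add: poly_monom)
  hence "poly p x - poly q' x \<in> P" using q'(4) True by (simp only: Padd Pmult)
  thus ?thesis using q' dq by (intro exI[of _ q']) auto
 qed
qed

text \<open>A is no field, so division costs a power of the leading coefficient. The bound on the
  degree of the quotient serves in \<open>extend_zero\<close>, where a generator of positive degree
  is excluded.\<close>

lemma pseudo_div:
 assumes g: "pA g" "g ~= 0"
 shows "pA p ==> \<exists>k q s. pA q \<and> pA s \<and> smult (lead_coeff g ^ k) p = q * g + s \<and> (s = 0 \<or> degree s < degree g) \<and> degree q \<le> degree p - degree g"
proof (induction "degree p" arbitrary: p rule: less_induct)
 case less
 let ?c = "lead_coeff g" and ?d = "degree p - degree g"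
 show ?case
 proof (cases "p = 0 \<or> degree p < degree g")
  case True
  thus ?thesis using less.prems A.S0 by (intro exI[of _ 0] exI[of _ p]) auto
 next
  case False
  hence dg: "degree g \<le> degree p" "p ~= 0" by auto
  let ?q = "smult ?c p - monom (lead_coeff p) ?d * g"
  have q: "pA ?q" using less.prems g by (intro pA_diff pA_mult pA_smult pA_monom) auto
  have "degree (monom (lead_coeff p) ?d * g) \<le> ?d + degree g"
   by (intro order.trans[OF degree_mult_le] add_mono degree_monom_le order.refl)
  hence le: "degree ?q \<le> degree p" using dg degree_smult_le[of ?c p] by (intro degree_diff_le) auto
  have c0: "coeff ?q (degree p) = 0" using dg by (simp add: coeff_monom_mult)
  have "\<exists>k q s. pA q \<and> pA s \<and> smult (?c ^ k) ?q = q * g + s \<and> (s = 0 \<or> degree s < degree g) \<and> degree q \<le> degree p - degree g"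
  proof (cases "?q = 0")
   case True
   thus ?thesis using A.S0 by (intro exI[of _ 0]) auto
  next
   case False
   hence "degree ?q < degree p" using le c0 by (metis le_neq_implies_less leading_coeff_0_iff)
   hence "degree ?q - degree g \<le> ?d" by simp
   thus ?thesis using less.hyps[OF \<open>degree ?q < degree p\<close> q] order.trans[of _ "degree ?q - degree g" ?d] by blast
  qed
  then obtain k q s where *: "pA q" "pA s" "smult (?c ^ k) ?q = q * g + s" "s = 0 \<or> degree s < degree g" "degree q \<le> ?d" by blast
  have "smult (?c ^ Suc k) p = smult (?c ^ k) ?q + smult (?c ^ k) (monom (lead_coeff p) ?d) * g"
   by (simp add: smult_diff_right mult.commute)
  also have "\<dots> = (q + smult (?c ^ k) (monom (lead_coeff p) ?d)) * g + s" unfolding *(3) by (simp add: algebra_simps)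
  finally have eq: "smult (?c ^ Suc k) p = (q + smult (?c ^ k) (monom (lead_coeff p) ?d)) * g + s" .
  have "pA (q + smult (?c ^ k) (monom (lead_coeff p) ?d))" using *(1) g less.prems A.Spow by (intro pA_add pA_smult pA_monom) auto
  moreover have "degree (q + smult (?c ^ k) (monom (lead_coeff p) ?d)) \<le> ?d"
   using *(5) degree_monom_le order.trans[OF degree_smult_le degree_monom_le] by (intro degree_add_le) auto
  ultimately show ?thesis using eq *(2,4) by blast
 qed
qed

lemma nonvanishing_point:
 fixes q :: "'k::alg_closed_field poly"
 assumes "q ~= 0" shows "\<exists>t. poly q t ~= 0"
proof -
 \<comment> \<open>A root t of X q - 1 satisfies t q(t) = 1.\<close>
 have "degree (pCons (- 1) q) > 0" using assms by simp
 then obtain t where "poly (pCons (- 1) q) t = 0" using alg_closed_imp_poly_has_root by blast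
 thus ?thesis by (intro exI[of _ t]) auto
qed

text \<open>The family \<open>e\<close> consists of the evaluations with x = t that agree on A. If x
  is transcendental modulo P, any t respects the relations and a is a coefficient of q0 outside P.
  Otherwise t is a root of a relation f of least degree, and a is the leading coefficient of f times
  an element of A that is a multiple of q0 modulo P.\<close>

lemma extend_zero:
 fixes q0 :: "'r poly"
 assumes q0: "pA q0" "poly q0 x \<notin> P"
 shows "\<exists>a\<in>A. a \<notin> P \<and> (\<forall>e :: 'k::alg_closed_field => 'r => 'k.
  (\<forall>t. rhom (e t) \<and> e t x = t) --> (\<forall>t. \<forall>y\<in>A. e t y = e 0 y) --> (\<forall>y\<in>A \<inter> P. e 0 y = 0) --> e 0 a ~= 0 -->
  (\<exists>t. (\<forall>p. pA p --> poly p x \<in> P --> e t (poly p x) = 0) \<and> e t (poly q0 x) ~= 0))"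
proof -
 have ev: "e t (poly p x) = poly (map_poly (e 0) p) t"
  if e: "\<forall>t. rhom (e t) \<and> e t x = t" "\<forall>t. \<forall>y\<in>A. e t y = e 0 y" and p: "pA p" for e :: "'k => 'r => 'k" and t p
 proof -
  have h: "rhom (e t)" "rhom (e 0)" "e t x = t" using e(1) by auto
  have "e t (poly p x) = (\<Sum>i\<le>degree p. e 0 (coeff p i) * t ^ i)"
  proof -
   have "e t (coeff p i) = e 0 (coeff p i)" for i using e(2) p by blast
   thus ?thesis unfolding poly_altdef by (simp only: rhomD(4,7,9)[OF h(1)] h(3))
  qed
  also have "\<dots> = poly (map_poly (e 0) p) t"
  proof -
   have "degree (map_poly (e 0) p) \<le> degree p" by (rule map_poly_degree_leq)
   hence "poly (map_poly (e 0) p) t = (\<Sum>i\<le>degree p. coeff (map_poly (e 0) p) i * t ^ i)"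
    unfolding poly_altdef by (intro sum.mono_neutral_left) (auto simp: coeff_eq_0)
   thus ?thesis by (simp add: coeff_map_poly rhomD(1)[OF h(2)])
  qed
  finally show ?thesis .
 qed
 have evP: "e t (poly p x) = 0" if e: "\<forall>t. rhom (e t) \<and> e t x = t" "\<forall>t. \<forall>y\<in>A. e t y = e 0 y" "\<forall>y\<in>A \<inter> P. e 0 y = 0"
  and p: "pA p" "pP p" for e :: "'k => 'r => 'k" and t p
 proof -
  have "map_poly (e 0) p = 0" using p e(3) by (intro poly_eqI) (simp add: coeff_map_poly P0 A.S0)
  thus ?thesis unfolding ev[OF e(1,2) p(1)] by simp
 qed
 have nq0: "~ pP q0" using q0 pP_eval by blast
 show ?thesis
 proof (cases "\<exists>f. pA f \<and> lead_coeff f \<notin> P \<and> poly f x \<in> P")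
  case False
  hence all: "pP p" if "pA p" "poly p x \<in> P" for p
   using trim[OF that(1)] Pdiff[OF that(2)] by (metis add.commute diff_add_cancel diff_diff_eq2)
  obtain i where i: "coeff q0 i \<notin> P" using nq0 by blast
  show ?thesis
  proof (intro bexI[of _ "coeff q0 i"] conjI allI impI i)
   fix e :: "'k => 'r => 'k"
   assume e: "\<forall>t. rhom (e t) \<and> e t x = t" "\<forall>t. \<forall>y\<in>A. e t y = e 0 y" "\<forall>y\<in>A \<inter> P. e 0 y = 0" and ne: "e 0 (coeff q0 i) ~= 0"
   have "rhom (e 0)" using e(1) by blast
   hence "coeff (map_poly (e 0) q0) i ~= 0" using ne by (simp add: coeff_map_poly rhomD(1))
   hence "map_poly (e 0) q0 ~= 0" by auto
   then obtain t where "poly (map_poly (e 0) q0) t ~= 0" using nonvanishing_point by blast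
   thus "\<exists>t. (\<forall>p. pA p --> poly p x \<in> P --> e t (poly p x) = 0) \<and> e t (poly q0 x) ~= 0"
    using ev[OF e(1,2) q0(1)] evP[OF e] all by (intro exI[of _ t]) auto
  qed (use q0 in auto)
 next
  case True
  then obtain f where f: "pA f" "lead_coeff f \<notin> P" "poly f x \<in> P"
   and fmin: "!!f'. pA f' \<and> lead_coeff f' \<notin> P \<and> poly f' x \<in> P ==> degree f \<le> degree f'"
   using ex_has_least_nat[of "%f. pA f \<and> lead_coeff f \<notin> P \<and> poly f x \<in> P" _ degree] by blast
  let ?c = "lead_coeff f" and ?m = "degree f"
  have f0: "f ~= 0" using f(2) P0 by auto
  have minf: "pP p" if p: "pA p" "poly p x \<in> P" "p = 0 \<or> degree p < ?m" for p
  proof (rule ccontr)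
   assume n: "~ pP p"
   then obtain q where q: "pA q" "lead_coeff q \<notin> P" "degree q \<le> degree p" "poly p x - poly q x \<in> P" using trim[OF p(1)] by blast
   have "poly q x \<in> P" using Pdiff[OF p(2) q(4)] by simp
   hence "?m \<le> degree q" using fmin q by blast
   thus False using q(3) p(3) n P0 by auto
  qed
  have m1: "?m \<ge> 1"
  proof (rule ccontr)
   assume "~ ?thesis"
   then obtain c where "f = [:c:]" by (metis degree_eq_zeroE less_one not_le)
   thus False using f by simp
  qed
  \<comment> \<open>Membership in the ideal generated by q0 modulo P. A member g of least degree
    among those with leading coefficient outside P will turn out to be a constant.\<close>
  define Jf where "Jf g \<longleftrightarrow> (\<exists>h. pA h \<and> poly (g - h * q0) x \<in> P)" for g
  have Jf_comb: "Jf (smult a g - q * p)" if J: "Jf g" "Jf p" and a: "a \<in> A" "pA q" for a g q p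
  proof -
   obtain h h' where h: "pA h" "poly (g - h * q0) x \<in> P" "pA h'" "poly (p - h' * q0) x \<in> P" using J unfolding Jf_def by blast
   have "poly (smult a g - q * p - (smult a h - q * h') * q0) x = a * poly (g - h * q0) x - poly q x * poly (p - h' * q0) x"
    by (simp add: algebra_simps)
   also have "\<dots> \<in> P" using h by (intro Pdiff Pmult)
   finally show ?thesis unfolding Jf_def using h a by (intro exI[of _ "smult a h - q * h'"] conjI pA_diff pA_smult pA_mult) auto
  qed
  have Jf_P: "Jf g" if "poly g x \<in> P" for g unfolding Jf_def using that A.S0 by (intro exI[of _ 0]) simp
  have Jq0: "Jf q0" unfolding Jf_def using P0 A.S0 A.S1 by (intro exI[of _ 1]) (simp add: coeff_1)
  obtain g0 where g0: "pA g0" "lead_coeff g0 \<notin> P" "poly q0 x - poly g0 x \<in> P" using trim[OF q0(1) nq0] by blast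
  have "Jf (smult 1 q0 - 1 * (q0 - g0))" using g0 A.S1 A.S0 by (intro Jf_comb[OF Jq0 Jf_P]) (auto simp: coeff_1)
  hence "Jf g0" by simp
  then obtain g where g: "pA g" "lead_coeff g \<notin> P" "Jf g"
   and gmin: "!!g'. pA g' \<and> lead_coeff g' \<notin> P \<and> Jf g' ==> degree g \<le> degree g'"
   using ex_has_least_nat[of "%g. pA g \<and> lead_coeff g \<notin> P \<and> Jf g" g0 degree] g0 by blast
  let ?e = "lead_coeff g" and ?k = "degree g"
  have g0': "g ~= 0" using g(2) P0 by auto
  have ming: "pP p" if p: "pA p" "Jf p" "p = 0 \<or> degree p < ?k" for p
  proof (rule ccontr)
   assume n: "~ pP p"
   then obtain q where q: "pA q" "lead_coeff q \<notin> P" "degree q \<le> degree p" "poly p x - poly q x \<in> P" using trim[OF p(1)] by blast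
   have "Jf (smult 1 p - 1 * (p - q))" using q A.S1 A.S0 by (intro Jf_comb[OF p(2) Jf_P]) (auto simp: coeff_1)
   hence "Jf q" by simp
   hence "?k \<le> degree q" using gmin q by blast
   thus False using q(3) p(3) n P0 by auto
  qed
  \<comment> \<open>Otherwise dividing q0 by f leaves a remainder in this ideal of degree below that
    of g, hence zero modulo P, and q0 would vanish at x modulo P.\<close>
  have km: "?k < ?m"
  proof (rule ccontr)
   assume "~ ?thesis"
   obtain k q s where s: "pA q" "pA s" "smult (?c ^ k) q0 = q * f + s" "s = 0 \<or> degree s < ?m"
    using pseudo_div[OF f(1) f0 q0(1)] by blast
   have se: "s = smult (?c ^ k) q0 - q * f" using s(3) by simp
   have "Jf s" unfolding se using f s by (intro Jf_comb[OF Jq0 Jf_P] A.Spow) auto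
   hence "pP s" using \<open>~ ?k < ?m\<close> s by (intro ming) auto
   hence "poly s x \<in> P" by (rule pP_eval)
   hence "poly s x + poly q x * poly f x \<in> P" using f by (intro Padd Pmult)
   moreover have "poly s x + poly q x * poly f x = ?c ^ k * poly q0 x" by (simp add: se)
   ultimately have "?c ^ k * poly q0 x \<in> P" by simp
   thus False using Pprime Ppow f q0 by blast
  qed
  \<comment> \<open>Dividing f by g shows that q g vanishes at x modulo P, while g does not, by
    minimality of f. So q does, and as its degree is below that of f, all its coefficients lie in P;
    this contradicts the coefficient at the degree of f.\<close>
  have k0: "?k = 0"
  proof (rule ccontr)
   assume k: "?k ~= 0"
   obtain t q s where s: "pA q" "pA s" "smult (?e ^ t) f = q * g + s" "s = 0 \<or> degree s < ?k" "degree q \<le> ?m - ?k"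
    using pseudo_div[OF g(1) g0' f(1)] by blast
   have se: "s = smult (?e ^ t) f - q * g" using s(3) by simp
   have "Jf s" unfolding se using f g s by (intro Jf_comb[OF Jf_P g(3)] A.Spow) auto
   hence "pP s" using s by (intro ming) auto
   hence "poly s x \<in> P" by (rule pP_eval)
   hence "?e ^ t * poly f x - poly s x \<in> P" using f by (intro Pdiff Pmult)
   moreover have "?e ^ t * poly f x - poly s x = poly q x * poly g x" by (simp add: se)
   moreover have "poly g x \<notin> P" using minf[OF g(1)] km g(2) by blast
   ultimately have "poly q x \<in> P" using Pprime by metis
   hence "pP q" using s k m1 km by (intro minf) auto
   hence "coeff (q * g) ?m \<in> P" unfolding coeff_mult by (intro Psum) (use Pmult in \<open>simp add: mult.commute[of "coeff q _"]\<close>)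
   moreover have "coeff s ?m = 0" using s(4) km by (auto intro: coeff_eq_0)
   moreover have "coeff (smult (?e ^ t) f) ?m = coeff (q * g) ?m + coeff s ?m" unfolding s(3) by simp
   ultimately have "?e ^ t * ?c \<in> P" by simp
   thus False using Pprime Ppow f g by blast
  qed
  then obtain e0 where e0: "g = [:e0:]" by (metis degree_eq_zeroE)
  then obtain h where h: "pA h" "poly ([:e0:] - h * q0) x \<in> P" using g(3) unfolding Jf_def by blast
  have e0A: "e0 \<in> A" "e0 \<notin> P" using g e0 by (metis coeff_pCons_0, simp)
  show ?thesis
  proof (intro bexI[of _ "?c * e0"] conjI allI impI)
   show "?c * e0 \<in> A" using f e0A by (intro A.Smult) auto
   show "?c * e0 \<notin> P" using Pprime f e0A by blast
   fix e :: "'k => 'r => 'k"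
   assume e: "\<forall>t. rhom (e t) \<and> e t x = t" "\<forall>t. \<forall>y\<in>A. e t y = e 0 y" "\<forall>y\<in>A \<inter> P. e 0 y = 0" and ne: "e 0 (?c * e0) ~= 0"
   have rh: "rhom (e t)" for t using e(1) by blast
   have ce: "e 0 ?c ~= 0" "e 0 e0 ~= 0" using ne by (auto simp: rhomD[OF rh])
   have "coeff (map_poly (e 0) f) ?m ~= 0" using ce by (simp add: coeff_map_poly rhomD[OF rh])
   hence "degree (map_poly (e 0) f) > 0" using m1 le_degree by fastforce
   then obtain t where t: "poly (map_poly (e 0) f) t = 0" using alg_closed_imp_poly_has_root by blast
   \<comment> \<open>Pseudo-division by f: the remainder vanishes modulo P by minimality, t is a
     root of f, and the leading coefficient of f is not sent to 0.\<close>
   have zero: "e t (poly p x) = 0" if p: "pA p" "poly p x \<in> P" for p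
   proof -
    obtain k q s where s: "pA q" "pA s" "smult (?c ^ k) p = q * f + s" "s = 0 \<or> degree s < ?m"
     using pseudo_div[OF f(1) f0 p(1)] by blast
    have se: "poly s x = ?c ^ k * poly p x - poly q x * poly f x" using arg_cong[OF s(3), of "%p. poly p x"] by simp
    have "poly s x \<in> P" unfolding se using p f by (intro Pdiff Pmult)
    hence "pP s" using s by (intro minf)
    hence "e t (poly s x) = 0" using s by (intro evP[OF e])
    hence "e t ?c ^ k * e t (poly p x) = e t (poly q x) * e t (poly f x)" by (simp add: se rhomD[OF rh])
    also have "\<dots> = 0" by (simp only: ev[OF e(1,2) f(1)] t mult_zero_right)
    moreover have "e t ?c ~= 0" using e(2) f(1) ce by metis
    ultimately show ?thesis by simp
   qed
   have "pA ([:e0:] - h * q0)" using e0A A.S0 h q0 by (intro pA_diff pA_mult) (auto simp: coeff_pCons split: nat.split)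
   hence "e t (poly ([:e0:] - h * q0) x) = 0" using h(2) by (rule zero)
   hence "e t e0 = e t (poly h x) * e t (poly q0 x)" by (simp add: rhomD[OF rh])
   moreover have "e t e0 ~= 0" using ce e(2) e0A by metis
   ultimately have "e t (poly q0 x) ~= 0" by auto
   thus "\<exists>t. (\<forall>p. pA p --> poly p x \<in> P --> e t (poly p x) = 0) \<and> e t (poly q0 x) ~= 0" using zero by blast
  qed
 qed
qed

end

lemma rhom_ident: "rhom (%c. c)" by (simp add: rhom_def)

lemma mpolys_insert:
 assumes "b \<in> mpolys (insert v V) UNIV"
 shows "\<exists>q. (\<forall>i. coeff q i \<in> mpolys V UNIV) \<and> b = poly q (mpoly_var v :: ('v \<Rightarrow>\<^sub>0 nat) \<Rightarrow>\<^sub>0 'a::comm_ring_1)"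
proof (induction b rule: pm_induct)
 case zero
 thus ?case by (intro exI[of _ 0]) (simp add: mpolys_def)
next
 case (single m)
 define m' where "m' = m - sgl v (lkp m v)"
 have m: "m = m' + sgl v (lkp m v)" by (rule poly_mapping_eqI) (simp add: m'_def lookup_add lookup_minus lookup_single when_def)
 have "pkeys m \<subseteq> insert v V" using assms single unfolding mpolys_def by blast
 moreover have "v \<notin> pkeys m'" "pkeys m' \<subseteq> pkeys m" by (auto simp: m'_def in_keys_iff lookup_minus)
 ultimately have "pkeys m' \<subseteq> V" by blast
 hence "sgl m' (lkp b m) \<in> mpolys V UNIV" "(0 :: _ \<Rightarrow>\<^sub>0 'a) \<in> mpolys V UNIV" by (auto simp: mpolys_def)
 moreover have "sgl m (lkp b m) = sgl m' (lkp b m) * mpoly_var v ^ lkp m v" by (subst m) (simp add: mpoly_var_power mult_single)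
 ultimately show ?case by (intro exI[of _ "monom (sgl m' (lkp b m)) (lkp m v)"]) (simp add: poly_monom)
next
 case (add a b)
 then obtain p q where "\<forall>i. coeff p i \<in> mpolys V UNIV" "a = poly p (mpoly_var v)"
  "\<forall>i. coeff q i \<in> mpolys V UNIV" "b = poly q (mpoly_var v)" by blast
 thus ?case using subring_on.Sadd[OF subring1_on.axioms(1)[OF subring1_on_mpolys[OF subring1_on_UNIV]]]
  by (intro exI[of _ "p + q"]) (simp; blast)
qed

lemma mpoly_eval_cong:
 "p \<in> mpolys V A ==> (!!v. v \<in> V ==> z v = z' v) ==> mpoly_eval \<phi> z p = mpoly_eval \<phi> z' p"
 unfolding mpoly_eval_def mpolys_def by (intro sum.cong arg_cong2[where f = "(*)"] prod.cong refl arg_cong2[where f = "(^)"]) blast+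

text \<open>Induction on the variables, trading the element b to be kept nonzero for an element a of
  the smaller ring. In the base case P contains no nonzero constant.\<close>

lemma prime_zero:
 fixes P :: "(('v \<Rightarrow>\<^sub>0 nat) \<Rightarrow>\<^sub>0 'k::alg_closed_field) set"
 assumes P: "prime_set P" and V: "finite V"
 shows "b \<in> mpolys V UNIV ==> b \<notin> P ==>
  \<exists>z. (\<forall>p\<in>mpolys V UNIV \<inter> P. mpoly_eval (%c. c) z p = 0) \<and> mpoly_eval (%c. c) z b ~= 0" using V
proof (induction V arbitrary: b rule: finite_induct)
 case empty
 have const: "\<exists>c. p = sgl 0 c" if "p \<in> mpolys {} UNIV" for p :: "('v \<Rightarrow>\<^sub>0 nat) \<Rightarrow>\<^sub>0 'k"
 proof -
  have "pkeys p \<subseteq> {0}" using that by (auto simp: mpolys_def)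
  hence "p = sgl 0 (lkp p 0)" by (intro poly_mapping_eqI) (auto simp: lookup_single when_def in_keys_iff)
  thus ?thesis by blast
 qed
 have P': "0 \<in> P" "1 \<notin> P" "!!s a. a \<in> P ==> s * a \<in> P" using P by (auto simp: prime_set_def)
 have ev: "mpoly_eval (%c. c) z (sgl 0 c) = (c :: 'k)" for z :: "'v => 'k" and c
  using mpoly_eval_const[OF rhom_ident, of z c] by (simp add: mpoly_const_def)
 have "c = 0" if "sgl 0 c \<in> P" for c
 proof (rule ccontr)
  assume "c ~= 0"
  hence "sgl 0 (inverse c) * sgl 0 c = (1 :: ('v \<Rightarrow>\<^sub>0 nat) \<Rightarrow>\<^sub>0 'k)" by (simp add: mult_single)
  thus False using P'(2,3) that by metis
 qed
 thus ?case using const[OF empty(1)] const empty(2) P'(1) ev by (intro exI[of _ "%_. 0"]) fastforce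
next
 case (insert v V)
 let ?A = "mpolys V (UNIV :: 'k set)"
 interpret E: simple_ext P ?A "mpoly_var v" by (intro simple_ext.intro P subring1_on_mpolys[OF subring1_on_UNIV])
 obtain q0 where q0: "\<forall>i. coeff q0 i \<in> ?A" "b = poly q0 (mpoly_var v)" using mpolys_insert[OF insert(4)] by blast
 obtain a where a: "a \<in> ?A" "a \<notin> P" and extn: "!!e :: 'k => _ => 'k.
  (\<forall>t. rhom (e t) \<and> e t (mpoly_var v) = t) ==> (\<forall>t. \<forall>y\<in>?A. e t y = e 0 y) ==> (\<forall>y\<in>?A \<inter> P. e 0 y = 0) ==> e 0 a ~= 0 ==>
  (\<exists>t. (\<forall>p. E.pA p --> poly p (mpoly_var v) \<in> P --> e t (poly p (mpoly_var v)) = 0) \<and> e t b ~= 0)"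
  using E.extend_zero[OF q0(1), where 'k = 'k] insert(5) unfolding q0(2)[symmetric] by blast
 obtain z where z: "\<forall>p\<in>?A \<inter> P. mpoly_eval (%c. c) z p = 0" "mpoly_eval (%c. c) z a ~= 0"
  using insert(3)[OF a] by blast
 let ?e = "%t. mpoly_eval (%c. c) (z(v := t))"
 have eq: "?e t y = mpoly_eval (%c. c) z y" if "y \<in> ?A" for t y using that insert(2) by (intro mpoly_eval_cong) auto
 have "\<exists>t. (\<forall>p. E.pA p --> poly p (mpoly_var v) \<in> P --> ?e t (poly p (mpoly_var v)) = 0) \<and> ?e t b ~= 0"
 proof (rule extn)
  show "\<forall>t. rhom (?e t) \<and> ?e t (mpoly_var v) = t" by (simp add: rhom_mpoly_eval mpoly_eval_var rhom_ident)
  show "\<forall>t. \<forall>y\<in>?A. ?e t y = ?e 0 y" using eq by metis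
  show "\<forall>y\<in>?A \<inter> P. ?e 0 y = 0" using eq z(1) by (metis IntD1)
  show "?e 0 a ~= 0" using eq[OF a(1)] z(2) by metis
 qed
 then obtain t where t: "!!p. E.pA p ==> poly p (mpoly_var v) \<in> P ==> ?e t (poly p (mpoly_var v)) = 0" "?e t b ~= 0" by blast
 have "?e t p = 0" if "p \<in> mpolys (insert v V) UNIV \<inter> P" for p using mpolys_insert[of p v V] t(1) that by blast
 thus ?case using t(2) by blast
qed

text \<open>If no power of s lies in the ideal of the f i, a prime containing this ideal but not s
  has a zero at which s does not vanish. The multipliers may have any degree;
  \<open>homogeneous_part\<close> cuts them down later.\<close>

theorem nullstellensatz:
 fixes f :: "'i => ('v \<Rightarrow>\<^sub>0 nat) \<Rightarrow>\<^sub>0 'k::alg_closed_field"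
 assumes V: "finite V" and f: "!!i. i \<in> J ==> f i \<in> mpolys V UNIV" and J: "finite J" and s: "s \<in> mpolys V UNIV"
  and van: "!!z. (!!i. i \<in> J ==> mpoly_eval (%c. c) z (f i) = 0) ==> mpoly_eval (%c. c) z s = 0"
 shows "\<exists>k h. s ^ k = (\<Sum>i\<in>J. h i * f i)"
proof (rule ccontr)
 assume no: "~ ?thesis"
 define I where "I = {\<Sum>i\<in>J. h i * f i | h. True}"
 have "\<exists>P. prime_set P \<and> I \<subseteq> P \<and> s \<notin> P"
 proof (rule avoiding_prime)
  show "0 \<in> I" unfolding I_def by (intro CollectI exI[of _ "%_. 0"]) simp
  show "a + b \<in> I" if ab: "a \<in> I" "b \<in> I" for a b
  proof -
   obtain h h' where "a = (\<Sum>i\<in>J. h i * f i)" "b = (\<Sum>i\<in>J. h' i * f i)" using ab unfolding I_def by blast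
   thus ?thesis unfolding I_def by (intro CollectI exI[of _ "%i. h i + h' i"]) (simp add: sum.distrib distrib_right)
  qed
  show "u * a \<in> I" if a: "a \<in> I" for u a
  proof -
   obtain h where "a = (\<Sum>i\<in>J. h i * f i)" using a unfolding I_def by blast
   thus ?thesis unfolding I_def by (intro CollectI exI[of _ "%i. u * h i"]) (simp add: sum_distrib_left mult.assoc)
  qed
  show "s ^ k \<notin> I" for k using no unfolding I_def by blast
 qed
 then obtain P where P: "prime_set P" "I \<subseteq> P" "s \<notin> P" by blast
 obtain z where z: "\<forall>p\<in>mpolys V UNIV \<inter> P. mpoly_eval (%c. c) z p = 0" "mpoly_eval (%c. c) z s ~= 0"
  using prime_zero[OF P(1) V s P(3)] by blast
 have "f i \<in> P" if i: "i \<in> J" for i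
 proof -
  have "f i = (\<Sum>k\<in>J. (if k = i then 1 else 0) * f k)" using i J by (simp add: if_distrib[of "%x. x * _"] cong: if_cong)
  hence "f i \<in> I" unfolding I_def by (intro CollectI exI[of _ "%k. if k = i then 1 else 0"]) simp
  thus ?thesis using P(2) by blast
 qed
 thus False using van[of z] f z by blast
qed

section \<open>Specialization\<close>

text \<open>Solvability of a generic linear system after inverting one element is proved by Gaussian
 elimination, so that no minors of the elimination matrices are needed.\<close>

definition unit_span :: "'a::comm_ring_1 set => 'c set => 'g set => ('c => 'g => 'a) => 'a => 'g => bool" where
 "unit_span S J \<Gamma> g a \<gamma> \<longleftrightarrow> (\<exists>w. (\<forall>c\<in>J. w c \<in> S) \<and> (\<forall>\<gamma>'\<in>\<Gamma>. (\<Sum>c\<in>J. w c * g c \<gamma>') = (if \<gamma>' = \<gamma> then a else 0)))"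

lemma unit_spanI:
 "(!!c. c \<in> J ==> w c \<in> S) ==> (!!\<gamma>'. \<gamma>' \<in> \<Gamma> ==> (\<Sum>c\<in>J. w c * g c \<gamma>') = (if \<gamma>' = \<gamma> then a else 0)) ==> unit_span S J \<Gamma> g a \<gamma>"
 unfolding unit_span_def by blast

lemma unit_spanE:
 assumes "unit_span S J \<Gamma> g a \<gamma>"
 obtains w where "!!c. c \<in> J ==> w c \<in> S" "!!\<gamma>'. \<gamma>' \<in> \<Gamma> ==> (\<Sum>c\<in>J. w c * g c \<gamma>') = (if \<gamma>' = \<gamma> then a else 0)"
 using assms unfolding unit_span_def by blast

text \<open>Solvability for \<gamma>0 after specialization yields a pivot
  \<open>g c0 \<gamma>0\<close> with nonzero image. Elimination by cross-multiplication stays inside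
  S, and the denominators collect in a.\<close>

lemma generic_span:
 fixes e :: "'a::comm_ring_1 => 'k::field" and g :: "'c => 'g => 'a"
 assumes S: "subring1_on S" and e: "rhom e" and J: "finite J" and \<Gamma>: "finite \<Gamma>"
  and "!!c \<gamma>. c \<in> J ==> \<gamma> \<in> \<Gamma> ==> g c \<gamma> \<in> S"
  and "!!\<gamma>. \<gamma> \<in> \<Gamma> ==> unit_span UNIV J \<Gamma> (%c \<gamma>. e (g c \<gamma>)) 1 \<gamma>"
 shows "\<exists>a\<in>S. e a ~= 0 \<and> (\<forall>\<gamma>\<in>\<Gamma>. unit_span S J \<Gamma> g a \<gamma>)"
 using \<Gamma> assms(5,6)
proof (induction \<Gamma> arbitrary: g rule: finite_induct)
 case empty
 thus ?case using subring1_on.S1[OF S] rhomD(2)[OF e] by (intro bexI[of _ 1]) auto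
next
 case (insert \<gamma>0 \<Gamma>)
 interpret S: subring1_on S by (rule S)
 have "unit_span UNIV J (insert \<gamma>0 \<Gamma>) (%c \<gamma>. e (g c \<gamma>)) 1 \<gamma>0" using insert.prems(2) by blast
 then obtain w0 where w0: "!!\<gamma>'. \<gamma>' \<in> insert \<gamma>0 \<Gamma> ==> (\<Sum>c\<in>J. w0 c * e (g c \<gamma>')) = (if \<gamma>' = \<gamma>0 then 1 else 0)" by (rule unit_spanE) blast
 have "\<exists>c0\<in>J. e (g c0 \<gamma>0) ~= 0"
 proof (rule ccontr)
  assume "~ ?thesis"
  hence "(\<Sum>c\<in>J. w0 c * e (g c \<gamma>0)) = 0" by (intro sum.neutral) auto
  thus False using w0[of \<gamma>0] by simp
 qed
 then obtain c0 where c0: "c0 \<in> J" "e (g c0 \<gamma>0) ~= 0" by blast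
 define u where "u = g c0 \<gamma>0"
 define g' where "g' c \<gamma> = u * g c \<gamma> - g c \<gamma>0 * g c0 \<gamma>" for c \<gamma>
 have gS: "g c \<gamma> \<in> S" if "c \<in> J" "\<gamma> \<in> insert \<gamma>0 \<Gamma>" for c \<gamma> using insert.prems(1) that by blast
 have uS: "u \<in> S" and eu: "e u ~= 0" using c0 gS by (simp_all add: u_def)
 have pick: "(\<Sum>c\<in>J. (if c = c0 then t else 0) * g c \<gamma>') = t * g c0 \<gamma>'" for t \<gamma>'
  using c0 J by (simp add: if_distrib[of "%x. x * _"] cong: if_cong)
 have "\<exists>a\<in>S. e a ~= 0 \<and> (\<forall>\<gamma>\<in>\<Gamma>. unit_span S J \<Gamma> g' a \<gamma>)"
 proof (rule insert.IH)
  show "g' c \<gamma> \<in> S" if "c \<in> J" "\<gamma> \<in> \<Gamma>" for c \<gamma>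
   unfolding g'_def using that uS c0 by (intro S.Sdiff S.Smult gS) auto
  fix \<gamma> assume \<gamma>: "\<gamma> \<in> \<Gamma>"
  hence "unit_span UNIV J (insert \<gamma>0 \<Gamma>) (%c \<gamma>. e (g c \<gamma>)) 1 \<gamma>" using insert.prems(2) by blast
  then obtain w where w: "!!\<gamma>'. \<gamma>' \<in> insert \<gamma>0 \<Gamma> ==> (\<Sum>c\<in>J. w c * e (g c \<gamma>')) = (if \<gamma>' = \<gamma> then 1 else 0)" by (rule unit_spanE) blast
  have w0: "(\<Sum>c\<in>J. w c * e (g c \<gamma>0)) = 0" using w[of \<gamma>0] \<gamma> insert.hyps by auto
  show "unit_span UNIV J \<Gamma> (%c \<gamma>. e (g' c \<gamma>)) 1 \<gamma>"
  proof (rule unit_spanI[of _ "%c. w c / e u"])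
   fix \<gamma>' assume \<gamma>': "\<gamma>' \<in> \<Gamma>"
   have t: "w c / e u * e (g' c \<gamma>') = w c * e (g c \<gamma>') - w c * e (g c \<gamma>0) * (e (g c0 \<gamma>') / e u)" for c
    using eu by (simp add: g'_def rhomD[OF e] field_simps)
   show "(\<Sum>c\<in>J. w c / e u * e (g' c \<gamma>')) = (if \<gamma>' = \<gamma> then 1 else 0)"
    unfolding t sum_subtractf sum_distrib_right[symmetric] w0 using w[of \<gamma>'] \<gamma>' by simp
  qed simp
 qed
 then obtain a where a: "a \<in> S" "e a ~= 0" and aw: "!!\<gamma>. \<gamma> \<in> \<Gamma> ==> unit_span S J \<Gamma> g' a \<gamma>" by blast
 have ext: "unit_span S J (insert \<gamma>0 \<Gamma>) g a \<gamma>" if \<gamma>: "\<gamma> \<in> \<Gamma>" for \<gamma>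
 proof -
  obtain w where w: "!!c. c \<in> J ==> w c \<in> S" "!!\<gamma>'. \<gamma>' \<in> \<Gamma> ==> (\<Sum>c\<in>J. w c * g' c \<gamma>') = (if \<gamma>' = \<gamma> then a else 0)" using aw[OF \<gamma>] by (rule unit_spanE) blast
  define t where "t = (\<Sum>b\<in>J. w b * g b \<gamma>0)"
  have tS: "t \<in> S" unfolding t_def by (intro S.Ssum S.Smult w gS) auto
  \<comment> \<open>The multiple t of the pivot column cancels the coordinate \<gamma>0.\<close>
  let ?w = "%c. u * w c - (if c = c0 then t else 0)"
  have eq: "(\<Sum>c\<in>J. ?w c * g c \<gamma>') = (\<Sum>c\<in>J. w c * g' c \<gamma>')" for \<gamma>'
  proof -
   have t1: "?w c * g c \<gamma>' = u * w c * g c \<gamma>' - (if c = c0 then t else 0) * g c \<gamma>'" for c by (rule left_diff_distrib)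
   have t2: "w c * g' c \<gamma>' = u * w c * g c \<gamma>' - w c * g c \<gamma>0 * g c0 \<gamma>'" for c by (simp add: g'_def algebra_simps)
   show ?thesis unfolding t1 t2 sum_subtractf pick sum_distrib_right[symmetric] unfolding t_def ..
  qed
  show ?thesis
  proof (rule unit_spanI[of _ ?w])
   show "?w c \<in> S" if "c \<in> J" for c using S.Sdiff[OF S.Smult[OF uS w(1)[OF that]]] tS S.S0 by simp
   fix \<gamma>' assume \<gamma>': "\<gamma>' \<in> insert \<gamma>0 \<Gamma>"
   have "g' c \<gamma>0 = 0" for c by (simp add: g'_def u_def mult.commute)
   thus "(\<Sum>c\<in>J. ?w c * g c \<gamma>') = (if \<gamma>' = \<gamma> then a else 0)"
    unfolding eq using \<gamma>' \<gamma> w(2)[of \<gamma>'] insert.hyps by (cases "\<gamma>' = \<gamma>0") auto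
  qed
 qed
 have "\<forall>\<gamma>. \<exists>w. \<gamma> \<in> \<Gamma> --> (\<forall>c\<in>J. w c \<in> S) \<and> (\<forall>\<gamma>'\<in>insert \<gamma>0 \<Gamma>. (\<Sum>c\<in>J. w c * g c \<gamma>') = (if \<gamma>' = \<gamma> then a else 0))"
  using ext unfolding unit_span_def by blast
 then obtain W where W0: "\<forall>\<gamma>. \<gamma> \<in> \<Gamma> --> (\<forall>c\<in>J. W \<gamma> c \<in> S) \<and> (\<forall>\<gamma>'\<in>insert \<gamma>0 \<Gamma>. (\<Sum>c\<in>J. W \<gamma> c * g c \<gamma>') = (if \<gamma>' = \<gamma> then a else 0))"
  unfolding choice_iff by blast
 have W: "W \<gamma> c \<in> S" if "\<gamma> \<in> \<Gamma>" "c \<in> J" for \<gamma> c using W0 that by blast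
 have Ws: "(\<Sum>c\<in>J. W \<gamma> c * g c \<gamma>') = (if \<gamma>' = \<gamma> then a else 0)" if "\<gamma> \<in> \<Gamma>" "\<gamma>' \<in> insert \<gamma>0 \<Gamma>" for \<gamma> \<gamma>' using W0 that by blast
 have "unit_span S J (insert \<gamma>0 \<Gamma>) g (a * u) \<gamma>" if \<gamma>: "\<gamma> \<in> insert \<gamma>0 \<Gamma>" for \<gamma>
 proof (cases "\<gamma> = \<gamma>0")
  case False
  hence g: "\<gamma> \<in> \<Gamma>" using \<gamma> by simp
  show ?thesis
  proof (rule unit_spanI[of _ "%c. u * W \<gamma> c"])
   fix \<gamma>' assume "\<gamma>' \<in> insert \<gamma>0 \<Gamma>"
   hence h: "(\<Sum>c\<in>J. W \<gamma> c * g c \<gamma>') = (if \<gamma>' = \<gamma> then a else 0)" by (rule Ws[OF g])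
   show "(\<Sum>c\<in>J. u * W \<gamma> c * g c \<gamma>') = (if \<gamma>' = \<gamma> then a * u else 0)"
    unfolding mult.assoc sum_distrib_left[symmetric] h by (simp add: mult.commute)
  qed (intro S.Smult uS W g)
 next
  case True
  \<comment> \<open>For \<gamma>0 itself: a times the pivot column, with its other coordinates
    cleared by the solutions already found.\<close>
  let ?w = "%c. (if c = c0 then a else 0) - (\<Sum>\<gamma>\<in>\<Gamma>. g c0 \<gamma> * W \<gamma> c)"
  show ?thesis
  proof (rule unit_spanI[of _ ?w])
   have "(\<Sum>\<gamma>\<in>\<Gamma>. g c0 \<gamma> * W \<gamma> c) \<in> S" if "c \<in> J" for c using that c0 by (intro S.Ssum S.Smult W gS) auto
   thus "?w c \<in> S" if "c \<in> J" for c using that S.Sdiff a(1) S.S0 by simp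
   fix \<gamma>' assume \<gamma>': "\<gamma>' \<in> insert \<gamma>0 \<Gamma>"
   have t: "?w c * g c \<gamma>' = (if c = c0 then a else 0) * g c \<gamma>' - (\<Sum>\<gamma>\<in>\<Gamma>. g c0 \<gamma> * W \<gamma> c) * g c \<gamma>'" for c by (rule left_diff_distrib)
   have "(\<Sum>c\<in>J. (\<Sum>\<gamma>\<in>\<Gamma>. g c0 \<gamma> * W \<gamma> c) * g c \<gamma>') = (\<Sum>\<gamma>\<in>\<Gamma>. g c0 \<gamma> * (\<Sum>c\<in>J. W \<gamma> c * g c \<gamma>'))"
    unfolding sum_distrib_right sum_distrib_left mult.assoc by (rule sum.swap)
   also have "\<dots> = (\<Sum>\<gamma>\<in>\<Gamma>. if \<gamma> = \<gamma>' then g c0 \<gamma> * a else 0)" using Ws[OF _ \<gamma>'] by (intro sum.cong) auto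
   also have "\<dots> = (if \<gamma>' \<in> \<Gamma> then g c0 \<gamma>' * a else 0)" using insert.hyps by simp
   finally have "(\<Sum>c\<in>J. ?w c * g c \<gamma>') = a * g c0 \<gamma>' - (if \<gamma>' \<in> \<Gamma> then g c0 \<gamma>' * a else 0)"
    unfolding t sum_subtractf pick by simp
   thus "(\<Sum>c\<in>J. ?w c * g c \<gamma>') = (if \<gamma>' = \<gamma> then a * u else 0)"
    using \<gamma>' insert.hyps True by (cases "\<gamma>' \<in> \<Gamma>") (auto simp: u_def mult.commute)
  qed
 qed
 moreover have "e (a * u) ~= 0" "a * u \<in> S" using a eu uS by (simp_all add: rhomD[OF e] S.Smult)
 ultimately show ?case by blast
qed

lemma rhom_of_int: "rhom of_int" by (simp add: rhom_def)

lemma rhom_to_ac: "rhom to_ac" by (simp add: rhom_def)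

lemma rhom_specialize: "rhom (specialize f)" unfolding specialize_def by (rule rhom_mpoly_eval[OF rhom_of_int])

lemma mpoly_eval_single: "rhom \<phi> ==> mpoly_eval \<phi> z (sgl m c) = \<phi> c * (\<Prod>v\<in>pkeys m. z v ^ lkp m v)"
 by (simp add: mpoly_eval_eq pm_eval_single)

lemma mpoly_eval_pmap: "rhom \<phi> ==> mpoly_eval (%c. c) z (pmap \<phi> p) = mpoly_eval \<phi> z p"
 by (rule rhom_eq_on_pm[of "%p. mpoly_eval (%c. c) z (pmap \<phi> p)" "mpoly_eval \<phi> z"])
   (simp_all add: rhom_compose rhom_mpoly_eval rhom_ident rhom_pmap pmap_single mpoly_eval_single)

text \<open>A common zero in coordinates, without passing to projective classes.\<close>

definition mult_zero :: "nat => (nat => nat) => (nat => 'a::field xpoly) => (xvar => 'a alg_closure) => bool" where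
 "mult_zero r n f z \<longleftrightarrow> (\<forall>j\<in>{1..r}. \<exists>l\<le>n j. z (j, l) ~= 0) \<and> (\<forall>i\<le>ntot r n. mpoly_eval to_ac z (f i) = 0)"

section \<open>Projective zeros and surjectivity after specialization\<close>

context multiproj
begin

lemma mpoly_eval_scale:
 assumes \<phi>: "rhom \<phi>" and p: "p \<in> XD A \<mu>" and z: "!!j l. j \<in> {1..r} ==> l \<le> n j ==> z' (j, l) = c j * z (j, l)"
 shows "mpoly_eval \<phi> z' p = (\<Prod>j\<in>{1..r}. c j ^ nat (\<mu> j)) * mpoly_eval \<phi> z p"
proof -
 have "(\<Prod>v\<in>pkeys m. z' v ^ lkp m v) = (\<Prod>j\<in>{1..r}. c j ^ nat (\<mu> j)) * (\<Prod>v\<in>pkeys m. z v ^ lkp m v)" if m: "m \<in> pkeys p" for m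
 proof -
  have mx: "pkeys m \<subseteq> VV" and md: "xmono_deg n m = \<mu>" using p m by (auto simp: xpolys_deg_def mpolys_def)
  have all: "(\<Prod>v\<in>pkeys m. y v ^ lkp m v) = (\<Prod>j\<in>{1..r}. \<Prod>l\<le>n j. y (j, l) ^ lkp m (j, l))" for y :: "xvar => 'b"
  proof -
   have "(\<Prod>v\<in>pkeys m. y v ^ lkp m v) = (\<Prod>v\<in>VV. y v ^ lkp m v)"
    using mx by (intro prod.mono_neutral_left) (auto simp: in_keys_iff)
   also have "VV = (SIGMA j:{1..r}. {..n j})" by (auto simp: xvars_def)
   finally show ?thesis by (subst prod.Sigma) (simp_all add: case_prod_unfold)
  qed
  have "nat (\<mu> j) = (\<Sum>l\<le>n j. lkp m (j, l))" for j
   unfolding md[symmetric] xmono_deg_def of_nat_sum[symmetric] nat_int ..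
  hence "(\<Prod>j\<in>{1..r}. \<Prod>l\<le>n j. z' (j, l) ^ lkp m (j, l)) = (\<Prod>j\<in>{1..r}. c j ^ nat (\<mu> j) * (\<Prod>l\<le>n j. z (j, l) ^ lkp m (j, l)))"
   using z by (intro prod.cong refl) (simp add: power_mult_distrib prod.distrib power_sum)
  thus ?thesis unfolding all by (simp add: prod.distrib)
 qed
 thus ?thesis unfolding mpoly_eval_def sum_distrib_left by (intro sum.cong) (simp_all add: mult.left_commute)
qed

text \<open>Multihomogeneity makes vanishing independent of the scaling in each factor, so it can be
  tested on one representative.\<close>

lemma has_common_zero_iff:
 assumes f: "!!i. i \<le> N ==> f i \<in> XD UNIV (d i)"
 shows "has_common_zero r n f \<longleftrightarrow> (\<exists>z. mult_zero r n f z)"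
proof
 let ?R = "%j. {(v, w). v \<in> nonzero_vecs (n j) \<and> w \<in> nonzero_vecs (n j) \<and> (\<exists>c. c ~= 0 \<and> (\<forall>l\<le>n j. w l = c * v l))} :: ((nat => 'a alg_closure) \<times> _) set"
 {
  assume "has_common_zero r n f"
  then obtain Q where Q: "Q \<in> (\<Pi>\<^sub>E j\<in>{1..r}. (proj_space (n j) :: (nat => 'a alg_closure) set set))"
   "!!i v. i \<le> N ==> v \<in> (\<Pi>\<^sub>E j\<in>{1..r}. Q j) ==> mpoly_eval to_ac (%(j, l). v j l) (f i) = 0"
   unfolding has_common_zero_def by blast
  have "\<exists>v. v \<in> Q j \<and> v \<in> nonzero_vecs (n j)" if "j \<in> {1..r}" for j
  proof -
   have "Q j \<in> nonzero_vecs (n j) // ?R j" using Q(1) that unfolding proj_space_def by auto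
   then obtain v where "v \<in> nonzero_vecs (n j)" "Q j = ?R j `` {v}" by (elim quotientE)
   thus ?thesis by (intro exI[of _ v]) (auto intro!: exI[of _ "1 :: 'a alg_closure"])
  qed
  then obtain v where v: "!!j. j \<in> {1..r} ==> v j \<in> Q j \<and> v j \<in> nonzero_vecs (n j)" by metis
  have "(\<lambda>j\<in>{1..r}. v j) \<in> (\<Pi>\<^sub>E j\<in>{1..r}. Q j)" using v by auto
  hence "mpoly_eval to_ac (%(j, l). (\<lambda>j\<in>{1..r}. v j) j l) (f i) = 0" if "i \<le> N" for i using Q(2) that by blast
  moreover have "\<exists>l\<le>n j. v j l ~= 0" if "j \<in> {1..r}" for j using v[OF that] by (auto simp: nonzero_vecs_def)
  hence "\<forall>j\<in>{1..r}. \<exists>l\<le>n j. (case (j, l) of (j, l) => (\<lambda>j\<in>{1..r}. v j) j l) ~= 0" by auto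
  ultimately have "mult_zero r n f (%(j, l). (\<lambda>j\<in>{1..r}. v j) j l)" unfolding mult_zero_def by blast
  thus "\<exists>z. mult_zero r n f z" by blast
 }
 assume "\<exists>z. mult_zero r n f z"
 then obtain z where z: "!!j. j \<in> {1..r} ==> \<exists>l\<le>n j. z (j, l) ~= 0" "!!i. i \<le> N ==> mpoly_eval to_ac z (f i) = 0"
  unfolding mult_zero_def by blast
 let ?v = "%j. \<lambda>l\<in>{..n j}. z (j, l)"
 let ?Q = "\<lambda>j\<in>{1..r}. ?R j `` {?v j}"
 have nz: "?v j \<in> nonzero_vecs (n j)" if "j \<in> {1..r}" for j using z(1)[OF that] by (auto simp: nonzero_vecs_def)
 have "?Q \<in> (\<Pi>\<^sub>E j\<in>{1..r}. proj_space (n j))"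
  unfolding proj_space_def by (intro restrict_PiE_iff[THEN iffD2] ballI quotientI nz)
 moreover have "mpoly_eval to_ac (%(j, l). v j l) (f i) = 0" if i: "i \<le> N" and v: "v \<in> (\<Pi>\<^sub>E j\<in>{1..r}. ?Q j)" for i v
 proof -
  have "\<exists>c. \<forall>l\<le>n j. v j l = c * z (j, l)" if "j \<in> {1..r}" for j
  proof -
   have "v j \<in> ?Q j" using v that by (rule PiE_mem)
   thus ?thesis using that by auto
  qed
  then obtain c where "!!j l. j \<in> {1..r} ==> l \<le> n j ==> v j l = c j * z (j, l)" by metis
  thus ?thesis using z(2)[OF i] by (subst mpoly_eval_scale[OF rhom_to_ac f[OF i], of _ c z]) auto
 qed
 ultimately show "has_common_zero r n f" unfolding has_common_zero_def by blast
qed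

lemma pmap_F_gen:
 assumes f: "f i \<in> XD UNIV (d i)"
 shows "pmap (specialize f) (FG i) = f i"
proof (rule poly_mapping_eqI)
 fix m
 have "lkp (f i) m = 0" if "m \<notin> Mon (d i)"
  using that f by (auto simp: xpolys_deg_def mpolys_def xmonos_def in_keys_iff)
 moreover have "specialize f (mpoly_var (i, m)) = lkp (f i) m" by (simp add: specialize_def mpoly_eval_var rhom_of_int)
 ultimately show "lkp (pmap (specialize f) (FG i)) m = lkp (f i) m"
  by (simp add: lkp_pmap rhom_specialize lkp_F_gen rhomD[OF rhom_specialize])
qed

lemma vmono_power: "sgl (vmono r \<sigma> (%_. 1)) 1 ^ k = (sgl (vmono r \<sigma> (%_. k)) 1 :: 'b::comm_ring_1 xpoly)"
proof (induction k)
 case 0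
 thus ?case by (simp add: vmono_def)
next
 case (Suc k)
 thus ?case by (simp only: power_Suc2 vmono_Suc mult_single mult_1)
qed

text \<open>Both sides are compared in the multidegree \<rho>; restriction to \<open>Mon\<close>
  also discards monomials of h with variables outside \<open>VV\<close>.\<close>

lemma homogeneous_part:
 assumes f: "!!i. i \<le> N ==> f i \<in> XD UNIV (d i)" and \<gamma>: "\<gamma> \<in> Mon \<rho>" and eq: "sgl \<gamma> 1 = (\<Sum>i\<le>N. h i * f i)"
 shows "sgl \<gamma> 1 = (\<Sum>(i, \<beta>)\<in>MC \<rho>. sgl \<beta> (lkp (h i) \<beta>) * f i)"
proof -
 let ?h = "%i. vec_poly (\<rho> - d i) (lkp (h i))"
 have "sgl \<gamma> 1 = pm_restrict (%m. m \<in> Mon \<rho>) (sgl \<gamma> 1)" using \<gamma> by (simp add: restrict_single)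
 also have "\<dots> = (\<Sum>i\<le>N. f i * ?h i)" unfolding eq restrict_sum
 proof (rule sum.cong[OF refl])
  fix i assume i: "i \<in> {..N}"
  have "m + m' \<in> Mon \<rho> \<longleftrightarrow> m' \<in> Mon (\<rho> - d i)" if m: "m \<in> pkeys (f i)" for m m'
  proof -
   have mx: "pkeys m \<subseteq> VV" "xmono_deg n m = d i" using f[of i] i m by (auto simp: xpolys_deg_def mpolys_def)
   have "pkeys (m + m') = pkeys m \<union> pkeys m'" by (auto simp: in_keys_iff lookup_add)
   thus ?thesis using mx by (simp add: xmonos_def fun_eq_iff xmono_deg_add eq_diff_eq add.commute)
  qed
  hence "pm_restrict (%m. m \<in> Mon \<rho>) (f i * h i) = f i * pm_restrict (%m. m \<in> Mon (\<rho> - d i)) (h i)" by (rule restrict_mult)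
  moreover have "pm_restrict (%m. m \<in> Mon (\<rho> - d i)) (h i) = ?h i" by (rule poly_mapping_eqI) (simp add: lkp_restrict lkp_vec_poly)
  ultimately show "pm_restrict (%m. m \<in> Mon \<rho>) (h i * f i) = f i * ?h i" by (simp add: mult.commute)
 qed
 also have "\<dots> = (\<Sum>i\<le>N. \<Sum>\<beta>\<in>Mon (\<rho> - d i). sgl \<beta> (lkp (h i) \<beta>) * f i)"
  by (simp add: vec_poly_def sum_distrib_left mult.commute)
 also have "\<dots> = (\<Sum>(i, \<beta>)\<in>MC \<rho>. sgl \<beta> (lkp (h i) \<beta>) * f i)"
  unfolding M_cols_def by (subst sum.Sigma) auto
 finally show ?thesis .
qed

text \<open>By the Nullstellensatz each x_\<sigma> has a power in the ideal of f over the algebraic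
  closure, so all monomials of a large degree \<rho> lie in that ideal. Hence the specialized matrix
  of degree \<rho> is onto, and \<open>generic_span\<close> lifts this to the generic matrix at the
  price of a factor a with nonzero specialization.\<close>

lemma no_zero_inertia:
 fixes f :: "nat => 'a::field xpoly"
 assumes f: "!!i. i \<le> N ==> f i \<in> XD UNIV (d i)" and no: "\<nexists>z. mult_zero r n f z"
 shows "\<exists>a\<in>AA. specialize f a ~= 0 \<and> in_sat (sgl 0 a)"
proof -
 let ?g = "%i. pmap to_ac (f i)" and ?\<Sigma> = "\<Pi>\<^sub>E j\<in>{1..r}. {..n j}"
 have gdeg: "?g i \<in> XD UNIV (d i)" if "i \<le> N" for i by (rule pmap_deg[OF rhom_to_ac f[OF that]])
 have "\<exists>k h. sgl (vmono r \<sigma> (%_. 1)) 1 ^ k = (\<Sum>i\<in>{..N}. h i * ?g i)" if \<sigma>: "\<sigma> \<in> ?\<Sigma>" for \<sigma>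
 proof (rule nullstellensatz)
  show "finite (VV)" by simp
  show "?g i \<in> mpolys (VV) UNIV" if "i \<in> {..N}" for i using gdeg[of i] that by (simp add: xpolys_deg_def)
  show "sgl (vmono r \<sigma> (%_. 1)) 1 \<in> mpolys (VV) UNIV"
   using keys_vmono[of r \<sigma> "%_. 1"] \<sigma> by (fastforce simp: mpolys_def xvars_def)
  fix z :: "xvar => 'a alg_closure"
  assume z: "!!i. i \<in> {..N} ==> mpoly_eval (%c. c) z (?g i) = 0"
  show "mpoly_eval (%c. c) z (sgl (vmono r \<sigma> (%_. 1)) 1) = 0"
  proof (rule ccontr)
   assume nz: "mpoly_eval (%c. c) z (sgl (vmono r \<sigma> (%_. 1)) 1) ~= 0"
   have "z (j, \<sigma> j) ~= 0" if j: "j \<in> {1..r}" for j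
   proof
    assume z0: "z (j, \<sigma> j) = 0"
    have l: "lkp (vmono r \<sigma> (%_. 1)) (j, \<sigma> j) = 1" unfolding lkp_vmono using j by simp
    hence "(j, \<sigma> j) \<in> pkeys (vmono r \<sigma> (%_. 1))" by (simp add: in_keys_iff)
    hence "(\<Prod>v\<in>pkeys (vmono r \<sigma> (%_. 1)). z v ^ lkp (vmono r \<sigma> (%_. 1)) v) = 0"
     using z0 l by (intro prod_zero) (auto intro!: bexI[of _ "(j, \<sigma> j)"])
    thus False using nz by (simp add: mpoly_eval_single rhom_ident)
   qed
   moreover have "\<sigma> j \<le> n j" if "j \<in> {1..r}" for j using \<sigma> that by auto
   ultimately have "\<forall>j\<in>{1..r}. \<exists>l\<le>n j. z (j, l) ~= 0" by blast
   hence "mult_zero r n f z" unfolding mult_zero_def using z by (simp add: mpoly_eval_pmap rhom_to_ac)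
   thus False using no by blast
  qed
 qed simp
 hence "\<exists>q. sgl (vmono r \<sigma> (%_. fst q)) 1 = (\<Sum>i\<le>N. snd q i * ?g i)" if "\<sigma> \<in> ?\<Sigma>" for \<sigma>
  using that unfolding vmono_power by fastforce
 hence "\<forall>\<sigma>\<in>?\<Sigma>. \<exists>q. sgl (vmono r \<sigma> (%_. fst q)) 1 = (\<Sum>i\<le>N. snd q i * ?g i)" by (intro ballI)
 hence "\<exists>q. \<forall>\<sigma>\<in>?\<Sigma>. sgl (vmono r \<sigma> (%_. fst (q \<sigma>))) 1 = (\<Sum>i\<le>N. snd (q \<sigma>) i * ?g i)" by (rule bchoice)
 then obtain q where q: "\<forall>\<sigma>\<in>?\<Sigma>. sgl (vmono r \<sigma> (%_. fst (q \<sigma>))) 1 = (\<Sum>i\<le>N. snd (q \<sigma>) i * ?g i)" by blast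
 define k where "k \<sigma> = fst (q \<sigma>)" for \<sigma>
 define h where "h \<sigma> = snd (q \<sigma>)" for \<sigma>
 have kh: "sgl (vmono r \<sigma> (%_. k \<sigma>)) 1 = (\<Sum>i\<le>N. h \<sigma> i * ?g i)" if "\<sigma> \<in> ?\<Sigma>" for \<sigma>
  using q that unfolding k_def h_def by blast
 have fin: "finite ?\<Sigma>" by (intro finite_PiE) auto
 define K where "K = (\<Sum>\<sigma>\<in>?\<Sigma>. k \<sigma>)"
 have K: "k \<sigma> \<le> K" if "\<sigma> \<in> ?\<Sigma>" for \<sigma> unfolding K_def using that fin by (intro member_le_sum) auto
 \<comment> \<open>Large enough for \<open>large_monomial\<close> in every group, so that one degree
   \<rho> serves all transversals.\<close>
 define k0 where "k0 = (\<Sum>j\<in>{1..r}. (n j + 1) * K)"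
 define \<rho> where "\<rho> = (%j. if j \<in> {1..r} then int k0 else 0)"
 let ?e = "%a. to_ac (specialize f a)" and ?J = "MC \<rho>"
 have e: "rhom ?e" by (rule rhom_compose[OF rhom_to_ac rhom_specialize])
 have eM: "pmap ?e (M_poly c) = sgl (snd c) 1 * ?g (fst c)" if c: "c \<in> ?J" for c
 proof -
  have "pmap ?e (M_poly c) = sgl (snd c) 1 * pmap ?e (FG (fst c))"
   by (simp add: M_poly_def rhomD(4)[OF rhom_pmap[OF e]] pmap_single[OF e] rhomD[OF e])
  also have "pmap ?e (FG (fst c)) = pmap to_ac (pmap (specialize f) (FG (fst c)))"
   by (rule poly_mapping_eqI) (simp add: lkp_pmap e rhom_to_ac rhom_specialize)
  also have "\<dots> = ?g (fst c)" using c f by (subst pmap_F_gen) (auto simp: M_cols_def)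
  finally show ?thesis .
 qed
 have "unit_span UNIV ?J (Mon \<rho>) (%c \<gamma>. ?e (lkp (M_poly c) \<gamma>)) 1 \<gamma>"
  if \<gamma>: "\<gamma> \<in> Mon \<rho>" for \<gamma>
 proof -
  have "int ((n j + 1) * K) \<le> xmono_deg n \<gamma> j" if j: "j \<in> {1..r}" for j
  proof -
   have "(n j + 1) * K \<le> k0" unfolding k0_def using j by (intro member_le_sum) auto
   moreover have "xmono_deg n \<gamma> j = int k0" using \<gamma> j unfolding xmonos_def \<rho>_def by auto
   ultimately show ?thesis by (simp only: of_nat_le_iff)
  qed
  moreover have "pkeys \<gamma> \<subseteq> VV" using \<gamma> by (simp add: xmonos_def)
  ultimately obtain \<sigma> where \<sigma>: "\<sigma> \<in> ?\<Sigma>" "\<forall>k\<le>K. \<exists>m'. \<gamma> = m' + vmono r \<sigma> (%_. k) \<and> pkeys m' \<subseteq> pkeys \<gamma>"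
   using large_monomial[of \<gamma> K] by blast
  then obtain m' where m': "\<gamma> = m' + vmono r \<sigma> (%_. k \<sigma>)" using K[OF \<sigma>(1)] by blast
  have "sgl \<gamma> 1 = sgl m' 1 * sgl (vmono r \<sigma> (%_. k \<sigma>)) (1 :: 'a alg_closure)" by (simp add: m' mult_single)
  also have "\<dots> = (\<Sum>i\<le>N. (sgl m' 1 * h \<sigma> i) * ?g i)" unfolding kh[OF \<sigma>(1)] by (simp add: sum_distrib_left mult.assoc)
  finally have t: "sgl \<gamma> 1 = (\<Sum>i\<le>N. (sgl m' 1 * h \<sigma> i) * ?g i)" .
  have s: "sgl \<gamma> 1 = (\<Sum>(i, \<beta>)\<in>?J. sgl \<beta> (lkp (sgl m' 1 * h \<sigma> i) \<beta>) * ?g i)"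
   using homogeneous_part[OF gdeg \<gamma> t] by simp
  define w where "w = (%(i, \<beta>). lkp (sgl m' 1 * h \<sigma> i) \<beta>)"
  have "sgl \<gamma> 1 = (\<Sum>c\<in>?J. sgl 0 (w c) * pmap ?e (M_poly c))" unfolding s
  proof (rule sum.cong[OF refl])
   fix c assume "c \<in> ?J"
   from eM[OF this] show "(case c of (i, \<beta>) => sgl \<beta> (lkp (sgl m' 1 * h \<sigma> i) \<beta>) * ?g i) = sgl 0 (w c) * pmap ?e (M_poly c)"
    by (cases c) (simp add: w_def mult.assoc[symmetric] mult_single)
  qed
  from arg_cong[OF this, of "%p. lkp p \<gamma>'" for \<gamma>']
  have "(\<Sum>c\<in>?J. w c * ?e (lkp (M_poly c) \<gamma>')) = (if \<gamma>' = \<gamma> then 1 else 0)" for \<gamma>'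
   by (simp add: lookup_sum lkp_const_mult lkp_pmap[OF e] lookup_single when_def eq_commute)
  thus ?thesis by (intro unit_spanI[of _ w]) simp_all
 qed
 moreover have "lkp (M_poly c) \<gamma> \<in> (AA :: int upoly set)" if "c \<in> ?J" for c \<gamma>
  using M_poly_deg[OF that, where 'k = int] by (intro mpolys_lkp[of _ "VV"]) (simp add: xpolys_deg_def)
 ultimately have "\<exists>a\<in>AA. ?e a ~= 0 \<and> (\<forall>\<gamma>\<in>Mon \<rho>. unit_span (AA) ?J (Mon \<rho>) (%c \<gamma>. lkp (M_poly c) \<gamma>) a \<gamma>)"
  by (intro generic_span[OF subring1_on_coeffs_A e finite_M_cols]) auto
 then obtain a where a: "a \<in> AA" "?e a ~= 0"
  and aw: "!!\<gamma>. \<gamma> \<in> Mon \<rho> ==> unit_span (AA) ?J (Mon \<rho>) (%c \<gamma>. lkp (M_poly c) \<gamma>) a \<gamma>" by blast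
 \<comment> \<open>For each \<sigma> the monomial x_\<sigma>^k0 has degree \<rho>, so a times it
   lies in the generic ideal.\<close>
 have "in_sat (sgl 0 a)" unfolding in_sat_def
 proof (intro allI impI exI[of _ k0])
  fix \<sigma> :: "nat => nat" assume \<sigma>: "\<forall>j\<in>{1..r}. \<sigma> j \<le> n j"
  let ?\<gamma> = "vmono r \<sigma> (%_. k0)"
  have "?\<gamma> = vmono r \<sigma> (%j. nat (\<rho> j))" unfolding vmono_def by (intro sum.cong) (auto simp: \<rho>_def)
  also have "\<dots> \<in> Mon \<rho>" using \<sigma> by (intro vmono_in_xmonos) (auto simp: \<rho>_def Nvec_def Zvec_def)
  finally have \<gamma>: "?\<gamma> \<in> Mon \<rho>" .
  then obtain w where w: "!!c. c \<in> ?J ==> w c \<in> AA"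
   "!!\<gamma>'. \<gamma>' \<in> Mon \<rho> ==> (\<Sum>c\<in>?J. w c * lkp (M_poly c) \<gamma>') = (if \<gamma>' = ?\<gamma> then a else 0)"
   by (rule unit_spanE[OF aw]) blast
  have "sgl ?\<gamma> a = (\<Sum>c\<in>?J. sgl 0 (w c) * M_poly c)"
  proof (rule poly_mapping_eqI)
   fix \<gamma>'
   have "lkp (M_poly c) \<gamma>' = (0 :: int upoly)" if "\<gamma>' \<notin> Mon \<rho>" "c \<in> ?J" for c
    using M_poly_deg[OF that(2), where 'k = int] that(1) by (auto simp: xpolys_deg_def mpolys_def xmonos_def in_keys_iff)
   thus "lkp (sgl ?\<gamma> a) \<gamma>' = lkp (\<Sum>c\<in>?J. sgl 0 (w c) * M_poly c) \<gamma>'"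
    using w(2) \<gamma> by (cases "\<gamma>' \<in> Mon \<rho>") (auto simp: lookup_sum lkp_const_mult lookup_single when_def)
  qed
  also have "\<dots> = (\<Sum>c\<in>?J. sgl 0 ((\<lambda>c\<in>?J. w c) c) * M_poly c)" by (intro sum.cong) auto
  finally have "\<exists>w\<in>?J \<rightarrow>\<^sub>E AA. sgl ?\<gamma> a = (\<Sum>c\<in>?J. sgl 0 (w c) * M_poly c)"
   using w(1) by (intro bexI[of _ "\<lambda>c\<in>?J. w c"]) auto
  hence "in_ideal (sgl ?\<gamma> a)" using M_poly_span in_ideal_deg_imp by blast
  thus "in_ideal (sgl ?\<gamma> 1 * sgl 0 a)" by (simp add: mult_single)
 qed
 thus ?thesis using a by auto
qed

text \<open>At a zero z some transversal \<sigma> has x_\<sigma> nonzero, and a power of x_\<sigma>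
  times p lies in the ideal.\<close>

lemma eval_sat_zero:
 assumes f: "!!i. i \<le> N ==> f i \<in> XD UNIV (d i)" and z: "mult_zero r n f z" and p: "in_sat p"
 shows "mpoly_eval to_ac z (pmap (specialize f) p) = 0"
proof -
 let ?E = "%p. mpoly_eval to_ac z (pmap (specialize f) p)"
 have E: "rhom ?E" by (rule rhom_compose[OF rhom_mpoly_eval[OF rhom_to_ac] rhom_pmap[OF rhom_specialize]])
 have "\<forall>j\<in>{1..r}. \<exists>l. l \<le> n j \<and> z (j, l) ~= 0" using z unfolding mult_zero_def by blast
 hence "\<exists>\<sigma>. \<forall>j\<in>{1..r}. \<sigma> j \<le> n j \<and> z (j, \<sigma> j) ~= 0" by (rule bchoice)
 then obtain \<sigma> where \<sigma>: "\<forall>j\<in>{1..r}. \<sigma> j \<le> n j \<and> z (j, \<sigma> j) ~= 0" by blast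
 then obtain k where "in_ideal (sgl (vmono r \<sigma> (%_. k)) 1 * p)" using p unfolding in_sat_def by blast
 then obtain h where h: "sgl (vmono r \<sigma> (%_. k)) 1 * p = (\<Sum>i\<le>N. h i * FG i)" unfolding in_ideal_def by blast
 have "?E (FG i) = 0" if "i \<le> N" for i using z that f by (simp add: pmap_F_gen mult_zero_def)
 moreover have "?E (sgl (vmono r \<sigma> (%_. k)) 1 * p) = (\<Sum>i\<le>N. ?E (h i) * ?E (FG i))"
  unfolding h by (simp only: rhomD(4,7)[OF E])
 ultimately have "?E (sgl (vmono r \<sigma> (%_. k)) 1) * ?E p = 0" by (simp only: rhomD(4)[OF E]) simp
 moreover have "?E (sgl (vmono r \<sigma> (%_. k)) 1) ~= 0" using \<sigma> keys_vmono[of r \<sigma> "%_. k"]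
  by (auto simp: pmap_single rhom_specialize mpoly_eval_single rhom_to_ac rhomD[OF rhom_specialize])
 ultimately show ?thesis by simp
qed

lemma mat_surjective_iff:
 fixes g :: "'c => 'a::field xpoly"
 assumes J: "finite J" and g: "!!c. c \<in> J ==> g c \<in> XD UNIV \<nu>"
 shows "mat_surjective (ring_on UNIV) (Mon \<nu>) J (%\<gamma> c. lkp (g c) \<gamma>) \<longleftrightarrow>
  (\<forall>\<gamma>\<in>Mon \<nu>. \<exists>w. sgl \<gamma> 1 = (\<Sum>c\<in>J. sgl 0 (w c) * g c))"
proof -
 let ?I = "Mon \<nu>" and ?f = "mat_map (ring_on (UNIV :: 'a set)) (Mon \<nu>) J (%\<gamma> c. lkp (g c) \<gamma>)"
 have cF: "carrier (free_module (ring_on (UNIV :: 'a set)) Y) = Y \<rightarrow>\<^sub>E UNIV" for Y :: "'z set" by (simp add: free_module_def ring_on_def)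
 have vp: "vec_poly \<nu> (?f w) = (\<Sum>c\<in>J. sgl 0 (w c) * g c)" if "w \<in> J \<rightarrow>\<^sub>E UNIV" for w
  by (rule vec_poly_mat_map[OF subring1_on_UNIV J g that])
 have inI: "?f w \<in> ?I \<rightarrow>\<^sub>E UNIV" for w by (auto simp: mat_map_def)
 have inj: "v = v'" if "vec_poly \<nu> v = vec_poly \<nu> v'" "v \<in> ?I \<rightarrow>\<^sub>E UNIV" "v' \<in> ?I \<rightarrow>\<^sub>E UNIV" for v v' :: "_ => 'a"
 proof (rule PiE_ext[OF that(2,3)])
  fix \<gamma> assume "\<gamma> \<in> ?I"
  thus "v \<gamma> = v' \<gamma>" using arg_cong[OF that(1), of "%p. lkp p \<gamma>"] by (simp add: lkp_vec_poly)
 qed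
 show ?thesis
 proof
  assume sur: "mat_surjective (ring_on UNIV) ?I J (%\<gamma> c. lkp (g c) \<gamma>)"
  show "\<forall>\<gamma>\<in>?I. \<exists>w. sgl \<gamma> 1 = (\<Sum>c\<in>J. sgl 0 (w c) * g c)"
  proof
   fix \<gamma> assume \<gamma>: "\<gamma> \<in> ?I"
   let ?v = "\<lambda>\<gamma>'\<in>?I. if \<gamma>' = \<gamma> then 1 else (0 :: 'a)"
   have "?v \<in> ?f ` (J \<rightarrow>\<^sub>E UNIV)" using sur unfolding mat_surjective_def cF by auto
   then obtain w where w: "w \<in> J \<rightarrow>\<^sub>E UNIV" "?v = ?f w" by blast
   have "sgl \<gamma> 1 = vec_poly \<nu> ?v" using \<gamma> by (intro poly_mapping_eqI) (auto simp: lkp_vec_poly lookup_single when_def)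
   thus "\<exists>w. sgl \<gamma> 1 = (\<Sum>c\<in>J. sgl 0 (w c) * g c)" using vp[OF w(1)] w(2) by auto
  qed
 next
  assume "\<forall>\<gamma>\<in>?I. \<exists>w. sgl \<gamma> 1 = (\<Sum>c\<in>J. sgl 0 (w c) * g c)"
  then obtain W where W: "!!\<gamma>. \<gamma> \<in> ?I ==> sgl \<gamma> 1 = (\<Sum>c\<in>J. sgl 0 (W \<gamma> c) * g c)" unfolding bchoice_iff by blast
  have "v \<in> ?f ` (J \<rightarrow>\<^sub>E UNIV)" if v: "v \<in> ?I \<rightarrow>\<^sub>E UNIV" for v
  proof -
   define w where "w = (\<lambda>c\<in>J. \<Sum>\<gamma>\<in>?I. v \<gamma> * W \<gamma> c)"
   have w: "w \<in> J \<rightarrow>\<^sub>E UNIV" by (simp add: w_def)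
   have "vec_poly \<nu> v = (\<Sum>\<gamma>\<in>?I. sgl 0 (v \<gamma>) * sgl \<gamma> 1)" by (simp add: vec_poly_def mult_single)
   also have "\<dots> = (\<Sum>\<gamma>\<in>?I. \<Sum>c\<in>J. sgl 0 (v \<gamma> * W \<gamma> c) * g c)"
    by (intro sum.cong refl) (simp add: W sum_distrib_left mult.assoc[symmetric] mult_single)
   also have "\<dots> = (\<Sum>c\<in>J. \<Sum>\<gamma>\<in>?I. sgl 0 (v \<gamma> * W \<gamma> c) * g c)" by (rule sum.swap)
   also have "\<dots> = (\<Sum>c\<in>J. sgl 0 (w c) * g c)"
    unfolding sum_distrib_right[symmetric] rhomD(7)[OF rhom_single0, symmetric] by (intro sum.cong) (simp_all add: w_def)
   finally have "v = ?f w" using vp[OF w] by (intro inj v inI) simp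
   thus ?thesis using w by blast
  qed
  thus "mat_surjective (ring_on UNIV) ?I J (%\<gamma> c. lkp (g c) \<gamma>)" unfolding mat_surjective_def cF using inI by blast
 qed
qed

text \<open>Stated for any columns spanning the saturation in degree \<nu> over the integers, so
  that it covers both matrices. At a common zero all columns vanish. Without one, a x^\<gamma> is a
  combination of columns, and a becomes invertible after specialization.\<close>

theorem surjective_specialization:
 fixes f :: "nat => 'a::field xpoly" and g :: "'c => int cpoly"
 assumes \<nu>: "\<nu> \<in> Nvec r" and J: "finite J" and g: "!!c. c \<in> J ==> g c \<in> XD (AA) \<nu>"
  and sat: "!!p. p \<in> XD (AA) \<nu> ==>
   in_sat p \<longleftrightarrow> (\<exists>w\<in>J \<rightarrow>\<^sub>E AA. p = (\<Sum>c\<in>J. sgl 0 (w c) * g c))"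
  and f: "\<forall>i\<le>N. f i \<in> XD UNIV (d i)"
 shows "mat_surjective (ring_on UNIV) (Mon \<nu>) J (%\<gamma> c. specialize f (lkp (g c) \<gamma>)) \<longleftrightarrow> ~ has_common_zero r n f"
proof -
 let ?h = "%c. pmap (specialize f) (g c)"
 have f': "f i \<in> XD UNIV (d i)" if "i \<le> N" for i using f that by blast
 have A: "subring1_on (AA :: int upoly set)" by (rule subring1_on_coeffs_A)
 have iff: "mat_surjective (ring_on UNIV) (Mon \<nu>) J (%\<gamma> c. specialize f (lkp (g c) \<gamma>)) \<longleftrightarrow>
  (\<forall>\<gamma>\<in>Mon \<nu>. \<exists>w. sgl \<gamma> 1 = (\<Sum>c\<in>J. sgl 0 (w c) * ?h c))"
  using mat_surjective_iff[OF J, of ?h \<nu>, OF pmap_deg[OF rhom_specialize g]] by (simp add: lkp_pmap[OF rhom_specialize])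
 have hz: "has_common_zero r n f \<longleftrightarrow> (\<exists>z. mult_zero r n f z)" by (rule has_common_zero_iff[OF f'])
 have sg: "in_sat (g c)" if c: "c \<in> J" for c
 proof -
  have "(\<Sum>b\<in>J. sgl 0 ((\<lambda>b\<in>J. if b = c then 1 else 0) b) * g b) = (\<Sum>b\<in>J. if b = c then g b else 0)"
   by (intro sum.cong) auto
  also have "\<dots> = g c" using c J by simp
  finally show ?thesis unfolding sat[OF g[OF c]] using subring1_on.S1[OF A] subring_on.S0[OF subring1_on.axioms(1)[OF A]]
   by (intro bexI[of _ "\<lambda>b\<in>J. if b = c then 1 else 0"]) auto
 qed
 show ?thesis unfolding iff hz
 proof (intro iffI notI)
  assume sur: "\<forall>\<gamma>\<in>Mon \<nu>. \<exists>w. sgl \<gamma> 1 = (\<Sum>c\<in>J. sgl 0 (w c) * ?h c)" and "\<exists>z. mult_zero r n f z"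
  then obtain z where z: "mult_zero r n f z" by blast
  hence "\<forall>j\<in>{1..r}. \<exists>l. l \<le> n j \<and> z (j, l) ~= 0" unfolding mult_zero_def by blast
  hence "\<exists>\<sigma>. \<forall>j\<in>{1..r}. \<sigma> j \<le> n j \<and> z (j, \<sigma> j) ~= 0" by (rule bchoice)
 then obtain \<sigma> where \<sigma>: "\<forall>j\<in>{1..r}. \<sigma> j \<le> n j \<and> z (j, \<sigma> j) ~= 0" by blast
  \<comment> \<open>A monomial of degree \<nu> that does not vanish at z.\<close>
  let ?\<gamma> = "vmono r \<sigma> (%j. nat (\<nu> j))"
  have "?\<gamma> \<in> Mon \<nu>" using \<sigma> \<nu> by (intro vmono_in_xmonos) auto
  then obtain w where w: "sgl ?\<gamma> 1 = (\<Sum>c\<in>J. sgl 0 (w c) * ?h c)" using sur by blast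
  have E: "rhom (mpoly_eval to_ac z)" by (rule rhom_mpoly_eval[OF rhom_to_ac])
  have "mpoly_eval to_ac z (sgl ?\<gamma> 1) = 0" unfolding w using eval_sat_zero[OF f' z sg] by (simp add: rhomD(4,7)[OF E])
  thus False using \<sigma> keys_vmono[of r \<sigma> "%j. nat (\<nu> j)"] by (auto simp: mpoly_eval_single rhom_to_ac)
 next
  assume "\<nexists>z. mult_zero r n f z"
  then obtain a where a: "a \<in> AA" "specialize f a ~= 0" "in_sat (sgl 0 a)" using no_zero_inertia[OF f'] by blast
  show "\<forall>\<gamma>\<in>Mon \<nu>. \<exists>w. sgl \<gamma> 1 = (\<Sum>c\<in>J. sgl 0 (w c) * ?h c)"
  proof
   fix \<gamma> assume \<gamma>: "\<gamma> \<in> Mon \<nu>"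
   have "in_sat (sgl \<gamma> 1 * sgl 0 a)" using a(3) \<gamma> by (intro in_sat_mult) (auto simp: mpolys_def xmonos_def)
   moreover have "sgl \<gamma> a \<in> XD (AA) \<nu>" using \<gamma> a(1) by (auto simp: xpolys_deg_def mpolys_def xmonos_def)
   ultimately obtain w where w: "sgl \<gamma> a = (\<Sum>c\<in>J. sgl 0 (w c) * g c)" using sat by (auto simp: mult_single)
   have R: "rhom (pmap (specialize f))" by (rule rhom_pmap[OF rhom_specialize])
   let ?i = "inverse (specialize f a)"
   have "sgl \<gamma> 1 = sgl 0 ?i * pmap (specialize f) (sgl \<gamma> a)"
    using a(2) by (simp add: pmap_single rhom_specialize mult_single)
   also have "\<dots> = (\<Sum>c\<in>J. sgl 0 (?i * specialize f (w c)) * ?h c)"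
    unfolding w by (simp add: rhomD(4,7)[OF R] pmap_single rhom_specialize sum_distrib_left mult.assoc[symmetric] mult_single)
   finally show "\<exists>w. sgl \<gamma> 1 = (\<Sum>c\<in>J. sgl 0 (w c) * ?h c)" by (intro exI[of _ "%c. ?i * specialize f (w c)"])
  qed
 qed
qed

end

theorem proposition5p2:
  fixes r :: nat and n :: "nat \<Rightarrow> nat" and d :: "nat \<Rightarrow> nat \<Rightarrow> int" and \<nu> :: "nat \<Rightarrow> int"
  assumes "r \<ge> 1" and "\<And>j. j \<in> {1..r} \<Longrightarrow> n j \<ge> 1"
    and "\<And>i. i \<le> ntot r n \<Longrightarrow> d i \<in> Zvec r"
    and "\<And>i j. i \<le> ntot r n \<Longrightarrow> j \<in> {1..r} \<Longrightarrow> d i j \<ge> 1"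
    and "\<nu> \<in> Nvec r"
  shows
    "(\<nu> \<notin> {delta r n d - \<beta> | \<beta>. \<beta> \<in> Nvec r}
           \<union> Gamma TYPE('k::comm_ring_1) 0 r n d \<union> Gamma TYPE('k) 1 r n d \<longrightarrow>
        presentation_matrix (ring_A r n d :: 'k upoly ring)
          (xmonos r n \<nu>) (M_cols r n d \<nu>) (M_mat r n d) (B_sat_piece r n d \<nu>) \<and>
        (\<forall>f :: nat \<Rightarrow> 'a::field xpoly.
           (\<forall>i\<le>ntot r n. f i \<in> xpolys_deg r n UNIV (d i)) \<longrightarrow>
           (mat_surjective (ring_on (UNIV :: 'a set)) (xmonos r n \<nu>) (M_cols r n d \<nu>)
              (\<lambda>\<gamma> c. specialize f (M_mat r n d \<gamma> c))
            \<longleftrightarrow> \<not> has_common_zero r n f)))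
     \<and>
     ((\<exists>\<mu>\<in>Zvec r. \<nu> = delta r n d - \<mu> \<and>
          (\<forall>j\<in>{1..r}. 0 \<le> \<mu> j \<and> \<mu> j < Min ((\<lambda>i. d i j) ` {..ntot r n}))) \<longrightarrow>
        (\<forall>G :: xmono \<Rightarrow> nat \<Rightarrow> nat \<Rightarrow> nat \<Rightarrow> 'k upoly xpoly.
           (\<forall>\<alpha>\<in>xmonos r n (delta r n d - \<nu>). sylv_decomp r n d \<alpha> (G \<alpha>)) \<longrightarrow>
           presentation_matrix (ring_A r n d)
             (xmonos r n \<nu>) (H_cols r n d \<nu>) (H_mat r n d G) (B_sat_piece r n d \<nu>)) \<and>
        (\<forall>(f :: nat \<Rightarrow> 'a xpoly) (G :: xmono \<Rightarrow> nat \<Rightarrow> nat \<Rightarrow> nat \<Rightarrow> int upoly xpoly).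
           (\<forall>i\<le>ntot r n. f i \<in> xpolys_deg r n UNIV (d i)) \<longrightarrow>
           (\<forall>\<alpha>\<in>xmonos r n (delta r n d - \<nu>). sylv_decomp r n d \<alpha> (G \<alpha>)) \<longrightarrow>
           (mat_surjective (ring_on (UNIV :: 'a set)) (xmonos r n \<nu>) (H_cols r n d \<nu>)
              (\<lambda>\<gamma> c. specialize f (H_mat r n d G \<gamma> c))
            \<longleftrightarrow> \<not> has_common_zero r n f)))"
proof -
 interpret multiproj r n d using assms(1-4) by unfold_locales
 have \<nu>Z: "\<nu> \<in> Zvec r" using assms(5) by (simp add: Nvec_def)
 {
  assume \<nu>: "\<nu> \<notin> {delta r n d - \<beta> | \<beta>. \<beta> \<in> Nvec r} \<union> Gamma TYPE('k) 0 r n d \<union> Gamma TYPE('k) 1 r n d"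
  \<comment> \<open>\<open>good_spot\<close> does not mention the base ring, so the hypothesis on
    \<open>Gamma\<close> over \<open>'k\<close> also serves the specialization, which runs over the
    integers.\<close>
  have good: "good_spot \<nu> q" if "1 \<le> q" "q \<le> Suc N" for q
   using good_spot_of_Gamma[OF \<nu>Z _ _ that, where 'k = 'k] \<nu> by blast
  have "presentation_matrix (ring_A r n d :: 'k upoly ring)
     (xmonos r n \<nu>) (M_cols r n d \<nu>) (M_mat r n d) (B_sat_piece r n d \<nu>)" by (rule presentation_M[OF good])
  moreover have "mat_surjective (ring_on (UNIV :: 'a set)) (xmonos r n \<nu>) (M_cols r n d \<nu>)
     (%\<gamma> c. specialize f (M_mat r n d \<gamma> c)) \<longleftrightarrow> ~ has_common_zero r n f"
   if f: "\<forall>i\<le>N. f i \<in> xpolys_deg r n UNIV (d i)" for f :: "nat => 'a xpoly"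
   unfolding M_mat_eq by (rule surjective_specialization[OF assms(5) finite_M_cols M_poly_deg sat_span_M[OF good] f])
  ultimately have "presentation_matrix (ring_A r n d :: 'k upoly ring)
     (xmonos r n \<nu>) (M_cols r n d \<nu>) (M_mat r n d) (B_sat_piece r n d \<nu>) \<and>
    (\<forall>f :: nat => 'a xpoly. (\<forall>i\<le>N. f i \<in> xpolys_deg r n UNIV (d i)) -->
     (mat_surjective (ring_on (UNIV :: 'a set)) (xmonos r n \<nu>) (M_cols r n d \<nu>)
       (%\<gamma> c. specialize f (M_mat r n d \<gamma> c)) \<longleftrightarrow> ~ has_common_zero r n f))" by blast
 }
 moreover {
  assume "\<exists>\<mu>\<in>Zvec r. \<nu> = delta r n d - \<mu> \<and> (\<forall>j\<in>{1..r}. 0 \<le> \<mu> j \<and> \<mu> j < Min ((%i. d i j) ` {..N}))"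
  then obtain \<mu> where \<mu>: "\<nu> = delta r n d - \<mu>" "!!j. j \<in> {1..r} ==> \<mu> j < Min ((%i. d i j) ` {..N})" by blast
  have lt: "delta r n d j - \<nu> j < d i j" if "i \<le> N" "j \<in> {1..r}" for i j
  proof -
   have "Min ((%i. d i j) ` {..N}) \<le> d i j" using that by (intro Min_le) auto
   with \<mu>(2)[OF that(2)] have "\<mu> j < d i j" by (rule less_le_trans)
   thus ?thesis by (simp add: \<mu>(1))
  qed
  have "presentation_matrix (ring_A r n d) (xmonos r n \<nu>) (H_cols r n d \<nu>) (H_mat r n d G) (B_sat_piece r n d \<nu>)"
   if G: "\<forall>\<alpha>\<in>xmonos r n (delta r n d - \<nu>). sylv_decomp r n d \<alpha> (G \<alpha>)"
   for G :: "xmono => nat => nat => nat => 'k cpoly" using G by (intro presentation_H lt \<nu>Z) auto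
  moreover have "mat_surjective (ring_on (UNIV :: 'a set)) (xmonos r n \<nu>) (H_cols r n d \<nu>)
     (%\<gamma> c. specialize f (H_mat r n d G \<gamma> c)) \<longleftrightarrow> ~ has_common_zero r n f"
   if f: "\<forall>i\<le>N. f i \<in> xpolys_deg r n UNIV (d i)"
    and G: "\<forall>\<alpha>\<in>xmonos r n (delta r n d - \<nu>). sylv_decomp r n d \<alpha> (G \<alpha>)"
   for f :: "nat => 'a xpoly" and G :: "xmono => nat => nat => nat => int cpoly"
  proof -
   have G': "sylv_decomp r n d \<alpha> (G \<alpha>)" if "\<alpha> \<in> xmonos r n (delta r n d - \<nu>)" for \<alpha> using G that by blast
   show ?thesis unfolding H_mat_eq
    by (rule surjective_specialization[OF assms(5) finite_H_cols H_poly_deg[OF \<nu>Z G'] sat_span_H[OF lt \<nu>Z G'] f])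
  qed
  ultimately have "(\<forall>G :: xmono => nat => nat => nat => 'k cpoly.
      (\<forall>\<alpha>\<in>xmonos r n (delta r n d - \<nu>). sylv_decomp r n d \<alpha> (G \<alpha>)) -->
      presentation_matrix (ring_A r n d) (xmonos r n \<nu>) (H_cols r n d \<nu>) (H_mat r n d G) (B_sat_piece r n d \<nu>)) \<and>
    (\<forall>(f :: nat => 'a xpoly) (G :: xmono => nat => nat => nat => int cpoly).
      (\<forall>i\<le>N. f i \<in> xpolys_deg r n UNIV (d i)) -->
      (\<forall>\<alpha>\<in>xmonos r n (delta r n d - \<nu>). sylv_decomp r n d \<alpha> (G \<alpha>)) -->
      (mat_surjective (ring_on (UNIV :: 'a set)) (xmonos r n \<nu>) (H_cols r n d \<nu>)
       (%\<gamma> c. specialize f (H_mat r n d G \<gamma> c)) \<longleftrightarrow> ~ has_common_zero r n f))" by blast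
 }
 ultimately show ?thesis by blast
qed

end
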